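(* Let $(\Sigma_1,g_1)$ and $(\Sigma_2,g_2)$ be two oriented Riemannian surfaces, and let $M=\Sigma_1\times\Sigma_2$ carry the product orientation and the split signature metric $g=g_1\oplus(-g_2)$. The map $$\Psi: C(\Sigma_1,\Sigma_2)\to \mathbb{T}(\Sigma_1\times\Sigma_2),\qquad \Psi(x,\hat x,A)=\big((x,\hat x),\ \mathrm{graph}(A)\big),\qquad \mathrm{graph}(A)=\{(v,Av): v\in T_x\Sigma_1\}\subset T_{(x,\hat x)}M,$$ is a natural identification (a diffeomorphism commuting with the projections to $\Sigma_1\times\Sigma_2$) between the configuration space $C(\Sigma_1,\Sigma_2)$ of the two surfaces rolling on each other without slipping or twisting and the circle twistor bundle $\mathbb{T}(\Sigma_1\times\Sigma_2)$ of $(M,g)$. Moreover, under this identification the rolling velocity distribution $\mathcal{D}_v$ on $C(\Sigma_1,\Sigma_2)$ coincides with the twistor distribution $\mathcal{D}$ on $\mathbb{T}(\Sigma_1\times\Sigma_2)$, i.e. $\Psi_*\mathcal{D}_v=\mathcal{D}$.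
   Context: Configuration space and velocity distribution. $C(\Sigma_1,\Sigma_2)$ is the set of triples $(x,\hat x,A)$ with $x\in\Sigma_1$, $\hat x\in\Sigma_2$ and $A:T_x\Sigma_1\to T_{\hat x}\Sigma_2$ an orientation-preserving linear isometry; it is a circle bundle over $\Sigma_1\times\Sigma_2$ via $(x,\hat x,A)\mapsto(x,\hat x)$. A smooth curve $\gamma(t)=(x(t),\hat x(t),A(t))$ in $C(\Sigma_1,\Sigma_2)$ is admissible if (no slipping) $A(t)\dot x(t)=\dot{\hat x}(t)$, and (no twisting) for every vector field $v(t)$ along $x(t)$ that is parallel for the Levi-Civita connection of $g_1$, the vector field $A(t)v(t)$ along $\hat x(t)$ is parallel for the Levi-Civita connection of $g_2$. The velocity distribution $\mathcal{D}_v$ at a point $p$ is the space of all velocities $\dot\gamma(0)$ of admissible curves with $\gamma(0)=p$; it is a rank 2 distribution on the 5-manifold $C(\Sigma_1,\Sigma_2)$. Twistor circle bundle. Let $(M,g)$ be an oriented 4-manifold with a metric of signature $(2,2)$. A 2-plane $N=\mathrm{Span}(n_1,n_2)\subset T_yM$ is totally null if $g$ vanishes identically on $N$; then the bivector $n_1\wedge n_2$ is an eigenvector of the Hodge star $*$ on $\bigwedge^2T_yM$ with eigenvalue $\pm1$, and $N$ is called selfdual if the eigenvalue is $+1$. In an oriented orthonormal basis $(e_1,e_2,e_3,e_4)$ with $g(e_1,e_1)=g(e_2,e_2)=1=-g(e_3,e_3)=-g(e_4,e_4)$ the Hodge star is $*(e_1\wedge e_2)=e_3\wedge e_4$, $*(e_1\wedge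 e_3)=e_2\wedge e_4$, $*(e_1\wedge e_4)=-e_2\wedge e_3$, extended by $*^2=\mathrm{Id}$. The selfdual totally null planes at $y$ form a circle $\mathcal{O}_+(y)$, and $\mathbb{T}(M)=\bigcup_{y\in M}\mathcal{O}_+(y)\xrightarrow{\pi}M$ is the twistor circle bundle; its points are pairs $(y,N)$. Twistor distribution. The horizontal lift of $Y\in T_yM$ to $(y,N)\in\mathbb{T}(M)$ is the velocity at $t=0$ of the curve $(y(t),N(t))$ in $\mathbb{T}(M)$, where $y(t)$ is a curve with $y(0)=y$, $\dot y(0)=Y$, and $N(t)$ is the Levi-Civita parallel transport of $N$ along $y(t)$. The twistor distribution $\mathcal{D}$ is the rank 2 distribution on $\mathbb{T}(M)$ whose fibre at $(y,N)$ is the set of horizontal lifts to $(y,N)$ of the vectors of $N$. *)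

theory Defs
  imports "HOL-Analysis.Analysis" "HOL-Library.Function_Algebras"
begin

text \<open>
  Pointwise real vector space structure on functions. Tangent vectors and bivectors below are
  functions with values in a vector space, so that \<open>subspace\<close>, \<open>span\<close> and \<open>dim\<close> apply to them.
\<close>

instantiation "fun" :: (type, real_vector) real_vector
begin

definition scaleR_fun :: "real \<Rightarrow> ('a \<Rightarrow> 'b) \<Rightarrow> 'a \<Rightarrow> 'b"
  where "scaleR_fun r f = (\<lambda>x. r *\<^sub>R f x)"

instance
  by standard (auto simp: scaleR_fun_def plus_fun_def scaleR_add_right scaleR_add_left)

end


section \<open>Smooth manifolds\<close>

primrec Ck_on :: "nat \<Rightarrow> 'e::real_normed_vector set \<Rightarrow> ('e \<Rightarrow> 'f::real_normed_vector) \<Rightarrow> bool"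
  where
    "Ck_on 0 S f \<longleftrightarrow> continuous_on S f"
  | "Ck_on (Suc k) S f \<longleftrightarrow>
       (\<forall>x\<in>S. f differentiable (at x)) \<and> (\<forall>v. Ck_on k S (\<lambda>x. frechet_derivative f (at x) v))"

text \<open>Smoothness (all orders); only used for open sets \<open>S\<close>.\<close>

definition smooth_on :: "'e::real_normed_vector set \<Rightarrow> ('e \<Rightarrow> 'f::real_normed_vector) \<Rightarrow> bool"
  where "smooth_on S f \<longleftrightarrow> (\<forall>k. Ck_on k S f)"

text \<open>
  A chart is a pair \<open>(U, \<phi>)\<close> of a domain and a coordinate map (whose values off \<open>U\<close> are irrelevant).
  A manifold is given by an atlas; its point set is the union of the chart domains and its topology
  is the one for which all charts are homeomorphisms onto open sets.
\<close>

type_synonym ('a, 'e) chart = "'a set \<times> ('a \<Rightarrow> 'e)"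
type_synonym ('a, 'e) atlas = "('a, 'e) chart set"

definition mcarrier :: "('a, 'e) atlas \<Rightarrow> 'a set"
  where "mcarrier \<A> = (\<Union>c\<in>\<A>. fst c)"

definition mtopology :: "('a, 'e::topological_space) atlas \<Rightarrow> 'a topology"
  where "mtopology \<A> =
    topology (\<lambda>W. W \<subseteq> mcarrier \<A> \<and> (\<forall>c\<in>\<A>. open (snd c ` (W \<inter> fst c))))"

definition charts_at :: "('a, 'e) atlas \<Rightarrow> 'a \<Rightarrow> ('a, 'e) chart set"
  where "charts_at \<A> p = {c \<in> \<A>. p \<in> fst c}"

definition chart_inv :: "('a, 'e) chart \<Rightarrow> 'e \<Rightarrow> 'a"
  where "chart_inv c = inv_into (fst c) (snd c)"

definition transition :: "('a, 'e) chart \<Rightarrow> ('a, 'f) chart \<Rightarrow> 'e \<Rightarrow> 'f"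
  where "transition c c' = snd c' \<circ> chart_inv c"

definition smooth_manifold :: "('a, 'e::euclidean_space) atlas \<Rightarrow> bool"
  where "smooth_manifold \<A> \<longleftrightarrow>
    (\<forall>c\<in>\<A>. inj_on (snd c) (fst c) \<and> open (snd c ` fst c)) \<and>
    (\<forall>c\<in>\<A>. \<forall>c'\<in>\<A>. open (snd c ` (fst c \<inter> fst c')) \<and>
        smooth_on (snd c ` (fst c \<inter> fst c')) (transition c c')) \<and>
    Hausdorff_space (mtopology \<A>) \<and> second_countable (mtopology \<A>)"

text \<open>
  \<open>smooth_map \<A> S \<B> f\<close>: the map \<open>f\<close>, defined on a subset \<open>S\<close> of the manifold \<open>\<A>\<close>, is smooth as a map
  into \<open>\<B>\<close>, i.e. in charts it is locally the restriction of a smooth map \<open>F\<close> defined on an open set.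
  For open \<open>S\<close> (in particular \<open>S = mcarrier \<A>\<close>) this is smoothness in the usual sense.
\<close>

definition smooth_map ::
  "('a, 'e::euclidean_space) atlas \<Rightarrow> 'a set \<Rightarrow> ('b, 'f::euclidean_space) atlas \<Rightarrow> ('a \<Rightarrow> 'b) \<Rightarrow> bool"
  where "smooth_map \<A> S \<B> f \<longleftrightarrow>
    (\<forall>p\<in>S. \<exists>c\<in>charts_at \<A> p. \<exists>d\<in>charts_at \<B> (f p). \<exists>W F.
        open W \<and> snd c p \<in> W \<and> W \<subseteq> snd c ` fst c \<and> smooth_on W F \<and>
        (\<forall>q\<in>S \<inter> fst c. snd c q \<in> W \<longrightarrow> f q \<in> fst d \<and> snd d (f q) = F (snd c q)))"

definition eucl :: "('e::euclidean_space, 'e) atlas"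
  where "eucl = {(UNIV, id)}"

definition diffeomorphism ::
  "('a, 'e::euclidean_space) atlas \<Rightarrow> ('b, 'f::euclidean_space) atlas \<Rightarrow> ('a \<Rightarrow> 'b) \<Rightarrow> bool"
  where "diffeomorphism \<A> \<B> f \<longleftrightarrow>
    bij_betw f (mcarrier \<A>) (mcarrier \<B>) \<and>
    smooth_map \<A> (mcarrier \<A>) \<B> f \<and>
    smooth_map \<B> (mcarrier \<B>) \<A> (inv_into (mcarrier \<A>) f)"

text \<open>
  The smooth structure induced on a subset \<open>S\<close> of a manifold: its charts are all diffeomorphisms from
  relatively open subsets of \<open>S\<close> onto open subsets of the Euclidean space \<open>'f\<close>. The subset is an
  embedded submanifold of dimension \<open>DIM('f)\<close> iff these charts cover \<open>S\<close>.
\<close>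

definition submanifold_atlas ::
  "('a, 'e::euclidean_space) atlas \<Rightarrow> 'a set \<Rightarrow> ('a, 'f::euclidean_space) atlas"
  where "submanifold_atlas \<A> S = {(V, \<kappa>).
    openin (subtopology (mtopology \<A>) S) V \<and> inj_on \<kappa> V \<and> open (\<kappa> ` V) \<and>
    smooth_map \<A> V eucl \<kappa> \<and> smooth_map eucl (\<kappa> ` V) \<A> (inv_into V \<kappa>)}"


section \<open>Tangent vectors\<close>

text \<open>
  A tangent vector at \<open>p\<close> is the family of its coordinate vectors in all charts around \<open>p\<close>, these being
  related by the derivatives of the transition maps (and \<open>0\<close> at charts not around \<open>p\<close>).
\<close>

type_synonym ('a, 'e) tvec = "('a, 'e) chart \<Rightarrow> 'e"

definition tangent_space :: "('a, 'e::euclidean_space) atlas \<Rightarrow> 'a \<Rightarrow> ('a, 'e) tvec set"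
  where "tangent_space \<A> p = {v.
    (\<forall>c. c \<notin> charts_at \<A> p \<longrightarrow> v c = 0) \<and>
    (\<forall>c\<in>charts_at \<A> p. \<forall>c'\<in>charts_at \<A> p.
        v c' = frechet_derivative (transition c c') (at (snd c p)) (v c))}"

text \<open>The tangent vector at \<open>p\<close> whose coordinate vector in the chart \<open>c\<close> is \<open>u\<close>.\<close>

definition coord_tvec ::
  "('a, 'e::euclidean_space) atlas \<Rightarrow> ('a, 'e) chart \<Rightarrow> 'a \<Rightarrow> 'e \<Rightarrow> ('a, 'e) tvec"
  where "coord_tvec \<A> c p u = (\<lambda>c'. if c' \<in> charts_at \<A> p
    then frechet_derivative (transition c c') (at (snd c p)) u else 0)"

definition velocity :: "('a, 'e::euclidean_space) atlas \<Rightarrow> (real \<Rightarrow> 'a) \<Rightarrow> real \<Rightarrow> ('a, 'e) tvec"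
  where "velocity \<A> \<gamma> t = (\<lambda>c. if c \<in> charts_at \<A> (\<gamma> t)
    then vector_derivative (\<lambda>s. snd c (\<gamma> s)) (at t) else 0)"

text \<open>For smooth \<open>f\<close> the value does not depend on the chosen chart \<open>c\<close>.\<close>

definition differential ::
  "('a, 'e::euclidean_space) atlas \<Rightarrow> ('b, 'f::euclidean_space) atlas \<Rightarrow> ('a \<Rightarrow> 'b) \<Rightarrow> 'a
    \<Rightarrow> ('a, 'e) tvec \<Rightarrow> ('b, 'f) tvec"
  where "differential \<A> \<B> f p v = (\<lambda>d. if d \<in> charts_at \<B> (f p)
    then (let c = (SOME c. c \<in> charts_at \<A> p) in
            frechet_derivative (snd d \<circ> f \<circ> chart_inv c) (at (snd c p)) (v c))
    else 0)"

definition linear_map_on :: "'v::real_vector set \<Rightarrow> ('v \<Rightarrow> 'w::real_vector) \<Rightarrow> bool"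
  where "linear_map_on V f \<longleftrightarrow>
    (\<forall>u\<in>V. \<forall>v\<in>V. f (u + v) = f u + f v) \<and> (\<forall>r. \<forall>u\<in>V. f (r *\<^sub>R u) = r *\<^sub>R f u)"


section \<open>Orientations and metrics\<close>

definition oriented_manifold :: "('a, real^'n) atlas \<Rightarrow> bool"
  where "oriented_manifold \<A> \<longleftrightarrow> smooth_manifold \<A> \<and>
    (\<forall>c\<in>\<A>. \<forall>c'\<in>\<A>. \<forall>x\<in>snd c ` (fst c \<inter> fst c').
        det (matrix (frechet_derivative (transition c c') (at x))) > 0)"

definition oriented_frame :: "('a, real^'n) atlas \<Rightarrow> 'a \<Rightarrow> ('n \<Rightarrow> ('a, real^'n) tvec) \<Rightarrow> bool"
  where "oriented_frame \<A> p e \<longleftrightarrow> (\<forall>i. e i \<in> tangent_space \<A> p) \<and>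
    (\<forall>c\<in>charts_at \<A> p. det (\<chi> i j. e j c $ i) > 0)"

type_synonym ('a, 'e) metric = "'a \<Rightarrow> ('a, 'e) tvec \<Rightarrow> ('a, 'e) tvec \<Rightarrow> real"

definition metric_coord ::
  "('a, 'e::euclidean_space) atlas \<Rightarrow> ('a, 'e) metric \<Rightarrow> ('a, 'e) chart \<Rightarrow> 'e \<Rightarrow> 'e \<Rightarrow> 'e \<Rightarrow> real"
  where "metric_coord \<A> g c x u v =
    g (chart_inv c x) (coord_tvec \<A> c (chart_inv c x) u) (coord_tvec \<A> c (chart_inv c x) v)"

definition riemannian_metric :: "('a, 'e::euclidean_space) atlas \<Rightarrow> ('a, 'e) metric \<Rightarrow> bool"
  where "riemannian_metric \<A> g \<longleftrightarrow>
    (\<forall>p\<in>mcarrier \<A>.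
        (\<forall>v\<in>tangent_space \<A> p. linear_map_on (tangent_space \<A> p) (g p v)) \<and>
        (\<forall>u\<in>tangent_space \<A> p. \<forall>v\<in>tangent_space \<A> p. g p u v = g p v u) \<and>
        (\<forall>v\<in>tangent_space \<A> p. v \<noteq> 0 \<longrightarrow> g p v v > 0)) \<and>
    (\<forall>c\<in>\<A>. \<forall>u v. smooth_on (snd c ` fst c) (\<lambda>x. metric_coord \<A> g c x u v))"

definition oriented_riemannian_surface :: "('a, real^2) atlas \<Rightarrow> ('a, real^2) metric \<Rightarrow> bool"
  where "oriented_riemannian_surface \<A> g \<longleftrightarrow> oriented_manifold \<A> \<and> riemannian_metric \<A> g"

text \<open>
  The Christoffel symbols \<open>\<Gamma>\<close> of the Levi-Civita connection of a (pseudo-)Riemannian metric in a chart,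
  as a bilinear map: \<open>\<Gamma>(u,v)\<close> is the vector with components
  \<open>\<Gamma>\<^sup>k\<^sub>i\<^sub>j u\<^sup>i v\<^sup>j\<close>, where \<open>2 g\<^sub>l\<^sub>k \<Gamma>\<^sup>k\<^sub>i\<^sub>j = \<partial>\<^sub>i g\<^sub>j\<^sub>l + \<partial>\<^sub>j g\<^sub>i\<^sub>l - \<partial>\<^sub>l g\<^sub>i\<^sub>j\<close>.
\<close>

definition christoffel ::
  "('a, 'e::euclidean_space) atlas \<Rightarrow> ('a, 'e) metric \<Rightarrow> ('a, 'e) chart \<Rightarrow> 'e \<Rightarrow> 'e \<Rightarrow> 'e \<Rightarrow> 'e"
  where "christoffel \<A> g c x u v = (THE z. \<forall>w.
    2 * metric_coord \<A> g c x z w =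
      frechet_derivative (\<lambda>y. metric_coord \<A> g c y v w) (at x) u
    + frechet_derivative (\<lambda>y. metric_coord \<A> g c y u w) (at x) v
    - frechet_derivative (\<lambda>y. metric_coord \<A> g c y u v) (at x) w)"

text \<open>
  The vector field \<open>V\<close> along the curve \<open>\<gamma>\<close> on the open interval \<open>I\<close> is parallel for the Levi-Civita
  connection: \<open>V\<^sup>k' + \<Gamma>\<^sup>k\<^sub>i\<^sub>j \<gamma>\<^sup>i' V\<^sup>j = 0\<close> in every chart.
\<close>

definition parallel_along ::
  "('a, 'e::euclidean_space) atlas \<Rightarrow> ('a, 'e) metric \<Rightarrow> real set \<Rightarrow> (real \<Rightarrow> 'a)
    \<Rightarrow> (real \<Rightarrow> ('a, 'e) tvec) \<Rightarrow> bool"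
  where "parallel_along \<A> g I \<gamma> V \<longleftrightarrow>
    (\<forall>t\<in>I. V t \<in> tangent_space \<A> (\<gamma> t) \<and>
      (\<forall>c\<in>charts_at \<A> (\<gamma> t).
         ((\<lambda>s. V s c) has_vector_derivative
            - christoffel \<A> g c (snd c (\<gamma> t)) (velocity \<A> \<gamma> t c) (V t c)) (at t)))"

definition open_interval_around_0 :: "real set \<Rightarrow> bool"
  where "open_interval_around_0 I \<longleftrightarrow> open I \<and> is_interval I \<and> 0 \<in> I"


section \<open>The product of two surfaces\<close>

text \<open>
  The order of the coordinates (first those of \<open>\<A>\<close>, then those of \<open>\<B>\<close>) makes this the atlas of the
  product orientation.
\<close>

definition product_chart ::
  "('a, real^2) chart \<Rightarrow> ('b, real^2) chart \<Rightarrow> ('a \<times> 'b, real^4) chart"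
  where "product_chart c d = (fst c \<times> fst d,
    \<lambda>(x, y). vector [snd c x $ 1, snd c x $ 2, snd d y $ 1, snd d y $ 2])"

definition product_atlas ::
  "('a, real^2) atlas \<Rightarrow> ('b, real^2) atlas \<Rightarrow> ('a \<times> 'b, real^4) atlas"
  where "product_atlas \<A> \<B> = {product_chart c d |c d. c \<in> \<A> \<and> d \<in> \<B>}"

definition dproj1 ::
  "('a, real^2) atlas \<Rightarrow> ('b, real^2) atlas \<Rightarrow> 'a \<times> 'b \<Rightarrow> ('a \<times> 'b, real^4) tvec \<Rightarrow> ('a, real^2) tvec"
  where "dproj1 \<A> \<B> y = differential (product_atlas \<A> \<B>) \<A> fst y"

definition dproj2 ::
  "('a, real^2) atlas \<Rightarrow> ('b, real^2) atlas \<Rightarrow> 'a \<times> 'b \<Rightarrow> ('a \<times> 'b, real^4) tvec \<Rightarrow> ('b, real^2) tvec"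
  where "dproj2 \<A> \<B> y = differential (product_atlas \<A> \<B>) \<B> snd y"

definition split_metric ::
  "('a, real^2) atlas \<Rightarrow> ('a, real^2) metric \<Rightarrow> ('b, real^2) atlas \<Rightarrow> ('b, real^2) metric
    \<Rightarrow> ('a \<times> 'b, real^4) metric"
  where "split_metric \<A> g1 \<B> g2 y u v =
    g1 (fst y) (dproj1 \<A> \<B> y u) (dproj1 \<A> \<B> y v) - g2 (snd y) (dproj2 \<A> \<B> y u) (dproj2 \<A> \<B> y v)"


section \<open>The configuration space and the rolling velocity distribution\<close>

type_synonym ('a, 'b) config = "'a \<times> 'b \<times> (('a, real^2) tvec \<Rightarrow> ('b, real^2) tvec)"

text \<open>
  The bundle of all linear maps between tangent spaces. Linear maps are represented by
  extensional functions, so that each of them is counted once.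
\<close>

definition hom_bundle :: "('a, real^2) atlas \<Rightarrow> ('b, real^2) atlas \<Rightarrow> ('a, 'b) config set"
  where "hom_bundle \<A> \<B> = {(x, y, A). x \<in> mcarrier \<A> \<and> y \<in> mcarrier \<B> \<and>
    A \<in> tangent_space \<A> x \<rightarrow>\<^sub>E tangent_space \<B> y \<and> linear_map_on (tangent_space \<A> x) A}"

definition hom_chart ::
  "('a, real^2) atlas \<Rightarrow> ('b, real^2) atlas \<Rightarrow> ('a, real^2) chart \<Rightarrow> ('b, real^2) chart
    \<Rightarrow> (('a, 'b) config, (real^2) \<times> (real^2) \<times> (real^2^2)) chart"
  where "hom_chart \<A> \<B> c d =
    ({(x, y, A) \<in> hom_bundle \<A> \<B>. x \<in> fst c \<and> y \<in> fst d},
     \<lambda>(x, y, A). (snd c x, snd d y, matrix (\<lambda>u. A (coord_tvec \<A> c x u) d)))"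

definition hom_atlas ::
  "('a, real^2) atlas \<Rightarrow> ('b, real^2) atlas
    \<Rightarrow> (('a, 'b) config, (real^2) \<times> (real^2) \<times> (real^2^2)) atlas"
  where "hom_atlas \<A> \<B> = {hom_chart \<A> \<B> c d |c d. c \<in> \<A> \<and> d \<in> \<B>}"

definition config_space ::
  "('a, real^2) atlas \<Rightarrow> ('a, real^2) metric \<Rightarrow> ('b, real^2) atlas \<Rightarrow> ('b, real^2) metric
    \<Rightarrow> ('a, 'b) config set"
  where "config_space \<A> g1 \<B> g2 = {(x, y, A) \<in> hom_bundle \<A> \<B>.
    (\<forall>u\<in>tangent_space \<A> x. \<forall>v\<in>tangent_space \<A> x. g2 y (A u) (A v) = g1 x u v) \<and>
    (\<forall>e. oriented_frame \<A> x e \<longrightarrow> oriented_frame \<B> y (\<lambda>i. A (e i)))}"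

definition config_atlas ::
  "('a, real^2) atlas \<Rightarrow> ('a, real^2) metric \<Rightarrow> ('b, real^2) atlas \<Rightarrow> ('b, real^2) metric
    \<Rightarrow> (('a, 'b) config, real^5) atlas"
  where "config_atlas \<A> g1 \<B> g2 = submanifold_atlas (hom_atlas \<A> \<B>) (config_space \<A> g1 \<B> g2)"

definition admissible_curve ::
  "('a, real^2) atlas \<Rightarrow> ('a, real^2) metric \<Rightarrow> ('b, real^2) atlas \<Rightarrow> ('b, real^2) metric
    \<Rightarrow> real set \<Rightarrow> (real \<Rightarrow> ('a, 'b) config) \<Rightarrow> bool"
  where "admissible_curve \<A> g1 \<B> g2 I \<gamma> \<longleftrightarrow>
    smooth_map eucl I (config_atlas \<A> g1 \<B> g2) \<gamma> \<and>
    (let x = (\<lambda>t. fst (\<gamma> t)); y = (\<lambda>t. fst (snd (\<gamma> t))); A = (\<lambda>t. snd (snd (\<gamma> t))) in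
       (\<forall>t\<in>I. A t (velocity \<A> x t) = velocity \<B> y t) \<and>
       (\<forall>V. parallel_along \<A> g1 I x V \<longrightarrow> parallel_along \<B> g2 I y (\<lambda>t. A t (V t))))"

definition rolling_distribution ::
  "('a, real^2) atlas \<Rightarrow> ('a, real^2) metric \<Rightarrow> ('b, real^2) atlas \<Rightarrow> ('b, real^2) metric
    \<Rightarrow> ('a, 'b) config \<Rightarrow> (('a, 'b) config, real^5) tvec set"
  where "rolling_distribution \<A> g1 \<B> g2 p = {velocity (config_atlas \<A> g1 \<B> g2) \<gamma> 0 |\<gamma> I.
    open_interval_around_0 I \<and> admissible_curve \<A> g1 \<B> g2 I \<gamma> \<and> \<gamma> 0 = p}"


section \<open>The twistor circle bundle and the twistor distribution\<close>

text \<open>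
  Bivectors are alternating bilinear functions on linear forms (and \<open>0\<close> at functions which
  are not linear forms).
\<close>

type_synonym 'v bivector = "('v \<Rightarrow> real) \<Rightarrow> ('v \<Rightarrow> real) \<Rightarrow> real"

definition wedge :: "'v::real_vector \<Rightarrow> 'v \<Rightarrow> 'v bivector"
  where "wedge u v = (\<lambda>\<alpha> \<beta>. if linear \<alpha> \<and> linear \<beta> then \<alpha> u * \<beta> v - \<alpha> v * \<beta> u else 0)"

definition bivectors :: "'v::real_vector set \<Rightarrow> 'v bivector set"
  where "bivectors V = span {wedge u v |u v. u \<in> V \<and> v \<in> V}"

definition oriented_on_frame ::
  "('a, real^4) atlas \<Rightarrow> ('a, real^4) metric \<Rightarrow> 'a \<Rightarrow> (4 \<Rightarrow> ('a, real^4) tvec) \<Rightarrow> bool"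
  where "oriented_on_frame \<A> g y e \<longleftrightarrow> oriented_frame \<A> y e \<and>
    g y (e 1) (e 1) = 1 \<and> g y (e 2) (e 2) = 1 \<and> g y (e 3) (e 3) = -1 \<and> g y (e 4) (e 4) = -1 \<and>
    (\<forall>i j. i \<noteq> j \<longrightarrow> g y (e i) (e j) = 0)"

definition hodge_star ::
  "('a, real^4) atlas \<Rightarrow> ('a, real^4) metric \<Rightarrow> 'a
    \<Rightarrow> ('a, real^4) tvec bivector \<Rightarrow> ('a, real^4) tvec bivector"
  where "hodge_star \<A> g y = (THE S.
    S \<in> bivectors (tangent_space \<A> y) \<rightarrow>\<^sub>E bivectors (tangent_space \<A> y) \<and>
    linear_map_on (bivectors (tangent_space \<A> y)) S \<and>
    (\<forall>b\<in>bivectors (tangent_space \<A> y). S (S b) = b) \<and>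
    (\<forall>e. oriented_on_frame \<A> g y e \<longrightarrow>
       S (wedge (e 1) (e 2)) = wedge (e 3) (e 4) \<and>
       S (wedge (e 1) (e 3)) = wedge (e 2) (e 4) \<and>
       S (wedge (e 1) (e 4)) = - wedge (e 2) (e 3)))"

definition tangent_plane :: "('a, real^4) atlas \<Rightarrow> 'a \<Rightarrow> ('a, real^4) tvec set \<Rightarrow> bool"
  where "tangent_plane \<A> y N \<longleftrightarrow> subspace N \<and> N \<subseteq> tangent_space \<A> y \<and> dim N = 2"

definition totally_null :: "('a, real^4) metric \<Rightarrow> 'a \<Rightarrow> ('a, real^4) tvec set \<Rightarrow> bool"
  where "totally_null g y N \<longleftrightarrow> (\<forall>u\<in>N. \<forall>v\<in>N. g y u v = 0)"

definition selfdual ::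
  "('a, real^4) atlas \<Rightarrow> ('a, real^4) metric \<Rightarrow> 'a \<Rightarrow> ('a, real^4) tvec set \<Rightarrow> bool"
  where "selfdual \<A> g y N \<longleftrightarrow>
    (\<forall>n1 n2. N = span {n1, n2} \<longrightarrow> hodge_star \<A> g y (wedge n1 n2) = wedge n1 n2)"

type_synonym 'a plane = "'a \<times> ('a, real^4) tvec set"

definition twistor_space :: "('a, real^4) atlas \<Rightarrow> ('a, real^4) metric \<Rightarrow> 'a plane set"
  where "twistor_space \<A> g = {(y, N). y \<in> mcarrier \<A> \<and>
    tangent_plane \<A> y N \<and> totally_null g y N \<and> selfdual \<A> g y N}"

text \<open>
  Standard charts of the bundle of all tangent planes. For a splitting \<open>L\<close> of the coordinate space
  into two planes, the tangent planes which are graphs over the first summand are described by the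
  matrices of the corresponding linear maps into the second one.
\<close>

definition is_graph_in ::
  "('a, real^4) chart \<Rightarrow> (real^4 \<Rightarrow> (real^2) \<times> (real^2)) \<Rightarrow> ('a, real^4) tvec set \<Rightarrow> real^2^2 \<Rightarrow> bool"
  where "is_graph_in c L N B \<longleftrightarrow> (\<lambda>u. L (u c)) ` N = {(a, B *v a) |a. True}"

definition plane_chart ::
  "('a, real^4) atlas \<Rightarrow> ('a, real^4) chart \<Rightarrow> (real^4 \<Rightarrow> (real^2) \<times> (real^2))
    \<Rightarrow> ('a plane, (real^4) \<times> (real^2^2)) chart"
  where "plane_chart \<A> c L =
    ({(y, N). y \<in> fst c \<and> tangent_plane \<A> y N \<and> (\<exists>B. is_graph_in c L N B)},
     \<lambda>(y, N). (snd c y, THE B. is_graph_in c L N B))"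

definition plane_atlas :: "('a, real^4) atlas \<Rightarrow> ('a plane, (real^4) \<times> (real^2^2)) atlas"
  where "plane_atlas \<A> = {plane_chart \<A> c L |c L. c \<in> \<A> \<and> linear L \<and> bij L}"

definition twistor_atlas ::
  "('a, real^4) atlas \<Rightarrow> ('a, real^4) metric \<Rightarrow> ('a plane, real^5) atlas"
  where "twistor_atlas \<A> g = submanifold_atlas (plane_atlas \<A>) (twistor_space \<A> g)"

definition parallel_transport ::
  "('a, 'e::euclidean_space) atlas \<Rightarrow> ('a, 'e) metric \<Rightarrow> real set \<Rightarrow> (real \<Rightarrow> 'a)
    \<Rightarrow> ('a, 'e) tvec set \<Rightarrow> real \<Rightarrow> ('a, 'e) tvec set"
  where "parallel_transport \<A> g I \<gamma> N t = {V t |V. parallel_along \<A> g I \<gamma> V \<and> V 0 \<in> N}"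

definition is_horizontal_lift ::
  "('a, real^4) atlas \<Rightarrow> ('a, real^4) metric \<Rightarrow> 'a plane \<Rightarrow> ('a, real^4) tvec
    \<Rightarrow> ('a plane, real^5) tvec \<Rightarrow> bool"
  where "is_horizontal_lift \<A> g q Y Z \<longleftrightarrow>
    (\<exists>I \<gamma>. open_interval_around_0 I \<and> smooth_map eucl I \<A> \<gamma> \<and> \<gamma> 0 = fst q \<and> velocity \<A> \<gamma> 0 = Y \<and>
       Z = velocity (twistor_atlas \<A> g) (\<lambda>t. (\<gamma> t, parallel_transport \<A> g I \<gamma> (snd q) t)) 0)"

definition twistor_distribution ::
  "('a, real^4) atlas \<Rightarrow> ('a, real^4) metric \<Rightarrow> 'a plane \<Rightarrow> ('a plane, real^5) tvec set"
  where "twistor_distribution \<A> g q = {Z. \<exists>Y\<in>snd q. is_horizontal_lift \<A> g q Y Z}"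


section \<open>The map from configurations to null planes\<close>

text \<open>
  \<open>{(v, A v) | v \<in> T\<^sub>x}\<close>, where \<open>(v, w)\<close> is the tangent vector of the product with projections \<open>v\<close> and \<open>w\<close>.
\<close>

definition graph_plane ::
  "('a, real^2) atlas \<Rightarrow> ('b, real^2) atlas \<Rightarrow> ('a, 'b) config \<Rightarrow> ('a \<times> 'b, real^4) tvec set"
  where "graph_plane \<A> \<B> = (\<lambda>(x, y, A). {u \<in> tangent_space (product_atlas \<A> \<B>) (x, y).
    \<exists>v\<in>tangent_space \<A> x. dproj1 \<A> \<B> (x, y) u = v \<and> dproj2 \<A> \<B> (x, y) u = A v})"

definition Psi ::
  "('a, real^2) atlas \<Rightarrow> ('b, real^2) atlas \<Rightarrow> ('a, 'b) config \<Rightarrow> ('a \<times> 'b) plane"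
  where "Psi \<A> \<B> = (\<lambda>(x, y, A). ((x, y), graph_plane \<A> \<B> (x, y, A)))"

end

theory Submission
  imports Defs
begin

text \<open>
  At a point \<open>(x, y)\<close> of the product, let \<open>N\<close> be a plane on which the metric
  \<open>g\<^sub>1 \<oplus> (- g\<^sub>2)\<close> vanishes. A vector of \<open>N\<close> without component along the first surface is null and
  tangent to the second one, where the metric is definite, so it is zero. Hence \<open>N\<close> is the graph
  of a linear map \<open>A\<close>, and nullity of the graph says that \<open>A\<close> is an isometry (\<open>null_plane_graph\<close>).
  Let \<open>e\<^sub>1, e\<^sub>2\<close> be an oriented orthonormal basis on the first surface. If \<open>A\<close> preserves the
  orientation, \<open>e\<^sub>1, e\<^sub>2, A e\<^sub>1, A e\<^sub>2\<close> is an oriented orthonormal basis \<open>e\<^sub>1, e\<^sub>2, e\<^sub>3, e\<^sub>4\<close> of the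
  product and the graph is spanned by \<open>e\<^sub>1 + e\<^sub>3\<close> and \<open>e\<^sub>2 + e\<^sub>4\<close>. The wedge of these vectors is
  \<open>e\<^sub>1 \<and> e\<^sub>2 + e\<^sub>1 \<and> e\<^sub>4 - e\<^sub>2 \<and> e\<^sub>3 + e\<^sub>3 \<and> e\<^sub>4\<close>, which the Hodge star fixes. If \<open>A\<close> reverses the
  orientation, \<open>e\<^sub>4\<close> is \<open>- A e\<^sub>2\<close> and the eigenvalue is \<open>-1\<close> (\<open>hodge_star_graph_plane\<close>). Therefore
  \<open>\<Psi>\<close> maps the configuration space bijectively onto the twistor space (\<open>twistor_space_eq\<close>).

  Both spaces are subsets of larger bundles: that of all linear maps between tangent planes of
  the two surfaces, and that of all tangent planes of the product. Coordinates on the surfaces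
  give coordinates on both bundles, consisting of the two points and the matrix of the linear
  map, and in these \<open>\<Psi>\<close> only rearranges the entries (\<open>Psi_chart\<close>). So \<open>\<Psi>\<close> and its inverse are
  smooth, and they remain so between the subsets once these are known to be submanifolds.
  For the configuration space this holds because in orthonormal frames an oriented isometry is a
  rotation, hence a point of the unit circle (\<open>config_chart_exists\<close>); the twistor space
  receives its charts through \<open>\<Psi>\<close> (\<open>mcarrier_twistor\<close>).

  The Levi-Civita connection of the product splits (\<open>christoffel_product\<close>), so a vector field
  along a curve is parallel iff both of its components are (\<open>parallel_product_iff\<close>). It follows
  that a curve \<open>(x(t), y(t), A(t))\<close> is free of twisting iff the graphs of \<open>A(t)\<close> are parallel
  along \<open>(x(t), y(t))\<close>; the direction needed is \<open>parallel_transport_graph\<close>. It is free of slipping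
  iff the velocity of \<open>(x(t), y(t))\<close> lies in the graph of \<open>A(t)\<close>. So \<open>\<Psi>\<close> turns a rolling curve
  into a curve of planes whose velocity is the horizontal lift of a vector of the plane.

  The converse needs two more facts, because a horizontal lift of a vector \<open>Y\<close> of \<open>N\<close> is computed
  along a curve whose velocity lies in the transported plane perhaps at time \<open>0\<close> only. First, the
  lift depends only on \<open>Y\<close>, since the derivative of a parallel family of linear maps is given by the
  Christoffel symbols (\<open>transporting_derivative\<close>). Secondly, from each configuration the
  surfaces can be rolled with any initial velocity of the point of contact: along a coordinate
  line of the first surface the two constraints become an autonomous differential equation for
  the second point and the matrix, and its solution consists of configurations because
  parallel transport preserves both metrics (\<open>rolling_exists\<close>).
\<close>

section \<open>Calculus of smooth functions\<close>

lemma frechet_derivative_cong_open: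
  assumes "open S" "x \<in> S" "\<And>y. y \<in> S \<Longrightarrow> f y = g y"
  shows "frechet_derivative f (at x) = frechet_derivative g (at x)"
    and "f differentiable (at x) \<longleftrightarrow> g differentiable (at x)"
proof -
  have "(f has_derivative D) (at x) \<longleftrightarrow> (g has_derivative D) (at x)" for D
    using has_derivative_transform_within_open[OF _ assms(1,2), of f D UNIV g]
      has_derivative_transform_within_open[OF _ assms(1,2), of g D UNIV f] assms(3) by auto
  then show "frechet_derivative f (at x) = frechet_derivative g (at x)"
    and "f differentiable (at x) \<longleftrightarrow> g differentiable (at x)"
    by (auto simp: frechet_derivative_def differentiable_def)
qed

lemma Ck_on_cong:
  assumes "open S" "\<And>x. x \<in> S \<Longrightarrow> f x = g x"
  shows "Ck_on k S f \<longleftrightarrow> Ck_on k S g"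
  using assms(2)
proof (induction k arbitrary: f g)
  case 0
  then show ?case using continuous_on_cong[OF refl, of S f g] by simp
next
  case (Suc k)
  have "Ck_on k S (\<lambda>x. frechet_derivative f (at x) v) = Ck_on k S (\<lambda>x. frechet_derivative g (at x) v)" for v
  proof (rule Suc.IH)
    fix x assume "x \<in> S"
    from frechet_derivative_cong_open(1)[OF assms(1) this Suc.prems]
    show "frechet_derivative f (at x) v = frechet_derivative g (at x) v" by simp
  qed
  moreover have "f differentiable (at x) \<longleftrightarrow> g differentiable (at x)" if "x \<in> S" for x
    using frechet_derivative_cong_open(2)[OF assms(1) that] Suc.prems by blast
  ultimately show ?case by simp
qed

lemma Ck_on_subset: "Ck_on k S f \<Longrightarrow> T \<subseteq> S \<Longrightarrow> Ck_on k T f"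
proof (induction k arbitrary: f)
  case 0
  then show ?case by (simp add: continuous_on_subset)
qed auto

lemma Ck_on_SucD:
  "Ck_on (Suc k) S f \<Longrightarrow> x \<in> S \<Longrightarrow> (f has_derivative frechet_derivative f (at x)) (at x)"
  using frechet_derivative_works by auto

text \<open>
  On an open set any family of derivatives can take the place of \<open>frechet_derivative\<close>. Every closure
  property below is an induction on the order in which this rule supplies the explicit derivative.
\<close>

lemma Ck_on_SucI:
  assumes "open S" "\<And>x. x \<in> S \<Longrightarrow> (f has_derivative f' x) (at x)" "\<And>v. Ck_on k S (\<lambda>x. f' x v)"
  shows "Ck_on (Suc k) S f"
proof -
  have eq: "frechet_derivative f (at x) = f' x" if "x \<in> S" for x
    using frechet_derivative_at[OF assms(2)[OF that]] by simp
  have "Ck_on k S (\<lambda>x. frechet_derivative f (at x) v)" for v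
    using Ck_on_cong[OF assms(1), of "\<lambda>x. frechet_derivative f (at x) v" "\<lambda>x. f' x v"] assms(3) eq by simp
  then show ?thesis
    using assms(2) by (auto simp: differentiable_def)
qed

lemma Ck_on_Suc_imp: "Ck_on (Suc k) S f \<Longrightarrow> Ck_on k S f"
proof (induction k arbitrary: f)
  case 0
  then show ?case
    by (auto intro!: differentiable_imp_continuous_on simp: differentiable_on_def differentiable_at_withinI)
qed auto

lemma Ck_on_const: "open S \<Longrightarrow> Ck_on k S (\<lambda>x. c)"
proof (induction k arbitrary: c)
  case (Suc k)
  show ?case by (rule Ck_on_SucI[where f' = "\<lambda>x v. 0"]) (use Suc in auto)
qed simp

lemma Ck_on_linear_comp:
  assumes "open S" "bounded_linear l"
  shows "Ck_on k S f \<Longrightarrow> Ck_on k S (\<lambda>x. l (f x))"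
proof (induction k arbitrary: f)
  case 0
  then show ?case
    using assms(2) by (simp add: bounded_linear.continuous_on)
next
  case (Suc k)
  show ?case
  proof (rule Ck_on_SucI[OF assms(1)])
    show "((\<lambda>x. l (f x)) has_derivative (\<lambda>v. l (frechet_derivative f (at x) v))) (at x)" if "x \<in> S" for x
      using bounded_linear.has_derivative[OF assms(2) Ck_on_SucD[OF Suc.prems that]] .
    show "Ck_on k S (\<lambda>x. l (frechet_derivative f (at x) v))" for v
      using Suc by simp
  qed
qed

lemma Ck_on_add:
  assumes "open S"
  shows "Ck_on k S f \<Longrightarrow> Ck_on k S g \<Longrightarrow> Ck_on k S (\<lambda>x. f x + g x)"
proof (induction k arbitrary: f g)
  case 0
  then show ?case by (simp add: continuous_on_add)
next
  case (Suc k)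
  show ?case
    by (rule Ck_on_SucI[OF assms has_derivative_add[OF Ck_on_SucD[OF Suc.prems(1)] Ck_on_SucD[OF Suc.prems(2)]]])
      (use Suc in auto)
qed

lemma Ck_on_id: "open S \<Longrightarrow> Ck_on k S (\<lambda>x. x)"
proof (cases k)
  case (Suc k)
  assume "open S"
  then show ?thesis unfolding Suc
    by (intro Ck_on_SucI[where f' = "\<lambda>x v. v"]) (auto intro: Ck_on_const)
qed simp

lemma Ck_on_bilinear:
  assumes "open S" "bounded_bilinear b"
  shows "Ck_on k S f \<Longrightarrow> Ck_on k S g \<Longrightarrow> Ck_on k S (\<lambda>x. b (f x) (g x))"
proof (induction k arbitrary: f g)
  case 0
  then show ?case
    using bounded_bilinear.continuous_on[OF assms(2)] by auto
next
  case (Suc k)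
  note * = Suc.prems[THEN Ck_on_Suc_imp]
  show ?case
    by (rule Ck_on_SucI[OF assms(1) bounded_bilinear.FDERIV[OF assms(2)
              Ck_on_SucD[OF Suc.prems(1)] Ck_on_SucD[OF Suc.prems(2)]]])
      (use Suc * in \<open>auto intro!: Ck_on_add[OF assms(1)]\<close>)
qed

lemma Ck_on_sum:
  assumes "open S"
  shows "(\<And>i. i \<in> I \<Longrightarrow> Ck_on k S (f i)) \<Longrightarrow> Ck_on k S (\<lambda>x. \<Sum>i\<in>I. f i x)"
proof (induction I rule: infinite_finite_induct)
  case (insert i I)
  then show ?case by (simp add: Ck_on_add[OF assms])
qed (use Ck_on_const[OF assms] in auto)

lemma linear_eq_sum_Basis:
  fixes l :: "'a::euclidean_space \<Rightarrow> 'b::real_vector"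
  assumes "linear l"
  shows "l v = (\<Sum>b\<in>Basis. (v \<bullet> b) *\<^sub>R l b)"
proof -
  have "l v = l (\<Sum>b\<in>Basis. (v \<bullet> b) *\<^sub>R b)" by (simp add: euclidean_representation)
  also have "\<dots> = (\<Sum>b\<in>Basis. (v \<bullet> b) *\<^sub>R l b)"
    by (simp add: linear_sum[OF assms] linear_cmul[OF assms])
  finally show ?thesis .
qed

text \<open>
  The chain rule evaluates the derivative of \<open>g\<close> on a vector that varies with \<open>x\<close>, while the
  induction hypothesis concerns it in a fixed direction; expanding the vector in a basis
  separates the two dependences.
\<close>

lemma Ck_on_compose:
  fixes f :: "'a::real_normed_vector \<Rightarrow> 'b::euclidean_space" and g :: "'b \<Rightarrow> 'c::real_normed_vector"
  assumes "open S" "open T" "f ` S \<subseteq> T"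
  shows "Ck_on k S f \<Longrightarrow> Ck_on k T g \<Longrightarrow> Ck_on k S (\<lambda>x. g (f x))"
proof (induction k arbitrary: g)
  case 0
  then show ?case
    using continuous_on_compose2[of T g S f] assms by simp
next
  case (Suc k)
  note * = Ck_on_SucD[OF Suc.prems(1)]
  have ** : "(g has_derivative frechet_derivative g (at (f x))) (at (f x))" if "x \<in> S" for x
    using Ck_on_SucD[OF Suc.prems(2)] that assms(3) by auto
  show ?case
  proof (rule Ck_on_SucI[OF assms(1)])
    fix x assume x: "x \<in> S"
    have "linear (frechet_derivative g (at (f x)))"
      using ** [OF x] has_derivative_linear by blast
    then show "((\<lambda>x. g (f x)) has_derivative (\<lambda>v. \<Sum>b\<in>Basis. (frechet_derivative f (at x) v \<bullet> b) *\<^sub>R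
        frechet_derivative g (at (f x)) b)) (at x)"
      using has_derivative_compose[OF *[OF x] **[OF x]] by (simp add: linear_eq_sum_Basis[symmetric])
  next
    fix v
    have "Ck_on k S (\<lambda>x. frechet_derivative g (at (f x)) b)" for b
      by (rule Suc.IH[OF Ck_on_Suc_imp[OF Suc.prems(1)]]) (use Suc.prems(2) in simp)
    then show "Ck_on k S (\<lambda>x. \<Sum>b\<in>Basis. (frechet_derivative f (at x) v \<bullet> b) *\<^sub>R frechet_derivative g (at (f x)) b)"
      using Suc.prems(1) assms(1)
      by (intro Ck_on_sum Ck_on_bilinear[OF _ bounded_bilinear_scaleR]
          Ck_on_linear_comp[OF _ bounded_linear_inner_left]) auto
  qed
qed

text \<open>
  The derivative is a polynomial in the function itself, so each order of smoothness yields the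
  next one.
\<close>

lemma Ck_on_inverse: "open S \<Longrightarrow> 0 \<notin> S \<Longrightarrow> Ck_on k S (inverse :: real \<Rightarrow> real)"
proof (induction k)
  case 0
  then show ?case by (auto intro!: continuous_on_inverse)
next
  case (Suc k)
  show ?case
  proof (rule Ck_on_SucI[OF Suc.prems(1)])
    show "(inverse has_derivative (\<lambda>v. - (inverse x * v * inverse x))) (at x)" if "x \<in> S" for x :: real
      using that Suc.prems by (intro has_derivative_inverse') auto
    show "Ck_on k S (\<lambda>x::real. - (inverse x * v * inverse x))" for v
      using Suc by (intro Ck_on_linear_comp[OF _ bounded_linear_minus[OF bounded_linear_ident]]
          Ck_on_bilinear[OF _ bounded_bilinear_mult] Ck_on_const) auto
  qed
qed

lemma Ck_on_sqrt: "open S \<Longrightarrow> S \<subseteq> {0<..} \<Longrightarrow> Ck_on k S sqrt"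
proof (induction k)
  case 0
  then show ?case by (auto intro!: continuous_intros)
next
  case (Suc k)
  show ?case
  proof (rule Ck_on_SucI[OF Suc.prems(1)])
    show "(sqrt has_derivative (\<lambda>v. v * (inverse (sqrt x) / 2))) (at x)" if "x \<in> S" for x :: real
      using that Suc.prems DERIV_real_sqrt[of x] by (simp add: has_field_derivative_def mult_commute_abs subset_iff del: times_divide_eq_right)
    have "Ck_on k S (\<lambda>x. inverse (sqrt x))"
      by (rule Ck_on_compose[where T = "{0<..}"]) (use Suc in \<open>auto intro: Ck_on_inverse\<close>)
    then show "Ck_on k S (\<lambda>x. v * (inverse (sqrt x) / 2))" for v
      using Ck_on_linear_comp[OF Suc.prems(1) bounded_linear_mult_right[of "v / 2"], of k "\<lambda>x. inverse (sqrt x)"]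
      by simp
  qed
qed

named_theorems smooth_intros

lemma smooth_on_cong: "open S \<Longrightarrow> (\<And>x. x \<in> S \<Longrightarrow> f x = g x) \<Longrightarrow> smooth_on S f \<longleftrightarrow> smooth_on S g"
  unfolding smooth_on_def using Ck_on_cong by blast

lemma smooth_on_subset: "smooth_on S f \<Longrightarrow> T \<subseteq> S \<Longrightarrow> smooth_on T f"
  unfolding smooth_on_def using Ck_on_subset by blast

lemma smooth_on_const [smooth_intros]: "open S \<Longrightarrow> smooth_on S (\<lambda>x. c)"
  unfolding smooth_on_def using Ck_on_const by blast

lemma smooth_on_id [smooth_intros]: "open S \<Longrightarrow> smooth_on S (\<lambda>x. x)"
  unfolding smooth_on_def using Ck_on_id by blast

lemma smooth_on_add [smooth_intros]:
  "open S \<Longrightarrow> smooth_on S f \<Longrightarrow> smooth_on S g \<Longrightarrow> smooth_on S (\<lambda>x. f x + g x)"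
  unfolding smooth_on_def using Ck_on_add by blast

lemma smooth_on_linear_comp:
  "bounded_linear l \<Longrightarrow> open S \<Longrightarrow> smooth_on S f \<Longrightarrow> smooth_on S (\<lambda>x. l (f x))"
  unfolding smooth_on_def using Ck_on_linear_comp by blast

lemma smooth_on_linear_comp':
  fixes l :: "'b::euclidean_space \<Rightarrow> 'c::real_normed_vector"
  shows "linear l \<Longrightarrow> open S \<Longrightarrow> smooth_on S f \<Longrightarrow> smooth_on S (\<lambda>x. l (f x))"
  using smooth_on_linear_comp linear_conv_bounded_linear by blast

lemma smooth_on_bilinear:
  "bounded_bilinear b \<Longrightarrow> open S \<Longrightarrow> smooth_on S f \<Longrightarrow> smooth_on S g \<Longrightarrow> smooth_on S (\<lambda>x. b (f x) (g x))"
  unfolding smooth_on_def using Ck_on_bilinear by blast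

lemmas smooth_on_minus [smooth_intros] = smooth_on_linear_comp[OF bounded_linear_minus[OF bounded_linear_ident]]
lemmas smooth_on_mult [smooth_intros] = smooth_on_bilinear[OF bounded_bilinear_mult]
lemmas smooth_on_scaleR [smooth_intros] = smooth_on_bilinear[OF bounded_bilinear_scaleR]
lemmas smooth_on_inner [smooth_intros] = smooth_on_bilinear[OF bounded_bilinear_inner]
lemmas smooth_on_fst [smooth_intros] = smooth_on_linear_comp[OF bounded_linear_fst]
lemmas smooth_on_snd [smooth_intros] = smooth_on_linear_comp[OF bounded_linear_snd]
lemmas smooth_on_vec_nth [smooth_intros] = smooth_on_linear_comp[OF bounded_linear_vec_nth]

lemma smooth_on_diff [smooth_intros]:
  "open S \<Longrightarrow> smooth_on S f \<Longrightarrow> smooth_on S g \<Longrightarrow> smooth_on S (\<lambda>x. f x - g x)"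
  using smooth_on_add[of S f "\<lambda>x. - g x"] smooth_on_minus[of S g] by simp

lemma smooth_on_sum [smooth_intros]:
  "open S \<Longrightarrow> (\<And>i. i \<in> I \<Longrightarrow> smooth_on S (f i)) \<Longrightarrow> smooth_on S (\<lambda>x. \<Sum>i\<in>I. f i x)"
  by (simp add: smooth_on_def Ck_on_sum)

lemma smooth_on_compose:
  fixes f :: "'a::real_normed_vector \<Rightarrow> 'b::euclidean_space"
  shows "smooth_on S f \<Longrightarrow> smooth_on T g \<Longrightarrow> open S \<Longrightarrow> open T \<Longrightarrow> f ` S \<subseteq> T \<Longrightarrow> smooth_on S (\<lambda>x. g (f x))"
  unfolding smooth_on_def using Ck_on_compose by blast

lemma smooth_on_Pair [smooth_intros]:
  assumes "open S" "smooth_on S f" "smooth_on S g"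
  shows "smooth_on S (\<lambda>x. (f x, g x))"
proof -
  have "smooth_on S (\<lambda>x. (f x, 0) + (0, g x))"
    using assms by (intro smooth_on_add smooth_on_linear_comp[of "\<lambda>a. (a, 0)"] smooth_on_linear_comp[of "\<lambda>a. (0, a)"])
      (auto intro!: bounded_linear_Pair bounded_linear_ident bounded_linear_zero)
  then show ?thesis by simp
qed

lemma smooth_on_vec [smooth_intros]:
  fixes f :: "'i::finite \<Rightarrow> 'a::real_normed_vector \<Rightarrow> 'b::euclidean_space"
  assumes "open S" "\<And>i. smooth_on S (f i)"
  shows "smooth_on S (\<lambda>x. \<chi> i. f i x)"
proof -
  have "linear (axis i :: 'b \<Rightarrow> 'b^'i)" for i :: 'i
    by (rule linearI) (auto simp: axis_def vec_eq_iff)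
  then have "smooth_on S (\<lambda>x. axis i (f i x) :: 'b^'i)" for i
    by (rule smooth_on_linear_comp'[OF _ assms])
  then have "smooth_on S (\<lambda>x. \<Sum>i\<in>UNIV. axis i (f i x))"
    by (intro smooth_on_sum assms)
  moreover have "(\<Sum>i\<in>UNIV. axis i (f i x)) = (\<chi> i. f i x)" for x
    by (simp add: vec_eq_iff axis_def if_distrib[of "\<lambda>z. z $ _"] cong: if_cong)
  ultimately show ?thesis by simp
qed

lemma smooth_on_inverse [smooth_intros]:
  fixes f :: "'a::real_normed_vector \<Rightarrow> real"
  assumes "open S" "smooth_on S f" "\<And>x. x \<in> S \<Longrightarrow> f x \<noteq> 0"
  shows "smooth_on S (\<lambda>x. inverse (f x))"
  by (rule smooth_on_compose[where T = "- {0}" and g = inverse, OF assms(2)])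
    (use assms Ck_on_inverse[of "- {0}"] in \<open>auto simp: smooth_on_def\<close>)

lemma smooth_on_divide [smooth_intros]:
  fixes f :: "'a::real_normed_vector \<Rightarrow> real"
  assumes "open S" "smooth_on S f" "smooth_on S g" "\<And>x. x \<in> S \<Longrightarrow> g x \<noteq> 0"
  shows "smooth_on S (\<lambda>x. f x / g x)"
  using smooth_on_mult[OF assms(1,2) smooth_on_inverse[OF assms(1,3,4)]] by (simp add: divide_inverse)

lemma smooth_on_sqrt [smooth_intros]:
  fixes f :: "'a::real_normed_vector \<Rightarrow> real"
  assumes "open S" "smooth_on S f" "\<And>x. x \<in> S \<Longrightarrow> f x > 0"
  shows "smooth_on S (\<lambda>x. sqrt (f x))"
  by (rule smooth_on_compose[where T = "{0<..}" and g = sqrt, OF assms(2)])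
    (use assms Ck_on_sqrt in \<open>auto simp: smooth_on_def\<close>)

lemma smooth_on_has_derivative:
  "smooth_on S f \<Longrightarrow> x \<in> S \<Longrightarrow> (f has_derivative frechet_derivative f (at x)) (at x)"
  unfolding smooth_on_def using Ck_on_SucD by blast

lemma smooth_on_differentiable: "smooth_on S f \<Longrightarrow> x \<in> S \<Longrightarrow> f differentiable (at x)"
  using smooth_on_has_derivative differentiable_def by blast

lemma smooth_on_imp_linear: "smooth_on S f \<Longrightarrow> x \<in> S \<Longrightarrow> linear (frechet_derivative f (at x))"
  using smooth_on_has_derivative has_derivative_linear by blast

lemma smooth_on_imp_continuous_on: "smooth_on S f \<Longrightarrow> continuous_on S f"
  unfolding smooth_on_def by (metis Ck_on.simps(1))

lemma smooth_on_frechet: "smooth_on S f \<Longrightarrow> smooth_on S (\<lambda>x. frechet_derivative f (at x) v)"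
  unfolding smooth_on_def by (metis Ck_on.simps(2))

lemma smooth_on_frechet_apply [smooth_intros]:
  fixes f :: "'a::euclidean_space \<Rightarrow> 'b::real_normed_vector" and p u :: "'c::real_normed_vector \<Rightarrow> 'a"
  assumes "smooth_on T f" "open S" "open T" "smooth_on S p" "p ` S \<subseteq> T" "smooth_on S u"
  shows "smooth_on S (\<lambda>z. frechet_derivative f (at (p z)) (u z))"
proof -
  have "smooth_on S (\<lambda>z. \<Sum>b\<in>Basis. (u z \<bullet> b) *\<^sub>R frechet_derivative f (at (p z)) b)"
    using assms by (intro smooth_on_sum smooth_on_scaleR smooth_on_inner smooth_on_const
        smooth_on_compose[OF _ smooth_on_frechet]) auto
  then show ?thesis
    by (rule smooth_on_cong[OF assms(2), THEN iffD1, rotated])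
      (use linear_eq_sum_Basis[OF smooth_on_imp_linear[OF assms(1)]] assms(5) in \<open>simp add: image_subset_iff\<close>)
qed

lemma smooth_on_linear:
  fixes l :: "'b::euclidean_space \<Rightarrow> 'c::real_normed_vector"
  shows "linear l \<Longrightarrow> open S \<Longrightarrow> smooth_on S l"
  using smooth_on_linear_comp'[of l S "\<lambda>x. x"] smooth_on_id by auto

lemma smooth_on_local:
  assumes "\<And>x. x \<in> S \<Longrightarrow> \<exists>W. open W \<and> x \<in> W \<and> smooth_on W f"
  shows "smooth_on S f"
proof -
  have "Ck_on k S f" for k
    using assms unfolding smooth_on_def
  proof (induction k arbitrary: f)
    case 0
    then show ?case
      by (simp, metis Ck_on.simps(1) continuous_on_eq_continuous_at continuous_at_imp_continuous_on)
  next
    case (Suc k)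
    have "f differentiable at x" if "x \<in> S" for x
      using Suc.prems[OF that] by (metis Ck_on.simps(2))
    moreover have "Ck_on k S (\<lambda>x. frechet_derivative f (at x) v)" for v
      using Suc.prems by (intro Suc.IH) (metis Ck_on.simps(2))
    ultimately show ?case by simp
  qed
  then show ?thesis by (simp add: smooth_on_def)
qed

text \<open>
  The derivative of a solution is a smooth function of the solution, which gains one order of
  differentiability at a time.
\<close>

lemma smooth_on_ode_solution:
  fixes w :: "real \<Rightarrow> 'a::euclidean_space"
  assumes "open J" "open T" "smooth_on T F" "w ` J \<subseteq> T"
    "\<And>t. t \<in> J \<Longrightarrow> (w has_vector_derivative F (w t)) (at t)"
  shows "smooth_on J w"
proof -
  have "Ck_on k J w" for k
  proof (induction k)
    case 0
    have "continuous (at t) w" if "t \<in> J" for t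
      using assms(5)[OF that] has_vector_derivative_continuous by blast
    then show ?case by (simp add: continuous_at_imp_continuous_on)
  next
    case (Suc k)
    have "Ck_on k J (\<lambda>t. F (w t))"
      by (rule Ck_on_compose[OF assms(1,2,4) Suc]) (use assms(3) in \<open>simp add: smooth_on_def\<close>)
    then show ?case
      using assms(1,5) by (intro Ck_on_SucI[where f' = "\<lambda>t v. v *\<^sub>R F (w t)"])
        (auto simp: has_vector_derivative_def intro!: Ck_on_linear_comp[OF _ bounded_linear_scaleR_right])
  qed
  then show ?thesis by (simp add: smooth_on_def)
qed

text \<open>
  The mean value theorem is applied first to the difference \<open>g (x + h v + s u) - g (x + s u)\<close> as a
  function of \<open>s\<close>, and then to the derivative of \<open>g\<close> in the direction \<open>u\<close>. The second difference on the
  left is symmetric in \<open>u\<close> and \<open>v\<close>, the right-hand side is not visibly so.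
\<close>

lemma second_difference_mvt:
  fixes g :: "'a::real_normed_vector \<Rightarrow> real"
  assumes "cball x (h * (norm u + norm v)) \<subseteq> S" "h > 0"
    and Dg: "\<And>y. y \<in> S \<Longrightarrow> (g has_derivative frechet_derivative g (at y)) (at y)"
    and Dg2: "\<And>y. y \<in> S \<Longrightarrow> ((\<lambda>y. frechet_derivative g (at y) u) has_derivative
          frechet_derivative (\<lambda>y. frechet_derivative g (at y) u) (at y)) (at y)"
  obtains y where "y \<in> cball x (h * (norm u + norm v))"
    "g (x + h *\<^sub>R u + h *\<^sub>R v) - g (x + h *\<^sub>R u) - g (x + h *\<^sub>R v) + g x
      = h * (h * frechet_derivative (\<lambda>y. frechet_derivative g (at y) u) (at y) v)"
proof -
  have in_ball: "x + s *\<^sub>R u + t *\<^sub>R v \<in> cball x (h * (norm u + norm v))"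
    if "0 \<le> s" "s \<le> h" "0 \<le> t" "t \<le> h" for s t
  proof -
    have "norm (s *\<^sub>R u + t *\<^sub>R v) \<le> s * norm u + t * norm v"
      using norm_triangle_ineq[of "s *\<^sub>R u" "t *\<^sub>R v"] that by simp
    also have "\<dots> \<le> h * norm u + h * norm v"
      using that by (intro add_mono mult_right_mono) auto
    finally show ?thesis by (simp add: dist_norm algebra_simps norm_minus_commute)
  qed
  have in_S: "x + s *\<^sub>R u + t *\<^sub>R v \<in> S" if "0 \<le> s" "s \<le> h" "0 \<le> t" "t \<le> h" for s t
    using in_ball[OF that] assms(1) by blast
  have line: "((\<lambda>s. f (p + s *\<^sub>R q)) has_field_derivative frechet_derivative f (at (p + s *\<^sub>R q)) q) (at s)"
    if "(f has_derivative frechet_derivative f (at (p + s *\<^sub>R q))) (at (p + s *\<^sub>R q))"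
    for f :: "'a \<Rightarrow> real" and p q s
  proof -
    have "((\<lambda>s. p + s *\<^sub>R q) has_derivative (\<lambda>a. a *\<^sub>R q)) (at s)"
      by (auto intro!: derivative_eq_intros)
    from has_derivative_compose[OF this that] show ?thesis
      using has_derivative_linear[OF that] by (simp add: has_field_derivative_def linear_cmul mult_commute_abs)
  qed
  let ?D = "\<lambda>y. frechet_derivative g (at y) u"
  have "\<exists>s. 0 < s \<and> s < h \<and> (g (x + h *\<^sub>R v + h *\<^sub>R u) - g (x + h *\<^sub>R u)) - (g (x + h *\<^sub>R v + 0 *\<^sub>R u) - g (x + 0 *\<^sub>R u))
      = (h - 0) * (?D (x + h *\<^sub>R v + s *\<^sub>R u) - ?D (x + s *\<^sub>R u))"
  proof (rule MVT2[OF \<open>h > 0\<close>])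
    fix s assume s: "0 \<le> s" "s \<le> h"
    show "((\<lambda>s. g (x + h *\<^sub>R v + s *\<^sub>R u) - g (x + s *\<^sub>R u)) has_field_derivative
        ?D (x + h *\<^sub>R v + s *\<^sub>R u) - ?D (x + s *\<^sub>R u)) (at s)"
      using in_S[OF s, of h] in_S[OF s, of 0] \<open>h > 0\<close>
      by (intro DERIV_diff line Dg) (auto simp: algebra_simps)
  qed
  then obtain s where s: "0 < s" "s < h" "g (x + h *\<^sub>R v + h *\<^sub>R u) - g (x + h *\<^sub>R u) - (g (x + h *\<^sub>R v) - g x)
      = h * (?D (x + h *\<^sub>R v + s *\<^sub>R u) - ?D (x + s *\<^sub>R u))" by auto
  have "\<exists>t. 0 < t \<and> t < h \<and> ?D (x + s *\<^sub>R u + h *\<^sub>R v) - ?D (x + s *\<^sub>R u + 0 *\<^sub>R v)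
      = (h - 0) * frechet_derivative ?D (at (x + s *\<^sub>R u + t *\<^sub>R v)) v"
    using in_S[of s] s by (intro MVT2[OF \<open>h > 0\<close>] line Dg2) auto
  then obtain t where t: "0 < t" "t < h" "?D (x + s *\<^sub>R u + h *\<^sub>R v) - ?D (x + s *\<^sub>R u)
      = h * frechet_derivative ?D (at (x + s *\<^sub>R u + t *\<^sub>R v)) v" by auto
  show ?thesis
    by (rule that[OF in_ball[of s t]]) (use s t in \<open>auto simp: algebra_simps\<close>)
qed

text \<open>
  If the two mixed derivatives differed at \<open>x\<close>, continuity would keep their values apart on a small
  ball, but the two ways of computing the same second difference give points of the ball with
  equal values.
\<close>

lemma symmetric_second_derivative_real:
  fixes g :: "'a::real_normed_vector \<Rightarrow> real"
  assumes "open S" "x \<in> S" "smooth_on S g"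
  shows "frechet_derivative (\<lambda>y. frechet_derivative g (at y) u) (at x) v =
    frechet_derivative (\<lambda>y. frechet_derivative g (at y) v) (at x) u"
proof (rule ccontr)
  let ?H = "\<lambda>u v y. frechet_derivative (\<lambda>y. frechet_derivative g (at y) u) (at y) v"
  assume ne: "?H u v x \<noteq> ?H v u x"
  define e where "e = \<bar>?H u v x - ?H v u x\<bar> / 2"
  have "e > 0" using ne by (simp add: e_def)
  have "continuous_on S (?H u v)" "continuous_on S (?H v u)"
    using smooth_on_imp_continuous_on[OF smooth_on_frechet[OF smooth_on_frechet[OF assms(3)]]] by auto
  then have "continuous (at x) (?H u v)" "continuous (at x) (?H v u)"
    using assms(1,2) continuous_on_eq_continuous_at by blast+
  then obtain d1 d2 where d: "d1 > 0" "\<And>y. dist y x < d1 \<Longrightarrow> dist (?H u v y) (?H u v x) < e"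
    "d2 > 0" "\<And>y. dist y x < d2 \<Longrightarrow> dist (?H v u y) (?H v u x) < e"
    using \<open>e > 0\<close> unfolding continuous_at_eps_delta by metis
  obtain d3 where d3: "d3 > 0" "ball x d3 \<subseteq> S"
    using assms(1,2) open_contains_ball by blast
  define d where "d = min d1 (min d2 d3)"
  \<comment> \<open>The \<open>1\<close> keeps the denominator positive when both vectors vanish.\<close>
  define h where "h = d / (norm u + norm v + 1)"
  have "d > 0" using d d3 by (simp add: d_def)
  have den: "norm u + norm v + 1 > 0" by (simp add: add_nonneg_pos)
  then have "h > 0" using \<open>d > 0\<close> by (simp add: h_def)
  have "h * (norm u + norm v) < d"
    using \<open>d > 0\<close> den by (simp add: h_def divide_simps)
  then have sub: "cball x (h * (norm u + norm v)) \<subseteq> ball x d" by auto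
  then have "cball x (h * (norm u + norm v)) \<subseteq> S"
    using d3 by (force simp: d_def)
  note Dg = smooth_on_has_derivative[OF assms(3)] smooth_on_has_derivative[OF smooth_on_frechet[OF assms(3)]]
  obtain y where y: "y \<in> cball x (h * (norm u + norm v))"
    "g (x + h *\<^sub>R u + h *\<^sub>R v) - g (x + h *\<^sub>R u) - g (x + h *\<^sub>R v) + g x = h * (h * ?H u v y)"
    by (rule second_difference_mvt[OF \<open>cball x (h * (norm u + norm v)) \<subseteq> S\<close> \<open>h > 0\<close> Dg])
  have *: "cball x (h * (norm v + norm u)) \<subseteq> S" "cball x (h * (norm v + norm u)) \<subseteq> ball x d"
    using sub \<open>cball x (h * (norm u + norm v)) \<subseteq> S\<close> by (simp_all add: add.commute)
  obtain z where z: "z \<in> cball x (h * (norm v + norm u))"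
    "g (x + h *\<^sub>R v + h *\<^sub>R u) - g (x + h *\<^sub>R v) - g (x + h *\<^sub>R u) + g x = h * (h * ?H v u z)"
    by (rule second_difference_mvt[OF *(1) \<open>h > 0\<close> Dg])
  have "y \<in> ball x d" "z \<in> ball x d" using y(1) z(1) sub *(2) by blast+
  have "h * (h * ?H u v y) = h * (h * ?H v u z)"
    using y(2) z(2) by (simp add: algebra_simps)
  then have "?H u v y = ?H v u z" using \<open>h > 0\<close> by simp
  moreover have "dist (?H u v y) (?H u v x) < e"
    using \<open>y \<in> ball x d\<close> by (intro d(2)) (simp add: d_def dist_commute)
  moreover have "dist (?H v u z) (?H v u x) < e"
    using \<open>z \<in> ball x d\<close> by (intro d(4)) (simp add: d_def dist_commute)
  ultimately show False
    unfolding dist_real_def e_def by (auto simp: abs_if split: if_splits)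
qed

lemma symmetric_second_derivative:
  fixes f :: "'a::real_normed_vector \<Rightarrow> 'b::euclidean_space"
  assumes "open S" "x \<in> S" "smooth_on S f"
  shows "frechet_derivative (\<lambda>y. frechet_derivative f (at y) u) (at x) v =
    frechet_derivative (\<lambda>y. frechet_derivative f (at y) v) (at x) u"
proof (rule euclidean_eqI)
  fix b :: 'b assume "b \<in> Basis"
  have 1: "frechet_derivative (\<lambda>y. h y \<bullet> b) (at y) = (\<lambda>u. frechet_derivative h (at y) u \<bullet> b)"
    if "y \<in> S" "smooth_on S h" for y and h :: "'a \<Rightarrow> 'b"
    using bounded_linear.has_derivative[OF bounded_linear_inner_left smooth_on_has_derivative[OF that(2,1)]]
    by (metis frechet_derivative_at)
  have 2: "frechet_derivative (\<lambda>y. frechet_derivative (\<lambda>y. f y \<bullet> b) (at y) u) (at x) v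
      = frechet_derivative (\<lambda>y. frechet_derivative f (at y) u) (at x) v \<bullet> b" for u v
  proof -
    have "frechet_derivative (\<lambda>y. frechet_derivative (\<lambda>y. f y \<bullet> b) (at y) u) (at x)
      = frechet_derivative (\<lambda>y. frechet_derivative f (at y) u \<bullet> b) (at x)"
      using 1[OF _ assms(3)] by (intro frechet_derivative_cong_open(1)[OF assms(1,2)]) auto
    also have "\<dots> = (\<lambda>v. frechet_derivative (\<lambda>y. frechet_derivative f (at y) u) (at x) v \<bullet> b)"
      by (rule 1[OF assms(2) smooth_on_frechet[OF assms(3)]])
    finally show ?thesis by simp
  qed
  have "smooth_on S (\<lambda>y. f y \<bullet> b)"
    using assms by (intro smooth_intros)
  from symmetric_second_derivative_real[OF assms(1,2) this, of u v]
  show "frechet_derivative (\<lambda>y. frechet_derivative f (at y) u) (at x) v \<bullet> b =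
    frechet_derivative (\<lambda>y. frechet_derivative f (at y) v) (at x) u \<bullet> b"
    unfolding 2 .
qed

section \<open>Ordinary differential equations\<close>

text \<open>
  On the interval of radius \<open>1 / (2 * L)\<close> the Picard operator is a contraction with factor \<open>1/2\<close>. Clamping
  the time to this interval lets it act on the bounded continuous functions on the whole line,
  which form a Banach space.
\<close>

lemma picard_global:
  fixes F :: "real \<Rightarrow> 'a::euclidean_space \<Rightarrow> 'a"
  assumes cont: "continuous_on UNIV (\<lambda>(t, x). F t x)"
    and lip: "\<And>t x y. norm (F t x - F t y) \<le> L * norm (x - y)" and "L > 0"
  shows "\<exists>x. x t0 = x0 \<and>
    (\<forall>t\<in>{t0 - 1 / (2 * L)<..<t0 + 1 / (2 * L)}. (x has_vector_derivative F t (x t)) (at t))"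
proof -
  define d where "d = 1 / (2 * L)"
  define a b where "a = t0 - d" and "b = t0 + d"
  have "d > 0" and Ld: "L * d = 1 / 2" using \<open>L > 0\<close> by (simp_all add: d_def)
  have ab: "a < t0" "t0 < b" using \<open>d > 0\<close> by (auto simp: a_def b_def)
  define cl where "cl = (\<lambda>t. max a (min b t))"
  have cl: "a \<le> cl t" "cl t \<le> b" for t using ab by (auto simp: cl_def)
  have cl_id: "cl t = t" if "a \<le> t" "t \<le> b" for t using that by (auto simp: cl_def)
  have Fx: "continuous_on S (\<lambda>s. F s (apply_bcontfun x s))" for x S
    using continuous_on_compose2[OF cont continuous_on_Pair[OF continuous_on_id continuous_on_apply_bcontfun]]
    by simp
  then have integrable: "(\<lambda>s. F s (apply_bcontfun x s)) integrable_on {u..v}" for x u v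
    using integrable_continuous_real by blast
  \<comment> \<open>Integrals start at \<open>a\<close>, so that times before and after \<open>t0\<close> are treated by the same formula.\<close>
  define P where "P = (\<lambda>x t. x0 + (integral {a..cl t} (\<lambda>s. F s (apply_bcontfun x s))
      - integral {a..t0} (\<lambda>s. F s (apply_bcontfun x s))))"
  have P_bcont: "P x \<in> bcontfun" for x
  proof -
    have I: "continuous_on {a..b} (\<lambda>t. integral {a..t} (\<lambda>s. F s (apply_bcontfun x s)))"
      by (rule indefinite_integral_continuous_1[OF integrable])
    have "continuous_on UNIV (\<lambda>t. integral {a..cl t} (\<lambda>s. F s (apply_bcontfun x s)))"
      by (rule continuous_on_compose2[OF I]) (use cl in \<open>auto simp: cl_def intro!: continuous_intros\<close>)
    have "bounded ((\<lambda>t. integral {a..t} (\<lambda>s. F s (apply_bcontfun x s))) ` {a..b})"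
      by (rule compact_imp_bounded[OF compact_continuous_image[OF I]]) auto
    then obtain B where "\<forall>t\<in>{a..b}. norm (integral {a..t} (\<lambda>s. F s (apply_bcontfun x s))) \<le> B"
      by (auto simp: bounded_iff simp del: atLeastAtMost_iff)
    then have "norm (P x t) \<le> norm x0 + (B + B)" for t
      unfolding P_def using cl[of t] ab
      by (intro order.trans[OF norm_triangle_ineq] add_mono order.trans[OF norm_triangle_ineq4]) auto
    moreover note \<open>continuous_on UNIV (\<lambda>t. integral {a..cl t} (\<lambda>s. F s (apply_bcontfun x s)))\<close>
    ultimately show ?thesis
      by (intro bcontfun_normI) (auto simp: P_def intro!: continuous_intros)
  qed
  define T where "T = (\<lambda>x. Bcontfun (P x))"
  have T: "apply_bcontfun (T x) t = P x t" for x t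
    by (simp add: T_def Bcontfun_inverse[OF P_bcont])
  have diff: "integral {a..u} (\<lambda>s. F s (apply_bcontfun x s)) - integral {a..v} (\<lambda>s. F s (apply_bcontfun x s))
     = integral {v..u} (\<lambda>s. F s (apply_bcontfun x s))" if "a \<le> v" "v \<le> u" for x u v
    using Henstock_Kurzweil_Integration.integral_combine[OF that integrable] by (simp add: algebra_simps)
  have est: "norm (integral {v..u} (\<lambda>s. F s (apply_bcontfun x s)) - integral {v..u} (\<lambda>s. F s (apply_bcontfun y s)))
     \<le> 1 / 2 * dist x y" if "v \<le> u" "u - v \<le> d" for x y u v
  proof -
    have "norm (integral {v..u} (\<lambda>s. F s (apply_bcontfun x s) - F s (apply_bcontfun y s)))
      \<le> (L * dist x y) * (u - v)"
    proof (rule integral_bound[OF that(1)])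
      show "continuous_on {v..u} (\<lambda>s. F s (apply_bcontfun x s) - F s (apply_bcontfun y s))"
        by (intro continuous_on_diff Fx)
      fix t
      have "norm (apply_bcontfun x t - apply_bcontfun y t) \<le> dist x y"
        using dist_bounded[of x t y] by (simp add: dist_norm)
      then show "norm (F t (apply_bcontfun x t) - F t (apply_bcontfun y t)) \<le> L * dist x y"
        using lip[of t] \<open>L > 0\<close> by (meson order.trans mult_left_mono less_imp_le)
    qed
    also have "\<dots> \<le> (L * dist x y) * d"
      using that \<open>L > 0\<close> by (intro mult_left_mono) auto
    also have "\<dots> = 1 / 2 * dist x y" using Ld by (metis mult.assoc mult.commute)
    finally show ?thesis
      by (simp add: Henstock_Kurzweil_Integration.integral_diff[OF integrable integrable])
  qed
  have "dist (T x) (T y) \<le> 1 / 2 * dist x y" for x y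
  proof (rule dist_bound)
    fix t
    have "dist (T x t) (T y t) = norm ((integral {a..cl t} (\<lambda>s. F s (apply_bcontfun x s))
        - integral {a..t0} (\<lambda>s. F s (apply_bcontfun x s))) - (integral {a..cl t} (\<lambda>s. F s (apply_bcontfun y s))
        - integral {a..t0} (\<lambda>s. F s (apply_bcontfun y s))))"
      by (simp add: T P_def dist_norm)
    also have "\<dots> \<le> 1 / 2 * dist x y"
    proof (cases "t0 \<le> cl t")
      case True
      then show ?thesis
        using diff[of t0 "cl t"] est[of t0 "cl t" x y] cl[of t] ab by (simp add: b_def)
    next
      case False
      define Ix where "Ix = (\<lambda>u. integral {a..u} (\<lambda>s. F s (apply_bcontfun x s)))"
      define Iy where "Iy = (\<lambda>u. integral {a..u} (\<lambda>s. F s (apply_bcontfun y s)))"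
      have "norm ((Ix (cl t) - Ix t0) - (Iy (cl t) - Iy t0)) = norm ((Ix t0 - Ix (cl t)) - (Iy t0 - Iy (cl t)))"
        by (subst norm_minus_cancel[symmetric]) (simp add: algebra_simps)
      then show ?thesis
        using diff[of "cl t" t0] est[of "cl t" t0 x y] cl[of t] ab False
        by (simp add: a_def Ix_def Iy_def)
    qed
    finally show "dist (T x t) (T y t) \<le> 1 / 2 * dist x y" .
  qed
  then obtain x where x: "T x = x"
    using banach_fix_type[of "1/2" T] by auto
  have xP: "apply_bcontfun x t = P x t" for t
    using T[of x t] x by simp
  have "apply_bcontfun x t0 = x0"
    unfolding xP using cl_id[of t0] ab by (simp add: P_def)
  moreover have "(apply_bcontfun x has_vector_derivative F t (apply_bcontfun x t)) (at t)"
    if "t \<in> {a<..<b}" for t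
  proof -
    let ?I = "\<lambda>t. integral {a..t} (\<lambda>s. F s (apply_bcontfun x s))"
    have "(?I has_vector_derivative F t (apply_bcontfun x t)) (at t within {a..b})"
      by (rule integral_has_vector_derivative[OF Fx]) (use that in auto)
    moreover have "at t within {a..b} = at t"
      using that by (intro at_within_interior) auto
    ultimately have "(?I has_vector_derivative F t (apply_bcontfun x t)) (at t)" by simp
    from has_vector_derivative_add[OF has_vector_derivative_const has_vector_derivative_diff[OF this has_vector_derivative_const]]
    have "((\<lambda>t. x0 + (?I t - ?I t0)) has_vector_derivative F t (apply_bcontfun x t)) (at t)"
      by simp
    then show ?thesis
    proof (rule has_vector_derivative_transform_within_open[of _ _ _ "{a<..<b}"])
      show "x0 + (?I s - ?I t0) = apply_bcontfun x s" if "s \<in> {a<..<b}" for s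
        using xP[of s] cl_id[of s] that by (simp add: P_def)
    qed (use that in auto)
  qed
  ultimately show ?thesis
    by (intro exI[of _ "apply_bcontfun x"]) (auto simp: a_def b_def d_def)
qed

text \<open>
  Continuity of the values on each vector is enough, because finitely many basis vectors control
  the operator norm.
\<close>

lemma linear_family_bounded:
  fixes A :: "'b::topological_space \<Rightarrow> 'a::euclidean_space \<Rightarrow> 'c::real_normed_vector"
  assumes "compact C" and lin: "\<And>x. x \<in> C \<Longrightarrow> linear (A x)" and cont: "\<And>b. continuous_on C (\<lambda>x. A x b)"
  obtains L where "L > 0" "\<And>x v. x \<in> C \<Longrightarrow> norm (A x v) \<le> L * norm v"
proof -
  have "\<exists>K. \<forall>x\<in>C. norm (A x b) \<le> K" for b
  proof -
    have "compact ((\<lambda>x. A x b) ` C)" by (rule compact_continuous_image[OF cont assms(1)])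
    from compact_imp_bounded[OF this] show ?thesis by (auto simp: bounded_iff)
  qed
  then obtain K where K: "\<And>b x. x \<in> C \<Longrightarrow> norm (A x b) \<le> K b" by metis
  define L where "L = (\<Sum>b\<in>Basis. \<bar>K b\<bar>) + 1"
  have "L > 0" by (simp add: L_def add_nonneg_pos sum_nonneg)
  moreover have "norm (A x v) \<le> L * norm v" if "x \<in> C" for x v
  proof -
    have "norm (A x v) = norm (\<Sum>b\<in>Basis. (v \<bullet> b) *\<^sub>R A x b)"
      using linear_eq_sum_Basis[OF lin[OF that], of v] by simp
    also have "\<dots> \<le> (\<Sum>b\<in>Basis. norm v * \<bar>K b\<bar>)"
    proof (rule sum_norm_le)
      fix b :: 'a assume "b \<in> Basis"
      then show "norm ((v \<bullet> b) *\<^sub>R A x b) \<le> norm v * \<bar>K b\<bar>"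
        using K[OF that, of b] Basis_le_norm[of b v] by (auto intro!: mult_mono)
    qed
    also have "\<dots> \<le> L * norm v"
      by (simp add: L_def sum_distrib_left algebra_simps)
    finally show ?thesis .
  qed
  ultimately show ?thesis using that by blast
qed

text \<open>
  One interval serves all initial times and values: the Lipschitz constant of a linear equation
  does not depend on the state, and the length of a Picard interval depends only on this constant.
  This is what allows solutions to be continued later on.
\<close>

lemma linear_ode_local:
  fixes A :: "real \<Rightarrow> 'a::euclidean_space \<Rightarrow> 'a"
  assumes "open J" "t0 \<in> J" and lin: "\<And>t. t \<in> J \<Longrightarrow> linear (A t)"
    and cont: "\<And>v. continuous_on J (\<lambda>t. A t v)"
  shows "\<exists>e>0. ball t0 e \<subseteq> J \<and> (\<forall>t1\<in>ball t0 e. \<forall>x0. \<exists>x. x t1 = x0 \<and>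
    (\<forall>t\<in>ball t0 e. (x has_vector_derivative A t (x t)) (at t)))"
proof -
  obtain r where r: "r > 0" "cball t0 r \<subseteq> J"
    using assms(1,2) open_contains_cball by blast
  define cl where "cl = (\<lambda>t. max (t0 - r) (min (t0 + r) t))"
  have cl: "cl t \<in> cball t0 r" for t using r(1) by (auto simp: cl_def dist_real_def)
  have cl_id: "cl t = t" if "t \<in> cball t0 r" for t using that by (auto simp: cl_def dist_real_def abs_le_iff)
  have clc: "continuous_on S cl" for S by (auto simp: cl_def intro!: continuous_intros)
  have linc: "linear (A (cl t))" for t using lin cl r(2) by blast
  obtain L where "L > 0" and L: "\<And>t v. t \<in> cball t0 r \<Longrightarrow> norm (A t v) \<le> L * norm v"
    by (rule linear_family_bounded[of "cball t0 r" A])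
      (use lin r(2) continuous_on_subset[OF cont r(2)] in auto)
  note bound = L[OF cl]
  have "continuous_on UNIV (\<lambda>z. \<Sum>b\<in>Basis. (snd z \<bullet> b) *\<^sub>R A (cl (fst z)) b)"
  proof (intro continuous_intros)
    fix b
    have "continuous_on UNIV (\<lambda>t. A (cl t) b)"
      by (rule continuous_on_compose2[OF cont[of b] clc]) (use cl r(2) in auto)
    then show "continuous_on UNIV (\<lambda>z::real \<times> 'a. A (cl (fst z)) b)"
      by (rule continuous_on_compose2) (auto intro!: continuous_intros)
  qed
  then have "continuous_on UNIV (\<lambda>(t, x). A (cl t) x)"
    by (simp add: linear_eq_sum_Basis[OF linc, symmetric] case_prod_beta')
  note picard = picard_global[OF this _ \<open>L > 0\<close>]
  \<comment> \<open>Any two times of the ball are then at most \<open>1 / (2 * L)\<close> apart.\<close>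
  define e where "e = min r (1 / (4 * L))"
  have "e > 0" using r(1) \<open>L > 0\<close> by (simp add: e_def)
  moreover have "\<exists>x. x t1 = x0 \<and> (\<forall>t\<in>ball t0 e. (x has_vector_derivative A t (x t)) (at t))"
    if t1: "t1 \<in> ball t0 e" for t1 x0
  proof -
    have "norm (A (cl t) x - A (cl t) y) \<le> L * norm (x - y)" for t x y
      using bound[of t "x - y"] by (simp add: linear_diff[OF linc])
    from picard[OF this, of t1 x0]
    obtain x where x: "x t1 = x0"
      "\<And>t. t \<in> {t1 - 1 / (2 * L)<..<t1 + 1 / (2 * L)} \<Longrightarrow> (x has_vector_derivative A (cl t) (x t)) (at t)" by auto
    have "(x has_vector_derivative A t (x t)) (at t)" if "t \<in> ball t0 e" for t
    proof -
      have "\<bar>t - t1\<bar> < e + e" using that t1 by (auto simp: dist_real_def)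
      also have "e + e \<le> 1 / (2 * L)" by (simp add: e_def min_def)
      finally show ?thesis
        using x(2)[of t] cl_id[of t] that by (auto simp: e_def dist_real_def abs_less_iff)
    qed
    then show ?thesis using x(1) by auto
  qed
  moreover have "ball t0 e \<subseteq> J" using r(2) by (auto simp: e_def)
  ultimately show ?thesis by blast
qed

text \<open>
  On a closed ball the right-hand side is Lipschitz. Composed with the nearest point projection
  onto the ball, which does not expand distances, it is so globally; its solution solves the
  original equation until it leaves the ball.
\<close>

lemma autonomous_ode_local:
  fixes F :: "'a::euclidean_space \<Rightarrow> 'a"
  assumes "open T" "x0 \<in> T" "smooth_on T F"
  shows "\<exists>e>0. \<exists>x. x 0 = x0 \<and> (\<forall>t\<in>ball 0 e. x t \<in> T \<and> (x has_vector_derivative F (x t)) (at t))"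
proof -
  obtain r where r: "r > 0" "cball x0 r \<subseteq> T"
    using assms(1,2) open_contains_cball by blast
  let ?C = "cball x0 r"
  let ?D = "\<lambda>x. frechet_derivative F (at x)"
  have "continuous_on ?C (\<lambda>x. ?D x b)" for b
    by (rule continuous_on_subset[OF smooth_on_imp_continuous_on[OF smooth_on_frechet[OF assms(3)]] r(2)])
  then obtain L where "L > 0" and bound: "\<And>x v. x \<in> ?C \<Longrightarrow> norm (?D x v) \<le> L * norm v"
    by (rule linear_family_bounded[of ?C ?D, rotated 2])
      (use smooth_on_imp_linear[OF assms(3)] r(2) in auto)
  have lipC: "norm (F x - F y) \<le> L * norm (x - y)" if "x \<in> ?C" "y \<in> ?C" for x y
  proof (rule differentiable_bound[OF convex_cball, of x0 r F ?D])
    show "(F has_derivative ?D x) (at x within ?C)" if "x \<in> ?C" for x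
      using smooth_on_has_derivative[OF assms(3)] that r(2) has_derivative_at_withinI by blast
    show "onorm (?D x) \<le> L" if "x \<in> ?C" for x
      using bound[OF that] by (intro onorm_bound) (use \<open>L > 0\<close> in auto)
  qed (use that in auto)
  define cp where "cp = closest_point ?C"
  have cp: "cp x \<in> ?C" for x
    unfolding cp_def using r(1) by (intro closest_point_in_set) auto
  have cp_id: "cp x = x" if "x \<in> ?C" for x
    unfolding cp_def using that by (rule closest_point_self)
  have cp_lip: "norm (cp x - cp y) \<le> norm (x - y)" for x y
    using closest_point_lipschitz[of ?C x y] r(1) by (auto simp: cp_def dist_norm)
  have cp_cont: "continuous_on UNIV cp"
    unfolding cp_def using r(1) by (intro continuous_on_closest_point) auto
  have "continuous_on UNIV (\<lambda>x. F (cp x))"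
    using continuous_on_compose2[OF smooth_on_imp_continuous_on[OF assms(3)] cp_cont] cp r(2) by blast
  then have cont: "continuous_on UNIV (\<lambda>(t::real, x). F (cp x))"
    unfolding case_prod_beta' by (rule continuous_on_compose2) (auto intro!: continuous_intros)
  have "norm (F (cp x) - F (cp y)) \<le> L * norm (x - y)" for x y
    using lipC[OF cp cp, of x y] cp_lip[of x y] \<open>L > 0\<close> by (meson order.trans mult_left_mono less_imp_le)
  from picard_global[OF cont this \<open>L > 0\<close>, of 0 x0]
  obtain x where x: "x 0 = x0"
    "\<And>t. t \<in> {- 1 / (2 * L)<..<1 / (2 * L)} \<Longrightarrow> (x has_vector_derivative F (cp (x t))) (at t)" by auto
  have "isCont x 0"
    using x(2)[of 0] \<open>L > 0\<close> has_vector_derivative_continuous by fastforce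
  then obtain d where d: "d > 0" "\<And>t. dist t 0 < d \<Longrightarrow> dist (x t) (x 0) < r"
    using r(1) unfolding continuous_at_eps_delta by metis
  define e where "e = min d (1 / (2 * L))"
  have "e > 0" using d \<open>L > 0\<close> by (simp add: e_def)
  moreover have "x t \<in> T \<and> (x has_vector_derivative F (x t)) (at t)" if t: "t \<in> ball 0 e" for t
  proof -
    have "x t \<in> ?C" using d(2)[of t] t x(1) by (auto simp: e_def dist_commute less_imp_le)
    moreover have "t \<in> {- 1 / (2 * L)<..<1 / (2 * L)}"
      using t by (auto simp: e_def dist_real_def abs_less_iff)
    ultimately show ?thesis using x(2)[of t] cp_id r(2) by auto
  qed
  ultimately show ?thesis using x(1) by blast
qed

section \<open>Atlases and smooth maps\<close>

text \<open>
  A smooth manifold up to the separation and countability axioms. The bundles and submanifolds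
  below enter only through their charts, for which this is the appropriate notion.
\<close>

definition compatible_atlas :: "('a, 'e::euclidean_space) atlas \<Rightarrow> bool"
  where "compatible_atlas \<A> \<longleftrightarrow>
    (\<forall>c\<in>\<A>. inj_on (snd c) (fst c) \<and> open (snd c ` fst c)) \<and>
    (\<forall>c\<in>\<A>. \<forall>c'\<in>\<A>. open (snd c ` (fst c \<inter> fst c')) \<and>
        smooth_on (snd c ` (fst c \<inter> fst c')) (transition c c'))"

lemma smooth_manifold_imp_compatible: "smooth_manifold \<A> \<Longrightarrow> compatible_atlas \<A>"
  by (simp add: smooth_manifold_def compatible_atlas_def)

lemma charts_at_iff: "c \<in> charts_at \<A> p \<longleftrightarrow> c \<in> \<A> \<and> p \<in> fst c"
  by (auto simp: charts_at_def)

lemma mcarrier_charts_at: "p \<in> mcarrier \<A> \<longleftrightarrow> (\<exists>c. c \<in> charts_at \<A> p)"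
  unfolding mcarrier_def charts_at_def by blast

lemma compatible_atlas_inj: "compatible_atlas \<A> \<Longrightarrow> c \<in> \<A> \<Longrightarrow> inj_on (snd c) (fst c)"
  by (simp add: compatible_atlas_def)

lemma compatible_atlas_open: "compatible_atlas \<A> \<Longrightarrow> c \<in> \<A> \<Longrightarrow> open (snd c ` fst c)"
  by (simp add: compatible_atlas_def)

lemma compatible_atlas_open_Int:
  "compatible_atlas \<A> \<Longrightarrow> c \<in> \<A> \<Longrightarrow> c' \<in> \<A> \<Longrightarrow> open (snd c ` (fst c \<inter> fst c'))"
  by (simp add: compatible_atlas_def)

lemma compatible_atlas_smooth:
  "compatible_atlas \<A> \<Longrightarrow> c \<in> \<A> \<Longrightarrow> c' \<in> \<A> \<Longrightarrow> smooth_on (snd c ` (fst c \<inter> fst c')) (transition c c')"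
  by (simp add: compatible_atlas_def)

lemma chart_inv_snd: "compatible_atlas \<A> \<Longrightarrow> c \<in> \<A> \<Longrightarrow> p \<in> fst c \<Longrightarrow> chart_inv c (snd c p) = p"
  by (simp add: chart_inv_def compatible_atlas_inj inv_into_f_f)

lemma chart_inv_in: "x \<in> snd c ` fst c \<Longrightarrow> chart_inv c x \<in> fst c"
  by (simp add: chart_inv_def inv_into_into)

lemma snd_chart_inv: "x \<in> snd c ` fst c \<Longrightarrow> snd c (chart_inv c x) = x"
  by (simp add: chart_inv_def f_inv_into_f)

lemma transition_snd:
  "compatible_atlas \<A> \<Longrightarrow> c \<in> \<A> \<Longrightarrow> p \<in> fst c \<Longrightarrow> transition c c' (snd c p) = snd c' p"
  by (simp add: transition_def chart_inv_snd)

lemma smooth_open_vimage: "smooth_on S f \<Longrightarrow> open S \<Longrightarrow> open T \<Longrightarrow> open (S \<inter> f -` T)"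
  using continuous_open_preimage[OF smooth_on_imp_continuous_on] by blast

lemma openin_mtopology:
  assumes "compatible_atlas \<A>"
  shows "openin (mtopology \<A>) W \<longleftrightarrow> W \<subseteq> mcarrier \<A> \<and> (\<forall>c\<in>\<A>. open (snd c ` (W \<inter> fst c)))"
proof -
  have "istopology (\<lambda>W. W \<subseteq> mcarrier \<A> \<and> (\<forall>c\<in>\<A>. open (snd c ` (W \<inter> fst c))))"
    unfolding istopology_def
  proof (intro conjI allI impI ballI)
    fix S T c
    assume S: "S \<subseteq> mcarrier \<A> \<and> (\<forall>c\<in>\<A>. open (snd c ` (S \<inter> fst c)))"
      and T: "T \<subseteq> mcarrier \<A> \<and> (\<forall>c\<in>\<A>. open (snd c ` (T \<inter> fst c)))" and c: "c \<in> \<A>"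
    have "snd c ` ((S \<inter> fst c) \<inter> (T \<inter> fst c)) = snd c ` (S \<inter> fst c) \<inter> snd c ` (T \<inter> fst c)"
      using compatible_atlas_inj[OF assms c] by (intro inj_on_image_Int[of _ "fst c"]) auto
    moreover have "(S \<inter> fst c) \<inter> (T \<inter> fst c) = S \<inter> T \<inter> fst c" by auto
    ultimately show "open (snd c ` (S \<inter> T \<inter> fst c))" using S T c by auto
  next
    fix \<K> c
    assume K: "\<forall>K\<in>\<K>. K \<subseteq> mcarrier \<A> \<and> (\<forall>c\<in>\<A>. open (snd c ` (K \<inter> fst c)))" and c: "c \<in> \<A>"
    have "snd c ` (\<Union>\<K> \<inter> fst c) = (\<Union>K\<in>\<K>. snd c ` (K \<inter> fst c))" by auto
    then show "open (snd c ` (\<Union>\<K> \<inter> fst c))" using K c by auto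
  qed auto
  then show ?thesis by (simp add: mtopology_def topology_inverse')
qed

lemma openin_chart_vimage:
  assumes "compatible_atlas \<A>" "c \<in> \<A>" "open T"
  shows "openin (mtopology \<A>) (fst c \<inter> snd c -` T)"
  unfolding openin_mtopology[OF assms(1)]
proof (intro conjI ballI)
  show "fst c \<inter> snd c -` T \<subseteq> mcarrier \<A>" using assms(2) by (auto simp: mcarrier_def)
  fix c' assume c': "c' \<in> \<A>"
  have "snd c' ` (fst c \<inter> snd c -` T \<inter> fst c') = snd c' ` (fst c' \<inter> fst c) \<inter> transition c' c -` T"
    by (auto simp: transition_snd[OF assms(1) c'])
  then show "open (snd c' ` (fst c \<inter> snd c -` T \<inter> fst c'))"
    using smooth_open_vimage[OF compatible_atlas_smooth compatible_atlas_open_Int] assms c' by metis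
qed

text \<open>
  Smoothness of a map provides a representation in some charts around the point; composing with
  transition maps gives one in any prescribed charts.
\<close>

lemma smooth_mapE:
  assumes "compatible_atlas \<A>" "compatible_atlas \<B>" "smooth_map \<A> S \<B> f"
    and "p \<in> S" "c \<in> charts_at \<A> p" "d \<in> charts_at \<B> (f p)"
  obtains W F where "open W" "snd c p \<in> W" "W \<subseteq> snd c ` fst c" "smooth_on W F"
    "\<And>q. q \<in> S \<Longrightarrow> q \<in> fst c \<Longrightarrow> snd c q \<in> W \<Longrightarrow> f q \<in> fst d"
    "\<And>q. q \<in> S \<Longrightarrow> q \<in> fst c \<Longrightarrow> snd c q \<in> W \<Longrightarrow> snd d (f q) = F (snd c q)"
proof -
  obtain c0 d0 W0 F0 where c0: "c0 \<in> charts_at \<A> p" "d0 \<in> charts_at \<B> (f p)"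
    and W0: "open W0" "snd c0 p \<in> W0" "W0 \<subseteq> snd c0 ` fst c0" "smooth_on W0 F0"
    and F0: "\<forall>q\<in>S \<inter> fst c0. snd c0 q \<in> W0 \<longrightarrow> f q \<in> fst d0 \<and> snd d0 (f q) = F0 (snd c0 q)"
    using assms(3,4) unfolding smooth_map_def by blast
  note ch = c0[unfolded charts_at_iff] assms(5,6)[unfolded charts_at_iff]
  let ?D = "snd d0 ` (fst d0 \<inter> fst d)" and ?C = "snd c ` (fst c \<inter> fst c0)"
  define W1 where "W1 = W0 \<inter> F0 -` ?D"
  define W where "W = ?C \<inter> transition c c0 -` W1"
  define F where "F = (\<lambda>x. transition d0 d (F0 (transition c c0 x)))"
  have D: "open ?D" "smooth_on ?D (transition d0 d)"
    using compatible_atlas_open_Int[OF assms(2)] compatible_atlas_smooth[OF assms(2)] ch by auto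
  have C: "open ?C" "smooth_on ?C (transition c c0)"
    using compatible_atlas_open_Int[OF assms(1)] compatible_atlas_smooth[OF assms(1)] ch by auto
  have "open W1" unfolding W1_def by (rule smooth_open_vimage[OF W0(4,1) D(1)])
  then have "open W" unfolding W_def by (rule smooth_open_vimage[OF C(2,1)])
  have tr: "transition c c0 (snd c q) = snd c0 q" if "q \<in> fst c" for q
    using transition_snd[OF assms(1) _ that] ch by blast
  have tr': "transition d0 d (snd d0 q) = snd d q" if "q \<in> fst d0" for q
    using transition_snd[OF assms(2) _ that] ch by blast
  show ?thesis
  proof (rule that[of W F])
    show "open W" by fact
    have fp: "f p \<in> fst d0" "snd d0 (f p) = F0 (snd c0 p)" using F0 ch W0 assms(4) by auto
    have "F0 (snd c0 p) \<in> ?D" unfolding fp(2)[symmetric] using fp(1) ch by (intro imageI) auto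
    then show "snd c p \<in> W"
      using W0 ch tr by (auto simp: W_def W1_def)
    show "W \<subseteq> snd c ` fst c" by (auto simp: W_def)
    have "smooth_on W (\<lambda>x. F0 (transition c c0 x))"
      by (rule smooth_on_compose[where T = W1])
        (use C W0 \<open>open W\<close> \<open>open W1\<close> in \<open>auto simp: W_def W1_def intro: smooth_on_subset\<close>)
    then show "smooth_on W F" unfolding F_def
      by (rule smooth_on_compose[OF _ D(2) \<open>open W\<close> D(1)]) (auto simp: W_def W1_def)
    fix q assume q: "q \<in> S" "q \<in> fst c" "snd c q \<in> W"
    have "q \<in> fst c0"
    proof -
      obtain q' where q': "q' \<in> fst c" "q' \<in> fst c0" "snd c q = snd c q'" using q(3) by (auto simp: W_def)
      then have "q = q'" using compatible_atlas_inj[OF assms(1), of c] ch q(2) by (auto dest: inj_onD)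
      then show ?thesis using q' by simp
    qed
    moreover have "snd c0 q \<in> W0" "F0 (snd c0 q) \<in> ?D" using q tr[OF q(2)] by (auto simp: W_def W1_def)
    ultimately have f: "f q \<in> fst d0" "snd d0 (f q) = F0 (snd c0 q)" "snd d0 (f q) \<in> ?D"
      using F0 q(1) by auto
    then obtain r where r: "r \<in> fst d0" "r \<in> fst d" "snd d0 (f q) = snd d0 r" by auto
    then have "f q = r" using compatible_atlas_inj[OF assms(2), of d0] ch f(1) by (auto dest: inj_onD)
    then show "f q \<in> fst d" using r by simp
    show "snd d (f q) = F (snd c q)"
      using tr'[OF f(1)] f(2) tr[OF q(2)] by (simp add: F_def)
  qed
qed

lemma smooth_mapI:
  assumes "\<And>p. p \<in> S \<Longrightarrow> \<exists>c\<in>charts_at \<A> p. \<exists>d\<in>charts_at \<B> (f p). \<exists>W F.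
        open W \<and> snd c p \<in> W \<and> W \<subseteq> snd c ` fst c \<and> smooth_on W F \<and>
        (\<forall>q\<in>S \<inter> fst c. snd c q \<in> W \<longrightarrow> f q \<in> fst d \<and> snd d (f q) = F (snd c q))"
  shows "smooth_map \<A> S \<B> f"
  using assms by (simp add: smooth_map_def)

lemma smooth_map_charts:
  assumes "smooth_map \<A> S \<B> f" "p \<in> S"
  shows "p \<in> mcarrier \<A>" "f p \<in> mcarrier \<B>"
  using assms unfolding smooth_map_def mcarrier_charts_at by blast+

lemma smooth_map_compose:
  assumes "compatible_atlas \<A>" "compatible_atlas \<B>" "compatible_atlas \<C>"
    and f: "smooth_map \<A> S \<B> f" and g: "smooth_map \<B> T \<C> g" and "f ` S \<subseteq> T"
  shows "smooth_map \<A> S \<C> (\<lambda>p. g (f p))"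
proof (rule smooth_mapI)
  fix p assume p: "p \<in> S"
  obtain c where c: "c \<in> charts_at \<A> p" using smooth_map_charts[OF f p] by (auto simp: mcarrier_charts_at)
  obtain d where d: "d \<in> charts_at \<B> (f p)" using smooth_map_charts[OF f p] by (auto simp: mcarrier_charts_at)
  have fp: "f p \<in> T" using p assms(6) by blast
  obtain e where e: "e \<in> charts_at \<C> (g (f p))" using smooth_map_charts[OF g fp] by (auto simp: mcarrier_charts_at)
  obtain W F where W: "open W" "snd c p \<in> W" "W \<subseteq> snd c ` fst c" "smooth_on W F"
    and F: "\<And>q. q \<in> S \<Longrightarrow> q \<in> fst c \<Longrightarrow> snd c q \<in> W \<Longrightarrow> f q \<in> fst d"
    "\<And>q. q \<in> S \<Longrightarrow> q \<in> fst c \<Longrightarrow> snd c q \<in> W \<Longrightarrow> snd d (f q) = F (snd c q)"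
    by (rule smooth_mapE[OF assms(1,2) f p c d]) blast
  obtain X G where X: "open X" "snd d (f p) \<in> X" "X \<subseteq> snd d ` fst d" "smooth_on X G"
    and G: "\<And>q. q \<in> T \<Longrightarrow> q \<in> fst d \<Longrightarrow> snd d q \<in> X \<Longrightarrow> g q \<in> fst e"
    "\<And>q. q \<in> T \<Longrightarrow> q \<in> fst d \<Longrightarrow> snd d q \<in> X \<Longrightarrow> snd e (g q) = G (snd d q)"
    by (rule smooth_mapE[OF assms(2,3) g fp d e]) blast
  have pc: "p \<in> fst c" using c by (simp add: charts_at_iff)
  have o: "open (W \<inter> F -` X)" by (rule smooth_open_vimage[OF W(4,1) X(1)])
  show "\<exists>c\<in>charts_at \<A> p. \<exists>d\<in>charts_at \<C> (g (f p)). \<exists>W F.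
        open W \<and> snd c p \<in> W \<and> W \<subseteq> snd c ` fst c \<and> smooth_on W F \<and>
        (\<forall>q\<in>S \<inter> fst c. snd c q \<in> W \<longrightarrow> g (f q) \<in> fst d \<and> snd d (g (f q)) = F (snd c q))"
  proof (intro bexI[OF _ c] bexI[OF _ e] exI[of _ "W \<inter> F -` X"] exI[of _ "\<lambda>x. G (F x)"] conjI ballI impI o)
    show "snd c p \<in> W \<inter> F -` X" using W X F[OF p pc] by auto
    show "W \<inter> F -` X \<subseteq> snd c ` fst c" using W(3) by blast
    show "smooth_on (W \<inter> F -` X) (\<lambda>x. G (F x))"
      by (rule smooth_on_compose[OF smooth_on_subset[OF W(4)] X(4) o X(1)]) auto
    fix q assume q: "q \<in> S \<inter> fst c" "snd c q \<in> W \<inter> F -` X"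
    then have "f q \<in> T" "f q \<in> fst d" "snd d (f q) = F (snd c q)" "snd d (f q) \<in> X"
      using F[of q] assms(6) by auto
    then show "g (f q) \<in> fst e" "snd e (g (f q)) = G (F (snd c q))" using G[of "f q"] by auto
  qed
qed

lemma smooth_map_cong_subset:
  assumes f: "smooth_map \<A> S \<B> f" and "T \<subseteq> S" "\<And>p. p \<in> T \<Longrightarrow> f p = g p"
  shows "smooth_map \<A> T \<B> g"
proof (rule smooth_mapI)
  fix p assume p: "p \<in> T"
  then obtain c d W F where *: "c \<in> charts_at \<A> p" "d \<in> charts_at \<B> (f p)" "open W" "snd c p \<in> W"
      "W \<subseteq> snd c ` fst c" "smooth_on W F" "\<forall>q\<in>S \<inter> fst c. snd c q \<in> W \<longrightarrow> f q \<in> fst d \<and> snd d (f q) = F (snd c q)"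
    using f \<open>T \<subseteq> S\<close> unfolding smooth_map_def by blast
  have "\<forall>q\<in>T \<inter> fst c. snd c q \<in> W \<longrightarrow> g q \<in> fst d \<and> snd d (g q) = F (snd c q)"
  proof (intro ballI impI)
    fix q assume q: "q \<in> T \<inter> fst c" "snd c q \<in> W"
    then have "q \<in> S \<inter> fst c" using \<open>T \<subseteq> S\<close> by blast
    then have "f q \<in> fst d \<and> snd d (f q) = F (snd c q)" using *(7) q(2) by blast
    then show "g q \<in> fst d \<and> snd d (g q) = F (snd c q)" using assms(3)[of q] q(1) by simp
  qed
  then show "\<exists>c\<in>charts_at \<A> p. \<exists>d\<in>charts_at \<B> (g p). \<exists>W F.
        open W \<and> snd c p \<in> W \<and> W \<subseteq> snd c ` fst c \<and> smooth_on W F \<and>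
        (\<forall>q\<in>T \<inter> fst c. snd c q \<in> W \<longrightarrow> g q \<in> fst d \<and> snd d (g q) = F (snd c q))"
    using * assms(3)[OF p] by metis
qed

lemmas smooth_map_subset = smooth_map_cong_subset[OF _ _ refl]
lemmas smooth_map_cong = smooth_map_cong_subset[OF _ subset_refl]

lemma openin_smooth_map_vimage:
  assumes "compatible_atlas \<A>" "compatible_atlas \<B>" "smooth_map \<A> S \<B> f" "openin (mtopology \<B>) U"
  shows "openin (subtopology (mtopology \<A>) S) (S \<inter> f -` U)"
proof (subst openin_subopen, intro ballI)
  fix p assume "p \<in> S \<inter> f -` U"
  then have p: "p \<in> S" "f p \<in> U" by auto
  obtain c where c: "c \<in> charts_at \<A> p" using smooth_map_charts[OF assms(3) p(1)] by (auto simp: mcarrier_charts_at)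
  obtain d where d: "d \<in> charts_at \<B> (f p)" using smooth_map_charts[OF assms(3) p(1)] by (auto simp: mcarrier_charts_at)
  obtain W F where W: "open W" "snd c p \<in> W" "W \<subseteq> snd c ` fst c" "smooth_on W F"
    and F: "\<And>q. q \<in> S \<Longrightarrow> q \<in> fst c \<Longrightarrow> snd c q \<in> W \<Longrightarrow> f q \<in> fst d"
    "\<And>q. q \<in> S \<Longrightarrow> q \<in> fst c \<Longrightarrow> snd c q \<in> W \<Longrightarrow> snd d (f q) = F (snd c q)"
    by (rule smooth_mapE[OF assms(1-3) p(1) c d]) blast
  let ?D = "snd d ` (U \<inter> fst d)"
  have cd: "c \<in> \<A>" "p \<in> fst c" "d \<in> \<B>" "f p \<in> fst d" using c d by (auto simp: charts_at_iff)
  have "open ?D" using assms(4) cd by (simp add: openin_mtopology[OF assms(2)])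
  let ?O = "fst c \<inter> snd c -` (W \<inter> F -` ?D)"
  have "openin (mtopology \<A>) ?O"
    by (rule openin_chart_vimage[OF assms(1) cd(1) smooth_open_vimage[OF W(4,1) \<open>open ?D\<close>]])
  then have "openin (subtopology (mtopology \<A>) S) (?O \<inter> S)"
    by (auto simp: openin_subtopology)
  moreover have "p \<in> ?O \<inter> S"
  proof -
    have "F (snd c p) \<in> ?D" unfolding F(2)[OF p(1) cd(2) W(2), symmetric] using p cd by (intro imageI) auto
    then show ?thesis using p cd W(2) by auto
  qed
  moreover have "?O \<inter> S \<subseteq> S \<inter> f -` U"
  proof
    fix q assume q: "q \<in> ?O \<inter> S"
    then obtain r where r: "r \<in> U" "r \<in> fst d" "snd d (f q) = snd d r" "f q \<in> fst d" using F[of q] by auto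
    then have "f q = r" using compatible_atlas_inj[OF assms(2) cd(3)] by (auto dest: inj_onD)
    then show "q \<in> S \<inter> f -` U" using q r by auto
  qed
  ultimately show "\<exists>T. openin (subtopology (mtopology \<A>) S) T \<and> p \<in> T \<and> T \<subseteq> S \<inter> f -` U" by blast
qed

lemma smooth_map_local:
  assumes "compatible_atlas \<A>"
    and loc: "\<And>p. p \<in> S \<Longrightarrow> \<exists>V. openin (subtopology (mtopology \<A>) S) V \<and> p \<in> V \<and> smooth_map \<A> V \<B> f"
  shows "smooth_map \<A> S \<B> f"
proof (rule smooth_mapI)
  fix p assume "p \<in> S"
  then obtain V where V: "openin (subtopology (mtopology \<A>) S) V" "p \<in> V" "smooth_map \<A> V \<B> f" using loc by blast
  then obtain c d W F where cd: "c \<in> charts_at \<A> p" "d \<in> charts_at \<B> (f p)"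
    and W: "open W" "snd c p \<in> W" "W \<subseteq> snd c ` fst c" "smooth_on W F"
    and F: "\<forall>q\<in>V \<inter> fst c. snd c q \<in> W \<longrightarrow> f q \<in> fst d \<and> snd d (f q) = F (snd c q)"
    unfolding smooth_map_def by blast
  obtain X where X: "openin (mtopology \<A>) X" "V = X \<inter> S" using V(1) by (auto simp: openin_subtopology)
  have c: "c \<in> \<A>" "p \<in> fst c" using cd by (auto simp: charts_at_iff)
  have "open (snd c ` (X \<inter> fst c))" using X(1) c by (simp add: openin_mtopology[OF assms(1)])
  then have o: "open (W \<inter> snd c ` (X \<inter> fst c))" using W by auto
  show "\<exists>c\<in>charts_at \<A> p. \<exists>d\<in>charts_at \<B> (f p). \<exists>W F.
        open W \<and> snd c p \<in> W \<and> W \<subseteq> snd c ` fst c \<and> smooth_on W F \<and>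
        (\<forall>q\<in>S \<inter> fst c. snd c q \<in> W \<longrightarrow> f q \<in> fst d \<and> snd d (f q) = F (snd c q))"
  proof (intro bexI[OF _ cd(1)] bexI[OF _ cd(2)] exI[of _ "W \<inter> snd c ` (X \<inter> fst c)"] exI[of _ F] conjI o)
    show "snd c p \<in> W \<inter> snd c ` (X \<inter> fst c)" using W V X c by auto
    show "W \<inter> snd c ` (X \<inter> fst c) \<subseteq> snd c ` fst c" by auto
    show "smooth_on (W \<inter> snd c ` (X \<inter> fst c)) F" by (rule smooth_on_subset[OF W(4)]) auto
    show "\<forall>q\<in>S \<inter> fst c. snd c q \<in> W \<inter> snd c ` (X \<inter> fst c) \<longrightarrow> f q \<in> fst d \<and> snd d (f q) = F (snd c q)"
    proof (intro ballI impI)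
      fix q assume q: "q \<in> S \<inter> fst c" "snd c q \<in> W \<inter> snd c ` (X \<inter> fst c)"
      then obtain r where r: "r \<in> X" "r \<in> fst c" "snd c q = snd c r" by auto
      then have "q = r" using compatible_atlas_inj[OF assms(1) c(1)] q by (auto dest: inj_onD)
      then show "f q \<in> fst d \<and> snd d (f q) = F (snd c q)" using F q r X by auto
    qed
  qed
qed

section \<open>Euclidean space\<close>

lemma transition_id: "transition (UNIV, id) (UNIV, id) = id"
  by (auto simp: transition_def chart_inv_def inv_id)

lemma compatible_eucl: "compatible_atlas eucl"
  by (simp add: compatible_atlas_def eucl_def transition_id smooth_on_id[of UNIV, folded id_def])

lemma charts_at_eucl [simp]: "charts_at eucl p = {(UNIV, id)}"
  by (auto simp: charts_at_def eucl_def)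

lemma mcarrier_eucl [simp]: "mcarrier eucl = UNIV"
  by (auto simp: mcarrier_def eucl_def)

lemma openin_eucl [simp]: "openin (mtopology eucl) W \<longleftrightarrow> open W"
  by (simp add: openin_mtopology[OF compatible_eucl]) (simp add: eucl_def)

lemma smooth_map_imp_smooth_on:
  assumes "open S" "smooth_map eucl S eucl f" shows "smooth_on S f"
proof (rule smooth_on_local)
  fix x assume "x \<in> S"
  then obtain W F where W: "open W" "x \<in> W" "smooth_on W F" "\<forall>q\<in>S. q \<in> W \<longrightarrow> f q = F q"
    using assms(2) by (auto simp: smooth_map_def)
  then have "smooth_on (W \<inter> S) f"
    using smooth_on_cong[of "W \<inter> S" f F] assms(1) smooth_on_subset[of W F "W \<inter> S"] by auto
  then show "\<exists>W. open W \<and> x \<in> W \<and> smooth_on W f"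
    using W \<open>x \<in> S\<close> assms(1) by (intro exI[of _ "W \<inter> S"]) auto
qed

section \<open>Submanifolds\<close>

context
  fixes \<A> :: "('a, 'e::euclidean_space) atlas" and S :: "'a set"
  assumes compat: "compatible_atlas \<A>"
begin

lemma submanifold_chartD:
  assumes "c \<in> submanifold_atlas \<A> S"
  shows "openin (subtopology (mtopology \<A>) S) (fst c)" "inj_on (snd c) (fst c)" "open (snd c ` fst c)"
    "smooth_map \<A> (fst c) eucl (snd c)" "smooth_map eucl (snd c ` fst c) \<A> (chart_inv c)" "fst c \<subseteq> S"
  using assms openin_imp_subset by (fastforce simp: submanifold_atlas_def chart_inv_def)+

lemma mcarrier_submanifold_subset: "mcarrier (submanifold_atlas \<A> S) \<subseteq> S"
  using submanifold_chartD(6) by (fastforce simp: mcarrier_def)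

text \<open>
  A change of charts of the submanifold is the inverse of one chart, smooth into the ambient
  manifold, followed by another chart, smooth on a subset of it. The overlap is open because the
  inverse chart is continuous.
\<close>

lemma compatible_submanifold:
  "compatible_atlas (submanifold_atlas \<A> S :: ('a, 'f::euclidean_space) atlas)"
  unfolding compatible_atlas_def
proof (intro conjI ballI)
  fix c c' :: "('a, 'f) chart"
  assume c: "c \<in> submanifold_atlas \<A> S" and c': "c' \<in> submanifold_atlas \<A> S"
  note C = submanifold_chartD[OF c] and C' = submanifold_chartD[OF c']
  show "inj_on (snd c) (fst c)" "open (snd c ` fst c)" by fact+
  obtain X where X: "openin (mtopology \<A>) X" "fst c' = X \<inter> S" using C'(1) by (auto simp: openin_subtopology)
  have eq: "snd c ` (fst c \<inter> fst c') = snd c ` fst c \<inter> chart_inv c -` X"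
    using C(2,6) X(2) by (auto simp: chart_inv_def inv_into_f_f)
  have "openin (subtopology (mtopology eucl) (snd c ` fst c)) (snd c ` fst c \<inter> chart_inv c -` X)"
    by (rule openin_smooth_map_vimage[OF compatible_eucl compat C(5) X(1)])
  then show o: "open (snd c ` (fst c \<inter> fst c'))"
    unfolding eq using C(3) by (auto simp: openin_subtopology)
  have "smooth_map eucl (snd c ` (fst c \<inter> fst c')) eucl (\<lambda>x. snd c' (chart_inv c x))"
    by (rule smooth_map_compose[OF compatible_eucl compat compatible_eucl smooth_map_subset[OF C(5)] C'(4)])
      (use C(2) in \<open>auto simp: chart_inv_def inv_into_f_f\<close>)
  then show "smooth_on (snd c ` (fst c \<inter> fst c')) (transition c c')"
    using smooth_map_imp_smooth_on[OF o] by (simp add: transition_def comp_def)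
qed

lemma smooth_submanifold_inclusion:
  "smooth_map (submanifold_atlas \<A> S :: ('a, 'f::euclidean_space) atlas)
    (mcarrier (submanifold_atlas \<A> S :: ('a, 'f) atlas)) \<A> (\<lambda>p. p)"
proof (rule smooth_mapI)
  fix p assume "p \<in> mcarrier (submanifold_atlas \<A> S :: ('a, 'f) atlas)"
  then obtain c :: "('a, 'f) chart" where c: "c \<in> submanifold_atlas \<A> S" "p \<in> fst c" by (auto simp: mcarrier_def)
  note C = submanifold_chartD[OF c(1)]
  have inv: "chart_inv c (snd c q) = q" if "q \<in> fst c" for q
    using C(2) that by (auto simp: chart_inv_def inv_into_f_f)
  have "snd c p \<in> snd c ` fst c" using c(2) by blast
  then obtain d W F where d: "d \<in> charts_at \<A> p" and W: "open W" "snd c p \<in> W" "smooth_on W F"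
    and F: "\<forall>x\<in>snd c ` fst c. x \<in> W \<longrightarrow> chart_inv c x \<in> fst d \<and> snd d (chart_inv c x) = F x"
    using C(5) inv[OF c(2)] unfolding smooth_map_def by fastforce
  show "\<exists>c\<in>charts_at (submanifold_atlas \<A> S) p. \<exists>d\<in>charts_at \<A> p. \<exists>W (F :: 'f \<Rightarrow> 'e).
        open W \<and> snd c p \<in> W \<and> W \<subseteq> snd c ` fst c \<and> smooth_on W F \<and>
        (\<forall>q\<in>mcarrier (submanifold_atlas \<A> S :: ('a, 'f) atlas) \<inter> fst c. snd c q \<in> W \<longrightarrow> q \<in> fst d \<and> snd d q = F (snd c q))"
  proof (rule bexI[of _ c], rule bexI[OF _ d], intro exI[of _ "W \<inter> snd c ` fst c"] exI[of _ F] conjI)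
    show "open (W \<inter> snd c ` fst c)" using W C(3) by auto
    show "smooth_on (W \<inter> snd c ` fst c) F" by (rule smooth_on_subset[OF W(3)]) auto
    show "\<forall>q\<in>mcarrier (submanifold_atlas \<A> S :: ('a, 'f) atlas) \<inter> fst c. snd c q \<in> W \<inter> snd c ` fst c \<longrightarrow> q \<in> fst d \<and> snd d q = F (snd c q)"
      using F inv by force
  qed (use c W in \<open>auto simp: charts_at_iff\<close>)
qed

text \<open>
  A chart of the submanifold is itself a smooth map on a relatively open subset, so its composition
  with \<open>f\<close> is smooth.
\<close>

lemma smooth_map_into_submanifold:
  assumes "compatible_atlas \<B>" "smooth_map \<B> R \<A> f"
    and sub: "f ` R \<subseteq> mcarrier (submanifold_atlas \<A> S :: ('a, 'f::euclidean_space) atlas)"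
  shows "smooth_map \<B> R (submanifold_atlas \<A> S :: ('a, 'f) atlas) f"
proof (rule smooth_map_local[OF assms(1)])
  fix p assume p: "p \<in> R"
  then obtain c :: "('a, 'f) chart" where c: "c \<in> submanifold_atlas \<A> S" "f p \<in> fst c"
    using sub by (auto simp: mcarrier_def)
  note C = submanifold_chartD[OF c(1)]
  obtain X where X: "openin (mtopology \<A>) X" "fst c = X \<inter> S" using C(1) by (auto simp: openin_subtopology)
  have fS: "f ` R \<subseteq> S" using sub mcarrier_submanifold_subset by blast
  let ?V = "R \<inter> f -` X"
  have V: "f ` ?V \<subseteq> fst c" using X(2) fS by auto
  have "openin (subtopology (mtopology \<B>) R) ?V"
    by (rule openin_smooth_map_vimage[OF assms(1) compat assms(2) X(1)])
  moreover have "p \<in> ?V" using p c X by auto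
  moreover have "smooth_map \<B> ?V (submanifold_atlas \<A> S :: ('a, 'f) atlas) f"
  proof (rule smooth_mapI)
    fix q assume q: "q \<in> ?V"
    have "smooth_map \<B> ?V eucl (\<lambda>p. snd c (f p))"
      by (rule smooth_map_compose[OF assms(1) compat compatible_eucl smooth_map_subset[OF assms(2)] C(4) V]) auto
    then obtain b W F where "b \<in> charts_at \<B> q" "open W" "snd b q \<in> W" "W \<subseteq> snd b ` fst b" "smooth_on W F"
      "\<forall>q\<in>?V \<inter> fst b. snd b q \<in> W \<longrightarrow> snd c (f q) = F (snd b q)"
      using q unfolding smooth_map_def by fastforce
    then show "\<exists>c\<in>charts_at \<B> q. \<exists>d\<in>charts_at (submanifold_atlas \<A> S) (f q). \<exists>W (F :: _ \<Rightarrow> 'f).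
        open W \<and> snd c q \<in> W \<and> W \<subseteq> snd c ` fst c \<and> smooth_on W F \<and>
        (\<forall>q\<in>?V \<inter> fst c. snd c q \<in> W \<longrightarrow> f q \<in> fst d \<and> snd d (f q) = F (snd c q))"
      using V q c(1) by (intro bexI[of _ b] bexI[of _ c] exI[of _ W] exI[of _ F]) (auto simp: charts_at_iff)
  qed
  ultimately show "\<exists>V. openin (subtopology (mtopology \<B>) R) V \<and> p \<in> V \<and> smooth_map \<B> V (submanifold_atlas \<A> S :: ('a, 'f) atlas) f"
    by blast
qed

text \<open>
  Charts can be carried from one subset to another by a pair of mutually inverse maps that are
  smooth into the ambient manifolds.
\<close>

lemma submanifold_chart_transport:
  fixes \<kappa> :: "'a \<Rightarrow> 'f::euclidean_space"
  assumes "compatible_atlas \<B>" "smooth_map \<A> S \<B> f" "smooth_map \<B> T \<A> g"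
    and "f ` S \<subseteq> T" "g ` T \<subseteq> S" "\<And>p. p \<in> S \<Longrightarrow> g (f p) = p" "\<And>q. q \<in> T \<Longrightarrow> f (g q) = q"
    and c: "(V, \<kappa>) \<in> submanifold_atlas \<A> S"
  shows "(f ` V, \<lambda>q. \<kappa> (g q)) \<in> submanifold_atlas \<B> T"
proof -
  note C = submanifold_chartD[OF c, simplified]
  obtain X where X: "openin (mtopology \<A>) X" "V = X \<inter> S" using C(1) by (auto simp: openin_subtopology)
  have fV: "f ` V = T \<inter> g -` X"
  proof
    show "f ` V \<subseteq> T \<inter> g -` X" using X(2) assms(4,6) by auto
    show "T \<inter> g -` X \<subseteq> f ` V"
    proof
      fix q assume "q \<in> T \<inter> g -` X"
      then show "q \<in> f ` V" using X(2) assms(5) assms(7)[of q] by (intro image_eqI[of q f "g q"]) auto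
    qed
  qed
  have o: "openin (subtopology (mtopology \<B>) T) (f ` V)"
    unfolding fV by (rule openin_smooth_map_vimage[OF assms(1) compat assms(3) X(1)])
  have gf: "g (f p) = p" if "p \<in> V" for p using that X assms(6) by auto
  have inj: "inj_on (\<lambda>q. \<kappa> (g q)) (f ` V)"
    using C(2) gf by (auto simp: inj_on_def)
  have img: "(\<lambda>q. \<kappa> (g q)) ` (f ` V) = \<kappa> ` V"
    using gf by (force simp: image_image)
  have "smooth_map \<B> (f ` V) eucl (\<lambda>q. \<kappa> (g q))"
    by (rule smooth_map_compose[OF assms(1) compat compatible_eucl smooth_map_subset[OF assms(3)] C(4)])
      (use gf fV X(2) assms(5) in auto)
  moreover have "smooth_map eucl (\<kappa> ` V) \<B> (inv_into (f ` V) (\<lambda>q. \<kappa> (g q)))"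
  proof (rule smooth_map_cong[OF smooth_map_compose[OF compatible_eucl compat assms(1) C(5) smooth_map_subset[OF assms(2)]]])
    show "V \<subseteq> S" by fact
    show "chart_inv (V, \<kappa>) ` \<kappa> ` V \<subseteq> V" using C(2) by (auto simp: chart_inv_def inv_into_f_f)
    fix x assume "x \<in> \<kappa> ` V"
    then obtain p where p: "p \<in> V" "x = \<kappa> p" by auto
    then have "chart_inv (V, \<kappa>) x = p" using C(2) by (simp add: chart_inv_def inv_into_f_f)
    moreover have "inv_into (f ` V) (\<lambda>q. \<kappa> (g q)) x = f p"
      using inv_into_f_f[OF inj, of "f p"] p gf by simp
    ultimately show "f (chart_inv (V, \<kappa>) x) = inv_into (f ` V) (\<lambda>q. \<kappa> (g q)) x" by simp
  qed
  ultimately show ?thesis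
    using o inj C(3) img by (simp add: submanifold_atlas_def)
qed

end

section \<open>Tangent vectors and velocities\<close>

abbreviation dtrans :: "('a, 'e::euclidean_space) chart \<Rightarrow> ('a, 'e) chart \<Rightarrow> 'a \<Rightarrow> 'e \<Rightarrow> 'e"
  where "dtrans c c' p \<equiv> frechet_derivative (transition c c') (at (snd c p))"

context
  fixes \<A> :: "('a, 'e::euclidean_space) atlas"
  assumes compat: "compatible_atlas \<A>"
begin

lemma transition_has_derivative:
  assumes "c \<in> charts_at \<A> p" "c' \<in> charts_at \<A> p"
  shows "(transition c c' has_derivative dtrans c c' p) (at (snd c p))"
  using assms by (intro smooth_on_has_derivative[OF compatible_atlas_smooth[OF compat]]) (auto simp: charts_at_iff)

lemma linear_dtrans: "c \<in> charts_at \<A> p \<Longrightarrow> c' \<in> charts_at \<A> p \<Longrightarrow> linear (dtrans c c' p)"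
  using transition_has_derivative has_derivative_linear by blast

lemma dtrans_self:
  assumes "c \<in> charts_at \<A> p" shows "dtrans c c p u = u"
proof -
  have c: "c \<in> \<A>" "p \<in> fst c" using assms by (auto simp: charts_at_iff)
  have "frechet_derivative (transition c c) (at (snd c p)) = frechet_derivative (\<lambda>x. x) (at (snd c p))"
    by (rule frechet_derivative_cong_open(1)[OF compatible_atlas_open[OF compat c(1)]])
      (use c transition_snd[OF compat c(1), of _ c] in auto)
  then show ?thesis using fun_cong[OF frechet_derivative_at[OF has_derivative_ident, of "snd c p"], of u] by simp
qed

lemma dtrans_comp:
  assumes "c \<in> charts_at \<A> p" "c' \<in> charts_at \<A> p" "c'' \<in> charts_at \<A> p"
  shows "dtrans c' c'' p (dtrans c c' p u) = dtrans c c'' p u"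
proof -
  have c: "c \<in> \<A>" "p \<in> fst c" "c' \<in> \<A>" "p \<in> fst c'" "c'' \<in> \<A>" "p \<in> fst c''" using assms by (auto simp: charts_at_iff)
  have tr: "transition c c' (snd c p) = snd c' p" using transition_snd[OF compat c(1,2)] .
  have 1: "((\<lambda>x. transition c' c'' (transition c c' x)) has_derivative (\<lambda>u. dtrans c' c'' p (dtrans c c' p u))) (at (snd c p))"
    by (rule has_derivative_compose[OF transition_has_derivative])
      (use assms tr transition_has_derivative in auto)
  have 2: "frechet_derivative (\<lambda>x. transition c' c'' (transition c c' x)) (at (snd c p)) = dtrans c c'' p"
    by (rule frechet_derivative_cong_open(1)[OF compatible_atlas_open_Int[OF compat c(1,3)]])
      (use c in \<open>auto simp: transition_snd[OF compat c(1)] transition_snd[OF compat c(3)]\<close>)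
  show ?thesis using fun_cong[OF frechet_derivative_at[OF 1], of u] 2 by simp
qed

lemma tangent_vector_transform:
  "v \<in> tangent_space \<A> p \<Longrightarrow> c \<in> charts_at \<A> p \<Longrightarrow> c' \<in> charts_at \<A> p \<Longrightarrow> v c' = dtrans c c' p (v c)"
  unfolding tangent_space_def by blast

lemma tangent_vector_outside: "v \<in> tangent_space \<A> p \<Longrightarrow> c \<notin> charts_at \<A> p \<Longrightarrow> v c = 0"
  unfolding tangent_space_def by blast

lemma tangent_vector_eqI:
  assumes "v \<in> tangent_space \<A> p" "w \<in> tangent_space \<A> p" "c \<in> charts_at \<A> p" "v c = w c"
  shows "v = w"
proof
  fix c' show "v c' = w c'"
    using assms tangent_vector_transform[of v p c c'] tangent_vector_transform[of w p c c']
      tangent_vector_outside[of v p c'] tangent_vector_outside[of w p c'] by (cases "c' \<in> charts_at \<A> p") auto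
qed

lemma tangent_spaceI:
  assumes "\<And>c. c \<notin> charts_at \<A> p \<Longrightarrow> v c = 0"
    "\<And>c c'. c \<in> charts_at \<A> p \<Longrightarrow> c' \<in> charts_at \<A> p \<Longrightarrow> v c' = dtrans c c' p (v c)"
  shows "v \<in> tangent_space \<A> p"
  using assms unfolding tangent_space_def by blast

lemma coord_tvec_in: "c \<in> charts_at \<A> p \<Longrightarrow> coord_tvec \<A> c p u \<in> tangent_space \<A> p"
  by (rule tangent_spaceI) (simp_all add: coord_tvec_def dtrans_comp)

lemma coord_tvec_self: "c \<in> charts_at \<A> p \<Longrightarrow> coord_tvec \<A> c p u c = u"
  by (simp add: coord_tvec_def dtrans_self)

lemma coord_tvec_eq: "v \<in> tangent_space \<A> p \<Longrightarrow> c \<in> charts_at \<A> p \<Longrightarrow> coord_tvec \<A> c p (v c) = v"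
  by (rule tangent_vector_eqI[OF coord_tvec_in]) (auto simp: coord_tvec_self)

lemma subspace_tangent_space: "subspace (tangent_space \<A> p)"
proof (rule subspaceI)
  show "0 \<in> tangent_space \<A> p"
    by (rule tangent_spaceI) (simp_all add: linear_0[OF linear_dtrans])
  fix u v assume uv: "u \<in> tangent_space \<A> p" "v \<in> tangent_space \<A> p"
  show "u + v \<in> tangent_space \<A> p"
  proof (rule tangent_spaceI)
    fix c c' assume c: "c \<in> charts_at \<A> p" "c' \<in> charts_at \<A> p"
    show "(u + v) c' = dtrans c c' p ((u + v) c)"
      using uv[THEN tangent_vector_transform[OF _ c]] by (simp add: linear_add[OF linear_dtrans[OF c]])
  qed (use uv[THEN tangent_vector_outside] in simp)
next
  fix r and v assume v: "v \<in> tangent_space \<A> p"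
  show "r *\<^sub>R v \<in> tangent_space \<A> p"
  proof (rule tangent_spaceI)
    fix c c' assume c: "c \<in> charts_at \<A> p" "c' \<in> charts_at \<A> p"
    show "(r *\<^sub>R v) c' = dtrans c c' p ((r *\<^sub>R v) c)"
      using tangent_vector_transform[OF v c] by (simp add: scaleR_fun_def linear_cmul[OF linear_dtrans[OF c]])
  qed (use tangent_vector_outside[OF v] in \<open>simp add: scaleR_fun_def\<close>)
qed

lemma coord_tvec_add: "c \<in> charts_at \<A> p \<Longrightarrow> coord_tvec \<A> c p (u + v) = coord_tvec \<A> c p u + coord_tvec \<A> c p v"
  by (auto simp: coord_tvec_def linear_add[OF linear_dtrans])

lemma coord_tvec_scaleR: "c \<in> charts_at \<A> p \<Longrightarrow> coord_tvec \<A> c p (r *\<^sub>R u) = r *\<^sub>R coord_tvec \<A> c p u"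
  by (auto simp: coord_tvec_def scaleR_fun_def linear_cmul[OF linear_dtrans])

lemma smooth_curve_chart:
  assumes "smooth_map eucl I \<A> \<gamma>" "open I" "t \<in> I" "c \<in> charts_at \<A> (\<gamma> t)"
  obtains W where "open W" "t \<in> W" "W \<subseteq> I" "\<And>s. s \<in> W \<Longrightarrow> \<gamma> s \<in> fst c" "smooth_on W (\<lambda>s. snd c (\<gamma> s))"
proof -
  obtain W F where W: "open W" "t \<in> W" "smooth_on W F"
    and F: "\<And>s. s \<in> I \<Longrightarrow> s \<in> W \<Longrightarrow> \<gamma> s \<in> fst c" "\<And>s. s \<in> I \<Longrightarrow> s \<in> W \<Longrightarrow> snd c (\<gamma> s) = F s"
    by (rule smooth_mapE[OF compatible_eucl compat assms(1,3), of "(UNIV, id)" c]) (use assms(4) in auto)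
  have "smooth_on (W \<inter> I) (\<lambda>s. snd c (\<gamma> s))"
    using smooth_on_cong[of "W \<inter> I" "\<lambda>s. snd c (\<gamma> s)" F] W F assms(2) smooth_on_subset[of W F "W \<inter> I"] by auto
  then show ?thesis using that[of "W \<inter> I"] W F assms by auto
qed

lemma smooth_curve_coord_derivative:
  assumes "smooth_map eucl I \<A> \<gamma>" "open I" "t \<in> I" "c \<in> charts_at \<A> (\<gamma> t)"
  shows "((\<lambda>s. snd c (\<gamma> s)) has_vector_derivative velocity \<A> \<gamma> t c) (at t)"
proof -
  obtain W where W: "open W" "t \<in> W" "smooth_on W (\<lambda>s. snd c (\<gamma> s))"
    by (rule smooth_curve_chart[OF assms]) blast
  then have "(\<lambda>s. snd c (\<gamma> s)) differentiable (at t)" using smooth_on_differentiable by blast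
  then show ?thesis using assms(4) by (simp add: velocity_def vector_derivative_works)
qed

lemma smooth_curve_velocity_in:
  assumes "smooth_map eucl I \<A> \<gamma>" "open I" "t \<in> I"
  shows "velocity \<A> \<gamma> t \<in> tangent_space \<A> (\<gamma> t)"
proof -
  have "velocity \<A> \<gamma> t c' = dtrans c c' (\<gamma> t) (velocity \<A> \<gamma> t c)"
    if c: "c \<in> charts_at \<A> (\<gamma> t)" "c' \<in> charts_at \<A> (\<gamma> t)" for c c'
  proof -
    obtain W where W: "open W" "t \<in> W" "\<And>s. s \<in> W \<Longrightarrow> \<gamma> s \<in> fst c"
      by (rule smooth_curve_chart[OF assms c(1)]) blast
    have "((\<lambda>s. transition c c' (snd c (\<gamma> s))) has_vector_derivative dtrans c c' (\<gamma> t) (velocity \<A> \<gamma> t c)) (at t)"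
      using has_derivative_compose[OF smooth_curve_coord_derivative[OF assms c(1), unfolded has_vector_derivative_def]
          transition_has_derivative[OF c]]
      by (simp add: has_vector_derivative_def linear_cmul[OF linear_dtrans[OF c]])
    then have "((\<lambda>s. snd c' (\<gamma> s)) has_vector_derivative dtrans c c' (\<gamma> t) (velocity \<A> \<gamma> t c)) (at t)"
      by (rule has_vector_derivative_transform_within_open[OF _ W(1,2)])
        (use W(3) c in \<open>auto simp: transition_snd[OF compat] charts_at_iff\<close>)
    from vector_derivative_at[OF this] show ?thesis using c(2) by (simp add: velocity_def)
  qed
  then show ?thesis by (rule tangent_spaceI[rotated]) (simp_all add: velocity_def)
qed

end

text \<open>
  A map that is smooth only on a subset still has a differential, acting on the velocities of curves
  in the subset: the derivative of a smooth extension. The same \<open>D\<close> serves all curves through the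
  point, which need only be differentiable at the one time.
\<close>

lemma smooth_map_curve_derivative:
  assumes "compatible_atlas \<A>" "compatible_atlas \<B>" "smooth_map \<A> S \<B> f" "p \<in> S"
    and "c \<in> charts_at \<A> p" "d \<in> charts_at \<B> (f p)"
  obtains D where "\<And>\<sigma> t w. \<sigma> t = p \<Longrightarrow> (\<forall>\<^sub>F s in at t. \<sigma> s \<in> S \<inter> fst c) \<Longrightarrow>
      ((\<lambda>s. snd c (\<sigma> s)) has_vector_derivative w) (at t) \<Longrightarrow>
      ((\<lambda>s. snd d (f (\<sigma> s))) has_vector_derivative D w) (at t)"
proof -
  obtain W F where W: "open W" "snd c p \<in> W" "W \<subseteq> snd c ` fst c" "smooth_on W F"
    and F: "\<And>q. q \<in> S \<Longrightarrow> q \<in> fst c \<Longrightarrow> snd c q \<in> W \<Longrightarrow> snd d (f q) = F (snd c q)"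
    by (rule smooth_mapE[OF assms]) blast
  show ?thesis
  proof (rule that[of "frechet_derivative F (at (snd c p))"])
    fix \<sigma> t w
    assume \<sigma>: "\<sigma> t = p" "\<forall>\<^sub>F s in at t. \<sigma> s \<in> S \<inter> fst c" "((\<lambda>s. snd c (\<sigma> s)) has_vector_derivative w) (at t)"
    have "((\<lambda>s. F (snd c (\<sigma> s))) has_vector_derivative frechet_derivative F (at (snd c p)) w) (at t)"
      using has_derivative_compose[OF \<sigma>(3)[unfolded has_vector_derivative_def]
          smooth_on_has_derivative[OF W(4,2), folded \<sigma>(1)]] \<sigma>(1)
        linear_cmul[OF smooth_on_imp_linear[OF W(4,2)]]
      by (simp add: has_vector_derivative_def)
    moreover have "isCont (\<lambda>s. snd c (\<sigma> s)) t" using \<sigma>(3) has_vector_derivative_continuous by blast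
    then have "\<forall>\<^sub>F s in at t. snd c (\<sigma> s) \<in> W"
      using W(1,2) \<sigma>(1) by (auto simp: isCont_def tendsto_def)
    with \<sigma>(2) have ev: "\<forall>\<^sub>F s in at t. F (snd c (\<sigma> s)) = snd d (f (\<sigma> s))"
      by eventually_elim (use F in auto)
    moreover have "F (snd c (\<sigma> t)) = snd d (f (\<sigma> t))"
      using F[of p] assms(4,5) W(2) \<sigma>(1) by (auto simp: charts_at_iff)
    ultimately show "((\<lambda>s. snd d (f (\<sigma> s))) has_vector_derivative frechet_derivative F (at (snd c p)) w) (at t)"
      unfolding has_vector_derivative_def
      using has_derivative_transform_eventually[of "\<lambda>s. F (snd c (\<sigma> s))" _ t UNIV "\<lambda>s. snd d (f (\<sigma> s))"] by simp
  qed
qed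

text \<open>
  Two curves in \<open>S\<close> that agree to first order have images that agree to first order. This
  compares a horizontal lift, of which only the derivative at one time is known, with a
  smooth curve.
\<close>

lemma velocity_smooth_map_cong:
  assumes "compatible_atlas \<A>" "compatible_atlas \<B>" "smooth_map \<A> S \<B> f" "p \<in> S" "c \<in> charts_at \<A> p"
    and \<sigma>: "\<sigma> t = p" "\<forall>\<^sub>F s in at t. \<sigma> s \<in> S \<inter> fst c" "((\<lambda>s. snd c (\<sigma> s)) has_vector_derivative w) (at t)"
    and \<rho>: "\<rho> t = p" "\<forall>\<^sub>F s in at t. \<rho> s \<in> S \<inter> fst c" "((\<lambda>s. snd c (\<rho> s)) has_vector_derivative w) (at t)"
  shows "velocity \<B> (\<lambda>s. f (\<sigma> s)) t = velocity \<B> (\<lambda>s. f (\<rho> s)) t"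
proof
  fix d
  show "velocity \<B> (\<lambda>s. f (\<sigma> s)) t d = velocity \<B> (\<lambda>s. f (\<rho> s)) t d"
  proof (cases "d \<in> charts_at \<B> (f p)")
    case True
    obtain D where D: "\<And>\<sigma> t w. \<sigma> t = p \<Longrightarrow> (\<forall>\<^sub>F s in at t. \<sigma> s \<in> S \<inter> fst c) \<Longrightarrow>
      ((\<lambda>s. snd c (\<sigma> s)) has_vector_derivative w) (at t) \<Longrightarrow>
      ((\<lambda>s. snd d (f (\<sigma> s))) has_vector_derivative D w) (at t)"
      by (rule smooth_map_curve_derivative[OF assms(1-5) True]) blast
    show ?thesis
      using True vector_derivative_at[OF D[OF \<sigma>]] vector_derivative_at[OF D[OF \<rho>]] \<sigma>(1) \<rho>(1)
      by (simp add: velocity_def)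
  qed (simp add: velocity_def \<sigma>(1) \<rho>(1))
qed

text \<open>
  The value of \<open>differential\<close> is taken in a chart picked by the choice operator, but the chain rule
  holds in every chart.
\<close>

lemma differential_velocity:
  assumes "compatible_atlas \<A>" "compatible_atlas \<B>" "smooth_map \<A> (mcarrier \<A>) \<B> f"
    and "smooth_map eucl I \<A> \<gamma>" "open I" "t \<in> I"
  shows "differential \<A> \<B> f (\<gamma> t) (velocity \<A> \<gamma> t) = velocity \<B> (\<lambda>s. f (\<gamma> s)) t"
proof
  fix d
  show "differential \<A> \<B> f (\<gamma> t) (velocity \<A> \<gamma> t) d = velocity \<B> (\<lambda>s. f (\<gamma> s)) t d"
  proof (cases "d \<in> charts_at \<B> (f (\<gamma> t))")
    case d: True
    define c where "c = (SOME c. c \<in> charts_at \<A> (\<gamma> t))"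
    have p: "\<gamma> t \<in> mcarrier \<A>" using smooth_map_charts[OF assms(4,6)] by simp
    then have c: "c \<in> charts_at \<A> (\<gamma> t)"
      unfolding mcarrier_charts_at c_def by (rule someI_ex)
    then have c': "c \<in> \<A>" "\<gamma> t \<in> fst c" by (auto simp: charts_at_iff)
    obtain W F where W: "open W" "snd c (\<gamma> t) \<in> W" "W \<subseteq> snd c ` fst c" "smooth_on W F"
      and F: "\<And>q. q \<in> mcarrier \<A> \<Longrightarrow> q \<in> fst c \<Longrightarrow> snd c q \<in> W \<Longrightarrow> snd d (f q) = F (snd c q)"
      by (rule smooth_mapE[OF assms(1-3) p c d]) blast
    let ?h = "snd d \<circ> f \<circ> chart_inv c"
    have "smooth_on W ?h"
    proof (rule smooth_on_cong[OF W(1), THEN iffD1, OF _ W(4)])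
      fix x assume "x \<in> W"
      then have "x \<in> snd c ` fst c" using W(3) by blast
      then have i: "chart_inv c x \<in> fst c" "snd c (chart_inv c x) = x"
        by (rule chart_inv_in, rule snd_chart_inv)
      then have "chart_inv c x \<in> mcarrier \<A>" using c'(1) by (auto simp: mcarrier_def)
      then show "F x = ?h x" using F[of "chart_inv c x"] i \<open>x \<in> W\<close> by simp
    qed
    note h = smooth_on_has_derivative[OF this W(2)]
    have h': "((\<lambda>s. ?h (snd c (\<gamma> s))) has_vector_derivative
        frechet_derivative ?h (at (snd c (\<gamma> t))) (velocity \<A> \<gamma> t c)) (at t)"
      using has_derivative_compose[OF smooth_curve_coord_derivative[OF assms(1,4-6) c, unfolded has_vector_derivative_def] h]
        linear_cmul[OF has_derivative_linear[OF h]] by (simp add: has_vector_derivative_def)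
    obtain X where X: "open X" "t \<in> X" "\<And>s. s \<in> X \<Longrightarrow> \<gamma> s \<in> fst c"
      by (rule smooth_curve_chart[OF assms(1,4-6) c]) blast
    have "((\<lambda>s. snd d (f (\<gamma> s))) has_vector_derivative
        frechet_derivative ?h (at (snd c (\<gamma> t))) (velocity \<A> \<gamma> t c)) (at t)"
      by (rule has_vector_derivative_transform_within_open[OF h' X(1,2)])
        (use X(3) c' in \<open>auto simp: chart_inv_snd[OF assms(1)]\<close>)
    from vector_derivative_at[OF this] show ?thesis
      using d by (simp add: differential_def velocity_def c_def Let_def)
  qed (simp add: velocity_def differential_def)
qed

section \<open>Families of linear maps along curves\<close>

lemma smooth_on_linear_family:
  fixes L :: "'a::euclidean_space \<Rightarrow> 'b::euclidean_space \<Rightarrow> 'c::real_normed_vector"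
  assumes "open S" "open T" "\<And>b. smooth_on T (\<lambda>x. L x b)" "\<And>x. x \<in> T \<Longrightarrow> linear (L x)"
    and "smooth_on S p" "p ` S \<subseteq> T" "smooth_on S u"
  shows "smooth_on S (\<lambda>z. L (p z) (u z))"
proof -
  have "smooth_on S (\<lambda>z. L (p z) b)" for b
    by (rule smooth_on_compose[OF assms(5,3,1,2,6)])
  then have "smooth_on S (\<lambda>z. \<Sum>b\<in>Basis. (u z \<bullet> b) *\<^sub>R L (p z) b)"
    by (intro smooth_on_sum smooth_on_scaleR smooth_on_inner smooth_on_const assms(1,7))
  then show ?thesis
  proof (rule smooth_on_cong[OF assms(1), THEN iffD1, rotated])
    fix z assume "z \<in> S"
    then show "(\<Sum>b\<in>Basis. (u z \<bullet> b) *\<^sub>R L (p z) b) = L (p z) (u z)"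
      using linear_eq_sum_Basis[OF assms(4), of "p z" "u z"] assms(6) by auto
  qed
qed

text \<open>
  The product rule for a linear map depending on a point. Differentiability of the values on
  fixed vectors is enough, since an expansion in a basis turns the expression into a finite sum
  of products.
\<close>

lemma linear_family_has_vector_derivative:
  fixes L :: "'a::euclidean_space \<Rightarrow> 'b::euclidean_space \<Rightarrow> 'c::real_normed_vector"
  assumes "open S" "\<xi> t \<in> S" and lin: "\<And>x. x \<in> S \<Longrightarrow> linear (L x)"
    and diff: "\<And>b. (\<lambda>x. L x b) differentiable (at (\<xi> t))"
    and \<xi>: "(\<xi> has_vector_derivative \<xi>') (at t)" and u: "(u has_vector_derivative u') (at t)"
  shows "((\<lambda>s. L (\<xi> s) (u s)) has_vector_derivative
    frechet_derivative (\<lambda>x. L x (u t)) (at (\<xi> t)) \<xi>' + L (\<xi> t) u') (at t)"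
proof -
  let ?D = "\<lambda>b. frechet_derivative (\<lambda>x. L x b) (at (\<xi> t))"
  have D: "((\<lambda>x. L x b) has_derivative ?D b) (at (\<xi> t))" for b
    using diff frechet_derivative_works by blast
  have expand: "L x v = (\<Sum>b\<in>Basis. (v \<bullet> b) *\<^sub>R L x b)" if "x \<in> S" for x v
    using linear_eq_sum_Basis[OF lin[OF that]] .
  have "((\<lambda>x. \<Sum>b\<in>Basis. (u t \<bullet> b) *\<^sub>R L x b) has_derivative (\<lambda>h. \<Sum>b\<in>Basis. (u t \<bullet> b) *\<^sub>R ?D b h)) (at (\<xi> t))"
    by (intro has_derivative_sum has_derivative_scaleR_right D)
  then have "((\<lambda>x. L x (u t)) has_derivative (\<lambda>h. \<Sum>b\<in>Basis. (u t \<bullet> b) *\<^sub>R ?D b h)) (at (\<xi> t))"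
    by (rule has_derivative_transform_within_open[OF _ assms(1,2)]) (simp add: expand[symmetric])
  from fun_cong[OF frechet_derivative_at[OF this], of \<xi>']
  have Dsum: "?D (u t) \<xi>' = (\<Sum>b\<in>Basis. (u t \<bullet> b) *\<^sub>R ?D b \<xi>')" by simp
  have Db: "((\<lambda>s. L (\<xi> s) b) has_vector_derivative ?D b \<xi>') (at t)" for b
    using has_derivative_compose[OF \<xi>[unfolded has_vector_derivative_def] D]
      linear_cmul[OF has_derivative_linear[OF D]] by (simp add: has_vector_derivative_def)
  have ub: "((\<lambda>s. u s \<bullet> b) has_real_derivative u' \<bullet> b) (at t)" for b
    using bounded_linear.has_vector_derivative[OF bounded_linear_inner_left u]
    by (simp add: has_real_derivative_iff_has_vector_derivative)
  have "((\<lambda>s. \<Sum>b\<in>Basis. (u s \<bullet> b) *\<^sub>R L (\<xi> s) b) has_vector_derivative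
      (\<Sum>b\<in>Basis. (u t \<bullet> b) *\<^sub>R ?D b \<xi>' + (u' \<bullet> b) *\<^sub>R L (\<xi> t) b)) (at t)"
    by (intro has_vector_derivative_sum has_vector_derivative_scaleR ub Db)
  moreover have "(\<Sum>b\<in>Basis. (u t \<bullet> b) *\<^sub>R ?D b \<xi>' + (u' \<bullet> b) *\<^sub>R L (\<xi> t) b) = ?D (u t) \<xi>' + L (\<xi> t) u'"
    by (simp add: sum.distrib Dsum expand[OF assms(2), symmetric])
  ultimately have *: "((\<lambda>s. \<Sum>b\<in>Basis. (u s \<bullet> b) *\<^sub>R L (\<xi> s) b) has_vector_derivative
      ?D (u t) \<xi>' + L (\<xi> t) u') (at t)" by simp
  have "isCont \<xi> t" using \<xi> has_vector_derivative_continuous by blast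
  then have "\<forall>\<^sub>F s in at t. \<xi> s \<in> S" using assms(1,2) by (auto simp: isCont_def tendsto_def)
  then have "\<forall>\<^sub>F s in at t. (\<Sum>b\<in>Basis. (u s \<bullet> b) *\<^sub>R L (\<xi> s) b) = L (\<xi> s) (u s)"
    by eventually_elim (simp add: expand[symmetric])
  then show ?thesis
    using * expand[OF assms(2), of "u t"] unfolding has_vector_derivative_def
    by (auto intro: has_derivative_transform_eventually)
qed

lemma bilinear_family_has_vector_derivative:
  fixes B :: "'a::euclidean_space \<Rightarrow> 'b::euclidean_space \<Rightarrow> 'b \<Rightarrow> real"
  assumes "open S" "\<xi> t \<in> S"
    and lin1: "\<And>x v. x \<in> S \<Longrightarrow> linear (\<lambda>u. B x u v)" and lin2: "\<And>x u. x \<in> S \<Longrightarrow> linear (B x u)"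
    and diff: "\<And>u v. (\<lambda>x. B x u v) differentiable (at (\<xi> t))"
    and \<xi>: "(\<xi> has_vector_derivative \<xi>') (at t)"
    and u: "(u has_vector_derivative u') (at t)" and v: "(v has_vector_derivative v') (at t)"
  shows "((\<lambda>s. B (\<xi> s) (u s) (v s)) has_vector_derivative
    frechet_derivative (\<lambda>x. B x (u t) (v t)) (at (\<xi> t)) \<xi>' + B (\<xi> t) u' (v t) + B (\<xi> t) (u t) v') (at t)"
proof -
  let ?D = "\<lambda>b. frechet_derivative (\<lambda>x. B x (u t) b) (at (\<xi> t))"
  have D: "((\<lambda>x. B x (u t) b) has_derivative ?D b) (at (\<xi> t))" for b
    using diff frechet_derivative_works by blast
  have expand: "B x w v = (\<Sum>b\<in>Basis. (v \<bullet> b) *\<^sub>R B x w b)" if "x \<in> S" for x v w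
    using linear_eq_sum_Basis[OF lin2[OF that]] .
  have "((\<lambda>x. \<Sum>b\<in>Basis. (v t \<bullet> b) *\<^sub>R B x (u t) b) has_derivative (\<lambda>h. \<Sum>b\<in>Basis. (v t \<bullet> b) *\<^sub>R ?D b h)) (at (\<xi> t))"
    by (intro has_derivative_sum has_derivative_scaleR_right D)
  then have "((\<lambda>x. B x (u t) (v t)) has_derivative (\<lambda>h. \<Sum>b\<in>Basis. (v t \<bullet> b) *\<^sub>R ?D b h)) (at (\<xi> t))"
    by (rule has_derivative_transform_within_open[OF _ assms(1,2)]) (simp add: expand[symmetric] del: real_scaleR_def)
  from fun_cong[OF frechet_derivative_at[OF this], of \<xi>']
  have Dsum: "?D (v t) \<xi>' = (\<Sum>b\<in>Basis. (v t \<bullet> b) *\<^sub>R ?D b \<xi>')" by simp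
  have Db: "((\<lambda>s. B (\<xi> s) (u s) b) has_vector_derivative ?D b \<xi>' + B (\<xi> t) u' b) (at t)" for b
    by (rule linear_family_has_vector_derivative[OF assms(1,2) lin1 diff \<xi> u])
  have vb: "((\<lambda>s. v s \<bullet> b) has_real_derivative v' \<bullet> b) (at t)" for b
    using bounded_linear.has_vector_derivative[OF bounded_linear_inner_left v]
    by (simp add: has_real_derivative_iff_has_vector_derivative)
  have "((\<lambda>s. \<Sum>b\<in>Basis. (v s \<bullet> b) *\<^sub>R B (\<xi> s) (u s) b) has_vector_derivative
      (\<Sum>b\<in>Basis. (v t \<bullet> b) *\<^sub>R (?D b \<xi>' + B (\<xi> t) u' b) + (v' \<bullet> b) *\<^sub>R B (\<xi> t) (u t) b)) (at t)"
    by (intro has_vector_derivative_sum has_vector_derivative_scaleR vb Db)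
  moreover have "(\<Sum>b\<in>Basis. (v t \<bullet> b) *\<^sub>R (?D b \<xi>' + B (\<xi> t) u' b) + (v' \<bullet> b) *\<^sub>R B (\<xi> t) (u t) b)
      = ?D (v t) \<xi>' + B (\<xi> t) u' (v t) + B (\<xi> t) (u t) v'"
    by (simp add: sum.distrib scaleR_add_right Dsum expand[OF assms(2), symmetric] del: real_scaleR_def)
  ultimately have *: "((\<lambda>s. \<Sum>b\<in>Basis. (v s \<bullet> b) *\<^sub>R B (\<xi> s) (u s) b) has_vector_derivative
      ?D (v t) \<xi>' + B (\<xi> t) u' (v t) + B (\<xi> t) (u t) v') (at t)" by simp
  have "isCont \<xi> t" using \<xi> has_vector_derivative_continuous by blast
  then have "\<forall>\<^sub>F s in at t. \<xi> s \<in> S" using assms(1,2) by (auto simp: isCont_def tendsto_def)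
  then have "\<forall>\<^sub>F s in at t. (\<Sum>b\<in>Basis. (v s \<bullet> b) *\<^sub>R B (\<xi> s) (u s) b) = B (\<xi> s) (u s) (v s)"
    by eventually_elim (simp add: expand[symmetric] del: real_scaleR_def)
  then show ?thesis
    using * expand[OF assms(2), of "u t" "v t"] unfolding has_vector_derivative_def
    by (auto intro: has_derivative_transform_eventually)
qed

section \<open>Surfaces\<close>

lemma vec2_expand: "(u :: real^2) = u $ 1 *\<^sub>R axis 1 1 + u $ 2 *\<^sub>R axis 2 1"
  by (simp add: vec_eq_iff forall_2 axis_def)

locale surface =
  fixes \<A> :: "('a, real^2) atlas" and g :: "('a, real^2) metric"
  assumes oriented_riemannian_surface: "oriented_riemannian_surface \<A> g"
begin

lemma compat: "compatible_atlas \<A>"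
  using oriented_riemannian_surface
  by (simp add: oriented_riemannian_surface_def oriented_manifold_def smooth_manifold_imp_compatible)

lemma riemannian: "riemannian_metric \<A> g"
  using oriented_riemannian_surface by (simp add: oriented_riemannian_surface_def)

abbreviation dom :: "('a, real^2) chart \<Rightarrow> (real^2) set" where "dom c \<equiv> snd c ` fst c"

abbreviation T :: "'a \<Rightarrow> ('a, real^2) tvec set" where "T p \<equiv> tangent_space \<A> p"

abbreviation G :: "('a, real^2) chart \<Rightarrow> real^2 \<Rightarrow> real^2 \<Rightarrow> real^2 \<Rightarrow> real"
  where "G \<equiv> metric_coord \<A> g"

abbreviation DG :: "('a, real^2) chart \<Rightarrow> real^2 \<Rightarrow> real^2 \<Rightarrow> real^2 \<Rightarrow> real^2 \<Rightarrow> real"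
  where "DG c x h u v \<equiv> frechet_derivative (\<lambda>y. G c y u v) (at x) h"

lemma open_dom: "c \<in> \<A> \<Longrightarrow> open (dom c)"
  using compatible_atlas_open[OF compat] .

lemma metric_linear:
  assumes "p \<in> mcarrier \<A>" "v \<in> T p"
  shows "w \<in> T p \<Longrightarrow> w' \<in> T p \<Longrightarrow> g p v (w + w') = g p v w + g p v w'"
    "w \<in> T p \<Longrightarrow> g p v (r *\<^sub>R w) = r * g p v w"
  using riemannian assms by (auto simp: riemannian_metric_def linear_map_on_def)

lemma metric_sym: "p \<in> mcarrier \<A> \<Longrightarrow> v \<in> T p \<Longrightarrow> w \<in> T p \<Longrightarrow> g p v w = g p w v"
  using riemannian by (auto simp: riemannian_metric_def)

lemma metric_pos: "p \<in> mcarrier \<A> \<Longrightarrow> v \<in> T p \<Longrightarrow> v \<noteq> 0 \<Longrightarrow> g p v v > 0"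
  using riemannian by (auto simp: riemannian_metric_def)

lemma smooth_G: "c \<in> \<A> \<Longrightarrow> smooth_on (dom c) (\<lambda>x. G c x u v)"
  using riemannian by (auto simp: riemannian_metric_def)

lemma dom_chart:
  assumes "c \<in> \<A>" "x \<in> dom c"
  shows "c \<in> charts_at \<A> (chart_inv c x)" "chart_inv c x \<in> mcarrier \<A>" "snd c (chart_inv c x) = x"
  using assms chart_inv_in[OF assms(2)] snd_chart_inv[OF assms(2)] by (auto simp: charts_at_iff mcarrier_def)

lemma metric_eq_G:
  assumes "c \<in> charts_at \<A> p" "v \<in> T p" "w \<in> T p"
  shows "g p v w = G c (snd c p) (v c) (w c)"
  using assms coord_tvec_eq[OF compat _ assms(1)] chart_inv_snd[OF compat, of c p]
  by (simp add: metric_coord_def charts_at_iff)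

context
  fixes c x assumes c: "c \<in> \<A>" and x: "x \<in> dom c"
begin

lemmas coord_in = coord_tvec_in[OF compat dom_chart(1)[OF c x]]

lemma G_sym: "G c x u v = G c x v u"
  using metric_sym[OF dom_chart(2)[OF c x] coord_in coord_in] by (simp add: metric_coord_def)

lemma linear_G: "linear (G c x u)"
  by (rule linearI)
    (use metric_linear[OF dom_chart(2)[OF c x] coord_in] coord_in in
      \<open>simp_all add: metric_coord_def coord_tvec_add[OF compat dom_chart(1)[OF c x]]
        coord_tvec_scaleR[OF compat dom_chart(1)[OF c x]]\<close>)

lemma linear_G': "linear (\<lambda>u. G c x u v)"
  using linear_G[of v] by (simp add: G_sym[of _ v])

lemma G_pos:
  assumes "u \<noteq> 0" shows "G c x u u > 0"
proof -
  have "coord_tvec \<A> c (chart_inv c x) u c = u"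
    by (rule coord_tvec_self[OF compat dom_chart(1)[OF c x]])
  then have "coord_tvec \<A> c (chart_inv c x) u \<noteq> 0" using assms by auto
  then show ?thesis using metric_pos[OF dom_chart(2)[OF c x] coord_in] by (simp add: metric_coord_def)
qed

lemmas G_lin_simps = linear_add[OF linear_G] linear_add[OF linear_G'] linear_diff[OF linear_G] linear_diff[OF linear_G']
  linear_cmul[OF linear_G] linear_cmul[OF linear_G'] linear_0[OF linear_G] linear_0[OF linear_G']
  linear_neg[OF linear_G] linear_neg[OF linear_G']

lemma G_nondegenerate: assumes "\<And>w. G c x u w = G c x v w" shows "u = v"
proof (rule ccontr)
  assume "u \<noteq> v"
  then have "G c x (u - v) (u - v) > 0" using G_pos by simp
  then show False using assms by (simp add: G_lin_simps)
qed

end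

subsection \<open>Orthonormal frames\<close>

text \<open>
  The Gram-Schmidt process applied to the coordinate vectors. The explicit formulas show that the
  frame depends smoothly on the point and is positively oriented.
\<close>

definition frame1 :: "('a, real^2) chart \<Rightarrow> real^2 \<Rightarrow> real^2"
  where "frame1 c x = (1 / sqrt (G c x (axis 1 1) (axis 1 1))) *\<^sub>R axis 1 1"

definition gram :: "('a, real^2) chart \<Rightarrow> real^2 \<Rightarrow> real"
  where "gram c x = G c x (axis 1 1) (axis 1 1) * G c x (axis 2 1) (axis 2 1) - (G c x (axis 1 1) (axis 2 1))\<^sup>2"

definition frame2 :: "('a, real^2) chart \<Rightarrow> real^2 \<Rightarrow> real^2"
  where "frame2 c x = (1 / (sqrt (G c x (axis 1 1) (axis 1 1)) * sqrt (gram c x))) *\<^sub>R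
    (G c x (axis 1 1) (axis 1 1) *\<^sub>R axis 2 1 - G c x (axis 1 1) (axis 2 1) *\<^sub>R axis 1 1)"

context
  fixes c x assumes c: "c \<in> \<A>" and x: "x \<in> dom c"
begin

lemma G11_pos: "G c x (axis 1 1) (axis 1 1) > 0"
  by (rule G_pos[OF c x]) (simp add: axis_eq_0_iff)

lemma gram_pos: "gram c x > 0"
proof -
  let ?E = "G c x (axis 1 1) (axis 1 1)" and ?F = "G c x (axis 1 1) (axis 2 1)" and ?H = "G c x (axis 2 1) (axis 2 1)"
  let ?w = "?E *\<^sub>R axis 2 1 - ?F *\<^sub>R axis 1 1 :: real^2"
  have "?w $ 2 = ?E" by (simp add: axis_def)
  then have "?w \<noteq> 0" using G11_pos by (metis less_irrefl zero_index)
  then have "0 < G c x ?w ?w" by (rule G_pos[OF c x])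
  also have "G c x ?w ?w = ?E * gram c x"
    by (simp add: G_lin_simps[OF c x] gram_def G_sym[OF c x, of "axis 2 1" "axis 1 1"] algebra_simps power2_eq_square)
  finally show ?thesis using G11_pos zero_less_mult_pos by blast
qed

lemma frame_orthonormal:
  "G c x (frame1 c x) (frame1 c x) = 1" "G c x (frame2 c x) (frame2 c x) = 1"
  "G c x (frame1 c x) (frame2 c x) = 0" "G c x (frame2 c x) (frame1 c x) = 0"
proof -
  let ?E = "G c x (axis 1 1) (axis 1 1)" and ?F = "G c x (axis 1 1) (axis 2 1)" and ?H = "G c x (axis 2 1) (axis 2 1)"
  have E: "?E > 0" "sqrt ?E * sqrt ?E = ?E" using G11_pos by auto
  have D: "gram c x > 0" "sqrt (gram c x) * sqrt (gram c x) = gram c x" using gram_pos by auto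
  show "G c x (frame1 c x) (frame1 c x) = 1"
    using E by (simp add: frame1_def G_lin_simps[OF c x])
  show 12: "G c x (frame1 c x) (frame2 c x) = 0"
    by (simp add: frame1_def frame2_def G_lin_simps[OF c x])
  then show "G c x (frame2 c x) (frame1 c x) = 0" by (simp add: G_sym[OF c x])
  let ?w = "?E *\<^sub>R axis 2 1 - ?F *\<^sub>R axis 1 1 :: real^2" and ?k = "1 / (sqrt ?E * sqrt (gram c x))"
  have w: "G c x ?w ?w = ?E * gram c x"
    by (simp add: G_lin_simps[OF c x] gram_def G_sym[OF c x, of "axis 2 1" "axis 1 1"] algebra_simps power2_eq_square)
  have "G c x (frame2 c x) (frame2 c x) = ?k * (?k * G c x ?w ?w)"
    unfolding frame2_def linear_cmul[OF linear_G[OF c x]] linear_cmul[OF linear_G'[OF c x]] by simp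
  also have "\<dots> = (?E * gram c x) / ((sqrt ?E * sqrt ?E) * (sqrt (gram c x) * sqrt (gram c x)))"
    unfolding w by (simp add: mult_ac)
  also have "\<dots> = 1" unfolding E(2) D(2) using E(1) D(1) by simp
  finally show "G c x (frame2 c x) (frame2 c x) = 1" .
qed

lemma frame_det: "frame1 c x $ 1 * frame2 c x $ 2 - frame2 c x $ 1 * frame1 c x $ 2 > 0"
  using G11_pos gram_pos by (simp add: frame1_def frame2_def axis_def)

lemma frame_expand: "w = G c x w (frame1 c x) *\<^sub>R frame1 c x + G c x w (frame2 c x) *\<^sub>R frame2 c x"
proof -
  let ?z = "w - (G c x w (frame1 c x) *\<^sub>R frame1 c x + G c x w (frame2 c x) *\<^sub>R frame2 c x)"
  have z: "G c x ?z (frame1 c x) = 0" "G c x ?z (frame2 c x) = 0"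
    by (simp_all add: G_lin_simps[OF c x] frame_orthonormal)
  have E: "sqrt (G c x (axis 1 1) (axis 1 1)) > 0" "sqrt (gram c x) > 0" using G11_pos gram_pos by auto
  have z1: "G c x ?z (axis 1 1) = 0"
    using z(1) E unfolding frame1_def by (simp add: linear_cmul[OF linear_G[OF c x]])
  have "G c x ?z (axis 2 1) = 0"
    using z(2) E z1 G11_pos unfolding frame2_def
    by (simp add: linear_cmul[OF linear_G[OF c x]] linear_diff[OF linear_G[OF c x]])
  then have "G c x ?z v = 0" for v
    using z1 by (subst vec2_expand[of v]) (simp add: linear_cmul[OF linear_G[OF c x]] linear_add[OF linear_G[OF c x]])
  then have "?z = 0" using G_pos[OF c x, of ?z] by (metis less_irrefl)
  then show ?thesis by simp
qed

end

lemma smooth_gram: "c \<in> \<A> \<Longrightarrow> smooth_on (dom c) (gram c)"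
  unfolding gram_def[abs_def] power2_eq_square by (intro smooth_intros smooth_G open_dom)

lemma sqrt_nonzero: "0 < (a::real) \<Longrightarrow> sqrt a \<noteq> 0"
  by simp

lemma smooth_frame1: "c \<in> \<A> \<Longrightarrow> smooth_on (dom c) (frame1 c)"
  unfolding frame1_def[abs_def]
  by (intro smooth_intros smooth_G open_dom sqrt_nonzero) (simp_all add: G11_pos)

lemma smooth_frame2: "c \<in> \<A> \<Longrightarrow> smooth_on (dom c) (frame2 c)"
  unfolding frame2_def[abs_def]
  by (intro smooth_intros smooth_G smooth_gram open_dom no_zero_divisors sqrt_nonzero)
    (simp_all add: G11_pos gram_pos)

subsection \<open>The Levi-Civita connection\<close>

abbreviation \<Gamma> :: "('a, real^2) chart \<Rightarrow> real^2 \<Rightarrow> real^2 \<Rightarrow> real^2 \<Rightarrow> real^2"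
  where "\<Gamma> \<equiv> christoffel \<A> g"

abbreviation koszul :: "('a, real^2) chart \<Rightarrow> real^2 \<Rightarrow> real^2 \<Rightarrow> real^2 \<Rightarrow> real^2 \<Rightarrow> real"
  where "koszul c x u v w \<equiv> DG c x u v w + DG c x v u w - DG c x w u v"

text \<open>
  The solution of Koszul's formula, expanded in the orthonormal frame. It shows that the
  Christoffel symbols, which are defined as a unique solution, exist and are smooth.
\<close>

definition christoffel_frame :: "('a, real^2) chart \<Rightarrow> real^2 \<Rightarrow> real^2 \<Rightarrow> real^2 \<Rightarrow> real^2"
  where "christoffel_frame c x u v =
    (koszul c x u v (frame1 c x) / 2) *\<^sub>R frame1 c x + (koszul c x u v (frame2 c x) / 2) *\<^sub>R frame2 c x"

context
  fixes c x assumes c: "c \<in> \<A>" and x: "x \<in> dom c"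
begin

lemma DG_has: "((\<lambda>y. G c y u v) has_derivative (\<lambda>h. DG c x h u v)) (at x)"
  using smooth_on_has_derivative[OF smooth_G[OF c] x] .

lemma linear_DG: "linear (\<lambda>h. DG c x h u v)"
  using has_derivative_linear[OF DG_has] .

lemma DG_sym: "DG c x h u v = DG c x h v u"
  using frechet_derivative_cong_open(1)[OF open_dom[OF c] x, of "\<lambda>y. G c y u v" "\<lambda>y. G c y v u"] G_sym[OF c] by simp

lemma linear_DG2: "linear (\<lambda>v. DG c x h u v)"
proof (rule linearI)
  fix v w
  have "((\<lambda>y. G c y u v + G c y u w) has_derivative (\<lambda>h. DG c x h u v + DG c x h u w)) (at x)"
    by (intro has_derivative_add DG_has)
  then have "((\<lambda>y. G c y u (v + w)) has_derivative (\<lambda>h. DG c x h u v + DG c x h u w)) (at x)"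
    by (rule has_derivative_transform_within_open[OF _ open_dom[OF c] x]) (simp add: G_lin_simps[OF c])
  from fun_cong[OF frechet_derivative_at[OF this], of h]
  show "DG c x h u (v + w) = DG c x h u v + DG c x h u w" by simp
next
  fix r v
  have "((\<lambda>y. r *\<^sub>R G c y u v) has_derivative (\<lambda>h. r *\<^sub>R DG c x h u v)) (at x)"
    by (intro has_derivative_scaleR_right DG_has)
  then have "((\<lambda>y. G c y u (r *\<^sub>R v)) has_derivative (\<lambda>h. r *\<^sub>R DG c x h u v)) (at x)"
    by (rule has_derivative_transform_within_open[OF _ open_dom[OF c] x]) (simp add: G_lin_simps[OF c])
  from fun_cong[OF frechet_derivative_at[OF this], of h]
  show "DG c x h u (r *\<^sub>R v) = r *\<^sub>R DG c x h u v" by simp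
qed

lemma linear_DG1: "linear (\<lambda>u. DG c x h u v)"
  using linear_DG2[of v h] by (simp add: DG_sym[of _ v h])

lemma linear_koszul: "linear (koszul c x u v)"
  by (intro linear_compose_add linear_compose_sub linear_DG2 linear_DG)

lemma christoffel_frame_koszul: "2 * G c x (christoffel_frame c x u v) w = koszul c x u v w"
proof -
  have "koszul c x u v w = koszul c x u v (G c x w (frame1 c x) *\<^sub>R frame1 c x + G c x w (frame2 c x) *\<^sub>R frame2 c x)"
    by (simp add: frame_expand[OF c x, symmetric])
  also have "\<dots> = G c x w (frame1 c x) * koszul c x u v (frame1 c x) + G c x w (frame2 c x) * koszul c x u v (frame2 c x)"
    unfolding linear_add[OF linear_koszul] linear_cmul[OF linear_koszul] by simp
  also have "\<dots> = 2 * G c x (christoffel_frame c x u v) w"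
    by (simp add: christoffel_frame_def G_lin_simps[OF c x] G_sym[OF c x, of w] field_simps)
  finally show ?thesis by simp
qed

lemma christoffel_eq_frame: "\<Gamma> c x u v = christoffel_frame c x u v"
  unfolding christoffel_def
proof (rule the_equality)
  show "\<forall>w. 2 * G c x (christoffel_frame c x u v) w = koszul c x u v w" using christoffel_frame_koszul by blast
  fix z assume "\<forall>w. 2 * G c x z w = koszul c x u v w"
  then have "G c x z w = G c x (christoffel_frame c x u v) w" for w
    using christoffel_frame_koszul[of u v w] by (metis mult_cancel_left zero_neq_numeral)
  then show "z = christoffel_frame c x u v" by (rule G_nondegenerate[OF c x])
qed

lemma christoffel_koszul: "2 * G c x (\<Gamma> c x u v) w = koszul c x u v w"
  by (simp add: christoffel_eq_frame christoffel_frame_koszul)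

lemma christoffel_eqI: "(\<And>w. 2 * G c x z w = koszul c x u v w) \<Longrightarrow> \<Gamma> c x u v = z"
  using G_nondegenerate[OF c x, of "\<Gamma> c x u v" z] christoffel_koszul[of u v]
  by (metis mult_cancel_left zero_neq_numeral)

lemma christoffel_sym: "\<Gamma> c x u v = \<Gamma> c x v u"
  by (rule christoffel_eqI) (simp add: christoffel_koszul DG_sym[of u v])

lemma linear_christoffel: "linear (\<Gamma> c x u)"
proof (rule linearI)
  show "\<Gamma> c x u (v + w) = \<Gamma> c x u v + \<Gamma> c x u w" for v w
    by (rule christoffel_eqI)
      (simp add: G_lin_simps[OF c x] distrib_left christoffel_koszul linear_add[OF linear_DG1] linear_add[OF linear_DG2]
        linear_add[OF linear_DG])
  show "\<Gamma> c x u (r *\<^sub>R v) = r *\<^sub>R \<Gamma> c x u v" for r v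
  proof (rule christoffel_eqI)
    fix w
    have "2 * G c x (r *\<^sub>R \<Gamma> c x u v) w = r * (2 * G c x (\<Gamma> c x u v) w)" by (simp add: G_lin_simps[OF c x])
    then show "2 * G c x (r *\<^sub>R \<Gamma> c x u v) w = koszul c x u (r *\<^sub>R v) w"
      unfolding christoffel_koszul
      by (simp add: linear_cmul[OF linear_DG1] linear_cmul[OF linear_DG2] linear_cmul[OF linear_DG] algebra_simps)
  qed
qed

lemma linear_christoffel': "linear (\<lambda>u. \<Gamma> c x u v)"
  using linear_christoffel[of v] by (simp add: christoffel_sym[of _ v])

text \<open>
  In the sum of the two Koszul expressions all terms cancel except twice the derivative in the
  direction \<open>h\<close>.
\<close>

lemma metric_compatible: "G c x (\<Gamma> c x h u) v + G c x u (\<Gamma> c x h v) = DG c x h u v"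
proof -
  show ?thesis
    using christoffel_koszul[of h u v] christoffel_koszul[of h v u] G_sym[OF c x, of u "\<Gamma> c x h v"] DG_sym[of v u h]
    by simp
qed

end

lemma smooth_DG:
  assumes "c \<in> \<A>" "smooth_on (dom c) h" "smooth_on (dom c) u" "smooth_on (dom c) v"
  shows "smooth_on (dom c) (\<lambda>x. DG c x (h x) (u x) (v x))"
proof -
  have id: "smooth_on (dom c) (\<lambda>x. x)" by (rule smooth_on_id[OF open_dom[OF assms(1)]])
  have 1: "smooth_on (dom c) (\<lambda>x. DG c x b d e)" for b d e
    by (rule smooth_on_frechet[OF smooth_G[OF assms(1)]])
  have 2: "smooth_on (dom c) (\<lambda>x. DG c x (h x) d e)" for d e
    by (rule smooth_on_linear_family[OF open_dom open_dom 1 linear_DG id]) (use assms in auto)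
  have 3: "smooth_on (dom c) (\<lambda>x. DG c x (h x) (u x) e)" for e
    by (rule smooth_on_linear_family[where L = "\<lambda>x b. DG c x (h x) b e", OF open_dom open_dom 2 linear_DG1 id])
      (use assms in auto)
  show ?thesis
    by (rule smooth_on_linear_family[where L = "\<lambda>x. DG c x (h x) (u x)", OF open_dom open_dom 3 linear_DG2 id])
      (use assms in auto)
qed

lemma smooth_christoffel:
  assumes "c \<in> \<A>" shows "smooth_on (dom c) (\<lambda>x. \<Gamma> c x u v)"
proof -
  note o = open_dom[OF assms]
  have "smooth_on (dom c) (\<lambda>x. christoffel_frame c x u v)"
    unfolding christoffel_frame_def
    by (intro smooth_intros smooth_DG o assms smooth_frame1 smooth_frame2) auto
  then show ?thesis
    using smooth_on_cong[OF o, of "\<lambda>x. \<Gamma> c x u v" "\<lambda>x. christoffel_frame c x u v"] christoffel_eq_frame[OF assms] by blast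
qed

subsection \<open>Change of charts\<close>

context
  fixes c c' p assumes c: "c \<in> charts_at \<A> p" and c': "c' \<in> charts_at \<A> p"
begin

abbreviation (input) "ovl \<equiv> snd c ` (fst c \<inter> fst c')"
abbreviation (input) "\<tau> \<equiv> transition c c'"
abbreviation (input) "D\<tau> x u \<equiv> frechet_derivative \<tau> (at x) u"
abbreviation (input) "D2\<tau> h u \<equiv> frechet_derivative (\<lambda>y. frechet_derivative \<tau> (at y) u) (at (snd c p)) h"

lemma chart_facts: "c \<in> \<A>" "c' \<in> \<A>" "p \<in> fst c" "p \<in> fst c'"
  using c c' by (auto simp: charts_at_iff)

lemma overlap_facts:
  "open ovl" "smooth_on ovl \<tau>" "snd c p \<in> ovl" "\<tau> (snd c p) = snd c' p" "snd c p \<in> dom c" "snd c' p \<in> dom c'"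
  using compatible_atlas_open_Int[OF compat] compatible_atlas_smooth[OF compat] chart_facts
    transition_snd[OF compat chart_facts(1,3), of c'] by auto

lemma D\<tau>_differentiable: "(\<lambda>x. D\<tau> x u) differentiable (at (snd c p))"
  by (rule smooth_on_differentiable[OF smooth_on_frechet[OF overlap_facts(2)] overlap_facts(3)])

lemma D2\<tau>_sym: "D2\<tau> h u = D2\<tau> u h"
  by (rule symmetric_second_derivative[OF overlap_facts(1,3,2)])

lemma G_transform:
  assumes "x \<in> ovl" shows "G c x u v = G c' (\<tau> x) (D\<tau> x u) (D\<tau> x v)"
proof -
  obtain q where q: "q \<in> fst c" "q \<in> fst c'" "x = snd c q" using assms by auto
  have cq: "c \<in> charts_at \<A> q" "c' \<in> charts_at \<A> q" using q chart_facts by (auto simp: charts_at_iff)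
  have "G c x u v = g q (coord_tvec \<A> c q u) (coord_tvec \<A> c q v)"
    using q chart_inv_snd[OF compat chart_facts(1)] by (simp add: metric_coord_def)
  also have "\<dots> = G c' (snd c' q) (coord_tvec \<A> c q u c') (coord_tvec \<A> c q v c')"
    by (rule metric_eq_G[OF cq(2) coord_tvec_in[OF compat cq(1)] coord_tvec_in[OF compat cq(1)]])
  also have "\<dots> = G c' (\<tau> x) (D\<tau> x u) (D\<tau> x v)"
    using q cq by (simp add: coord_tvec_def transition_snd[OF compat chart_facts(1)])
  finally show ?thesis .
qed

text \<open>
  This differentiates \<open>G_transform\<close> along a straight line in the direction \<open>h\<close>; the base point and
  the two arguments of the metric move, hence the three terms.
\<close>

lemma DG_transform:
  "DG c (snd c p) h u v = DG c' (snd c' p) (D\<tau> (snd c p) h) (D\<tau> (snd c p) u) (D\<tau> (snd c p) v)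
    + G c' (snd c' p) (D2\<tau> h u) (D\<tau> (snd c p) v) + G c' (snd c' p) (D\<tau> (snd c p) u) (D2\<tau> h v)"
proof -
  note O = overlap_facts
  let ?x = "snd c p"
  let ?l = "\<lambda>s. ?x + s *\<^sub>R h"
  have l: "(?l has_vector_derivative h) (at 0)"
    by (auto intro!: derivative_eq_intros)
  have comp: "((\<lambda>s. f (?l s)) has_vector_derivative frechet_derivative f (at ?x) h) (at 0)"
    if "f differentiable (at ?x)" for f :: "real^2 \<Rightarrow> 'z::real_normed_vector"
  proof -
    have f: "(f has_derivative frechet_derivative f (at ?x)) (at (?l 0))"
      using that by (simp add: frechet_derivative_works)
    show ?thesis
      using has_derivative_compose[OF l[unfolded has_vector_derivative_def] f] linear_cmul[OF has_derivative_linear[OF f]]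
      by (simp add: has_vector_derivative_def)
  qed
  have 1: "((\<lambda>s. G c (?l s) u v) has_vector_derivative DG c ?x h u v) (at 0)"
    by (rule comp[OF smooth_on_differentiable[OF smooth_G[OF chart_facts(1)] O(5)]])
  have \<tau>': "((\<lambda>s. \<tau> (?l s)) has_vector_derivative D\<tau> ?x h) (at 0)"
    by (rule comp[OF smooth_on_differentiable[OF O(2,3)]])
  have D: "((\<lambda>s. D\<tau> (?l s) u) has_vector_derivative D2\<tau> h u) (at 0)" for u
    by (rule comp[OF D\<tau>_differentiable])
  have l0: "\<tau> (?l 0) = snd c' p" using O(4) by simp
  have "((\<lambda>s. G c' (\<tau> (?l s)) (D\<tau> (?l s) u) (D\<tau> (?l s) v)) has_vector_derivative
      DG c' (\<tau> (?l 0)) (D\<tau> ?x h) (D\<tau> (?l 0) u) (D\<tau> (?l 0) v)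
    + G c' (\<tau> (?l 0)) (D2\<tau> h u) (D\<tau> (?l 0) v) + G c' (\<tau> (?l 0)) (D\<tau> (?l 0) u) (D2\<tau> h v)) (at 0)"
    by (rule bilinear_family_has_vector_derivative[OF open_dom[OF chart_facts(2)] _ linear_G' linear_G _ \<tau>' D D])
      (use chart_facts O smooth_on_differentiable[OF smooth_G] in simp_all)
  then have 2: "((\<lambda>s. G c' (\<tau> (?l s)) (D\<tau> (?l s) u) (D\<tau> (?l s) v)) has_vector_derivative
      DG c' (snd c' p) (D\<tau> ?x h) (D\<tau> ?x u) (D\<tau> ?x v)
    + G c' (snd c' p) (D2\<tau> h u) (D\<tau> ?x v) + G c' (snd c' p) (D\<tau> ?x u) (D2\<tau> h v)) (at 0)"
    using O(4) by simp
  have "open (?l -` ovl)"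
    by (rule open_vimage[OF O(1)]) (intro continuous_intros)
  from has_vector_derivative_transform_within_open[OF 2 this]
  have "((\<lambda>s. G c (?l s) u v) has_vector_derivative
      DG c' (snd c' p) (D\<tau> ?x h) (D\<tau> ?x u) (D\<tau> ?x v)
    + G c' (snd c' p) (D2\<tau> h u) (D\<tau> ?x v) + G c' (snd c' p) (D\<tau> ?x u) (D2\<tau> h v)) (at 0)"
    using O(3) G_transform by simp
  from vector_derivative_unique_at[OF 1 this] show ?thesis .
qed

text \<open>
  By \<open>DG_transform\<close> the Koszul expressions in the two charts differ by six terms with a second
  derivative of the transition map. Four of them cancel by its symmetry and the other two are
  equal.
\<close>

lemma christoffel_transform:
  "D\<tau> (snd c p) (\<Gamma> c (snd c p) u v) = \<Gamma> c' (snd c' p) (D\<tau> (snd c p) u) (D\<tau> (snd c p) v) + D2\<tau> u v"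
proof (rule G_nondegenerate[OF chart_facts(2) overlap_facts(6)])
  fix w'
  \<comment> \<open>The Koszul formula in the chart \<open>c\<close> is tested on the preimage of \<open>w\'\<close>.\<close>
  define w where "w = dtrans c' c p w'"
  have w': "w' = D\<tau> (snd c p) w"
    unfolding w_def using dtrans_comp[OF compat c' c c'] dtrans_self[OF compat c'] by simp
  note O = overlap_facts
  have "2 * G c' (snd c' p) (D\<tau> (snd c p) (\<Gamma> c (snd c p) u v)) w' = 2 * G c (snd c p) (\<Gamma> c (snd c p) u v) w"
    unfolding w' using G_transform[OF O(3)] O(4) by simp
  also have "\<dots> = koszul c (snd c p) u v w" by (rule christoffel_koszul[OF chart_facts(1) O(5)])
  also have "\<dots> = koszul c' (snd c' p) (D\<tau> (snd c p) u) (D\<tau> (snd c p) v) w' + 2 * G c' (snd c' p) (D2\<tau> u v) w'"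
    unfolding DG_transform w'
    using D2\<tau>_sym[of w u] D2\<tau>_sym[of w v] D2\<tau>_sym[of v u]
      G_sym[OF chart_facts(2) O(6), of "D\<tau> (snd c p) v"] G_sym[OF chart_facts(2) O(6), of "D\<tau> (snd c p) u"]
    by simp
  also have "\<dots> = 2 * G c' (snd c' p) (\<Gamma> c' (snd c' p) (D\<tau> (snd c p) u) (D\<tau> (snd c p) v) + D2\<tau> u v) w'"
    unfolding linear_add[OF linear_G'[OF chart_facts(2) O(6)]] distrib_left christoffel_koszul[OF chart_facts(2) O(6)] by simp
  finally show "G c' (snd c' p) (D\<tau> (snd c p) (\<Gamma> c (snd c p) u v)) w' =
    G c' (snd c' p) (\<Gamma> c' (snd c' p) (D\<tau> (snd c p) u) (D\<tau> (snd c p) v) + D2\<tau> u v) w'" by simp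
qed

end

subsection \<open>Parallel vector fields along curves\<close>

abbreviation parallel_in_chart where
  "parallel_in_chart c \<gamma> V t \<equiv> ((\<lambda>s. V s c) has_vector_derivative
      - \<Gamma> c (snd c (\<gamma> t)) (velocity \<A> \<gamma> t c) (V t c)) (at t)"

text \<open>
  The second derivative of the transition map appears twice: when the coordinates of \<open>V\<close> are
  differentiated and in \<open>christoffel_transform\<close>. The two contributions cancel.
\<close>

lemma parallel_chart_change:
  assumes \<gamma>: "smooth_map eucl I \<A> \<gamma>" "open I" "t \<in> I" and V: "\<And>s. s \<in> I \<Longrightarrow> V s \<in> T (\<gamma> s)"
    and c: "c \<in> charts_at \<A> (\<gamma> t)" "c' \<in> charts_at \<A> (\<gamma> t)" and par: "parallel_in_chart c \<gamma> V t"
  shows "parallel_in_chart c' \<gamma> V t"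
proof -
  obtain W where W: "open W" "t \<in> W" "W \<subseteq> I" "\<And>s. s \<in> W \<Longrightarrow> \<gamma> s \<in> fst c" by (rule smooth_curve_chart[OF compat \<gamma> c(1)]) blast
  obtain W' where W': "open W'" "t \<in> W'" "\<And>s. s \<in> W' \<Longrightarrow> \<gamma> s \<in> fst c'" by (rule smooth_curve_chart[OF compat \<gamma> c(2)]) blast
  note O = overlap_facts[OF c]
  have lin: "linear (frechet_derivative (transition c c') (at x))" if "x \<in> snd c ` (fst c \<inter> fst c')" for x
    by (rule smooth_on_imp_linear[OF O(2) that])
  have "((\<lambda>s. frechet_derivative (transition c c') (at (snd c (\<gamma> s))) (V s c)) has_vector_derivative
    frechet_derivative (\<lambda>y. frechet_derivative (transition c c') (at y) (V t c)) (at (snd c (\<gamma> t))) (velocity \<A> \<gamma> t c)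
    + dtrans c c' (\<gamma> t) (- \<Gamma> c (snd c (\<gamma> t)) (velocity \<A> \<gamma> t c) (V t c))) (at t)"
    by (rule linear_family_has_vector_derivative[OF O(1,3) lin D\<tau>_differentiable[OF c]
          smooth_curve_coord_derivative[OF compat \<gamma> c(1)] par])
  moreover have "frechet_derivative (\<lambda>y. frechet_derivative (transition c c') (at y) (V t c)) (at (snd c (\<gamma> t))) (velocity \<A> \<gamma> t c)
    + dtrans c c' (\<gamma> t) (- \<Gamma> c (snd c (\<gamma> t)) (velocity \<A> \<gamma> t c) (V t c))
    = - \<Gamma> c' (snd c' (\<gamma> t)) (velocity \<A> \<gamma> t c') (V t c')"
    unfolding linear_neg[OF lin[OF O(3)]] christoffel_transform[OF c]
      tangent_vector_transform[OF compat smooth_curve_velocity_in[OF compat \<gamma>] c]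
      tangent_vector_transform[OF compat V[OF \<gamma>(3)] c]
    using D2\<tau>_sym[OF c] by simp
  ultimately have "((\<lambda>s. frechet_derivative (transition c c') (at (snd c (\<gamma> s))) (V s c)) has_vector_derivative
      - \<Gamma> c' (snd c' (\<gamma> t)) (velocity \<A> \<gamma> t c') (V t c')) (at t)" by simp
  then show ?thesis
  proof (rule has_vector_derivative_transform_within_open[of _ _ _ "W \<inter> W'"])
    fix s assume s: "s \<in> W \<inter> W'"
    then show "dtrans c c' (\<gamma> s) (V s c) = V s c'"
      using tangent_vector_transform[OF compat V, of s c c'] W W' c by (auto simp: charts_at_iff)
  qed (use W W' in auto)
qed

lemma parallel_alongI:
  assumes \<gamma>: "smooth_map eucl I \<A> \<gamma>" "open I" and V: "\<And>s. s \<in> I \<Longrightarrow> V s \<in> T (\<gamma> s)"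
    and par: "\<And>t. t \<in> I \<Longrightarrow> \<exists>c\<in>charts_at \<A> (\<gamma> t). parallel_in_chart c \<gamma> V t"
  shows "parallel_along \<A> g I \<gamma> V"
  unfolding parallel_along_def
proof (intro ballI conjI)
  fix t c' assume t: "t \<in> I" and c': "c' \<in> charts_at \<A> (\<gamma> t)"
  then obtain c where "c \<in> charts_at \<A> (\<gamma> t)" "parallel_in_chart c \<gamma> V t" using par by blast
  then show "parallel_in_chart c' \<gamma> V t" using parallel_chart_change[OF \<gamma> t V _ c'] by blast
qed (use V in blast)

lemma parallel_alongD:
  assumes "parallel_along \<A> g I \<gamma> V" "t \<in> I"
  shows "V t \<in> T (\<gamma> t)" "c \<in> charts_at \<A> (\<gamma> t) \<Longrightarrow> parallel_in_chart c \<gamma> V t"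
  using assms by (auto simp: parallel_along_def)

lemma parallel_along_subset: "parallel_along \<A> g I \<gamma> V \<Longrightarrow> J \<subseteq> I \<Longrightarrow> parallel_along \<A> g J \<gamma> V"
  by (auto simp: parallel_along_def)

lemma chart_point: "c \<in> charts_at \<A> p \<Longrightarrow> c \<in> \<A>" "c \<in> charts_at \<A> p \<Longrightarrow> snd c p \<in> dom c"
  by (auto simp: charts_at_iff)

lemma parallel_along_lincomb:
  assumes "parallel_along \<A> g I \<gamma> V" "parallel_along \<A> g I \<gamma> W"
  shows "parallel_along \<A> g I \<gamma> (\<lambda>t. a *\<^sub>R V t + b *\<^sub>R W t)"
  unfolding parallel_along_def
proof (intro ballI conjI)
  fix t assume t: "t \<in> I"
  note V = parallel_alongD[OF assms(1) t] and W = parallel_alongD[OF assms(2) t]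
  show "a *\<^sub>R V t + b *\<^sub>R W t \<in> T (\<gamma> t)"
    by (intro subspace_add subspace_scale subspace_tangent_space[OF compat] V W)
  fix c assume c: "c \<in> charts_at \<A> (\<gamma> t)"
  have "((\<lambda>s. a *\<^sub>R V s c + b *\<^sub>R W s c) has_vector_derivative
      a *\<^sub>R (- \<Gamma> c (snd c (\<gamma> t)) (velocity \<A> \<gamma> t c) (V t c)) + b *\<^sub>R (- \<Gamma> c (snd c (\<gamma> t)) (velocity \<A> \<gamma> t c) (W t c))) (at t)"
    using V(2)[OF c] W(2)[OF c] by (auto intro!: derivative_eq_intros)
  then show "parallel_in_chart c \<gamma> (\<lambda>t. a *\<^sub>R V t + b *\<^sub>R W t) t"
    using linear_add[OF linear_christoffel[OF chart_point[OF c]]] linear_cmul[OF linear_christoffel[OF chart_point[OF c]]]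
    by (simp add: scaleR_fun_def)
qed

text \<open>
  By \<open>metric_compatible\<close> the inner product of two parallel fields has derivative zero.
\<close>

lemma parallel_isometry:
  assumes \<gamma>: "smooth_map eucl I \<A> \<gamma>" "open I" "is_interval I"
    and V: "parallel_along \<A> g I \<gamma> V" and W: "parallel_along \<A> g I \<gamma> W" and "s \<in> I" "t \<in> I"
  shows "g (\<gamma> s) (V s) (W s) = g (\<gamma> t) (V t) (W t)"
proof -
  have "((\<lambda>s. g (\<gamma> s) (V s) (W s)) has_vector_derivative 0) (at t)" if t: "t \<in> I" for t
  proof -
    note V' = parallel_alongD[OF V t] and W' = parallel_alongD[OF W t]
    obtain c where c: "c \<in> charts_at \<A> (\<gamma> t)" using smooth_map_charts[OF \<gamma>(1) t] by (auto simp: mcarrier_charts_at)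
    obtain X where X: "open X" "t \<in> X" "X \<subseteq> I" "\<And>s. s \<in> X \<Longrightarrow> \<gamma> s \<in> fst c"
      by (rule smooth_curve_chart[OF compat \<gamma>(1,2) t c]) blast
    note cp = chart_point[OF c]
    let ?x = "snd c (\<gamma> t)" and ?v = "velocity \<A> \<gamma> t c"
    have "((\<lambda>s. G c (snd c (\<gamma> s)) (V s c) (W s c)) has_vector_derivative
        DG c ?x ?v (V t c) (W t c) + G c ?x (- \<Gamma> c ?x ?v (V t c)) (W t c) + G c ?x (V t c) (- \<Gamma> c ?x ?v (W t c))) (at t)"
      by (rule bilinear_family_has_vector_derivative[OF open_dom[OF cp(1)] cp(2) linear_G' linear_G
            smooth_on_differentiable[OF smooth_G] smooth_curve_coord_derivative[OF compat \<gamma>(1,2) t c] V'(2)[OF c] W'(2)[OF c]])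
        (use cp in auto)
    moreover have "DG c ?x ?v (V t c) (W t c) + G c ?x (- \<Gamma> c ?x ?v (V t c)) (W t c) + G c ?x (V t c) (- \<Gamma> c ?x ?v (W t c)) = 0"
      using metric_compatible[OF cp, of ?v "V t c" "W t c"] by (simp add: linear_neg[OF linear_G[OF cp]] linear_neg[OF linear_G'[OF cp]])
    ultimately have "((\<lambda>s. G c (snd c (\<gamma> s)) (V s c) (W s c)) has_vector_derivative 0) (at t)" by simp
    then show ?thesis
    proof (rule has_vector_derivative_transform_within_open[OF _ X(1,2)])
      fix s assume "s \<in> X"
      then show "G c (snd c (\<gamma> s)) (V s c) (W s c) = g (\<gamma> s) (V s) (W s)"
        using metric_eq_G[of c "\<gamma> s" "V s" "W s"] parallel_alongD(1)[OF V] parallel_alongD(1)[OF W] X cp(1)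
        by (auto simp: charts_at_iff)
    qed
  qed
  then have der: "((\<lambda>s. g (\<gamma> s) (V s) (W s)) has_vector_derivative 0) (at t within I)" if "t \<in> I" for t
    using that has_vector_derivative_at_within by blast
  have "convex I" using \<gamma>(3) by (simp add: is_interval_convex_1)
  from has_vector_derivative_zero_constant[OF this der]
  obtain k where "\<And>t. t \<in> I \<Longrightarrow> g (\<gamma> t) (V t) (W t) = k" by blast
  then show ?thesis using assms(6,7) by simp
qed

text \<open>
  The difference of the two fields is parallel, so its length is constant and vanishes with its
  value at \<open>s\<close>.
\<close>

lemma parallel_unique:
  assumes \<gamma>: "smooth_map eucl I \<A> \<gamma>" "open I" "is_interval I"
    and V: "parallel_along \<A> g I \<gamma> V" and W: "parallel_along \<A> g I \<gamma> W"
    and s: "s \<in> I" "V s = W s" and "t \<in> I"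
  shows "V t = W t"
proof -
  let ?U = "\<lambda>t. 1 *\<^sub>R V t + (-1) *\<^sub>R W t"
  have U: "parallel_along \<A> g I \<gamma> ?U" by (rule parallel_along_lincomb[OF V W])
  have p: "\<gamma> s \<in> mcarrier \<A>" "\<gamma> t \<in> mcarrier \<A>" using smooth_map_charts[OF \<gamma>(1)] s(1) \<open>t \<in> I\<close> by auto
  have "?U s = 0" using s(2) by (simp add: fun_eq_iff scaleR_fun_def)
  moreover have "g (\<gamma> s) 0 0 = 0"
    using metric_linear(2)[OF p(1), of 0 0 0] subspace_0[OF subspace_tangent_space[OF compat]]
    by (simp add: scaleR_fun_def zero_fun_def)
  ultimately have "g (\<gamma> t) (?U t) (?U t) = 0"
    using parallel_isometry[OF \<gamma> U U s(1) \<open>t \<in> I\<close>] by simp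
  then have "?U t = 0" using metric_pos[OF p(2) parallel_alongD(1)[OF U \<open>t \<in> I\<close>]] by (metis less_irrefl)
  then have "V t + - W t = 0" by (simp add: fun_eq_iff scaleR_fun_def)
  then show ?thesis by (simp add: fun_eq_iff)
qed

text \<open>
  In a chart parallelism is a linear differential equation. The interval \<open>J\<close> is independent of the
  initial time and vector, as in \<open>linear_ode_local\<close>.
\<close>

lemma parallel_local_existence:
  assumes \<gamma>: "smooth_map eucl I \<A> \<gamma>" "open I" "t0 \<in> I"
  shows "\<exists>J. open J \<and> is_interval J \<and> t0 \<in> J \<and> J \<subseteq> I \<and>
    (\<forall>t1\<in>J. \<forall>v\<in>T (\<gamma> t1). \<exists>V. parallel_along \<A> g J \<gamma> V \<and> V t1 = v)"
proof -
  obtain c where c: "c \<in> charts_at \<A> (\<gamma> t0)" using smooth_map_charts[OF \<gamma>(1,3)] by (auto simp: mcarrier_charts_at)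
  obtain X where X: "open X" "t0 \<in> X" "X \<subseteq> I" "\<And>s. s \<in> X \<Longrightarrow> \<gamma> s \<in> fst c" "smooth_on X (\<lambda>s. snd c (\<gamma> s))"
    by (rule smooth_curve_chart[OF compat \<gamma> c]) blast
  have cX: "c \<in> charts_at \<A> (\<gamma> t)" if "t \<in> X" for t using X(4)[OF that] c by (auto simp: charts_at_iff)
  note cA = chart_point(1)[OF c]
  have "smooth_on X (\<lambda>t. velocity \<A> \<gamma> t c)"
  proof (rule smooth_on_cong[OF X(1), THEN iffD1, OF _ smooth_on_frechet[OF X(5), of 1]])
    fix t assume "t \<in> X"
    then show "frechet_derivative (\<lambda>s. snd c (\<gamma> s)) (at t) 1 = velocity \<A> \<gamma> t c"
      using cX frechet_derivative_eq_vector_derivative[OF smooth_on_differentiable[OF X(5)]] by (simp add: velocity_def)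
  qed
  then have "smooth_on X (\<lambda>t. \<Gamma> c (snd c (\<gamma> t)) (velocity \<A> \<gamma> t c) v)" for v
    using cA X by (intro smooth_on_linear_family[where L = "\<lambda>x u. \<Gamma> c x u v", OF X(1) open_dom[OF cA] smooth_christoffel linear_christoffel' X(5)]) auto
  then have cont: "continuous_on X (\<lambda>t. - \<Gamma> c (snd c (\<gamma> t)) (velocity \<A> \<gamma> t c) v)" for v
    by (intro continuous_on_minus smooth_on_imp_continuous_on)
  have lin: "linear (\<lambda>v. - \<Gamma> c (snd c (\<gamma> t)) (velocity \<A> \<gamma> t c) v)" if "t \<in> X" for t
    by (rule linear_compose_neg[OF linear_christoffel]) (use cX[OF that] chart_point in auto)
  obtain e where e: "e > 0" "ball t0 e \<subseteq> X" and ex: "\<And>t1 x0. t1 \<in> ball t0 e \<Longrightarrow> \<exists>x. x t1 = x0 \<and>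
      (\<forall>t\<in>ball t0 e. (x has_vector_derivative - \<Gamma> c (snd c (\<gamma> t)) (velocity \<A> \<gamma> t c) (x t)) (at t))"
    using linear_ode_local[OF X(1,2) lin cont] by blast
  let ?J = "ball t0 e"
  show ?thesis
  proof (intro exI[of _ ?J] conjI ballI)
    show "is_interval ?J" by (simp add: is_interval_ball_real)
    show "?J \<subseteq> I" "open ?J" "t0 \<in> ?J" using e X(3) by auto
    fix t1 v assume t1: "t1 \<in> ?J" and v: "v \<in> T (\<gamma> t1)"
    obtain x where x: "x t1 = v c"
      "\<And>t. t \<in> ?J \<Longrightarrow> (x has_vector_derivative - \<Gamma> c (snd c (\<gamma> t)) (velocity \<A> \<gamma> t c) (x t)) (at t)"
      using ex[OF t1, of "v c"] by blast
    let ?V = "\<lambda>t. coord_tvec \<A> c (\<gamma> t) (x t)"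
    have Vc: "?V t c = x t" if "t \<in> ?J" for t
      using coord_tvec_self[OF compat cX] that e(2) by blast
    have "parallel_along \<A> g ?J \<gamma> ?V"
    proof (rule parallel_alongI)
      show "smooth_map eucl ?J \<A> \<gamma>" by (rule smooth_map_subset[OF \<gamma>(1)]) (use e X in auto)
      show "?V s \<in> T (\<gamma> s)" if "s \<in> ?J" for s using coord_tvec_in[OF compat cX] that e(2) by blast
      show "\<exists>c\<in>charts_at \<A> (\<gamma> t). parallel_in_chart c \<gamma> ?V t" if t: "t \<in> ?J" for t
      proof (rule bexI[OF _ cX])
        show "parallel_in_chart c \<gamma> ?V t"
          unfolding Vc[OF t]
          by (rule has_vector_derivative_transform_within_open[OF x(2)[OF t] open_ball t]) (simp add: Vc)
      qed (use t e in auto)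
    qed simp
    moreover have "?V t1 = v" using x(1) coord_tvec_eq[OF compat v cX] t1 e(2) by auto
    ultimately show "\<exists>V. parallel_along \<A> g ?J \<gamma> V \<and> V t1 = v" by blast
  qed
qed

lemma parallel_glue:
  assumes \<gamma>: "smooth_map eucl (\<Union>(range J)) \<A> \<gamma>"
    and J: "\<And>i. open (J i)" "\<And>i. parallel_along \<A> g (J i) \<gamma> (V i)"
    and agree: "\<And>i j t. t \<in> J i \<Longrightarrow> t \<in> J j \<Longrightarrow> V i t = V j t"
    and U: "\<And>i t. t \<in> J i \<Longrightarrow> U t = V i t"
  shows "parallel_along \<A> g (\<Union>(range J)) \<gamma> U"
  unfolding parallel_along_def
proof (intro ballI conjI)
  fix t assume "t \<in> \<Union>(range J)"
  then obtain i where i: "t \<in> J i" by auto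
  note V = parallel_alongD[OF J(2) i]
  show "U t \<in> T (\<gamma> t)" using V(1) U[OF i] by simp
  fix c assume c: "c \<in> charts_at \<A> (\<gamma> t)"
  show "parallel_in_chart c \<gamma> U t"
    unfolding U[OF i] by (rule has_vector_derivative_transform_within_open[OF V(2)[OF c] J(1) i]) (simp add: U)
qed

text \<open>
  Consider the times \<open>t\<close> that can be reached from \<open>s0\<close> by a parallel field with initial value \<open>v\<close>. Near
  every time of \<open>I\<close> either all or none are reached, as local solutions start at all times of a
  neighbourhood; so connectedness of \<open>I\<close> gives all of them. The fields reaching different times
  agree by uniqueness and can be glued.
\<close>

lemma parallel_existence:
  assumes \<gamma>: "smooth_map eucl I \<A> \<gamma>" "open I" "is_interval I" and s0: "s0 \<in> I" "v \<in> T (\<gamma> s0)"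
  shows "\<exists>V. parallel_along \<A> g I \<gamma> V \<and> V s0 = v"
proof -
  define P where "P = (\<lambda>t. \<exists>J V. open J \<and> is_interval J \<and> s0 \<in> J \<and> t \<in> J \<and> J \<subseteq> I \<and> parallel_along \<A> g J \<gamma> V \<and> V s0 = v)"
  have "P t" if "t \<in> I" for t
  proof (rule connected_induction_simple[of I s0 t P])
    show "connected I" using \<gamma>(3) is_interval_connected by blast
    show "P s0" using parallel_local_existence[OF \<gamma>(1,2) s0(1)] s0(2) unfolding P_def by blast
    fix a assume "a \<in> I"
    then obtain J where J: "open J" "is_interval J" "a \<in> J" "J \<subseteq> I"
      and ex: "\<And>t1 v. t1 \<in> J \<Longrightarrow> v \<in> T (\<gamma> t1) \<Longrightarrow> \<exists>V. parallel_along \<A> g J \<gamma> V \<and> V t1 = v"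
      using parallel_local_existence[OF \<gamma>(1,2)] by metis
    show "\<exists>X. openin (top_of_set I) X \<and> a \<in> X \<and> (\<forall>x\<in>X. \<forall>y\<in>X. P x \<longrightarrow> P y)"
    proof (intro exI[of _ J] conjI ballI impI)
      show "openin (top_of_set I) J" using J \<gamma>(2) by (simp add: openin_open_eq)
      show "a \<in> J" by fact
      fix x y assume xy: "x \<in> J" "y \<in> J" and "P x"
      then obtain K V where K: "open K" "is_interval K" "s0 \<in> K" "x \<in> K" "K \<subseteq> I" "parallel_along \<A> g K \<gamma> V" "V s0 = v"
        unfolding P_def by blast
      obtain W where W: "parallel_along \<A> g J \<gamma> W" "W x = V x"
        using ex[OF xy(1)] parallel_alongD(1)[OF K(6,4)] by blast
      have agree: "V t = W t" if "t \<in> K" "t \<in> J" for t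
      proof (rule parallel_unique[of "K \<inter> J" \<gamma> V W x])
        show "smooth_map eucl (K \<inter> J) \<A> \<gamma>" by (rule smooth_map_subset[OF \<gamma>(1)]) (use K in blast)
        show "parallel_along \<A> g (K \<inter> J) \<gamma> V" by (rule parallel_along_subset[OF K(6)]) blast
        show "parallel_along \<A> g (K \<inter> J) \<gamma> W" by (rule parallel_along_subset[OF W(1)]) blast
      qed (use K J W xy that is_interval_Int in auto)
      define Z where "Z = (\<lambda>t. if t \<in> K then V t else W t)"
      have "parallel_along \<A> g (\<Union>(range (\<lambda>b. if b then K else J))) \<gamma> Z"
      proof (rule parallel_glue[where V = "\<lambda>b. if b then V else W"])
        show "smooth_map eucl (\<Union>(range (\<lambda>b. if b then K else J))) \<A> \<gamma>"
          by (rule smooth_map_subset[OF \<gamma>(1)]) (use K J in auto)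
      qed (use K J W agree in \<open>auto simp: Z_def split: if_splits\<close>)
      moreover have "\<Union>(range (\<lambda>b. if b then K else J)) = K \<union> J" by (auto simp: UNIV_bool)
      moreover have "is_interval (K \<union> J)"
        unfolding is_interval_connected_1
        by (rule connected_Un) (use K J xy in \<open>auto simp: is_interval_connected_1\<close>)
      ultimately show "P y"
        unfolding P_def using K J xy by (intro exI[of _ "K \<union> J"] exI[of _ Z]) (auto simp: Z_def)
    qed
  qed (use s0 that in auto)
  then have "\<forall>t\<in>I. \<exists>J V. open J \<and> is_interval J \<and> s0 \<in> J \<and> t \<in> J \<and> J \<subseteq> I \<and> parallel_along \<A> g J \<gamma> V \<and> V s0 = v"
    unfolding P_def by blast
  then obtain J V where JV: "\<And>t. t \<in> I \<Longrightarrow> open (J t) \<and> is_interval (J t) \<and> s0 \<in> J t \<and> t \<in> J t \<and> J t \<subseteq> I \<and>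
      parallel_along \<A> g (J t) \<gamma> (V t) \<and> V t s0 = v" by metis
  have agree: "V i t = V j t" if "i \<in> I" "j \<in> I" "t \<in> J i" "t \<in> J j" for i j t
  proof (rule parallel_unique[of "J i \<inter> J j" \<gamma> "V i" "V j" s0])
    show "smooth_map eucl (J i \<inter> J j) \<A> \<gamma>"
      by (rule smooth_map_subset[OF \<gamma>(1)]) (use JV[OF that(1)] in blast)
    show "parallel_along \<A> g (J i \<inter> J j) \<gamma> (V i)"
      by (rule parallel_along_subset[of "J i"]) (use JV[OF that(1)] in auto)
    show "parallel_along \<A> g (J i \<inter> J j) \<gamma> (V j)"
      by (rule parallel_along_subset[of "J j"]) (use JV[OF that(2)] in auto)
  qed (use JV[OF that(1)] JV[OF that(2)] that is_interval_Int in auto)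
  \<comment> \<open>The family to be glued is indexed by all real numbers; \<open>s0\<close> stands in for those outside of \<open>I\<close>.\<close>
  define f where "f = (\<lambda>i. if i \<in> I then i else s0)"
  have fI: "f i \<in> I" for i using s0 by (simp add: f_def)
  have un: "\<Union>(range (\<lambda>i. J (f i))) = I"
  proof
    show "\<Union>(range (\<lambda>i. J (f i))) \<subseteq> I" using JV fI by blast
    show "I \<subseteq> \<Union>(range (\<lambda>i. J (f i)))"
    proof
      fix t assume "t \<in> I"
      then have "t \<in> J (f t)" using JV by (simp add: f_def)
      then show "t \<in> \<Union>(range (\<lambda>i. J (f i)))" by blast
    qed
  qed
  have "parallel_along \<A> g (\<Union>(range (\<lambda>i. J (f i)))) \<gamma> (\<lambda>t. V t t)"
  proof (rule parallel_glue[where V = "\<lambda>i. V (f i)"])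
    show "smooth_map eucl (\<Union>(range (\<lambda>i. J (f i)))) \<A> \<gamma>" unfolding un by fact
    fix i t assume "t \<in> J (f i)"
    then have "t \<in> I" using un by blast
    then show "V t t = V (f i) t" using agree[of t "f i" t] JV fI \<open>t \<in> J (f i)\<close> by blast
  qed (use JV fI agree in blast)+
  then show ?thesis unfolding un using JV[OF s0(1)] by blast
qed

end

section \<open>The product of two surfaces\<close>

lemma scaleR_fun_apply: "(r *\<^sub>R f) x = r *\<^sub>R f x"
  by (simp add: scaleR_fun_def)

definition cat4 :: "real^2 \<Rightarrow> real^2 \<Rightarrow> real^4"
  where "cat4 a b = vector [a $ 1, a $ 2, b $ 1, b $ 2]"

definition pr1 :: "real^4 \<Rightarrow> real^2" where "pr1 z = vector [z $ 1, z $ 2]"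
definition pr2 :: "real^4 \<Rightarrow> real^2" where "pr2 z = vector [z $ 3, z $ 4]"

lemma vector_4_nth [simp]:
  "(vector [a, b, c, d] :: 'a::zero^4) $ 1 = a" "(vector [a, b, c, d] :: 'a^4) $ 2 = b"
  "(vector [a, b, c, d] :: 'a^4) $ 3 = c" "(vector [a, b, c, d] :: 'a^4) $ 4 = d"
  by (simp_all add: vector_def)

lemma pr_cat4 [simp]: "pr1 (cat4 a b) = a" "pr2 (cat4 a b) = b" "cat4 (pr1 z) (pr2 z) = z"
  by (simp_all add: pr1_def pr2_def cat4_def vec_eq_iff forall_2 forall_4)

lemma linear_pr1: "linear pr1" and linear_pr2: "linear pr2"
  by (auto intro!: linearI simp: pr1_def pr2_def vec_eq_iff forall_2)

lemma linear_cat4: "linear (\<lambda>(a, b). cat4 a b)"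
  by (rule linearI) (auto simp: cat4_def vec_eq_iff forall_4)

lemma cat4_simps: "cat4 a b + cat4 a' b' = cat4 (a + a') (b + b')" "r *\<^sub>R cat4 a b = cat4 (r *\<^sub>R a) (r *\<^sub>R b)"
  "- cat4 a b = cat4 (- a) (- b)" "cat4 0 0 = 0"
  by (simp_all add: cat4_def vec_eq_iff forall_4)

lemma cat4_eq_iff: "cat4 a b = cat4 a' b' \<longleftrightarrow> a = a' \<and> b = b'"
  using pr_cat4(1,2) by metis

lemmas smooth_on_pr1 = smooth_on_linear_comp'[OF linear_pr1]
lemmas smooth_on_pr2 = smooth_on_linear_comp'[OF linear_pr2]

lemma smooth_on_cat4:
  assumes "open S" "smooth_on S f" "smooth_on S g" shows "smooth_on S (\<lambda>x. cat4 (f x) (g x))"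
  using smooth_on_linear_comp'[OF linear_cat4 assms(1) smooth_on_Pair[OF assms]] by simp

lemmas pr1_bounded = linear_conv_bounded_linear[THEN iffD1, OF linear_pr1]
lemmas pr2_bounded = linear_conv_bounded_linear[THEN iffD1, OF linear_pr2]

lemma has_vector_derivative_cat4:
  "((\<lambda>s. cat4 (f s) (g s)) has_vector_derivative cat4 f' g') (at t) \<longleftrightarrow>
    (f has_vector_derivative f') (at t) \<and> (g has_vector_derivative g') (at t)"
proof
  assume *: "((\<lambda>s. cat4 (f s) (g s)) has_vector_derivative cat4 f' g') (at t)"
  show "(f has_vector_derivative f') (at t) \<and> (g has_vector_derivative g') (at t)"
    using bounded_linear.has_vector_derivative[OF pr1_bounded *] bounded_linear.has_vector_derivative[OF pr2_bounded *] by simp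
next
  assume "(f has_vector_derivative f') (at t) \<and> (g has_vector_derivative g') (at t)"
  then have "((\<lambda>s. (f s, g s)) has_vector_derivative (f', g')) (at t)"
    unfolding has_vector_derivative_def scaleR_Pair by (auto intro: has_derivative_Pair)
  from bounded_linear.has_vector_derivative[OF linear_conv_bounded_linear[THEN iffD1, OF linear_cat4] this]
  show "((\<lambda>s. cat4 (f s) (g s)) has_vector_derivative cat4 f' g') (at t)" by simp
qed

lemma open_pr: assumes "open S" "open S'" shows "open {z. pr1 z \<in> S \<and> pr2 z \<in> S'}"
proof -
  have "open (pr1 -` S)" "open (pr2 -` S')"
    using assms linear_continuous_on[OF pr1_bounded] linear_continuous_on[OF pr2_bounded] by (auto intro: open_vimage)
  moreover have "{z. pr1 z \<in> S \<and> pr2 z \<in> S'} = pr1 -` S \<inter> pr2 -` S'" by auto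
  ultimately show ?thesis by auto
qed

lemma snd_product_chart: "snd (product_chart c d) (x, y) = cat4 (snd c x) (snd d y)"
  by (simp add: product_chart_def cat4_def)

lemma fst_product_chart: "fst (product_chart c d) = fst c \<times> fst d"
  by (simp add: product_chart_def)

lemma cat4_image: "(\<lambda>(x, y). cat4 (f x) (g y)) ` (A \<times> B) = {z. pr1 z \<in> f ` A \<and> pr2 z \<in> g ` B}"
proof
  show "{z. pr1 z \<in> f ` A \<and> pr2 z \<in> g ` B} \<subseteq> (\<lambda>(x, y). cat4 (f x) (g y)) ` (A \<times> B)"
  proof
    fix z assume "z \<in> {z. pr1 z \<in> f ` A \<and> pr2 z \<in> g ` B}"
    then obtain a b where "a \<in> A" "b \<in> B" "pr1 z = f a" "pr2 z = g b" by auto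
    then show "z \<in> (\<lambda>(x, y). cat4 (f x) (g y)) ` (A \<times> B)"
      using pr_cat4(3)[of z] by (intro image_eqI[of _ _ "(a, b)"]) auto
  qed
qed auto

locale surface_pair = S1: surface \<A> g1 + S2: surface \<B> g2
  for \<A> :: "('a, real^2) atlas" and g1 and \<B> :: "('b, real^2) atlas" and g2
begin

abbreviation M :: "('a \<times> 'b, real^4) atlas" where "M \<equiv> product_atlas \<A> \<B>"
abbreviation g :: "('a \<times> 'b, real^4) metric" where "g \<equiv> split_metric \<A> g1 \<B> g2"
abbreviation dp1 where "dp1 \<equiv> dproj1 \<A> \<B>"
abbreviation dp2 where "dp2 \<equiv> dproj2 \<A> \<B>"
abbreviation TM where "TM \<equiv> tangent_space M"

lemma product_atlasI: "c \<in> \<A> \<Longrightarrow> d \<in> \<B> \<Longrightarrow> product_chart c d \<in> M"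
  unfolding product_atlas_def by blast

lemma charts_at_product: "C \<in> charts_at M (x, y) \<longleftrightarrow> (\<exists>c\<in>charts_at \<A> x. \<exists>d\<in>charts_at \<B> y. C = product_chart c d)"
  unfolding charts_at_def product_atlas_def using fst_product_chart by fastforce

lemma charts_at_productI: "c \<in> charts_at \<A> x \<Longrightarrow> d \<in> charts_at \<B> y \<Longrightarrow> product_chart c d \<in> charts_at M (x, y)"
  by (auto simp: charts_at_product)

lemma product_image: "snd (product_chart c d) ` (A \<times> B) = {z. pr1 z \<in> snd c ` A \<and> pr2 z \<in> snd d ` B}"
proof -
  have "snd (product_chart c d) = (\<lambda>(x, y). cat4 (snd c x) (snd d y))"
    by (rule ext) (auto simp: snd_product_chart)
  then show ?thesis by (simp add: cat4_image)
qed

lemma product_dom: "snd (product_chart c d) ` fst (product_chart c d) = {z. pr1 z \<in> snd c ` fst c \<and> pr2 z \<in> snd d ` fst d}"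
  by (simp add: fst_product_chart product_image)

lemma inj_product_chart: "c \<in> \<A> \<Longrightarrow> d \<in> \<B> \<Longrightarrow> inj_on (snd (product_chart c d)) (fst (product_chart c d))"
proof (rule inj_onI, goal_cases)
  case (1 p q)
  then show ?case
    using inj_onD[OF compatible_atlas_inj[OF S1.compat 1(1)], of "fst p" "fst q"]
      inj_onD[OF compatible_atlas_inj[OF S2.compat 1(2)], of "snd p" "snd q"]
    by (cases p; cases q) (simp add: fst_product_chart snd_product_chart cat4_eq_iff)
qed

lemma chart_inv_product:
  assumes "c \<in> \<A>" "d \<in> \<B>" "pr1 z \<in> snd c ` fst c" "pr2 z \<in> snd d ` fst d"
  shows "chart_inv (product_chart c d) z = (chart_inv c (pr1 z), chart_inv d (pr2 z))"
  unfolding chart_inv_def[of "product_chart c d"]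
proof (rule inv_into_f_eq[OF inj_product_chart[OF assms(1,2)]])
  show "(chart_inv c (pr1 z), chart_inv d (pr2 z)) \<in> fst (product_chart c d)"
    using chart_inv_in[OF assms(3)] chart_inv_in[OF assms(4)] by (simp add: fst_product_chart)
  show "snd (product_chart c d) (chart_inv c (pr1 z), chart_inv d (pr2 z)) = z"
    by (simp add: snd_product_chart snd_chart_inv assms)
qed

lemma transition_product:
  assumes "c \<in> \<A>" "d \<in> \<B>" "pr1 z \<in> snd c ` fst c" "pr2 z \<in> snd d ` fst d"
  shows "transition (product_chart c d) (product_chart c' d') z = cat4 (transition c c' (pr1 z)) (transition d d' (pr2 z))"
  by (simp add: transition_def chart_inv_product[OF assms] snd_product_chart)

lemma compat: "compatible_atlas M"
  unfolding compatible_atlas_def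
proof (intro conjI ballI)
  fix C C' assume C: "C \<in> M" "C' \<in> M"
  obtain c d where cd: "C = product_chart c d" "c \<in> \<A>" "d \<in> \<B>" using C by (auto simp: product_atlas_def)
  obtain c' d' where cd': "C' = product_chart c' d'" "c' \<in> \<A>" "d' \<in> \<B>" using C by (auto simp: product_atlas_def)
  show "inj_on (snd C) (fst C)" using inj_product_chart cd by simp
  show "open (snd C ` fst C)"
    unfolding cd(1) product_dom using cd S1.open_dom S2.open_dom by (intro open_pr) auto
  have ov: "snd C ` (fst C \<inter> fst C') = {z. pr1 z \<in> snd c ` (fst c \<inter> fst c') \<and> pr2 z \<in> snd d ` (fst d \<inter> fst d')}"
    unfolding cd(1) cd'(1) fst_product_chart Times_Int_Times product_image ..
  note o1 = compatible_atlas_open_Int[OF S1.compat cd(2) cd'(2)] and o2 = compatible_atlas_open_Int[OF S2.compat cd(3) cd'(3)]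
  show o: "open (snd C ` (fst C \<inter> fst C'))"
    unfolding ov by (rule open_pr[OF o1 o2])
  have "smooth_on (snd C ` (fst C \<inter> fst C')) (\<lambda>z. cat4 (transition c c' (pr1 z)) (transition d d' (pr2 z)))"
  proof (rule smooth_on_cat4[OF o])
    show "smooth_on (snd C ` (fst C \<inter> fst C')) (\<lambda>z. transition c c' (pr1 z))"
      by (rule smooth_on_compose[OF smooth_on_linear[OF linear_pr1 o] compatible_atlas_smooth[OF S1.compat cd(2) cd'(2)] o o1])
        (auto simp: ov)
    show "smooth_on (snd C ` (fst C \<inter> fst C')) (\<lambda>z. transition d d' (pr2 z))"
      by (rule smooth_on_compose[OF smooth_on_linear[OF linear_pr2 o] compatible_atlas_smooth[OF S2.compat cd(3) cd'(3)] o o2])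
        (auto simp: ov)
  qed
  then show "smooth_on (snd C ` (fst C \<inter> fst C')) (transition C C')"
  proof (rule smooth_on_cong[OF o, THEN iffD1, rotated])
    fix z assume "z \<in> snd C ` (fst C \<inter> fst C')"
    then have "pr1 z \<in> snd c ` fst c" "pr2 z \<in> snd d ` fst d" unfolding ov by auto
    then show "cat4 (transition c c' (pr1 z)) (transition d d' (pr2 z)) = transition C C' z"
      unfolding cd(1) cd'(1) by (rule transition_product[OF cd(2,3), symmetric])
  qed
qed

lemma mcarrier_product: "mcarrier M = mcarrier \<A> \<times> mcarrier \<B>"
proof -
  have "(x, y) \<in> mcarrier M \<longleftrightarrow> x \<in> mcarrier \<A> \<and> y \<in> mcarrier \<B>" for x y
    unfolding mcarrier_charts_at charts_at_product by blast
  then show ?thesis by auto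
qed

lemma mcarrier_productI: "c \<in> charts_at \<A> x \<Longrightarrow> d \<in> charts_at \<B> y \<Longrightarrow> (x, y) \<in> mcarrier M"
  unfolding mcarrier_charts_at charts_at_product by blast

lemma mcarrier_productE:
  assumes "(x, y) \<in> mcarrier M" obtains c d where "c \<in> charts_at \<A> x" "d \<in> charts_at \<B> y"
  using assms unfolding mcarrier_charts_at charts_at_product by blast

lemma dtrans_product:
  assumes c: "c \<in> charts_at \<A> x" "c' \<in> charts_at \<A> x" and d: "d \<in> charts_at \<B> y" "d' \<in> charts_at \<B> y"
  shows "dtrans (product_chart c d) (product_chart c' d') (x, y) u = cat4 (dtrans c c' x (pr1 u)) (dtrans d d' y (pr2 u))"
proof -
  note ch = c[unfolded charts_at_iff] d[unfolded charts_at_iff]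
  let ?z = "snd (product_chart c d) (x, y)" and ?O = "snd (product_chart c d) ` fst (product_chart c d)"
  have "?z = cat4 (snd c x) (snd d y)" by (rule snd_product_chart)
  then have z: "pr1 ?z = snd c x" "pr2 ?z = snd d y" by simp_all
  have o: "open ?O" "?z \<in> ?O" using compatible_atlas_open[OF compat product_atlasI] ch by (auto simp: fst_product_chart)
  have "((\<lambda>z. (transition c c' (pr1 z), transition d d' (pr2 z))) has_derivative
      (\<lambda>u. (dtrans c c' x (pr1 u), dtrans d d' y (pr2 u)))) (at ?z)"
    by (intro has_derivative_Pair has_derivative_compose[OF bounded_linear.has_derivative[OF pr1_bounded has_derivative_ident]]
        has_derivative_compose[OF bounded_linear.has_derivative[OF pr2_bounded has_derivative_ident]])
      (simp_all only: z transition_has_derivative[OF S1.compat c] transition_has_derivative[OF S2.compat d])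
  from bounded_linear.has_derivative[OF linear_conv_bounded_linear[THEN iffD1, OF linear_cat4] this]
  have "((\<lambda>z. cat4 (transition c c' (pr1 z)) (transition d d' (pr2 z))) has_derivative
      (\<lambda>u. cat4 (dtrans c c' x (pr1 u)) (dtrans d d' y (pr2 u)))) (at ?z)" by simp
  then have "(transition (product_chart c d) (product_chart c' d') has_derivative
      (\<lambda>u. cat4 (dtrans c c' x (pr1 u)) (dtrans d d' y (pr2 u)))) (at ?z)"
    by (rule has_derivative_transform_within_open[OF _ o])
      (use ch in \<open>simp add: product_dom transition_product\<close>)
  from fun_cong[OF frechet_derivative_at[OF this], of u] show ?thesis by simp
qed

text \<open>
  The projections are differentials, computed in a chart chosen by the choice operator; the
  transition maps of the product split, so every product chart gives the same answer.
\<close>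

lemma dproj_eq:
  assumes u: "u \<in> TM (x, y)" and c: "c \<in> charts_at \<A> x" and d: "d \<in> charts_at \<B> y"
  shows "dp1 (x, y) u c = pr1 (u (product_chart c d))" "dp2 (x, y) u d = pr2 (u (product_chart c d))"
proof -
  define C where "C = (SOME C. C \<in> charts_at M (x, y))"
  have "C \<in> charts_at M (x, y)" unfolding C_def using charts_at_productI[OF c d] by (rule someI)
  then obtain c0 d0 where C: "C = product_chart c0 d0" and cd: "c0 \<in> charts_at \<A> x" "d0 \<in> charts_at \<B> y"
    by (auto simp: charts_at_product)
  note ch = c[unfolded charts_at_iff] d[unfolded charts_at_iff] cd[unfolded charts_at_iff]
  let ?z = "snd C (x, y)" and ?O = "snd C ` fst C"
  have "?z = cat4 (snd c0 x) (snd d0 y)" unfolding C by (rule snd_product_chart)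
  then have z: "pr1 ?z = snd c0 x" "pr2 ?z = snd d0 y" by simp_all
  have o: "open ?O" "?z \<in> ?O" using compatible_atlas_open[OF compat product_atlasI] ch C by (auto simp: fst_product_chart)
  have "((\<lambda>z. transition c0 c (pr1 z)) has_derivative (\<lambda>h. dtrans c0 c x (pr1 h))) (at ?z)"
    by (rule has_derivative_compose[OF bounded_linear.has_derivative[OF pr1_bounded has_derivative_ident]])
      (simp only: z transition_has_derivative[OF S1.compat cd(1) c])
  then have "((snd c \<circ> fst \<circ> chart_inv C) has_derivative (\<lambda>h. dtrans c0 c x (pr1 h))) (at ?z)"
    by (rule has_derivative_transform_within_open[OF _ o])
      (use ch in \<open>simp add: C product_dom chart_inv_product transition_def\<close>)
  from fun_cong[OF frechet_derivative_at[OF this], of "u C"]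
  have "dp1 (x, y) u c = dtrans c0 c x (pr1 (u C))"
    using c by (simp add: dproj1_def differential_def C_def[symmetric] Let_def)
  also have "u C = cat4 (dtrans c c0 x (pr1 (u (product_chart c d)))) (dtrans d d0 y (pr2 (u (product_chart c d))))"
    unfolding C dtrans_product[OF c cd(1) d cd(2), symmetric]
    by (rule tangent_vector_transform[OF compat u charts_at_productI[OF c d] charts_at_productI[OF cd]])
  finally show "dp1 (x, y) u c = pr1 (u (product_chart c d))"
    by (simp add: dtrans_comp[OF S1.compat c cd(1) c] dtrans_self[OF S1.compat c])
  have "((\<lambda>z. transition d0 d (pr2 z)) has_derivative (\<lambda>h. dtrans d0 d y (pr2 h))) (at ?z)"
    by (rule has_derivative_compose[OF bounded_linear.has_derivative[OF pr2_bounded has_derivative_ident]])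
      (simp only: z transition_has_derivative[OF S2.compat cd(2) d])
  then have "((snd d \<circ> snd \<circ> chart_inv C) has_derivative (\<lambda>h. dtrans d0 d y (pr2 h))) (at ?z)"
    by (rule has_derivative_transform_within_open[OF _ o])
      (use ch in \<open>simp add: C product_dom chart_inv_product transition_def\<close>)
  from fun_cong[OF frechet_derivative_at[OF this], of "u C"]
  have "dp2 (x, y) u d = dtrans d0 d y (pr2 (u C))"
    using d by (simp add: dproj2_def differential_def C_def[symmetric] Let_def)
  also have "u C = cat4 (dtrans c c0 x (pr1 (u (product_chart c d)))) (dtrans d d0 y (pr2 (u (product_chart c d))))"
    unfolding C dtrans_product[OF c cd(1) d cd(2), symmetric]
    by (rule tangent_vector_transform[OF compat u charts_at_productI[OF c d] charts_at_productI[OF cd]])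
  finally show "dp2 (x, y) u d = pr2 (u (product_chart c d))"
    by (simp add: dtrans_comp[OF S2.compat d cd(2) d] dtrans_self[OF S2.compat d])
qed

lemma tangent_product_eval:
  "u \<in> TM (x, y) \<Longrightarrow> c \<in> charts_at \<A> x \<Longrightarrow> d \<in> charts_at \<B> y \<Longrightarrow>
    u (product_chart c d) = cat4 (dp1 (x, y) u c) (dp2 (x, y) u d)"
  by (simp add: dproj_eq)

lemma dproj_in:
  assumes "u \<in> TM (x, y)" "(x, y) \<in> mcarrier M"
  shows "dp1 (x, y) u \<in> S1.T x" "dp2 (x, y) u \<in> S2.T y"
proof -
  obtain c0 d0 where cd: "c0 \<in> charts_at \<A> x" "d0 \<in> charts_at \<B> y" by (rule mcarrier_productE[OF assms(2)])
  show "dp1 (x, y) u \<in> S1.T x"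
  proof (rule tangent_spaceI[OF S1.compat])
    fix c c' assume c: "c \<in> charts_at \<A> x" "c' \<in> charts_at \<A> x"
    show "dp1 (x, y) u c' = dtrans c c' x (dp1 (x, y) u c)"
      unfolding dproj_eq(1)[OF assms(1) c(2) cd(2)] dproj_eq(1)[OF assms(1) c(1) cd(2)]
        tangent_vector_transform[OF compat assms(1) charts_at_productI[OF c(1) cd(2)] charts_at_productI[OF c(2) cd(2)]]
        dtrans_product[OF c cd(2) cd(2)] by simp
  qed (simp add: dproj1_def differential_def)
  show "dp2 (x, y) u \<in> S2.T y"
  proof (rule tangent_spaceI[OF S2.compat])
    fix d d' assume d: "d \<in> charts_at \<B> y" "d' \<in> charts_at \<B> y"
    show "dp2 (x, y) u d' = dtrans d d' y (dp2 (x, y) u d)"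
      unfolding dproj_eq(2)[OF assms(1) cd(1) d(2)] dproj_eq(2)[OF assms(1) cd(1) d(1)]
        tangent_vector_transform[OF compat assms(1) charts_at_productI[OF cd(1) d(1)] charts_at_productI[OF cd(1) d(2)]]
        dtrans_product[OF cd(1) cd(1) d] by simp
  qed (simp add: dproj2_def differential_def)
qed

lemma tangent_product_eqI:
  assumes "u \<in> TM (x, y)" "u' \<in> TM (x, y)" "(x, y) \<in> mcarrier M"
    "dp1 (x, y) u = dp1 (x, y) u'" "dp2 (x, y) u = dp2 (x, y) u'"
  shows "u = u'"
proof -
  obtain c d where cd: "c \<in> charts_at \<A> x" "d \<in> charts_at \<B> y" by (rule mcarrier_productE[OF assms(3)])
  show ?thesis
    by (rule tangent_vector_eqI[OF compat assms(1,2) charts_at_productI[OF cd]])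
      (simp add: tangent_product_eval[OF _ cd] assms)
qed

lemma tangent_product_ex:
  assumes "v \<in> S1.T x" "w \<in> S2.T y" "(x, y) \<in> mcarrier M"
  shows "\<exists>u\<in>TM (x, y). dp1 (x, y) u = v \<and> dp2 (x, y) u = w"
proof -
  obtain c d where cd: "c \<in> charts_at \<A> x" "d \<in> charts_at \<B> y"
    by (rule mcarrier_productE[OF assms(3)])
  let ?u = "coord_tvec M (product_chart c d) (x, y) (cat4 (v c) (w d))"
  have u: "?u \<in> TM (x, y)" by (rule coord_tvec_in[OF compat charts_at_productI[OF cd]])
  have "?u (product_chart c d) = cat4 (v c) (w d)" by (rule coord_tvec_self[OF compat charts_at_productI[OF cd]])
  then have "dp1 (x, y) ?u c = v c" "dp2 (x, y) ?u d = w d" using dproj_eq[OF u cd] by auto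
  then have "dp1 (x, y) ?u = v" "dp2 (x, y) ?u = w"
    using tangent_vector_eqI[OF S1.compat dproj_in(1)[OF u assms(3)] assms(1) cd(1)]
      tangent_vector_eqI[OF S2.compat dproj_in(2)[OF u assms(3)] assms(2) cd(2)] by auto
  then show ?thesis using u by blast
qed

text \<open>
  The tangent vector \<open>(v, w)\<close>, characterised by its projections in order not to depend on a chart.
\<close>

definition pairT where "pairT x y v w = (THE u. u \<in> TM (x, y) \<and> dp1 (x, y) u = v \<and> dp2 (x, y) u = w)"

lemma pairT:
  assumes "v \<in> S1.T x" "w \<in> S2.T y" "(x, y) \<in> mcarrier M"
  shows "pairT x y v w \<in> TM (x, y)" "dp1 (x, y) (pairT x y v w) = v" "dp2 (x, y) (pairT x y v w) = w"
proof -
  have "\<exists>!u. u \<in> TM (x, y) \<and> dp1 (x, y) u = v \<and> dp2 (x, y) u = w"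
    using tangent_product_ex[OF assms] tangent_product_eqI[OF _ _ assms(3)] by metis
  from theI'[OF this] show "pairT x y v w \<in> TM (x, y)" "dp1 (x, y) (pairT x y v w) = v" "dp2 (x, y) (pairT x y v w) = w"
    unfolding pairT_def by auto
qed

lemma dproj_lincomb:
  assumes "u \<in> TM (x, y)" "u' \<in> TM (x, y)" "(x, y) \<in> mcarrier M"
  shows "dp1 (x, y) (a *\<^sub>R u + b *\<^sub>R u') = a *\<^sub>R dp1 (x, y) u + b *\<^sub>R dp1 (x, y) u'"
    "dp2 (x, y) (a *\<^sub>R u + b *\<^sub>R u') = a *\<^sub>R dp2 (x, y) u + b *\<^sub>R dp2 (x, y) u'"
proof -
  obtain c d where cd: "c \<in> charts_at \<A> x" "d \<in> charts_at \<B> y" by (rule mcarrier_productE[OF assms(3)])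
  have s: "a *\<^sub>R u + b *\<^sub>R u' \<in> TM (x, y)"
    by (intro subspace_add subspace_scale subspace_tangent_space[OF compat] assms)
  note i = dproj_in[OF s assms(3)] dproj_in[OF assms(1,3)] dproj_in[OF assms(2,3)]
  show "dp1 (x, y) (a *\<^sub>R u + b *\<^sub>R u') = a *\<^sub>R dp1 (x, y) u + b *\<^sub>R dp1 (x, y) u'"
    by (rule tangent_vector_eqI[OF S1.compat i(1) _ cd(1)])
      (intro subspace_add subspace_scale subspace_tangent_space[OF S1.compat] i,
        simp add: dproj_eq(1)[OF s cd] dproj_eq(1)[OF assms(1) cd] dproj_eq(1)[OF assms(2) cd] scaleR_fun_apply linear_add[OF linear_pr1] linear_cmul[OF linear_pr1])
  show "dp2 (x, y) (a *\<^sub>R u + b *\<^sub>R u') = a *\<^sub>R dp2 (x, y) u + b *\<^sub>R dp2 (x, y) u'"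
    by (rule tangent_vector_eqI[OF S2.compat i(2) _ cd(2)])
      (intro subspace_add subspace_scale subspace_tangent_space[OF S2.compat] i,
        simp add: dproj_eq(2)[OF s cd] dproj_eq(2)[OF assms(1) cd] dproj_eq(2)[OF assms(2) cd] scaleR_fun_apply linear_add[OF linear_pr2] linear_cmul[OF linear_pr2])
qed

subsection \<open>The connection of the split metric\<close>

lemma product_coord:
  assumes "c \<in> \<A>" "d \<in> \<B>" "pr1 z \<in> snd c ` fst c" "pr2 z \<in> snd d ` fst d"
  shows "metric_coord M g (product_chart c d) z u v
    = S1.G c (pr1 z) (pr1 u) (pr1 v) - S2.G d (pr2 z) (pr2 u) (pr2 v)"
proof -
  define x y where "x = chart_inv c (pr1 z)" and "y = chart_inv d (pr2 z)"
  have cd: "c \<in> charts_at \<A> x" "d \<in> charts_at \<B> y" and inv: "snd c x = pr1 z" "snd d y = pr2 z"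
    using S1.dom_chart[OF assms(1,3)] S2.dom_chart[OF assms(2,4)] by (auto simp: x_def y_def)
  have xy: "(x, y) \<in> mcarrier M" by (rule mcarrier_productI[OF cd])
  let ?u = "\<lambda>u. coord_tvec M (product_chart c d) (x, y) u"
  have i: "?u u \<in> TM (x, y)" for u by (rule coord_tvec_in[OF compat charts_at_productI[OF cd]])
  have e: "?u u (product_chart c d) = u" for u by (rule coord_tvec_self[OF compat charts_at_productI[OF cd]])
  have "chart_inv (product_chart c d) z = (x, y)" unfolding x_def y_def by (rule chart_inv_product[OF assms])
  then have "metric_coord M g (product_chart c d) z u v = g (x, y) (?u u) (?u v)" by (simp add: metric_coord_def)
  also have "\<dots> = S1.G c (snd c x) (dp1 (x, y) (?u u) c) (dp1 (x, y) (?u v) c) - S2.G d (snd d y) (dp2 (x, y) (?u u) d) (dp2 (x, y) (?u v) d)"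
    unfolding split_metric_def fst_conv snd_conv
    using S1.metric_eq_G[OF cd(1) dproj_in(1)[OF i xy] dproj_in(1)[OF i xy]] S2.metric_eq_G[OF cd(2) dproj_in(2)[OF i xy] dproj_in(2)[OF i xy]]
    by simp
  finally show ?thesis by (simp add: dproj_eq[OF i cd] e inv)
qed

text \<open>
  The metric coefficients are a difference of functions of separate variables, so the Koszul
  formula decouples into one for each surface. In the second one the sign of the metric occurs
  on both sides and drops out.
\<close>

lemma christoffel_product:
  assumes "c \<in> \<A>" "d \<in> \<B>" "pr1 z \<in> snd c ` fst c" "pr2 z \<in> snd d ` fst d"
  shows "christoffel M g (product_chart c d) z u v
    = cat4 (S1.\<Gamma> c (pr1 z) (pr1 u) (pr1 v)) (S2.\<Gamma> d (pr2 z) (pr2 u) (pr2 v))"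
proof -
  let ?C = "product_chart c d"
  let ?O = "snd ?C ` fst ?C"
  have o: "open ?O" "z \<in> ?O" using compatible_atlas_open[OF compat product_atlasI[OF assms(1,2)]] assms by (auto simp: product_dom)
  have D: "frechet_derivative (\<lambda>y. metric_coord M g ?C y u v) (at z) h
      = S1.DG c (pr1 z) (pr1 h) (pr1 u) (pr1 v) - S2.DG d (pr2 z) (pr2 h) (pr2 u) (pr2 v)" for h u v
  proof -
    have "((\<lambda>z. S1.G c (pr1 z) (pr1 u) (pr1 v) - S2.G d (pr2 z) (pr2 u) (pr2 v)) has_derivative
       (\<lambda>h. S1.DG c (pr1 z) (pr1 h) (pr1 u) (pr1 v) - S2.DG d (pr2 z) (pr2 h) (pr2 u) (pr2 v))) (at z)"
      by (intro has_derivative_diff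
          has_derivative_compose[OF bounded_linear.has_derivative[OF pr1_bounded has_derivative_ident] S1.DG_has[OF assms(1,3)]]
          has_derivative_compose[OF bounded_linear.has_derivative[OF pr2_bounded has_derivative_ident] S2.DG_has[OF assms(2,4)]])
    then have "((\<lambda>y. metric_coord M g ?C y u v) has_derivative
       (\<lambda>h. S1.DG c (pr1 z) (pr1 h) (pr1 u) (pr1 v) - S2.DG d (pr2 z) (pr2 h) (pr2 u) (pr2 v))) (at z)"
      by (rule has_derivative_transform_within_open[OF _ o]) (simp add: product_dom product_coord assms)
    from fun_cong[OF frechet_derivative_at[OF this], of h] show ?thesis by simp
  qed
  show ?thesis
    unfolding christoffel_def[of M] D product_coord[OF assms]
  proof (rule the_equality, intro allI)
    show "2 * (S1.G c (pr1 z) (pr1 (cat4 (S1.\<Gamma> c (pr1 z) (pr1 u) (pr1 v)) (S2.\<Gamma> d (pr2 z) (pr2 u) (pr2 v)))) (pr1 w)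
        - S2.G d (pr2 z) (pr2 (cat4 (S1.\<Gamma> c (pr1 z) (pr1 u) (pr1 v)) (S2.\<Gamma> d (pr2 z) (pr2 u) (pr2 v)))) (pr2 w))
      = S1.DG c (pr1 z) (pr1 u) (pr1 v) (pr1 w) - S2.DG d (pr2 z) (pr2 u) (pr2 v) (pr2 w)
      + (S1.DG c (pr1 z) (pr1 v) (pr1 u) (pr1 w) - S2.DG d (pr2 z) (pr2 v) (pr2 u) (pr2 w))
      - (S1.DG c (pr1 z) (pr1 w) (pr1 u) (pr1 v) - S2.DG d (pr2 z) (pr2 w) (pr2 u) (pr2 v))" for w
      unfolding pr_cat4 right_diff_distrib S1.christoffel_koszul[OF assms(1,3)] S2.christoffel_koszul[OF assms(2,4)] by simp
    fix q
    assume q: "\<forall>w. 2 * (S1.G c (pr1 z) (pr1 q) (pr1 w) - S2.G d (pr2 z) (pr2 q) (pr2 w))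
      = S1.DG c (pr1 z) (pr1 u) (pr1 v) (pr1 w) - S2.DG d (pr2 z) (pr2 u) (pr2 v) (pr2 w)
      + (S1.DG c (pr1 z) (pr1 v) (pr1 u) (pr1 w) - S2.DG d (pr2 z) (pr2 v) (pr2 u) (pr2 w))
      - (S1.DG c (pr1 z) (pr1 w) (pr1 u) (pr1 v) - S2.DG d (pr2 z) (pr2 w) (pr2 u) (pr2 v))"
    have "S1.\<Gamma> c (pr1 z) (pr1 u) (pr1 v) = pr1 q"
    proof (rule S1.christoffel_eqI[OF assms(1,3)])
      fix w
      show "2 * S1.G c (pr1 z) (pr1 q) w = S1.koszul c (pr1 z) (pr1 u) (pr1 v) w"
        using q[rule_format, of "cat4 w 0"]
        by (simp add: linear_0[OF S2.linear_G[OF assms(2,4)]] linear_0[OF S2.linear_DG2[OF assms(2,4)]] linear_0[OF S2.linear_DG[OF assms(2,4)]])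
    qed
    moreover have "S2.\<Gamma> d (pr2 z) (pr2 u) (pr2 v) = pr2 q"
    proof (rule S2.christoffel_eqI[OF assms(2,4)])
      fix w
      show "2 * S2.G d (pr2 z) (pr2 q) w = S2.koszul d (pr2 z) (pr2 u) (pr2 v) w"
        using q[rule_format, of "cat4 0 w"]
        by (simp add: linear_0[OF S1.linear_G[OF assms(1,3)]] linear_0[OF S1.linear_DG2[OF assms(1,3)]] linear_0[OF S1.linear_DG[OF assms(1,3)]])
    qed
    ultimately show "q = cat4 (S1.\<Gamma> c (pr1 z) (pr1 u) (pr1 v)) (S2.\<Gamma> d (pr2 z) (pr2 u) (pr2 v))" by simp
  qed
qed

subsection \<open>Curves in the product\<close>

lemma smooth_proj: "smooth_map M (mcarrier M) \<A> fst" "smooth_map M (mcarrier M) \<B> snd"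
proof -
  have *: "\<exists>c d. c \<in> charts_at \<A> (fst p) \<and> d \<in> charts_at \<B> (snd p) \<and> product_chart c d \<in> charts_at M p"
    if "p \<in> mcarrier M" for p
    using that charts_at_productI mcarrier_productE by (metis prod.collapse)
  have dom: "open (snd C ` fst C)" if "C \<in> charts_at M p" for C p
    using compatible_atlas_open[OF compat] that by (auto simp: charts_at_iff)
  show "smooth_map M (mcarrier M) \<A> fst"
  proof (rule smooth_mapI)
    fix p assume "p \<in> mcarrier M"
    then obtain c d where cd: "c \<in> charts_at \<A> (fst p)" "product_chart c d \<in> charts_at M p" using * by blast
    show "\<exists>c\<in>charts_at M p. \<exists>d\<in>charts_at \<A> (fst p). \<exists>W F. open W \<and> snd c p \<in> W \<and> W \<subseteq> snd c ` fst c \<and> smooth_on W F \<and>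
        (\<forall>q\<in>mcarrier M \<inter> fst c. snd c q \<in> W \<longrightarrow> fst q \<in> fst d \<and> snd d (fst q) = F (snd c q))"
      by (intro bexI[OF _ cd(1)] bexI[OF _ cd(2)] exI[of _ "snd (product_chart c d) ` fst (product_chart c d)"] exI[of _ pr1] conjI
          dom[OF cd(2)] smooth_on_linear[OF linear_pr1])
        (use cd(2) in \<open>auto simp: charts_at_iff fst_product_chart snd_product_chart\<close>)
  qed
  show "smooth_map M (mcarrier M) \<B> snd"
  proof (rule smooth_mapI)
    fix p assume "p \<in> mcarrier M"
    then obtain c d where cd: "d \<in> charts_at \<B> (snd p)" "product_chart c d \<in> charts_at M p" using * by blast
    show "\<exists>c\<in>charts_at M p. \<exists>d\<in>charts_at \<B> (snd p). \<exists>W F. open W \<and> snd c p \<in> W \<and> W \<subseteq> snd c ` fst c \<and> smooth_on W F \<and>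
        (\<forall>q\<in>mcarrier M \<inter> fst c. snd c q \<in> W \<longrightarrow> snd q \<in> fst d \<and> snd d (snd q) = F (snd c q))"
      by (intro bexI[OF _ cd(1)] bexI[OF _ cd(2)] exI[of _ "snd (product_chart c d) ` fst (product_chart c d)"] exI[of _ pr2] conjI
          dom[OF cd(2)] smooth_on_linear[OF linear_pr2])
        (use cd(2) in \<open>auto simp: charts_at_iff fst_product_chart snd_product_chart\<close>)
  qed
qed

lemma smooth_curve_proj:
  assumes "smooth_map eucl I M \<gamma>"
  shows "smooth_map eucl I \<A> (\<lambda>t. fst (\<gamma> t))" "smooth_map eucl I \<B> (\<lambda>t. snd (\<gamma> t))"
  using smooth_map_compose[OF compatible_eucl compat S1.compat assms smooth_proj(1)]
    smooth_map_compose[OF compatible_eucl compat S2.compat assms smooth_proj(2)] smooth_map_charts(2)[OF assms] by blast+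

lemma smooth_curve_pair:
  assumes "smooth_map eucl I \<A> x" "smooth_map eucl I \<B> y" "open I"
  shows "smooth_map eucl I M (\<lambda>t. (x t, y t))"
proof (rule smooth_mapI)
  fix t assume t: "t \<in> I"
  obtain c where c: "c \<in> charts_at \<A> (x t)" using smooth_map_charts[OF assms(1) t] by (auto simp: mcarrier_charts_at)
  obtain d where d: "d \<in> charts_at \<B> (y t)" using smooth_map_charts[OF assms(2) t] by (auto simp: mcarrier_charts_at)
  obtain X where X: "open X" "t \<in> X" "X \<subseteq> I" "\<And>s. s \<in> X \<Longrightarrow> x s \<in> fst c" "smooth_on X (\<lambda>s. snd c (x s))"
    by (rule smooth_curve_chart[OF S1.compat assms(1,3) t c]) blast
  obtain Y where Y: "open Y" "t \<in> Y" "Y \<subseteq> I" "\<And>s. s \<in> Y \<Longrightarrow> y s \<in> fst d" "smooth_on Y (\<lambda>s. snd d (y s))"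
    by (rule smooth_curve_chart[OF S2.compat assms(2,3) t d]) blast
  have "smooth_on (X \<inter> Y) (\<lambda>s. cat4 (snd c (x s)) (snd d (y s)))"
    using X Y by (intro smooth_on_cat4 smooth_on_subset[OF X(5)] smooth_on_subset[OF Y(5)]) auto
  then show "\<exists>c\<in>charts_at eucl t. \<exists>d\<in>charts_at M (x t, y t). \<exists>W F. open W \<and> snd c t \<in> W \<and> W \<subseteq> snd c ` fst c \<and> smooth_on W F \<and>
      (\<forall>q\<in>I \<inter> fst c. snd c q \<in> W \<longrightarrow> (x q, y q) \<in> fst d \<and> snd d (x q, y q) = F (snd c q))"
    by (intro bexI[of _ "(UNIV, id)"] bexI[OF _ charts_at_productI[OF c d]] exI[of _ "X \<inter> Y"]
        exI[of _ "\<lambda>s. cat4 (snd c (x s)) (snd d (y s))"])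
      (use X Y in \<open>auto simp: fst_product_chart snd_product_chart\<close>)
qed

lemma velocity_proj:
  assumes \<gamma>: "smooth_map eucl I M \<gamma>" "open I" "t \<in> I"
  shows "dp1 (\<gamma> t) (velocity M \<gamma> t) = velocity \<A> (\<lambda>t. fst (\<gamma> t)) t"
    "dp2 (\<gamma> t) (velocity M \<gamma> t) = velocity \<B> (\<lambda>t. snd (\<gamma> t)) t"
  unfolding dproj1_def dproj2_def
  by (rule differential_velocity[OF compat S1.compat smooth_proj(1) \<gamma>], rule differential_velocity[OF compat S2.compat smooth_proj(2) \<gamma>])

text \<open>
  In a product chart the equation of parallel transport splits by \<open>christoffel_product\<close>.
\<close>

lemma parallel_product_iff:
  assumes \<gamma>: "smooth_map eucl I M \<gamma>" "open I"
  shows "parallel_along M g I \<gamma> V \<longleftrightarrow> (\<forall>t\<in>I. V t \<in> TM (\<gamma> t)) \<and>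
    parallel_along \<A> g1 I (\<lambda>t. fst (\<gamma> t)) (\<lambda>t. dp1 (\<gamma> t) (V t)) \<and>
    parallel_along \<B> g2 I (\<lambda>t. snd (\<gamma> t)) (\<lambda>t. dp2 (\<gamma> t) (V t))"
proof (cases "\<forall>t\<in>I. V t \<in> TM (\<gamma> t)")
  case V: True
  have car: "\<gamma> t \<in> mcarrier M" if "t \<in> I" for t using smooth_map_charts(2)[OF \<gamma>(1) that] .
  have in1: "dp1 (\<gamma> t) (V t) \<in> S1.T (fst (\<gamma> t))" "dp2 (\<gamma> t) (V t) \<in> S2.T (snd (\<gamma> t))" if "t \<in> I" for t
    using dproj_in[of "V t" "fst (\<gamma> t)" "snd (\<gamma> t)"] V car that by auto
  have key: "((\<lambda>s. V s (product_chart c d)) has_vector_derivative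
      - christoffel M g (product_chart c d) (snd (product_chart c d) (\<gamma> t)) (velocity M \<gamma> t (product_chart c d)) (V t (product_chart c d))) (at t)
    \<longleftrightarrow> S1.parallel_in_chart c (\<lambda>t. fst (\<gamma> t)) (\<lambda>t. dp1 (\<gamma> t) (V t)) t \<and> S2.parallel_in_chart d (\<lambda>t. snd (\<gamma> t)) (\<lambda>t. dp2 (\<gamma> t) (V t)) t"
    if t: "t \<in> I" and c: "c \<in> charts_at \<A> (fst (\<gamma> t))" and d: "d \<in> charts_at \<B> (snd (\<gamma> t))" for t c d
  proof -
    have C: "product_chart c d \<in> charts_at M (\<gamma> t)" using charts_at_productI[OF c d] by simp
    obtain X where X: "open X" "t \<in> X" "X \<subseteq> I" "\<And>s. s \<in> X \<Longrightarrow> \<gamma> s \<in> fst (product_chart c d)"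
      by (rule smooth_curve_chart[OF compat \<gamma> t C]) blast
    have ev: "u (product_chart c d) = cat4 (dp1 (\<gamma> s) u c) (dp2 (\<gamma> s) u d)" if "s \<in> X" "u \<in> TM (\<gamma> s)" for s u
      using tangent_product_eval[of u "fst (\<gamma> s)" "snd (\<gamma> s)" c d] that X(4)[of s] c d by (auto simp: charts_at_iff fst_product_chart)
    have Vs: "V s (product_chart c d) = cat4 (dp1 (\<gamma> s) (V s) c) (dp2 (\<gamma> s) (V s) d)" if "s \<in> X" for s
      using ev[OF that] V that X(3) by blast
    have vel: "velocity M \<gamma> t (product_chart c d) = cat4 (velocity \<A> (\<lambda>t. fst (\<gamma> t)) t c) (velocity \<B> (\<lambda>t. snd (\<gamma> t)) t d)"
      using ev[OF X(2) smooth_curve_velocity_in[OF compat \<gamma> t]] by (simp add: velocity_proj[OF \<gamma> t])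
    have pt: "snd (product_chart c d) (\<gamma> t) = cat4 (snd c (fst (\<gamma> t))) (snd d (snd (\<gamma> t)))"
      using snd_product_chart[of c d "fst (\<gamma> t)" "snd (\<gamma> t)"] by simp
    have ch: "christoffel M g (product_chart c d) (snd (product_chart c d) (\<gamma> t)) (velocity M \<gamma> t (product_chart c d)) (V t (product_chart c d))
      = cat4 (S1.\<Gamma> c (snd c (fst (\<gamma> t))) (velocity \<A> (\<lambda>t. fst (\<gamma> t)) t c) (dp1 (\<gamma> t) (V t) c))
          (S2.\<Gamma> d (snd d (snd (\<gamma> t))) (velocity \<B> (\<lambda>t. snd (\<gamma> t)) t d) (dp2 (\<gamma> t) (V t) d))"
      using christoffel_product[of c d "snd (product_chart c d) (\<gamma> t)"] S1.chart_point[OF c] S2.chart_point[OF d]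
      unfolding pt vel Vs[OF X(2)] by simp
    have "((\<lambda>s. V s (product_chart c d)) has_vector_derivative D) (at t) \<longleftrightarrow>
        ((\<lambda>s. cat4 (dp1 (\<gamma> s) (V s) c) (dp2 (\<gamma> s) (V s) d)) has_vector_derivative D) (at t)" for D
      using has_vector_derivative_transform_within_open[OF _ X(1,2), of "\<lambda>s. V s (product_chart c d)" D "\<lambda>s. cat4 (dp1 (\<gamma> s) (V s) c) (dp2 (\<gamma> s) (V s) d)"]
        has_vector_derivative_transform_within_open[OF _ X(1,2), of "\<lambda>s. cat4 (dp1 (\<gamma> s) (V s) c) (dp2 (\<gamma> s) (V s) d)" D "\<lambda>s. V s (product_chart c d)"]
        Vs by auto
    then show ?thesis unfolding ch cat4_simps has_vector_derivative_cat4[symmetric] .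
  qed
  have c_ex: "\<exists>c. c \<in> charts_at \<A> (fst (\<gamma> t))" "\<exists>d. d \<in> charts_at \<B> (snd (\<gamma> t))" if "t \<in> I" for t
    using car[OF that] mcarrier_productE[of "fst (\<gamma> t)" "snd (\<gamma> t)"] by (metis prod.collapse)+
  have "parallel_along M g I \<gamma> V \<longleftrightarrow> (\<forall>t\<in>I. \<forall>c\<in>charts_at \<A> (fst (\<gamma> t)). \<forall>d\<in>charts_at \<B> (snd (\<gamma> t)).
      S1.parallel_in_chart c (\<lambda>t. fst (\<gamma> t)) (\<lambda>t. dp1 (\<gamma> t) (V t)) t \<and> S2.parallel_in_chart d (\<lambda>t. snd (\<gamma> t)) (\<lambda>t. dp2 (\<gamma> t) (V t)) t)"
    (is "_ \<longleftrightarrow> ?R")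
  proof
    assume par: "parallel_along M g I \<gamma> V"
    show ?R
    proof (intro ballI)
      fix t c d assume t: "t \<in> I" and c: "c \<in> charts_at \<A> (fst (\<gamma> t))" and d: "d \<in> charts_at \<B> (snd (\<gamma> t))"
      have "product_chart c d \<in> charts_at M (\<gamma> t)" using charts_at_productI[OF c d] by simp
      then show "S1.parallel_in_chart c (\<lambda>t. fst (\<gamma> t)) (\<lambda>t. dp1 (\<gamma> t) (V t)) t \<and> S2.parallel_in_chart d (\<lambda>t. snd (\<gamma> t)) (\<lambda>t. dp2 (\<gamma> t) (V t)) t"
        using par t unfolding key[OF t c d, symmetric] parallel_along_def by blast
    qed
  next
    assume R: ?R
    show "parallel_along M g I \<gamma> V"
      unfolding parallel_along_def
    proof (intro ballI conjI)
      fix t C assume t: "t \<in> I" and C: "C \<in> charts_at M (\<gamma> t)"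
      then obtain c d where cd: "C = product_chart c d" "c \<in> charts_at \<A> (fst (\<gamma> t))" "d \<in> charts_at \<B> (snd (\<gamma> t))"
        using charts_at_product[of C "fst (\<gamma> t)" "snd (\<gamma> t)"] by auto
      show "((\<lambda>s. V s C) has_vector_derivative - christoffel M g C (snd C (\<gamma> t)) (velocity M \<gamma> t C) (V t C)) (at t)"
        unfolding cd(1) key[OF t cd(2,3)] using R t cd(2,3) by blast
    qed (use V in blast)
  qed
  also have "\<dots> \<longleftrightarrow> parallel_along \<A> g1 I (\<lambda>t. fst (\<gamma> t)) (\<lambda>t. dp1 (\<gamma> t) (V t)) \<and> parallel_along \<B> g2 I (\<lambda>t. snd (\<gamma> t)) (\<lambda>t. dp2 (\<gamma> t) (V t))"
    unfolding parallel_along_def[of \<A>] parallel_along_def[of \<B>] using in1 c_ex by blast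
  finally show ?thesis using V by blast
next
  case False
  then show ?thesis by (auto simp: parallel_along_def)
qed

end

section \<open>The bundle of linear maps between tangent planes\<close>

lemma smooth_on_matrix_vector:
  fixes B :: "'a::real_normed_vector \<Rightarrow> real^'n^'m"
  assumes "open S" "smooth_on S B" "smooth_on S u"
  shows "smooth_on S (\<lambda>z. B z *v u z)"
  unfolding matrix_vector_mult_def using assms by (intro smooth_intros)

lemma smooth_on_matrix:
  fixes f :: "'a::real_normed_vector \<Rightarrow> real^'n \<Rightarrow> real^'m"
  assumes "open S" "\<And>u. smooth_on S (\<lambda>z. f z u)"
  shows "smooth_on S (\<lambda>z. matrix (f z))"
  unfolding matrix_def using assms by (intro smooth_intros)

context surface_pair begin

abbreviation "HB \<equiv> hom_bundle \<A> \<B>"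
abbreviation "H \<equiv> hom_atlas \<A> \<B>"

definition mat where "mat c d x A = matrix (\<lambda>u. A (coord_tvec \<A> c x u) d)"

definition hom_of where "hom_of c d x y B = restrict (\<lambda>v. coord_tvec \<B> d y (B *v (v c))) (S1.T x)"

lemma hom_bundleD:
  assumes "(x, y, A) \<in> HB"
  shows "x \<in> mcarrier \<A>" "y \<in> mcarrier \<B>" "v \<in> S1.T x \<Longrightarrow> A v \<in> S2.T y" "v \<notin> S1.T x \<Longrightarrow> A v = undefined"
    "u \<in> S1.T x \<Longrightarrow> v \<in> S1.T x \<Longrightarrow> A (u + v) = A u + A v" "u \<in> S1.T x \<Longrightarrow> A (r *\<^sub>R u) = r *\<^sub>R A u"
  using assms by (auto simp: hom_bundle_def linear_map_on_def)

lemma mat_works: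
  assumes A: "(x, y, A) \<in> HB" and c: "c \<in> charts_at \<A> x" and v: "v \<in> S1.T x"
  shows "A v d = mat c d x A *v v c"
proof -
  let ?co = "coord_tvec \<A> c x"
  have i: "?co u \<in> S1.T x" for u by (rule coord_tvec_in[OF S1.compat c])
  have "linear (\<lambda>u. A (?co u) d)"
    by (rule linearI)
      (simp_all add: coord_tvec_add[OF S1.compat c] coord_tvec_scaleR[OF S1.compat c] hom_bundleD(5,6)[OF A] i scaleR_fun_apply)
  then have "A (?co (v c)) d = mat c d x A *v v c" by (simp add: mat_def matrix_works)
  then show ?thesis by (simp add: coord_tvec_eq[OF S1.compat v c])
qed

lemma hom_of_in:
  assumes c: "c \<in> charts_at \<A> x" and d: "d \<in> charts_at \<B> y"
  shows "(x, y, hom_of c d x y B) \<in> HB"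
proof -
  have "x \<in> mcarrier \<A>" "y \<in> mcarrier \<B>" using c d unfolding mcarrier_charts_at by blast+
  moreover have "coord_tvec \<B> d y u \<in> S2.T y" for u by (rule coord_tvec_in[OF S2.compat d])
  moreover have "u + v \<in> S1.T x" "r *\<^sub>R u \<in> S1.T x" if "u \<in> S1.T x" "v \<in> S1.T x" for u v r
    using subspace_tangent_space[OF S1.compat] that by (auto simp: subspace_def)
  ultimately show ?thesis
    by (auto simp: hom_bundle_def hom_of_def linear_map_on_def coord_tvec_add[OF S2.compat d] coord_tvec_scaleR[OF S2.compat d]
        scaleR_fun_apply matrix_vector_right_distrib matrix_vector_mult_scaleR)
qed

lemma mat_hom_of:
  assumes c: "c \<in> charts_at \<A> x" and d: "d \<in> charts_at \<B> y"
  shows "mat c d x (hom_of c d x y B) = B"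
  using coord_tvec_in[OF S1.compat c]
  by (simp add: mat_def hom_of_def coord_tvec_self[OF S1.compat c] coord_tvec_self[OF S2.compat d])

lemma hom_eqI:
  assumes A: "(x, y, A) \<in> HB" and A': "(x, y, A') \<in> HB" and c: "c \<in> charts_at \<A> x" and d: "d \<in> charts_at \<B> y"
    and "mat c d x A = mat c d x A'"
  shows "A = A'"
proof
  fix v
  show "A v = A' v"
  proof (cases "v \<in> S1.T x")
    case True
    show ?thesis
      by (rule tangent_vector_eqI[OF S2.compat hom_bundleD(3)[OF A True] hom_bundleD(3)[OF A' True] d])
        (simp add: mat_works[OF A c True] mat_works[OF A' c True] assms(5))
  qed (simp add: hom_bundleD(4)[OF A] hom_bundleD(4)[OF A'])
qed

lemma hom_of_mat:
  assumes A: "(x, y, A) \<in> HB" and c: "c \<in> charts_at \<A> x" and d: "d \<in> charts_at \<B> y"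
  shows "hom_of c d x y (mat c d x A) = A"
  by (rule hom_eqI[OF hom_of_in[OF c d] A c d]) (simp add: mat_hom_of[OF c d])

lemma mat_change:
  assumes A: "(x, y, A) \<in> HB" and c: "c \<in> charts_at \<A> x" "c' \<in> charts_at \<A> x" and d: "d \<in> charts_at \<B> y" "d' \<in> charts_at \<B> y"
  shows "mat c' d' x A = matrix (\<lambda>u. dtrans d d' y (mat c d x A *v dtrans c' c x u))"
proof -
  have "A (coord_tvec \<A> c' x u) d' = dtrans d d' y (mat c d x A *v dtrans c' c x u)" for u
  proof -
    have i: "coord_tvec \<A> c' x u \<in> S1.T x" by (rule coord_tvec_in[OF S1.compat c(2)])
    have "A (coord_tvec \<A> c' x u) d' = dtrans d d' y (A (coord_tvec \<A> c' x u) d)"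
      by (rule tangent_vector_transform[OF S2.compat hom_bundleD(3)[OF A i] d])
    also have "A (coord_tvec \<A> c' x u) d = mat c d x A *v dtrans c' c x u"
      using mat_works[OF A c(1) i] c by (simp add: coord_tvec_def)
    finally show ?thesis .
  qed
  then show ?thesis by (simp add: mat_def)
qed

lemma fst_hom_chart: "p \<in> fst (hom_chart \<A> \<B> c d) \<longleftrightarrow> p \<in> HB \<and> fst p \<in> fst c \<and> fst (snd p) \<in> fst d"
  by (cases p) (auto simp: hom_chart_def)

lemma snd_hom_chart: "snd (hom_chart \<A> \<B> c d) (x, y, A) = (snd c x, snd d y, mat c d x A)"
  by (simp add: hom_chart_def mat_def)

lemma charts_at_hom: "C \<in> charts_at H (x, y, A) \<longleftrightarrow>
    (x, y, A) \<in> HB \<and> (\<exists>c\<in>charts_at \<A> x. \<exists>d\<in>charts_at \<B> y. C = hom_chart \<A> \<B> c d)"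
proof
  assume "C \<in> charts_at H (x, y, A)"
  then obtain c d where "C = hom_chart \<A> \<B> c d" "c \<in> \<A>" "d \<in> \<B>" "(x, y, A) \<in> fst C"
    unfolding charts_at_iff hom_atlas_def by blast
  moreover from this have "(x, y, A) \<in> HB" "x \<in> fst c" "y \<in> fst d" by (simp_all add: fst_hom_chart)
  ultimately show "(x, y, A) \<in> HB \<and> (\<exists>c\<in>charts_at \<A> x. \<exists>d\<in>charts_at \<B> y. C = hom_chart \<A> \<B> c d)"
    by (auto simp: charts_at_iff intro!: bexI[of _ c] bexI[of _ d])
next
  assume "(x, y, A) \<in> HB \<and> (\<exists>c\<in>charts_at \<A> x. \<exists>d\<in>charts_at \<B> y. C = hom_chart \<A> \<B> c d)"
  then obtain c d where *: "(x, y, A) \<in> HB" "c \<in> charts_at \<A> x" "d \<in> charts_at \<B> y" "C = hom_chart \<A> \<B> c d" by blast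
  then have "c \<in> \<A>" "d \<in> \<B>" "C = hom_chart \<A> \<B> c d" by (simp_all add: charts_at_iff)
  moreover from * have "(x, y, A) \<in> fst C" by (simp add: fst_hom_chart charts_at_iff)
  ultimately show "C \<in> charts_at H (x, y, A)" unfolding charts_at_iff hom_atlas_def by blast
qed

lemma charts_at_homI: "(x, y, A) \<in> HB \<Longrightarrow> c \<in> charts_at \<A> x \<Longrightarrow> d \<in> charts_at \<B> y \<Longrightarrow> hom_chart \<A> \<B> c d \<in> charts_at H (x, y, A)"
  unfolding charts_at_hom by blast

lemma hom_chart_image:
  assumes "c \<in> \<A>" "d \<in> \<B>" "U \<subseteq> fst c" "V \<subseteq> fst d"
  shows "snd (hom_chart \<A> \<B> c d) ` {(x, y, A) \<in> HB. x \<in> U \<and> y \<in> V} = (snd c ` U) \<times> (snd d ` V) \<times> UNIV"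
proof
  show "snd (hom_chart \<A> \<B> c d) ` {(x, y, A) \<in> HB. x \<in> U \<and> y \<in> V} \<subseteq> (snd c ` U) \<times> (snd d ` V) \<times> UNIV"
    by (auto simp: snd_hom_chart)
  show "(snd c ` U) \<times> (snd d ` V) \<times> UNIV \<subseteq> snd (hom_chart \<A> \<B> c d) ` {(x, y, A) \<in> HB. x \<in> U \<and> y \<in> V}"
  proof
    fix z :: "(real^2) \<times> (real^2) \<times> (real^2^2)" assume "z \<in> (snd c ` U) \<times> (snd d ` V) \<times> UNIV"
    then obtain x y B where z: "z = (snd c x, snd d y, B)" "x \<in> U" "y \<in> V" by (cases z) auto
    then have cd: "c \<in> charts_at \<A> x" "d \<in> charts_at \<B> y" using assms by (auto simp: charts_at_iff)
    show "z \<in> snd (hom_chart \<A> \<B> c d) ` {(x, y, A) \<in> HB. x \<in> U \<and> y \<in> V}"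
      using z hom_of_in[OF cd, of B] by (intro image_eqI[of _ _ "(x, y, hom_of c d x y B)"])
        (auto simp: snd_hom_chart mat_hom_of[OF cd])
  qed
qed

lemma fst_hom_chart_eq: "fst (hom_chart \<A> \<B> c d) = {(x, y, A) \<in> HB. x \<in> fst c \<and> y \<in> fst d}"
  by (auto simp: hom_chart_def)

lemma hom_chart_inj: assumes "c \<in> \<A>" "d \<in> \<B>" shows "inj_on (snd (hom_chart \<A> \<B> c d)) (fst (hom_chart \<A> \<B> c d))"
proof (rule inj_onI)
  fix p q assume pq: "p \<in> fst (hom_chart \<A> \<B> c d)" "q \<in> fst (hom_chart \<A> \<B> c d)"
    and eq: "snd (hom_chart \<A> \<B> c d) p = snd (hom_chart \<A> \<B> c d) q"
  obtain x y A x' y' A' where p: "p = (x, y, A)" and q: "q = (x', y', A')" by (cases p, cases q) auto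
  have A: "(x, y, A) \<in> HB" "(x', y', A') \<in> HB" and in_chart: "x \<in> fst c" "y \<in> fst d" "x' \<in> fst c" "y' \<in> fst d"
    using pq unfolding p q fst_hom_chart by auto
  have e: "snd c x = snd c x'" "snd d y = snd d y'" "mat c d x A = mat c d x' A'"
    using eq unfolding p q snd_hom_chart by auto
  have xy: "x' = x" "y' = y"
    using inj_onD[OF compatible_atlas_inj[OF S1.compat assms(1)] e(1)] inj_onD[OF compatible_atlas_inj[OF S2.compat assms(2)] e(2)]
      in_chart by auto
  have "A' = A"
    by (rule hom_eqI[of x y A' A c d]) (use A xy e in_chart assms in \<open>auto simp: charts_at_iff\<close>)
  then show "p = q" using xy p q by simp
qed

lemma chart_inv_hom:
  assumes "c \<in> \<A>" "d \<in> \<B>" "x \<in> fst c" "y \<in> fst d"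
  shows "chart_inv (hom_chart \<A> \<B> c d) (snd c x, snd d y, B) = (x, y, hom_of c d x y B)"
proof -
  have cd: "c \<in> charts_at \<A> x" "d \<in> charts_at \<B> y" using assms by (auto simp: charts_at_iff)
  show ?thesis unfolding chart_inv_def
    by (rule inv_into_f_eq[OF hom_chart_inj[OF assms(1,2)]])
      (use hom_of_in[OF cd, of B] assms in \<open>simp_all add: fst_hom_chart snd_hom_chart mat_hom_of[OF cd]\<close>)
qed

lemma compatible_hom: "compatible_atlas H"
  unfolding compatible_atlas_def
proof (intro conjI ballI)
  fix C C' assume C: "C \<in> H" "C' \<in> H"
  obtain c d where cd: "C = hom_chart \<A> \<B> c d" "c \<in> \<A>" "d \<in> \<B>" using C unfolding hom_atlas_def by blast
  obtain c' d' where cd': "C' = hom_chart \<A> \<B> c' d'" "c' \<in> \<A>" "d' \<in> \<B>" using C unfolding hom_atlas_def by blast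
  show "inj_on (snd C) (fst C)" unfolding cd(1) by (rule hom_chart_inj[OF cd(2,3)])
  have "snd C ` fst C = (snd c ` fst c) \<times> (snd d ` fst d) \<times> UNIV"
    unfolding cd(1) fst_hom_chart_eq by (rule hom_chart_image[OF cd(2,3)]) auto
  then show "open (snd C ` fst C)" using S1.open_dom S2.open_dom cd by (simp add: open_Times)
  have "fst C \<inter> fst C' = {(x, y, A) \<in> HB. x \<in> fst c \<inter> fst c' \<and> y \<in> fst d \<inter> fst d'}"
    unfolding cd(1) cd'(1) fst_hom_chart_eq by auto
  then have ov: "snd C ` (fst C \<inter> fst C') = (snd c ` (fst c \<inter> fst c')) \<times> (snd d ` (fst d \<inter> fst d')) \<times> UNIV"
    unfolding cd(1) by (simp only: hom_chart_image[OF cd(2,3)] Int_lower1)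
  note o1 = compatible_atlas_open_Int[OF S1.compat cd(2) cd'(2)] and o2 = compatible_atlas_open_Int[OF S2.compat cd(3) cd'(3)]
  note s1 = compatible_atlas_smooth[OF S1.compat cd(2) cd'(2)] and s2 = compatible_atlas_smooth[OF S2.compat cd(3) cd'(3)]
  note o1' = compatible_atlas_open_Int[OF S1.compat cd'(2) cd(2)] and s1' = compatible_atlas_smooth[OF S1.compat cd'(2) cd(2)]
  let ?O = "snd C ` (fst C \<inter> fst C')"
  show o: "open ?O"
    unfolding ov by (intro open_Times o1 o2 open_UNIV)
  let ?\<tau>1 = "transition c c'" and ?\<tau>2 = "transition d d'"
  let ?F = "\<lambda>z::(real^2) \<times> (real^2) \<times> (real^2^2). (?\<tau>1 (fst z), ?\<tau>2 (fst (snd z)), matrix (\<lambda>u. frechet_derivative ?\<tau>2 (at (fst (snd z)))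
      (snd (snd z) *v frechet_derivative (transition c' c) (at (?\<tau>1 (fst z))) u)))"
  note id = smooth_on_id[OF o]
  have t1: "smooth_on ?O (\<lambda>z. ?\<tau>1 (fst z))"
    by (rule smooth_on_compose[OF smooth_on_fst[OF o id] s1 o o1]) (auto simp: ov)
  have t2: "smooth_on ?O (\<lambda>z. ?\<tau>2 (fst (snd z)))"
    by (rule smooth_on_compose[OF smooth_on_fst[OF o smooth_on_snd[OF o id]] s2 o o2]) (auto simp: ov)
  have "smooth_on ?O ?F"
  proof (intro smooth_on_Pair smooth_on_matrix smooth_on_frechet_apply[OF s2 o o2] smooth_on_matrix_vector
        smooth_on_frechet_apply[OF s1' o o1'] o t1 t2 smooth_on_fst smooth_on_snd smooth_on_const id)
    show "(\<lambda>z. fst (snd z)) ` ?O \<subseteq> snd d ` (fst d \<inter> fst d')" by (auto simp: ov)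
    show "(\<lambda>z. ?\<tau>1 (fst z)) ` ?O \<subseteq> snd c' ` (fst c' \<inter> fst c)"
      by (auto simp: ov transition_snd[OF S1.compat cd(2)])
  qed
  then show "smooth_on ?O (transition C C')"
  proof (rule smooth_on_cong[OF o, THEN iffD1, rotated])
    fix z assume "z \<in> ?O"
    then obtain x y B where z: "z = (snd c x, snd d y, B)" "x \<in> fst c" "x \<in> fst c'" "y \<in> fst d" "y \<in> fst d'"
      unfolding ov by (cases z) auto
    have ch: "c \<in> charts_at \<A> x" "c' \<in> charts_at \<A> x" "d \<in> charts_at \<B> y" "d' \<in> charts_at \<B> y"
      using z cd cd' by (auto simp: charts_at_iff)
    show "?F z = transition C C' z"
      unfolding transition_def[of "hom_chart \<A> \<B> c d" "hom_chart \<A> \<B> c' d'"] comp_apply z(1) cd(1) cd'(1) chart_inv_hom[OF cd(2,3) z(2,4)] snd_hom_chart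
        mat_change[OF hom_of_in[OF ch(1,3)] ch] mat_hom_of[OF ch(1,3)]
      by (simp add: transition_snd[OF S1.compat cd(2) z(2)] transition_snd[OF S2.compat cd(3) z(4)])
  qed
qed

lemma mcarrier_hom: "mcarrier H = HB"
proof -
  have "(x, y, A) \<in> mcarrier H \<longleftrightarrow> (x, y, A) \<in> HB" for x y A
    unfolding mcarrier_charts_at charts_at_hom using hom_bundleD(1,2)[of x y A] mcarrier_charts_at[of x \<A>] mcarrier_charts_at[of y \<B>] by blast
  then show ?thesis by auto
qed

end

section \<open>The bundle of tangent planes\<close>

lemma linear_inv_bij:
  assumes "linear L" "bij L" shows "linear (inv L)"
proof (rule linearI)
  note s = surj_f_inv_f[OF bij_is_surj[OF assms(2)]]
  show "inv L (u + v) = inv L u + inv L v" for u v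
    by (rule inv_f_eq[OF bij_is_inj[OF assms(2)]]) (simp add: linear_add[OF assms(1)] s)
  show "inv L (r *\<^sub>R u) = r *\<^sub>R inv L u" for r u
    by (rule inv_f_eq[OF bij_is_inj[OF assms(2)]]) (simp add: linear_cmul[OF assms(1)] s)
qed

text \<open>Cramer's rule, which makes the smooth dependence on the matrix explicit.\<close>

definition inv2 :: "real^2^2 \<Rightarrow> real^2^2"
  where "inv2 P = (1 / det P) *\<^sub>R vector [vector [P $ 2 $ 2, - P $ 1 $ 2], vector [- P $ 2 $ 1, P $ 1 $ 1]]"

lemma inv2: assumes "det P \<noteq> 0" shows "P ** inv2 P = mat 1" "inv2 P ** P = mat 1"
proof -
  have *: "P $ 1 $ 1 * P $ 2 $ 2 - P $ 1 $ 2 * P $ 2 $ 1 \<noteq> 0" using assms by (simp add: det_2)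
  then show "P ** inv2 P = mat 1" "inv2 P ** P = mat 1"
    by (simp_all add: inv2_def vec_eq_iff forall_2 matrix_matrix_mult_def sum_2 mat_def det_2 divide_simps)
qed

lemma smooth_on_vector_2:
  fixes f g :: "'a::real_normed_vector \<Rightarrow> 'b::euclidean_space"
  assumes "open S" "smooth_on S f" "smooth_on S g"
  shows "smooth_on S (\<lambda>z. vector [f z, g z] :: 'b^2)"
proof -
  have "(\<lambda>z. vector [f z, g z] :: 'b^2) = (\<lambda>z. \<chi> i. if i = 1 then f z else g z)"
    by (rule ext) (simp add: vec_eq_iff forall_2)
  moreover have "smooth_on S (\<lambda>z. \<chi> i. if (i::2) = 1 then f z else g z)"
  proof (rule smooth_on_vec[OF assms(1)])
    show "smooth_on S (\<lambda>z. if (i::2) = 1 then f z else g z)" for i using assms by (cases "i = 1") auto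
  qed
  ultimately show ?thesis by simp
qed

lemma smooth_on_det2: "open S \<Longrightarrow> smooth_on S P \<Longrightarrow> smooth_on S (\<lambda>z. det (P z :: real^2^2))"
  unfolding det_2 by (intro smooth_intros)

lemma smooth_on_inv2:
  assumes "open S" "smooth_on S P" "\<And>z. z \<in> S \<Longrightarrow> det (P z) \<noteq> 0"
  shows "smooth_on S (\<lambda>z. inv2 (P z))"
  unfolding inv2_def using assms by (intro smooth_on_scaleR smooth_on_divide smooth_on_const smooth_on_det2
      smooth_on_vector_2 smooth_on_minus smooth_on_vec_nth) auto

lemma smooth_on_matrix_mult:
  fixes A :: "'a::real_normed_vector \<Rightarrow> real^'n^'m" and B :: "'a \<Rightarrow> real^'k^'n"
  assumes "open S" "smooth_on S A" "smooth_on S B"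
  shows "smooth_on S (\<lambda>z. A z ** B z)"
  unfolding matrix_matrix_mult_def using assms by (intro smooth_intros)

context
  fixes \<N> :: "('a, real^4) atlas"
  assumes compat: "compatible_atlas \<N>"
begin

definition graph_of :: "('a, real^4) chart \<Rightarrow> (real^4 \<Rightarrow> (real^2) \<times> (real^2)) \<Rightarrow> 'a \<Rightarrow> real^2^2 \<Rightarrow> ('a, real^4) tvec set"
  where "graph_of C L y B = range (\<lambda>a. coord_tvec \<N> C y (inv L (a, B *v a)))"

lemma is_graph_unique: "is_graph_in C L N B \<Longrightarrow> is_graph_in C L N B' \<Longrightarrow> B = B'"
proof -
  assume "is_graph_in C L N B" "is_graph_in C L N B'"
  then have "{(a, B *v a) |a. True} = {(a, B' *v a) |a. True}" by (simp add: is_graph_in_def)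
  then have "B *v a = B' *v a" for a by blast
  then show "B = B'" by (simp add: matrix_eq)
qed

context
  fixes C :: "('a, real^4) chart" and L :: "real^4 \<Rightarrow> (real^2) \<times> (real^2)" and y
  assumes C: "C \<in> charts_at \<N> y" and L: "linear L" "bij L"
begin

lemma graph_coord_linear: "linear (\<lambda>a. inv L (a, B *v a))"
proof -
  have "linear (inv L)" by (rule linear_inv_bij[OF L])
  moreover have "linear (\<lambda>a. (a, B *v a))"
    by (rule linearI) (simp_all add: matrix_vector_right_distrib matrix_vector_mult_scaleR)
  ultimately show ?thesis using linear_compose[of "\<lambda>a. (a, B *v a)" "inv L"] by (simp add: o_def)
qed

lemma is_graph_graph_of: "is_graph_in C L (graph_of C L y B) B"
  by (simp add: is_graph_in_def graph_of_def image_image coord_tvec_self[OF compat C]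
      surj_f_inv_f[OF bij_is_surj[OF L(2)]] full_SetCompr_eq)

lemma graph_of_eq:
  assumes "N \<subseteq> tangent_space \<N> y" "is_graph_in C L N B" shows "N = graph_of C L y B"
proof
  have img: "(\<lambda>u. L (u C)) ` N = {(a, B *v a) |a. True}" using assms(2) by (simp add: is_graph_in_def)
  show "N \<subseteq> graph_of C L y B"
  proof
    fix u assume u: "u \<in> N"
    then obtain a where a: "L (u C) = (a, B *v a)" using img by blast
    then have "u C = inv L (a, B *v a)" using L(2) by (metis bij_inv_eq_iff)
    then have "u = coord_tvec \<N> C y (inv L (a, B *v a))" using coord_tvec_eq[OF compat _ C, of u] u assms(1) by auto
    then show "u \<in> graph_of C L y B" by (auto simp: graph_of_def)
  qed
  show "graph_of C L y B \<subseteq> N"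
  proof
    fix u assume "u \<in> graph_of C L y B"
    then obtain a where a: "u = coord_tvec \<N> C y (inv L (a, B *v a))" by (auto simp: graph_of_def)
    have "(a, B *v a) \<in> (\<lambda>u. L (u C)) ` N" unfolding img by blast
    then obtain n where n: "n \<in> N" "L (n C) = (a, B *v a)" by auto
    then have "n C = inv L (a, B *v a)" using L(2) by (metis bij_inv_eq_iff)
    then have "n = u" using coord_tvec_eq[OF compat _ C, of n] n(1) assms(1) a by auto
    then show "u \<in> N" using n by simp
  qed
qed

lemma tangent_plane_graph_of: "tangent_plane \<N> y (graph_of C L y B)"
proof -
  let ?h = "\<lambda>a. coord_tvec \<N> C y (inv L (a, B *v a))"
  have lin: "linear ?h"
    by (rule linearI) (simp_all add: linear_add[OF graph_coord_linear] linear_cmul[OF graph_coord_linear]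
        coord_tvec_add[OF compat C] coord_tvec_scaleR[OF compat C])
  have inj: "inj ?h"
  proof (rule injI)
    fix a b assume "?h a = ?h b"
    then have "inv L (a, B *v a) = inv L (b, B *v b)" by (metis coord_tvec_self[OF compat C])
    then have "(a, B *v a) = (b, B *v b)" using L(2) by (metis bij_inv_eq_iff)
    then show "a = b" by simp
  qed
  have "dim (range ?h) = dim (UNIV :: (real^2) set)"
    by (rule dim_image_eq[OF lin]) (use inj in \<open>simp add: span_UNIV\<close>)
  moreover have "subspace (range ?h)" by (rule linear_subspace_image[OF lin subspace_UNIV])
  ultimately show ?thesis
    using coord_tvec_in[OF compat C] by (auto simp: tangent_plane_def graph_of_def)
qed

end

lemma fst_plane_chart: "(y, N) \<in> fst (plane_chart \<N> C L) \<longleftrightarrow> y \<in> fst C \<and> tangent_plane \<N> y N \<and> (\<exists>B. is_graph_in C L N B)"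
  by (simp add: plane_chart_def)

lemma snd_plane_chart: "is_graph_in C L N B \<Longrightarrow> snd (plane_chart \<N> C L) (y, N) = (snd C y, B)"
  by (auto simp: plane_chart_def intro!: the_equality intro: is_graph_unique)

lemma plane_chart_image:
  assumes "C \<in> \<N>" "linear L" "bij L"
  shows "snd (plane_chart \<N> C L) ` fst (plane_chart \<N> C L) = (snd C ` fst C) \<times> UNIV"
proof
  show "snd (plane_chart \<N> C L) ` fst (plane_chart \<N> C L) \<subseteq> (snd C ` fst C) \<times> UNIV"
    by (auto simp: plane_chart_def)
  show "(snd C ` fst C) \<times> UNIV \<subseteq> snd (plane_chart \<N> C L) ` fst (plane_chart \<N> C L)"
  proof
    fix z :: "(real^4) \<times> (real^2^2)" assume "z \<in> (snd C ` fst C) \<times> UNIV"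
    then obtain y B where z: "z = (snd C y, B)" "y \<in> fst C" by (cases z) auto
    have C: "C \<in> charts_at \<N> y" using z assms by (simp add: charts_at_iff)
    note g = is_graph_graph_of[OF C assms(2,3), of B]
    show "z \<in> snd (plane_chart \<N> C L) ` fst (plane_chart \<N> C L)"
      using z g tangent_plane_graph_of[OF C assms(2,3)] snd_plane_chart[OF g]
      by (intro image_eqI[of _ _ "(y, graph_of C L y B)"]) (auto simp: fst_plane_chart)
  qed
qed

lemma plane_chart_inj:
  assumes "C \<in> \<N>" "linear L" "bij L"
  shows "inj_on (snd (plane_chart \<N> C L)) (fst (plane_chart \<N> C L))"
proof (rule inj_onI)
  fix p q assume pq: "p \<in> fst (plane_chart \<N> C L)" "q \<in> fst (plane_chart \<N> C L)"
    and eq: "snd (plane_chart \<N> C L) p = snd (plane_chart \<N> C L) q"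
  obtain y N y' N' where p: "p = (y, N)" and q: "q = (y', N')" by (cases p, cases q) auto
  obtain B where B: "y \<in> fst C" "tangent_plane \<N> y N" "is_graph_in C L N B" using pq(1) unfolding p fst_plane_chart by blast
  obtain B' where B': "y' \<in> fst C" "tangent_plane \<N> y' N'" "is_graph_in C L N' B'" using pq(2) unfolding q fst_plane_chart by blast
  have e: "snd C y = snd C y'" "B = B'" using eq unfolding p q snd_plane_chart[OF B(3)] snd_plane_chart[OF B'(3)] by auto
  have y: "y' = y" using inj_onD[OF compatible_atlas_inj[OF compat assms(1)] e(1)] B B' by simp
  have C: "C \<in> charts_at \<N> y" using B assms by (simp add: charts_at_iff)
  have "N = N'"
    using graph_of_eq[OF C assms(2,3) _ B(3)] graph_of_eq[OF C assms(2,3) _ B'(3)] B(2) B'(2) e y by (simp add: tangent_plane_def)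
  then show "p = q" using p q y by simp
qed

lemma chart_inv_plane:
  assumes "C \<in> \<N>" "linear L" "bij L" "y \<in> fst C"
  shows "chart_inv (plane_chart \<N> C L) (snd C y, B) = (y, graph_of C L y B)"
proof -
  have C: "C \<in> charts_at \<N> y" using assms by (simp add: charts_at_iff)
  note g = is_graph_graph_of[OF C assms(2,3), of B]
  show ?thesis unfolding chart_inv_def
    by (rule inv_into_f_eq[OF plane_chart_inj[OF assms(1-3)]])
      (use assms g tangent_plane_graph_of[OF C assms(2,3)] in \<open>auto simp: fst_plane_chart snd_plane_chart[OF g]\<close>)
qed

text \<open>
  The plane over the point with coordinates \<open>fst z\<close> which is the graph of \<open>snd z\<close> in the splitting \<open>L\<close>,
  parametrised by the first summand and read in the splitting \<open>L'\<close> of another chart.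
\<close>

definition plane_tr where
  "plane_tr C L C' L' = (\<lambda>z a. L' (frechet_derivative (transition C C') (at (fst z)) (inv L (a, snd z *v a))))"

text \<open>
  In the new splitting the plane is \<open>{(P a, Q a) | a}\<close>. If \<open>P\<close> is invertible, this is the graph of
  \<open>Q P\<^sup>-\<^sup>1\<close>. If the plane is a graph, a vector \<open>a\<close> in the kernel of \<open>P\<close> also satisfies
  \<open>Q a = 0\<close>, and \<open>a = 0\<close> because the parametrisation is injective.
\<close>

lemma graph_change:
  fixes B :: "real^2^2"
  assumes C: "C \<in> charts_at \<N> y" and C': "C' \<in> charts_at \<N> y" and L: "linear L" "bij L" and L': "linear L'" "bij L'"
  defines "P \<equiv> matrix (\<lambda>a. fst (plane_tr C L C' L' (snd C y, B) a))" and "Q \<equiv> matrix (\<lambda>a. snd (plane_tr C L C' L' (snd C y, B) a))"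
  shows "(\<exists>B'. is_graph_in C' L' (graph_of C L y B) B') \<longleftrightarrow> det P \<noteq> 0"
    and "det P \<noteq> 0 \<Longrightarrow> is_graph_in C' L' (graph_of C L y B) (Q ** inv2 P)"
proof -
  let ?h = "plane_tr C L C' L' (snd C y, B)"
  have lin: "linear ?h"
  proof -
    have "linear (\<lambda>a. dtrans C C' y (inv L (a, B *v a)))"
      using linear_compose[OF graph_coord_linear[OF C L, of B] linear_dtrans[OF compat C C']] by (simp add: o_def)
    from linear_compose[OF this L'(1)] show ?thesis by (simp add: o_def plane_tr_def)
  qed
  have P: "fst (?h a) = P *v a" and Q: "snd (?h a) = Q *v a" for a
    unfolding P_def Q_def using lin linear_compose[OF lin linear_fst] linear_compose[OF lin linear_snd]
    by (simp_all add: matrix_works o_def)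
  have img: "(\<lambda>u. L' (u C')) ` graph_of C L y B = range ?h"
  proof -
    have "L' (coord_tvec \<N> C y (inv L (a, B *v a)) C') = ?h a" for a
      using C' by (simp add: plane_tr_def coord_tvec_def)
    then show ?thesis by (simp add: graph_of_def image_image)
  qed
  have inj: "a = 0" if "?h a = 0" for a
  proof -
    have "dtrans C C' y (inv L (a, B *v a)) = 0"
      using that L' linear_0[OF L'(1)] by (simp add: plane_tr_def) (metis bij_pointE)
    then have "dtrans C' C y (dtrans C C' y (inv L (a, B *v a))) = 0" using linear_0[OF linear_dtrans[OF compat C' C]] by simp
    then have "inv L (a, B *v a) = 0" by (simp add: dtrans_comp[OF compat C C' C] dtrans_self[OF compat C])
    then have "(a, B *v a) = L 0" using L(2) by (metis bij_inv_eq_iff)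
    then show "a = 0" using linear_0[OF L(1)] by (simp add: zero_prod_def)
  qed
  show isg: "is_graph_in C' L' (graph_of C L y B) (Q ** inv2 P)" if d: "det P \<noteq> 0"
    unfolding is_graph_in_def img
  proof
    show "range ?h \<subseteq> {(a, (Q ** inv2 P) *v a) |a. True}"
    proof
      fix z assume "z \<in> range ?h"
      then obtain a where a: "z = ?h a" by auto
      have "(Q ** inv2 P) *v (P *v a) = Q *v ((inv2 P ** P) *v a)"
        by (simp add: matrix_vector_mul_assoc matrix_mul_assoc)
      then have "z = (P *v a, (Q ** inv2 P) *v (P *v a))"
        using a P Q inv2(2)[OF d] by (simp add: prod_eq_iff)
      then show "z \<in> {(a, (Q ** inv2 P) *v a) |a. True}" by blast
    qed
    show "{(a, (Q ** inv2 P) *v a) |a. True} \<subseteq> range ?h"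
    proof
      fix z assume "z \<in> {(a, (Q ** inv2 P) *v a) |a. True}"
      then obtain a where a: "z = (a, (Q ** inv2 P) *v a)" by auto
      have "z = ?h (inv2 P *v a)"
        using a P[of "inv2 P *v a"] Q[of "inv2 P *v a"] inv2(1)[OF d] by (simp add: prod_eq_iff matrix_vector_mul_assoc)
      then show "z \<in> range ?h" by blast
    qed
  qed
  show "(\<exists>B'. is_graph_in C' L' (graph_of C L y B) B') \<longleftrightarrow> det P \<noteq> 0"
  proof
    assume "\<exists>B'. is_graph_in C' L' (graph_of C L y B) B'"
    then obtain B' where B': "range ?h = {(a, B' *v a) |a. True}" unfolding is_graph_in_def img by blast
    show "det P \<noteq> 0"
    proof
      assume "det P = 0"
      then obtain a where a: "a \<noteq> 0" "P *v a = 0"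
        using invertible_det_nz[of P] invertible_left_inverse[of P] matrix_left_invertible_ker[of P] by blast
      have "?h a \<in> {(a, B' *v a) |a. True}" using B' by blast
      then have "snd (?h a) = B' *v fst (?h a)" by auto
      then have "?h a = 0" using P[of a] a by (simp add: prod_eq_iff)
      then show False using inj a by blast
    qed
  qed (use isg in blast)
qed

lemma compatible_plane: "compatible_atlas (plane_atlas \<N>)"
  unfolding compatible_atlas_def
proof (intro conjI ballI)
  fix c c' assume c: "c \<in> plane_atlas \<N>" "c' \<in> plane_atlas \<N>"
  obtain C L where C: "c = plane_chart \<N> C L" "C \<in> \<N>" "linear L" "bij L" using c(1) unfolding plane_atlas_def by blast
  obtain C' L' where C': "c' = plane_chart \<N> C' L'" "C' \<in> \<N>" "linear L'" "bij L'" using c(2) unfolding plane_atlas_def by blast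
  show "inj_on (snd c) (fst c)" unfolding C(1) by (rule plane_chart_inj[OF C(2-4)])
  show "open (snd c ` fst c)"
    unfolding C(1) plane_chart_image[OF C(2-4)] by (intro open_Times compatible_atlas_open[OF compat C(2)] open_UNIV)
  let ?O = "(snd C ` (fst C \<inter> fst C')) \<times> (UNIV :: (real^2^2) set)"
  note o1 = compatible_atlas_open_Int[OF compat C(2) C'(2)] and s1 = compatible_atlas_smooth[OF compat C(2) C'(2)]
  have o: "open ?O" by (intro open_Times o1 open_UNIV)
  let ?P = "\<lambda>z. matrix (\<lambda>a. fst (plane_tr C L C' L' z a))" and ?Q = "\<lambda>z. matrix (\<lambda>a. snd (plane_tr C L C' L' z a))"
  have linL: "linear (inv L)" by (rule linear_inv_bij[OF C(3,4)])
  have sh: "smooth_on ?O (\<lambda>z. plane_tr C L C' L' z a)" for a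
    unfolding plane_tr_def
    by (intro smooth_on_linear_comp'[OF C'(3) o] smooth_on_frechet_apply[OF s1 o o1] smooth_on_linear_comp'[OF linL o]
        smooth_on_Pair smooth_on_matrix_vector smooth_on_fst smooth_on_snd smooth_on_id smooth_on_const o) auto
  have sP: "smooth_on ?O ?P" by (intro smooth_on_matrix smooth_on_fst sh o)
  have sQ: "smooth_on ?O ?Q" by (intro smooth_on_matrix smooth_on_snd sh o)
  have ov: "snd c ` (fst c \<inter> fst c') = ?O \<inter> (\<lambda>z. det (?P z)) -` (- {0})"
  proof
    show "snd c ` (fst c \<inter> fst c') \<subseteq> ?O \<inter> (\<lambda>z. det (?P z)) -` (- {0})"
    proof
      fix z assume "z \<in> snd c ` (fst c \<inter> fst c')"
      then obtain y N where yN: "(y, N) \<in> fst c" "(y, N) \<in> fst c'" "z = snd c (y, N)" by auto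
      obtain B where B: "y \<in> fst C" "tangent_plane \<N> y N" "is_graph_in C L N B" using yN(1) unfolding C(1) fst_plane_chart by blast
      obtain B' where B': "y \<in> fst C'" "is_graph_in C' L' N B'" using yN(2) unfolding C'(1) fst_plane_chart by blast
      have ch: "C \<in> charts_at \<N> y" "C' \<in> charts_at \<N> y" using B B' C C' by (auto simp: charts_at_iff)
      have "N = graph_of C L y B" using graph_of_eq[OF ch(1) C(3,4) _ B(3)] B(2) by (simp add: tangent_plane_def)
      then have "det (?P (snd C y, B)) \<noteq> 0" using graph_change(1)[OF ch C(3,4) C'(3,4), of B] B'(2) by blast
      moreover have "z = (snd C y, B)" using yN(3) snd_plane_chart[OF B(3)] C(1) by simp
      ultimately show "z \<in> ?O \<inter> (\<lambda>z. det (?P z)) -` (- {0})" using B B' by auto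
    qed
    show "?O \<inter> (\<lambda>z. det (?P z)) -` (- {0}) \<subseteq> snd c ` (fst c \<inter> fst c')"
    proof
      fix z assume z: "z \<in> ?O \<inter> (\<lambda>z. det (?P z)) -` (- {0})"
      then obtain y B where y: "z = (snd C y, B)" "y \<in> fst C" "y \<in> fst C'" by (cases z) auto
      have ch: "C \<in> charts_at \<N> y" "C' \<in> charts_at \<N> y" using y C C' by (auto simp: charts_at_iff)
      have d: "det (?P (snd C y, B)) \<noteq> 0" using z y(1) by simp
      note g = is_graph_graph_of[OF ch(1) C(3,4), of B]
      have "(y, graph_of C L y B) \<in> fst c \<inter> fst c'"
        using y g tangent_plane_graph_of[OF ch(1) C(3,4), of B] graph_change(2)[OF ch C(3,4) C'(3,4) d]
        unfolding C(1) C'(1) fst_plane_chart Int_iff by blast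
      moreover have "snd c (y, graph_of C L y B) = z" unfolding C(1) y(1) by (rule snd_plane_chart[OF g])
      ultimately show "z \<in> snd c ` (fst c \<inter> fst c')" by (metis imageI)
    qed
  qed
  show oo: "open (snd c ` (fst c \<inter> fst c'))"
    unfolding ov by (rule smooth_open_vimage[OF smooth_on_det2[OF o sP] o]) auto
  have "smooth_on (snd c ` (fst c \<inter> fst c')) (\<lambda>z. (transition C C' (fst z), ?Q z ** inv2 (?P z)))"
  proof (intro smooth_on_Pair smooth_on_matrix_mult smooth_on_inv2 oo)
    have "smooth_on ?O (\<lambda>z. transition C C' (fst z))"
      by (rule smooth_on_compose[OF smooth_on_fst[OF o smooth_on_id[OF o]] s1 o o1]) auto
    then show "smooth_on (snd c ` (fst c \<inter> fst c')) (\<lambda>z. transition C C' (fst z))"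
      by (rule smooth_on_subset) (auto simp: ov)
    show "smooth_on (snd c ` (fst c \<inter> fst c')) ?P" by (rule smooth_on_subset[OF sP]) (simp add: ov)
    show "smooth_on (snd c ` (fst c \<inter> fst c')) ?Q" by (rule smooth_on_subset[OF sQ]) (simp add: ov)
  qed (auto simp: ov)
  then show "smooth_on (snd c ` (fst c \<inter> fst c')) (transition c c')"
  proof (rule smooth_on_cong[OF oo, THEN iffD1, rotated])
    fix z assume z: "z \<in> snd c ` (fst c \<inter> fst c')"
    then obtain y B where y: "z = (snd C y, B)" "y \<in> fst C" "y \<in> fst C'" unfolding ov by (cases z) auto
    have ch: "C \<in> charts_at \<N> y" "C' \<in> charts_at \<N> y" using y C C' by (auto simp: charts_at_iff)
    have d: "det (?P (snd C y, B)) \<noteq> 0" using z y(1) ov by auto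
    show "(transition C C' (fst z), ?Q z ** inv2 (?P z)) = transition c c' z"
      unfolding transition_def[of "plane_chart \<N> C L" "plane_chart \<N> C' L'"] comp_apply y(1) C(1) C'(1) chart_inv_plane[OF C(2-4) y(2)]
        snd_plane_chart[OF graph_change(2)[OF ch C(3,4) C'(3,4) d]]
      by (simp add: transition_snd[OF compat C(2) y(2)])
  qed
qed

end

section \<open>Orientations\<close>

lemma matrix_works_real: "linear f \<Longrightarrow> matrix f *v x = f (x :: real^'n)" for f :: "real^'n \<Rightarrow> real^'m"
  by (simp add: matrix_works)

lemma oriented_frame_iff:
  fixes \<A> :: "('a, real^'n) atlas"
  assumes compat: "compatible_atlas \<A>"
    and det: "\<And>c c'. c \<in> charts_at \<A> p \<Longrightarrow> c' \<in> charts_at \<A> p \<Longrightarrow> det (matrix (dtrans c c' p)) > 0"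
    and e: "\<And>i. e i \<in> tangent_space \<A> p" and c: "c \<in> charts_at \<A> p"
  shows "oriented_frame \<A> p e \<longleftrightarrow> det (\<chi> i j. e j c $ i) > 0"
proof -
  have "det (\<chi> i j. e j c' $ i) > 0 \<longleftrightarrow> det (\<chi> i j. e j c $ i) > 0" if c': "c' \<in> charts_at \<A> p" for c'
  proof -
    have "e j c' = matrix (dtrans c c' p) *v e j c" for j
      using tangent_vector_transform[OF compat e c c', of j] matrix_works_real[OF linear_dtrans[OF compat c c'], of "e j c"] by simp
    then have "(\<chi> i j. e j c' $ i) = (\<chi> i j. (matrix (dtrans c c' p) *v e j c) $ i)" by simp
    also have "\<dots> = matrix (dtrans c c' p) ** (\<chi> i j. e j c $ i)"
      by (simp add: matrix_matrix_mult_def matrix_vector_mult_def)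
    finally have "(\<chi> i j. e j c' $ i) = matrix (dtrans c c' p) ** (\<chi> i j. e j c $ i)" .
    then show ?thesis using det[OF c c'] by (simp add: det_mul zero_less_mult_iff)
  qed
  then show ?thesis unfolding oriented_frame_def using e c by blast
qed

text \<open>The area form of the plane.\<close>

definition cross2 :: "real^2 \<Rightarrow> real^2 \<Rightarrow> real"
  where "cross2 u v = u $ 1 * v $ 2 - v $ 1 * u $ 2"

lemma cross2_matrix: "cross2 (B *v u) (B *v v) = det B * cross2 u v"
  by (simp add: cross2_def det_2 matrix_vector_mult_def sum_2 algebra_simps)

lemma cross2_combination:
  "cross2 (a *\<^sub>R u + b *\<^sub>R v) (p *\<^sub>R u + q *\<^sub>R v) = (a * q - b * p) * cross2 u v"
  by (simp add: cross2_def algebra_simps)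

context surface begin

lemma det_dtrans_pos:
  assumes "c \<in> charts_at \<A> p" "c' \<in> charts_at \<A> p"
  shows "det (matrix (dtrans c c' p)) > 0"
proof -
  have "c \<in> \<A>" "c' \<in> \<A>" "snd c p \<in> snd c ` (fst c \<inter> fst c')" using assms by (auto simp: charts_at_iff)
  then show ?thesis
    using oriented_riemannian_surface unfolding oriented_riemannian_surface_def oriented_manifold_def by blast
qed

lemmas oriented_frame_iff = oriented_frame_iff[OF compat det_dtrans_pos]

lemma smooth_G_apply:
  fixes S :: "'z::euclidean_space set"
  assumes "c \<in> \<A>" "open S" "smooth_on S q" "q ` S \<subseteq> dom c" "smooth_on S u" "smooth_on S v"
  shows "smooth_on S (\<lambda>z. G c (q z) (u z) (v z))"
proof -
  note o = open_dom[OF assms(1)]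
  have 1: "smooth_on S (\<lambda>z. G c (q z) (u z) e)" for e
    by (rule smooth_on_linear_family[where L = "\<lambda>x u. G c x u e", OF assms(2) o smooth_G[OF assms(1)] linear_G'[OF assms(1)] assms(3,4,5)])
  show ?thesis
    by (rule smooth_on_linear_family[where L = "\<lambda>z. G c (q z) (u z)" and T = S and p = "\<lambda>z. z", OF _ _ 1 linear_G[OF assms(1)] smooth_on_id _ assms(6)])
      (use assms(2,4) in auto)
qed

lemma smooth_frame_apply:
  assumes "c \<in> \<A>" "open S" "smooth_on S q" "q ` S \<subseteq> dom c"
  shows "smooth_on S (\<lambda>z. frame1 c (q z))" "smooth_on S (\<lambda>z. frame2 c (q z))"
  by (rule smooth_on_compose[OF assms(3) smooth_frame1[OF assms(1)] assms(2) open_dom[OF assms(1)] assms(4)],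
      rule smooth_on_compose[OF assms(3) smooth_frame2[OF assms(1)] assms(2) open_dom[OF assms(1)] assms(4)])

lemma cross2_frame: "c \<in> \<A> \<Longrightarrow> x \<in> dom c \<Longrightarrow> cross2 (frame1 c x) (frame2 c x) > 0"
  using frame_det by (simp add: cross2_def)

end

section \<open>Charts of the configuration space\<close>

text \<open>
  In the coordinates of \<open>c\<close>, the map \<open>\<nu>\<close> parametrises the part of \<open>S\<close> in \<open>W\<close> and \<open>F\<close> recovers the parameter.
\<close>

lemma submanifold_chartI:
  fixes \<A> :: "('a, 'e::euclidean_space) atlas" and F :: "'e \<Rightarrow> 'f::euclidean_space"
  assumes compat: "compatible_atlas \<A>" and c: "c \<in> \<A>" and W: "open W" "W \<subseteq> snd c ` fst c" "smooth_on W F"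
    and U: "open U" "smooth_on U \<nu>"
    and F\<nu>: "\<And>p. p \<in> S \<Longrightarrow> p \<in> fst c \<Longrightarrow> snd c p \<in> W \<Longrightarrow> F (snd c p) \<in> U \<and> \<nu> (F (snd c p)) = snd c p"
    and \<nu>F: "\<And>w. w \<in> U \<Longrightarrow> \<nu> w \<in> W \<and> chart_inv c (\<nu> w) \<in> S \<and> F (\<nu> w) = w"
  shows "(S \<inter> (fst c \<inter> snd c -` W), \<lambda>p. F (snd c p)) \<in> submanifold_atlas \<A> S"
proof -
  let ?V = "S \<inter> (fst c \<inter> snd c -` W)" and ?\<kappa> = "\<lambda>p. F (snd c p)"
  have op: "openin (subtopology (mtopology \<A>) S) ?V"
    using openin_chart_vimage[OF compat c W(1)] by (auto simp: openin_subtopology)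
  have V: "chart_inv c (\<nu> w) \<in> ?V" "?\<kappa> (chart_inv c (\<nu> w)) = w" "snd c (chart_inv c (\<nu> w)) = \<nu> w" if "w \<in> U" for w
  proof -
    have "\<nu> w \<in> snd c ` fst c" using \<nu>F[OF that] W(2) by blast
    then have "chart_inv c (\<nu> w) \<in> fst c" "snd c (chart_inv c (\<nu> w)) = \<nu> w" by (rule chart_inv_in, rule snd_chart_inv)
    then show "chart_inv c (\<nu> w) \<in> ?V" "?\<kappa> (chart_inv c (\<nu> w)) = w" "snd c (chart_inv c (\<nu> w)) = \<nu> w"
      using \<nu>F[OF that] by auto
  qed
  have inj: "inj_on ?\<kappa> ?V"
  proof (rule inj_onI)
    fix p q assume p: "p \<in> ?V" and q: "q \<in> ?V" and eq: "?\<kappa> p = ?\<kappa> q"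
    have "snd c p = snd c q" using F\<nu>[of p] F\<nu>[of q] p q eq by (metis IntD1 IntD2 vimageD)
    then show "p = q" using inj_onD[OF compatible_atlas_inj[OF compat c]] p q by blast
  qed
  have img: "?\<kappa> ` ?V = U"
  proof
    show "?\<kappa> ` ?V \<subseteq> U" using F\<nu> by auto
    show "U \<subseteq> ?\<kappa> ` ?V"
    proof
      fix w assume "w \<in> U"
      then show "w \<in> ?\<kappa> ` ?V" using V[of w] by (intro image_eqI[of w ?\<kappa> "chart_inv c (\<nu> w)"]) auto
    qed
  qed
  have s1: "smooth_map \<A> ?V eucl ?\<kappa>"
  proof (rule smooth_mapI)
    fix p assume p: "p \<in> ?V"
    then have "c \<in> charts_at \<A> p" using c by (simp add: charts_at_iff)
    then show "\<exists>c\<in>charts_at \<A> p. \<exists>d\<in>charts_at eucl (?\<kappa> p). \<exists>W F. open W \<and> snd c p \<in> W \<and> W \<subseteq> snd c ` fst c \<and> smooth_on W F \<and>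
        (\<forall>q\<in>?V \<inter> fst c. snd c q \<in> W \<longrightarrow> ?\<kappa> q \<in> fst d \<and> snd d (?\<kappa> q) = F (snd c q))"
      using W p by (intro bexI[of _ c] bexI[of _ "(UNIV, id)"] exI[of _ W] exI[of _ F]) auto
  qed
  have s2: "smooth_map eucl U \<A> (\<lambda>w. chart_inv c (\<nu> w))"
  proof (rule smooth_mapI)
    fix w assume w: "w \<in> U"
    then have "c \<in> charts_at \<A> (chart_inv c (\<nu> w))" using c V(1)[OF w] by (simp add: charts_at_iff)
    then show "\<exists>b\<in>charts_at eucl w. \<exists>d\<in>charts_at \<A> (chart_inv c (\<nu> w)). \<exists>W F. open W \<and> snd b w \<in> W \<and> W \<subseteq> snd b ` fst b \<and> smooth_on W F \<and>
        (\<forall>q\<in>U \<inter> fst b. snd b q \<in> W \<longrightarrow> chart_inv c (\<nu> q) \<in> fst d \<and> snd d (chart_inv c (\<nu> q)) = F (snd b q))"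
      using U w V(1,3) by (intro bexI[of _ "(UNIV, id)"] bexI[of _ c] exI[of _ U] exI[of _ \<nu>]) auto
  qed
  have "smooth_map eucl (?\<kappa> ` ?V) \<A> (inv_into ?V ?\<kappa>)"
    unfolding img
  proof (rule smooth_map_cong[OF s2])
    fix w assume "w \<in> U"
    then show "chart_inv c (\<nu> w) = inv_into ?V ?\<kappa> w"
      using V[of w] by (intro inv_into_f_eq[OF inj, symmetric]) auto
  qed
  then show ?thesis
    using op inj s1 U(1) img by (simp add: submanifold_atlas_def)
qed

text \<open>
  The rational parametrisation of the unit circle by stereographic projection from \<open>(-1, 0)\<close>. The
  inverse map is \<open>(a, b) \<mapsto> b / (1 + a)\<close>.
\<close>

definition st_cos :: "real \<Rightarrow> real" where "st_cos s = (1 - s\<^sup>2) / (1 + s\<^sup>2)"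
definition st_sin :: "real \<Rightarrow> real" where "st_sin s = 2 * s / (1 + s\<^sup>2)"

lemma one_plus_square_pos: "1 + (s::real)\<^sup>2 > 0"
  by (simp add: add_pos_nonneg)

lemma st_circle: "(st_cos s)\<^sup>2 + (st_sin s)\<^sup>2 = 1"
proof -
  have "(1 - s\<^sup>2)\<^sup>2 + (2 * s)\<^sup>2 = (1 + s\<^sup>2)\<^sup>2" by (simp add: power2_eq_square algebra_simps)
  then show ?thesis
    using one_plus_square_pos[of s] by (simp add: st_cos_def st_sin_def power_divide add_divide_distrib[symmetric])
qed

lemma st_inverse1: "1 + st_cos s \<noteq> 0" "st_sin s / (1 + st_cos s) = s"
proof -
  have *: "1 + st_cos s = 2 / (1 + s\<^sup>2)"
    using one_plus_square_pos[of s] by (simp add: st_cos_def field_simps)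
  show "1 + st_cos s \<noteq> 0" unfolding * using one_plus_square_pos[of s] by simp
  show "st_sin s / (1 + st_cos s) = s" unfolding * st_sin_def using one_plus_square_pos[of s] by simp
qed

lemma st_inverse2:
  assumes "a\<^sup>2 + b\<^sup>2 = (1::real)" "1 + a \<noteq> 0"
  shows "st_cos (b / (1 + a)) = a" "st_sin (b / (1 + a)) = b"
proof -
  have b: "b\<^sup>2 = (1 + a) * (1 - a)" using assms(1) by (simp add: power2_eq_square algebra_simps)
  have s: "(b / (1 + a))\<^sup>2 = (1 - a) / (1 + a)"
    unfolding power_divide b using assms(2) by (simp add: power2_eq_square)
  have d: "1 + (b / (1 + a))\<^sup>2 = 2 / (1 + a)" unfolding s using assms(2) by (simp add: field_simps)
  have n: "1 - (b / (1 + a))\<^sup>2 = 2 * a / (1 + a)" unfolding s using assms(2) by (simp add: field_simps)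
  show "st_cos (b / (1 + a)) = a" unfolding st_cos_def d n using assms(2) by simp
  show "st_sin (b / (1 + a)) = b" unfolding st_sin_def d using assms(2) by simp
qed

lemma smooth_st: "open S \<Longrightarrow> smooth_on S f \<Longrightarrow> smooth_on S (\<lambda>x. st_cos (f x))" "open S \<Longrightarrow> smooth_on S f \<Longrightarrow> smooth_on S (\<lambda>x. st_sin (f x))"
proof -
  have nz: "1 + r * r \<noteq> 0" for r :: real using one_plus_square_pos[of r] by (simp add: power2_eq_square)
  show "open S \<Longrightarrow> smooth_on S f \<Longrightarrow> smooth_on S (\<lambda>x. st_cos (f x))" "open S \<Longrightarrow> smooth_on S f \<Longrightarrow> smooth_on S (\<lambda>x. st_sin (f x))"
    unfolding st_cos_def st_sin_def power2_eq_square by (intro smooth_intros nz | assumption)+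
qed

context surface_pair begin

text \<open>
  The linear map that takes the orthonormal frame at \<open>a\<close> to the frame at \<open>q\<close> turned by the angle with
  cosine \<open>\<alpha>\<close> and sine \<open>\<beta>\<close>.
\<close>

definition rot where
  "rot c d a q \<alpha> \<beta> u = S1.G c a u (S1.frame1 c a) *\<^sub>R (\<alpha> *\<^sub>R S2.frame1 d q + \<beta> *\<^sub>R S2.frame2 d q)
    + S1.G c a u (S1.frame2 c a) *\<^sub>R ((- \<beta>) *\<^sub>R S2.frame1 d q + \<alpha> *\<^sub>R S2.frame2 d q)"

definition iso_mat where
  "iso_mat c d a q B \<longleftrightarrow> (\<forall>u v. S2.G d q (B *v u) (B *v v) = S1.G c a u v) \<and> det B > 0"

text \<open>
  The coordinates of the image of the first frame vector; for the matrix of an oriented isometry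
  they are the cosine and the sine of its angle.
\<close>

definition cos_coord where "cos_coord c d z = S2.G d (fst (snd z)) (snd (snd z) *v S1.frame1 c (fst z)) (S2.frame1 d (fst (snd z)))"
definition sin_coord where "sin_coord c d z = S2.G d (fst (snd z)) (snd (snd z) *v S1.frame1 c (fst z)) (S2.frame2 d (fst (snd z)))"

context
  fixes c d a q assumes c: "c \<in> \<A>" and a: "a \<in> snd c ` fst c" and d: "d \<in> \<B>" and q: "q \<in> snd d ` fst d"
begin

lemma linear_rot: "linear (rot c d a q \<alpha> \<beta>)"
  by (rule linearI) (simp_all add: rot_def S1.G_lin_simps[OF c a] algebra_simps)

lemma rot_frame:
  "rot c d a q \<alpha> \<beta> (S1.frame1 c a) = \<alpha> *\<^sub>R S2.frame1 d q + \<beta> *\<^sub>R S2.frame2 d q"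
  "rot c d a q \<alpha> \<beta> (S1.frame2 c a) = (- \<beta>) *\<^sub>R S2.frame1 d q + \<alpha> *\<^sub>R S2.frame2 d q"
  by (simp_all add: rot_def S1.frame_orthonormal[OF c a])

lemma S2_G_combination:
  "S2.G d q (r *\<^sub>R S2.frame1 d q + s *\<^sub>R S2.frame2 d q) (r' *\<^sub>R S2.frame1 d q + s' *\<^sub>R S2.frame2 d q) = r * r' + s * s'"
  by (simp add: S2.G_lin_simps[OF d q] S2.frame_orthonormal[OF d q])

lemma iso_mat_rot:
  assumes "\<alpha>\<^sup>2 + \<beta>\<^sup>2 = 1" shows "iso_mat c d a q (matrix (rot c d a q \<alpha> \<beta>))"
  unfolding iso_mat_def
proof (intro conjI allI)
  let ?B = "matrix (rot c d a q \<alpha> \<beta>)"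
  have B: "?B *v u = rot c d a q \<alpha> \<beta> u" for u by (rule matrix_works_real[OF linear_rot])
  fix u v
  let ?u1 = "S1.G c a u (S1.frame1 c a)" and ?u2 = "S1.G c a u (S1.frame2 c a)"
  let ?v1 = "S1.G c a v (S1.frame1 c a)" and ?v2 = "S1.G c a v (S1.frame2 c a)"
  have r: "rot c d a q \<alpha> \<beta> u = (?u1 * \<alpha> - ?u2 * \<beta>) *\<^sub>R S2.frame1 d q + (?u1 * \<beta> + ?u2 * \<alpha>) *\<^sub>R S2.frame2 d q"
    "rot c d a q \<alpha> \<beta> v = (?v1 * \<alpha> - ?v2 * \<beta>) *\<^sub>R S2.frame1 d q + (?v1 * \<beta> + ?v2 * \<alpha>) *\<^sub>R S2.frame2 d q"
    by (simp_all add: rot_def algebra_simps)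
  have "S2.G d q (rot c d a q \<alpha> \<beta> u) (rot c d a q \<alpha> \<beta> v) = (\<alpha>\<^sup>2 + \<beta>\<^sup>2) * (?u1 * ?v1 + ?u2 * ?v2)"
    unfolding r S2_G_combination by (simp add: power2_eq_square algebra_simps)
  also have "\<dots> = S1.G c a u v"
  proof -
    have "S1.G c a u v = S1.G c a (?u1 *\<^sub>R S1.frame1 c a + ?u2 *\<^sub>R S1.frame2 c a) v"
      using S1.frame_expand[OF c a, of u] by simp
    also have "\<dots> = ?u1 * ?v1 + ?u2 * ?v2"
      by (simp add: S1.G_lin_simps[OF c a] S1.G_sym[OF c a, of _ v])
    finally show ?thesis using assms by simp
  qed
  finally show "S2.G d q (?B *v u) (?B *v v) = S1.G c a u v" by (simp add: B)
  have "det ?B * cross2 (S1.frame1 c a) (S1.frame2 c a) = (\<alpha> * \<alpha> - \<beta> * (- \<beta>)) * cross2 (S2.frame1 d q) (S2.frame2 d q)"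
    unfolding cross2_matrix[symmetric] B rot_frame cross2_combination ..
  also have "\<dots> > 0" using assms S2.cross2_frame[OF d q] by (simp add: power2_eq_square)
  finally show "det ?B > 0" using S1.cross2_frame[OF c a] by (simp add: zero_less_mult_iff)
qed

text \<open>
  With respect to the orthonormal frames the columns \<open>(\<alpha>, \<beta>)\<close> and \<open>(\<gamma>, \<delta>)\<close> of \<open>B\<close> are orthonormal, so
  their determinant is \<open>1\<close> or \<open>-1\<close>. If it is \<open>1\<close>, then
  \<open>(\<gamma> + \<beta>)\<^sup>2 + (\<delta> - \<alpha>)\<^sup>2 = 2 - 2 (\<alpha> \<delta> - \<beta> \<gamma>) = 0\<close>, which makes \<open>B\<close> a rotation.
\<close>

lemma isometry_det:
  assumes iso: "\<And>u v. S2.G d q (B *v u) (B *v v) = S1.G c a u v"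
  shows "det B \<noteq> 0"
    and "det B > 0 \<Longrightarrow> (cos_coord c d (a, q, B))\<^sup>2 + (sin_coord c d (a, q, B))\<^sup>2 = 1"
    and "det B > 0 \<Longrightarrow> B = matrix (rot c d a q (cos_coord c d (a, q, B)) (sin_coord c d (a, q, B)))"
proof -
  let ?f1 = "S1.frame1 c a" and ?f2 = "S1.frame2 c a" and ?h1 = "S2.frame1 d q" and ?h2 = "S2.frame2 d q"
  define \<alpha> \<beta> where "\<alpha> = S2.G d q (B *v ?f1) ?h1" and "\<beta> = S2.G d q (B *v ?f1) ?h2"
  define \<gamma> \<delta> where "\<gamma> = S2.G d q (B *v ?f2) ?h1" and "\<delta> = S2.G d q (B *v ?f2) ?h2"
  have B1: "B *v ?f1 = \<alpha> *\<^sub>R ?h1 + \<beta> *\<^sub>R ?h2" and B2: "B *v ?f2 = \<gamma> *\<^sub>R ?h1 + \<delta> *\<^sub>R ?h2"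
    unfolding \<alpha>_def \<beta>_def \<gamma>_def \<delta>_def by (rule S2.frame_expand[OF d q])+
  have n: "\<alpha> * \<alpha> + \<beta> * \<beta> = 1" "\<gamma> * \<gamma> + \<delta> * \<delta> = 1" "\<alpha> * \<gamma> + \<beta> * \<delta> = 0"
    using iso[of ?f1 ?f1] iso[of ?f2 ?f2] iso[of ?f1 ?f2]
    unfolding B1 B2 S2_G_combination S1.frame_orthonormal[OF c a] by auto
  have det: "det B * cross2 ?f1 ?f2 = (\<alpha> * \<delta> - \<beta> * \<gamma>) * cross2 ?h1 ?h2"
    unfolding cross2_matrix[symmetric] B1 B2 cross2_combination ..
  have "(\<alpha> * \<delta> - \<beta> * \<gamma>)\<^sup>2 + (\<alpha> * \<gamma> + \<beta> * \<delta>)\<^sup>2 = (\<alpha> * \<alpha> + \<beta> * \<beta>) * (\<gamma> * \<gamma> + \<delta> * \<delta>)"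
    by (simp add: power2_eq_square algebra_simps)
  then have sq: "(\<alpha> * \<delta> - \<beta> * \<gamma>)\<^sup>2 = 1" using n by simp
  then have "\<alpha> * \<delta> - \<beta> * \<gamma> \<noteq> 0" by auto
  then show "det B \<noteq> 0" using det S2.cross2_frame[OF d q] by auto
  have ab: "cos_coord c d (a, q, B) = \<alpha>" "sin_coord c d (a, q, B) = \<beta>"
    by (simp_all add: cos_coord_def sin_coord_def \<alpha>_def \<beta>_def)
  assume "det B > 0"
  show "(cos_coord c d (a, q, B))\<^sup>2 + (sin_coord c d (a, q, B))\<^sup>2 = 1"
    unfolding ab using n(1) by (simp add: power2_eq_square)
  have "(\<alpha> * \<delta> - \<beta> * \<gamma>) * cross2 ?h1 ?h2 > 0" unfolding det[symmetric] using \<open>det B > 0\<close> S1.cross2_frame[OF c a] by simp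
  then have "\<alpha> * \<delta> - \<beta> * \<gamma> > 0" using S2.cross2_frame[OF d q] zero_less_mult_pos2 by blast
  then have one: "\<alpha> * \<delta> - \<beta> * \<gamma> = 1" using sq by (simp add: power2_eq_1_iff)
  have "(\<gamma> + \<beta>)\<^sup>2 + (\<delta> - \<alpha>)\<^sup>2 = (\<gamma> * \<gamma> + \<delta> * \<delta>) + (\<alpha> * \<alpha> + \<beta> * \<beta>) - 2 * (\<alpha> * \<delta> - \<beta> * \<gamma>)"
    by (simp add: power2_eq_square algebra_simps)
  then have "(\<gamma> + \<beta>)\<^sup>2 + (\<delta> - \<alpha>)\<^sup>2 = 0" using n one by simp
  then have gd: "\<gamma> = - \<beta>" "\<delta> = \<alpha>" by (simp_all add: sum_power2_eq_zero_iff)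
  have "B *v u = rot c d a q \<alpha> \<beta> u" for u
  proof -
    have "B *v u = B *v (S1.G c a u ?f1 *\<^sub>R ?f1 + S1.G c a u ?f2 *\<^sub>R ?f2)"
      using S1.frame_expand[OF c a, of u] by simp
    also have "\<dots> = rot c d a q \<alpha> \<beta> u"
      by (simp add: matrix_vector_right_distrib matrix_vector_mult_scaleR B1 B2 gd rot_def)
    finally show ?thesis .
  qed
  then have "B = matrix (rot c d a q \<alpha> \<beta>)"
    by (simp add: matrix_eq matrix_works_real[OF linear_rot])
  then show "B = matrix (rot c d a q (cos_coord c d (a, q, B)) (sin_coord c d (a, q, B)))" unfolding ab .
qed

lemma coords_rot:
  "cos_coord c d (a, q, matrix (rot c d a q \<alpha> \<beta>)) = \<alpha>" "sin_coord c d (a, q, matrix (rot c d a q \<alpha> \<beta>)) = \<beta>"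
  by (simp_all add: cos_coord_def sin_coord_def matrix_works_real[OF linear_rot] rot_frame S2.G_lin_simps[OF d q] S2.frame_orthonormal[OF d q])

end

abbreviation "CS \<equiv> config_space \<A> g1 \<B> g2"
abbreviation "CA \<equiv> config_atlas \<A> g1 \<B> g2"

text \<open>
  For the orientation it is enough to test the coordinate frame, since any other frame changes
  both determinants by the same factor.
\<close>

lemma config_space_iff:
  assumes A: "(x, y, A) \<in> HB" and c: "c \<in> charts_at \<A> x" and d: "d \<in> charts_at \<B> y"
  shows "(x, y, A) \<in> CS \<longleftrightarrow> iso_mat c d (snd c x) (snd d y) (mat c d x A)"
proof -
  let ?B = "mat c d x A" and ?co = "coord_tvec \<A> c x"
  have metric: "g2 y (A u) (A v) = S2.G d (snd d y) (?B *v u c) (?B *v v c)" if "u \<in> S1.T x" "v \<in> S1.T x" for u v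
    using S2.metric_eq_G[OF d hom_bundleD(3)[OF A that(1)] hom_bundleD(3)[OF A that(2)]] by (simp add: mat_works[OF A c] that)
  have iso: "(\<forall>u\<in>S1.T x. \<forall>v\<in>S1.T x. g2 y (A u) (A v) = g1 x u v) \<longleftrightarrow>
      (\<forall>u v. S2.G d (snd d y) (?B *v u) (?B *v v) = S1.G c (snd c x) u v)" (is "?L \<longleftrightarrow> ?R")
  proof
    assume L: ?L
    show ?R
    proof (intro allI)
      fix u v
      have i: "?co u \<in> S1.T x" "?co v \<in> S1.T x" using coord_tvec_in[OF S1.compat c] by auto
      show "S2.G d (snd d y) (?B *v u) (?B *v v) = S1.G c (snd c x) u v"
        using L i metric[OF i] S1.metric_eq_G[OF c i] by (simp add: coord_tvec_self[OF S1.compat c])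
    qed
  next
    assume ?R then show ?L using metric S1.metric_eq_G[OF c] by simp
  qed
  have frame: "det (\<chi> i j. A (e j) d $ i) = det ?B * det (\<chi> i j. e j c $ i)" if "\<And>i. e i \<in> S1.T x" for e :: "2 \<Rightarrow> _"
  proof -
    have "(\<chi> i j. A (e j) d $ i) = ?B ** (\<chi> i j. e j c $ i)"
      by (simp add: vec_eq_iff matrix_matrix_mult_def mat_works[OF A c that] matrix_vector_mult_def)
    then show ?thesis by (simp add: det_mul)
  qed
  have ori: "(\<forall>e. oriented_frame \<A> x e \<longrightarrow> oriented_frame \<B> y (\<lambda>i. A (e i))) \<longleftrightarrow> det ?B > 0"
  proof
    assume L: "\<forall>e. oriented_frame \<A> x e \<longrightarrow> oriented_frame \<B> y (\<lambda>i. A (e i))"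
    let ?e = "\<lambda>j::2. ?co (axis j 1)"
    have e: "?e i \<in> S1.T x" for i by (rule coord_tvec_in[OF S1.compat c])
    have "(\<chi> i j. ?e j c $ i) = Finite_Cartesian_Product.mat 1"
      by (simp add: coord_tvec_self[OF S1.compat c] vec_eq_iff Finite_Cartesian_Product.mat_def axis_def)
    then have 1: "det (\<chi> i j. ?e j c $ i) = 1" by simp
    then have "oriented_frame \<A> x ?e" using S1.oriented_frame_iff[OF _ _ e c] by simp
    then have "oriented_frame \<B> y (\<lambda>i. A (?e i))" using L by blast
    then have "det (\<chi> i j. A (?e j) d $ i) > 0" using d by (simp add: oriented_frame_def)
    then show "det ?B > 0" unfolding frame[OF e] 1 by simp
  next
    assume pos: "det ?B > 0"
    show "\<forall>e. oriented_frame \<A> x e \<longrightarrow> oriented_frame \<B> y (\<lambda>i. A (e i))"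
    proof (intro allI impI)
      fix e assume e: "oriented_frame \<A> x e"
      then have i: "\<And>i. e i \<in> S1.T x" and p: "det (\<chi> i j. e j c $ i) > 0" using c by (auto simp: oriented_frame_def)
      show "oriented_frame \<B> y (\<lambda>i. A (e i))"
        using S2.oriented_frame_iff[OF _ _ hom_bundleD(3)[OF A i] d] frame[OF i] pos p by simp
    qed
  qed
  show ?thesis using A iso ori by (simp add: config_space_def iso_mat_def)
qed

lemma config_space_subset: "CS \<subseteq> HB"
  by (auto simp: config_space_def)

lemma isometry_config_iff:
  assumes A: "(x, y, A) \<in> HB" and c: "c \<in> charts_at \<A> x" and d: "d \<in> charts_at \<B> y"
    and iso: "\<And>u v. u \<in> S1.T x \<Longrightarrow> v \<in> S1.T x \<Longrightarrow> g2 y (A u) (A v) = g1 x u v"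
  shows "(x, y, A) \<in> CS \<longleftrightarrow> det (mat c d x A) > 0" "det (mat c d x A) \<noteq> 0"
proof -
  let ?B = "mat c d x A"
  have isoB: "S2.G d (snd d y) (?B *v u) (?B *v v) = S1.G c (snd c x) u v" for u v
  proof -
    let ?u = "coord_tvec \<A> c x u" and ?v = "coord_tvec \<A> c x v"
    have i: "?u \<in> S1.T x" "?v \<in> S1.T x" by (rule coord_tvec_in[OF S1.compat c])+
    show ?thesis
      using iso[OF i] S1.metric_eq_G[OF c i] S2.metric_eq_G[OF d hom_bundleD(3)[OF A i(1)] hom_bundleD(3)[OF A i(2)]]
      by (simp add: mat_works[OF A c] i coord_tvec_self[OF S1.compat c])
  qed
  show "(x, y, A) \<in> CS \<longleftrightarrow> det (mat c d x A) > 0" using config_space_iff[OF A c d] isoB by (simp add: iso_mat_def)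
  show "det (mat c d x A) \<noteq> 0" by (rule isometry_det(1)[OF S1.chart_point[OF c] S2.chart_point[OF d] isoB])
qed

lemma config_iso: "(x, y, A) \<in> CS \<Longrightarrow> u \<in> S1.T x \<Longrightarrow> v \<in> S1.T x \<Longrightarrow> g2 y (A u) (A v) = g1 x u v"
  by (auto simp: config_space_def)

lemma dim5: "\<exists>J :: (real^2) \<times> (real^2) \<times> real \<Rightarrow> real^5. linear J \<and> bij J"
proof -
  have "dim (UNIV :: ((real^2) \<times> (real^2) \<times> real) set) = dim (UNIV :: (real^5) set)"
    by (simp add: dim_UNIV)
  then obtain J :: "(real^2) \<times> (real^2) \<times> real \<Rightarrow> real^5" where J: "linear J" "J ` UNIV = UNIV" "inj J"
    using subspace_isomorphism[of "UNIV :: ((real^2) \<times> (real^2) \<times> real) set" "UNIV :: (real^5) set"] by auto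
  then show ?thesis by (intro exI[of _ J]) (auto simp: bij_def)
qed

text \<open>
  A configuration close to a given one is described by the coordinates of its two points and the
  stereographic parameter of its angle. The angle is measured from that of the given
  configuration, because the parameter degenerates at the angle \<open>\<pi>\<close>. The isomorphism \<open>J\<close> merely
  renames the parameter space to \<open>real^5\<close>.
\<close>

lemma config_chart_exists:
  assumes p: "(x, y, A) \<in> CS"
  shows "\<exists>C\<in>CA. (x, y, A) \<in> fst C"
proof -
  have A: "(x, y, A) \<in> HB" using p config_space_subset by blast
  obtain c where cx: "c \<in> charts_at \<A> x" using hom_bundleD(1)[OF A] by (auto simp: mcarrier_charts_at)
  obtain d where dy: "d \<in> charts_at \<B> y" using hom_bundleD(2)[OF A] by (auto simp: mcarrier_charts_at)
  have c: "c \<in> \<A>" "x \<in> fst c" and d: "d \<in> \<B>" "y \<in> fst d" using cx dy by (auto simp: charts_at_iff)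
  obtain J :: "(real^2) \<times> (real^2) \<times> real \<Rightarrow> real^5" where J: "linear J" "bij J" using dim5 by blast
  define K where "K = inv J"
  have K: "linear K" "K (J z) = z" "J (K w) = w" for z w
    using linear_inv_bij[OF J] bij_is_inj[OF J(2)] surj_f_inv_f[OF bij_is_surj[OF J(2)]] by (auto simp: K_def)
  let ?C = "hom_chart \<A> \<B> c d"
  let ?D = "(snd c ` fst c) \<times> (snd d ` fst d) \<times> (UNIV :: (real^2^2) set)"
  let ?z0 = "snd ?C (x, y, A)"
  define \<alpha>0 \<beta>0 where "\<alpha>0 = cos_coord c d ?z0" and "\<beta>0 = sin_coord c d ?z0"
  \<comment> \<open>Cosine and sine of the relative angle, by the addition theorems.\<close>
  define cc where "cc = (\<lambda>z. cos_coord c d z * \<alpha>0 + sin_coord c d z * \<beta>0)"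
  define ss where "ss = (\<lambda>z. sin_coord c d z * \<alpha>0 - cos_coord c d z * \<beta>0)"
  have CH: "?C \<in> H" using c d unfolding hom_atlas_def by blast
  have dom: "snd ?C ` fst ?C = ?D"
    unfolding fst_hom_chart_eq by (rule hom_chart_image[OF c(1) d(1)]) auto
  have oD: "open ?D" by (intro open_Times S1.open_dom S2.open_dom c d open_UNIV)
  have iso0: "iso_mat c d (snd c x) (snd d y) (mat c d x A)" using config_space_iff[OF A cx dy] p by simp
  have ab0: "\<alpha>0 * \<alpha>0 + \<beta>0 * \<beta>0 = 1"
    using isometry_det(2)[OF c(1) imageI[OF c(2)] d(1) imageI[OF d(2)]] iso0
    by (simp add: iso_mat_def \<alpha>0_def \<beta>0_def snd_hom_chart power2_eq_square)
  have sm: "smooth_on ?D (cos_coord c d)" "smooth_on ?D (sin_coord c d)"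
    unfolding cos_coord_def[abs_def] sin_coord_def[abs_def]
    by (intro S2.smooth_G_apply[OF d(1) oD] smooth_on_matrix_vector S1.smooth_frame_apply[OF c(1) oD] S2.smooth_frame_apply[OF d(1) oD]
        smooth_on_fst smooth_on_snd smooth_on_id oD; force)+
  have sm': "smooth_on ?D cc" "smooth_on ?D ss"
    unfolding cc_def ss_def by (intro smooth_on_add smooth_on_diff smooth_on_mult smooth_on_const sm oD)+
  \<comment> \<open>All configurations over the two charts except those at the relative angle \<open>\<pi>\<close>.\<close>
  define W where "W = ?D \<inter> (\<lambda>z. 1 + cc z) -` (- {0})"
  have oW: "open W"
    unfolding W_def by (rule smooth_open_vimage[OF smooth_on_add[OF oD smooth_on_const[OF oD] sm'(1)] oD]) auto
  define F where "F = (\<lambda>z. J (fst z, fst (snd z), ss z / (1 + cc z)))"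
  have sF: "smooth_on W F"
    unfolding F_def
    by (intro smooth_on_linear_comp'[OF J(1) oW] smooth_on_Pair smooth_on_divide smooth_on_add smooth_on_fst smooth_on_snd smooth_on_const
        smooth_on_id smooth_on_subset[OF sm'(1)] smooth_on_subset[OF sm'(2)] oW) (auto simp: W_def)
  define U where "U = K -` ((snd c ` fst c) \<times> (snd d ` fst d) \<times> UNIV)"
  have oU: "open U"
    unfolding U_def by (rule open_vimage) (use K(1) S1.open_dom S2.open_dom c d in
        \<open>auto intro!: open_Times linear_continuous_on simp: linear_conv_bounded_linear\<close>)
  define B where "B = (\<lambda>a q s. matrix (rot c d a q (st_cos s * \<alpha>0 - st_sin s * \<beta>0) (st_cos s * \<beta>0 + st_sin s * \<alpha>0)))"
  define \<nu> where "\<nu> = (\<lambda>w. (fst (K w), fst (snd (K w)), B (fst (K w)) (fst (snd (K w))) (snd (snd (K w)))))"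
  have sK: "smooth_on U K" by (rule smooth_on_linear[OF K(1) oU])
  have KU: "(\<lambda>w. fst (K w)) ` U \<subseteq> snd c ` fst c" "(\<lambda>w. fst (snd (K w))) ` U \<subseteq> snd d ` fst d" by (auto simp: U_def)
  have sf: "smooth_on U (\<lambda>w. fst (K w))" "smooth_on U (\<lambda>w. fst (snd (K w)))" "smooth_on U (\<lambda>w. snd (snd (K w)))"
    by (intro smooth_on_fst smooth_on_snd sK oU)+
  have s\<nu>: "smooth_on U \<nu>"
    unfolding \<nu>_def B_def rot_def
    by (intro smooth_on_Pair smooth_on_matrix smooth_on_add smooth_on_diff smooth_on_scaleR smooth_on_mult smooth_on_minus smooth_st
        S1.smooth_G_apply[OF c(1) oU sf(1) KU(1)] S1.smooth_frame_apply[OF c(1) oU sf(1) KU(1)] S2.smooth_frame_apply[OF d(1) oU sf(2) KU(2)]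
        smooth_on_const sf oU)
  have circ: "(st_cos s * \<alpha>0 - st_sin s * \<beta>0)\<^sup>2 + (st_cos s * \<beta>0 + st_sin s * \<alpha>0)\<^sup>2 = 1" for s
  proof -
    have "(st_cos s * \<alpha>0 - st_sin s * \<beta>0)\<^sup>2 + (st_cos s * \<beta>0 + st_sin s * \<alpha>0)\<^sup>2
      = ((st_cos s)\<^sup>2 + (st_sin s)\<^sup>2) * (\<alpha>0 * \<alpha>0 + \<beta>0 * \<beta>0)" by (simp add: power2_eq_square algebra_simps)
    then show ?thesis using st_circle ab0 by simp
  qed
  have ccB: "cc (a, q, B a q s) = st_cos s" "ss (a, q, B a q s) = st_sin s"
    if "a \<in> snd c ` fst c" "q \<in> snd d ` fst d" for a q s
  proof -
    have "cc (a, q, B a q s) = st_cos s * (\<alpha>0 * \<alpha>0 + \<beta>0 * \<beta>0)" "ss (a, q, B a q s) = st_sin s * (\<alpha>0 * \<alpha>0 + \<beta>0 * \<beta>0)"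
      unfolding cc_def ss_def B_def coords_rot[OF c(1) that(1) d(1) that(2)] by (simp_all add: algebra_simps)
    then show "cc (a, q, B a q s) = st_cos s" "ss (a, q, B a q s) = st_sin s" using ab0 by auto
  qed
  have "(CS \<inter> (fst ?C \<inter> snd ?C -` W), \<lambda>p. F (snd ?C p)) \<in> submanifold_atlas H CS"
  proof (rule submanifold_chartI[OF compatible_hom CH oW _ sF oU s\<nu>])
    show "W \<subseteq> snd ?C ` fst ?C" unfolding dom W_def by blast
  next
    fix p' assume p': "p' \<in> CS" "p' \<in> fst ?C" "snd ?C p' \<in> W"
    obtain x' y' A' where e: "p' = (x', y', A')" by (cases p') auto
    have A': "(x', y', A') \<in> HB" and xy: "x' \<in> fst c" "y' \<in> fst d" using p' unfolding e fst_hom_chart by auto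
    have ch: "c \<in> charts_at \<A> x'" "d \<in> charts_at \<B> y'" using c d xy by (auto simp: charts_at_iff)
    have z: "snd ?C p' = (snd c x', snd d y', mat c d x' A')" unfolding e by (rule snd_hom_chart)
    have iso: "iso_mat c d (snd c x') (snd d y') (mat c d x' A')" using config_space_iff[OF A' ch] p'(1) e by simp
    note I = isometry_det(2,3)[OF c(1) imageI[OF xy(1)] d(1) imageI[OF xy(2)], of "mat c d x' A'", folded z]
    have I: "(cos_coord c d (snd ?C p'))\<^sup>2 + (sin_coord c d (snd ?C p'))\<^sup>2 = 1"
      "mat c d x' A' = matrix (rot c d (snd c x') (snd d y') (cos_coord c d (snd ?C p')) (sin_coord c d (snd ?C p')))"
      using I iso by (auto simp: iso_mat_def)
    let ?a = "cos_coord c d (snd ?C p')" and ?b = "sin_coord c d (snd ?C p')"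
    have "(cc (snd ?C p'))\<^sup>2 + (ss (snd ?C p'))\<^sup>2 = (?a\<^sup>2 + ?b\<^sup>2) * (\<alpha>0 * \<alpha>0 + \<beta>0 * \<beta>0)"
      by (simp add: cc_def ss_def power2_eq_square algebra_simps)
    then have "(cc (snd ?C p'))\<^sup>2 + (ss (snd ?C p'))\<^sup>2 = 1" using I(1) ab0 by simp
    note st = st_inverse2[OF this]
    have ne: "1 + cc (snd ?C p') \<noteq> 0" using p'(3) by (simp add: W_def)
    define s where "s = ss (snd ?C p') / (1 + cc (snd ?C p'))"
    have st: "st_cos s = cc (snd ?C p')" "st_sin s = ss (snd ?C p')" using st[OF ne] by (auto simp: s_def)
    have "st_cos s * \<alpha>0 - st_sin s * \<beta>0 = ?a * (\<alpha>0 * \<alpha>0 + \<beta>0 * \<beta>0)" "st_cos s * \<beta>0 + st_sin s * \<alpha>0 = ?b * (\<alpha>0 * \<alpha>0 + \<beta>0 * \<beta>0)"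
      unfolding st cc_def ss_def by (simp_all add: algebra_simps)
    then have ab: "st_cos s * \<alpha>0 - st_sin s * \<beta>0 = ?a" "st_cos s * \<beta>0 + st_sin s * \<alpha>0 = ?b" using ab0 by auto
    have Fp: "F (snd ?C p') = J (snd c x', snd d y', s)" by (simp add: F_def s_def[symmetric]) (simp add: z)
    show "F (snd ?C p') \<in> U \<and> \<nu> (F (snd ?C p')) = snd ?C p'"
      unfolding Fp U_def \<nu>_def using xy by (simp add: K(2) B_def ab I(2)[symmetric]) (simp add: z)
  next
    fix w assume w: "w \<in> U"
    obtain a q s where Kw: "K w = (a, q, s)" by (cases "K w") auto
    have aq: "a \<in> snd c ` fst c" "q \<in> snd d ` fst d" using w Kw by (auto simp: U_def)
    have \<nu>w: "\<nu> w = (a, q, B a q s)" by (simp add: \<nu>_def Kw)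
    have 1: "\<nu> w \<in> W" using aq ccB[OF aq] st_inverse1(1)[of s] by (simp add: W_def \<nu>w)
    obtain x' y' where xy: "a = snd c x'" "x' \<in> fst c" "q = snd d y'" "y' \<in> fst d" using aq by auto
    have ch: "c \<in> charts_at \<A> x'" "d \<in> charts_at \<B> y'" using c d xy by (auto simp: charts_at_iff)
    have 2: "chart_inv ?C (\<nu> w) \<in> CS"
      unfolding \<nu>w xy(1,3) chart_inv_hom[OF c(1) d(1) xy(2,4)] config_space_iff[OF hom_of_in[OF ch] ch] mat_hom_of[OF ch]
      unfolding B_def by (rule iso_mat_rot[OF c(1) _ d(1) _ circ]) (use xy in auto)
    have "F (\<nu> w) = J (a, q, s)" unfolding F_def \<nu>w using ccB[OF aq] st_inverse1(2)[of s] by simp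
    then have 3: "F (\<nu> w) = w" using K(3)[of w] Kw by simp
    show "\<nu> w \<in> W \<and> chart_inv ?C (\<nu> w) \<in> CS \<and> F (\<nu> w) = w" using 1 2 3 by blast
  qed
  then show ?thesis
  proof (intro bexI)
    have "cc ?z0 = 1" unfolding cc_def using ab0 by (simp add: \<alpha>0_def \<beta>0_def)
    moreover have "?z0 \<in> ?D" using c d by (simp add: snd_hom_chart)
    ultimately show "(x, y, A) \<in> fst (CS \<inter> (fst ?C \<inter> snd ?C -` W), \<lambda>p. F (snd ?C p))"
      using p A c d by (simp add: W_def fst_hom_chart)
  qed (simp add: config_atlas_def)
qed

lemma mcarrier_config: "mcarrier CA = CS"
proof
  show "mcarrier CA \<subseteq> CS" unfolding config_atlas_def by (rule mcarrier_submanifold_subset[OF compatible_hom])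
  show "CS \<subseteq> mcarrier CA" using config_chart_exists unfolding mcarrier_def by (auto 0 3)
qed

lemma compatible_config: "compatible_atlas CA"
  unfolding config_atlas_def by (rule compatible_submanifold[OF compatible_hom])

section \<open>The map to null planes in charts\<close>

definition split4 :: "real^4 \<Rightarrow> (real^2) \<times> (real^2)" where "split4 z = (pr1 z, pr2 z)"

lemma split4: "linear split4" "bij split4" "inv split4 (a, b) = cat4 a b"
proof -
  show "linear split4" unfolding split4_def by (rule linearI) (simp_all add: linear_add[OF linear_pr1] linear_add[OF linear_pr2]
    linear_cmul[OF linear_pr1] linear_cmul[OF linear_pr2])
  have inj: "inj split4" by (rule inj_on_inverseI[of _ "\<lambda>(a, b). cat4 a b"]) (simp add: split4_def)
  moreover have "surj split4" by (rule surjI[of _ "\<lambda>(a, b). cat4 a b"]) (auto simp: split4_def)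
  ultimately show "bij split4" by (simp add: bij_def)
  show "inv split4 (a, b) = cat4 a b" by (rule inv_f_eq[OF inj]) (simp add: split4_def)
qed

abbreviation "PM \<equiv> plane_atlas M"
abbreviation "\<Psi> \<equiv> Psi \<A> \<B>"

lemma compatible_PM: "compatible_atlas PM"
  by (rule compatible_plane[OF compat])

lemma graph_plane_eq: "graph_plane \<A> \<B> (x, y, A) = {u \<in> TM (x, y). dp1 (x, y) u \<in> S1.T x \<and> dp2 (x, y) u = A (dp1 (x, y) u)}"
  by (auto simp: graph_plane_def)

lemma hom_mcarrier: "(x, y, A) \<in> HB \<Longrightarrow> (x, y) \<in> mcarrier M"
  using hom_bundleD(1,2) by (simp add: mcarrier_product)

lemma graph_planeI:
  assumes A: "(x, y, A) \<in> HB" and v: "v \<in> S1.T x"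
  shows "pairT x y v (A v) \<in> graph_plane \<A> \<B> (x, y, A)"
  using pairT[OF v hom_bundleD(3)[OF A v] hom_mcarrier[OF A]] v by (simp add: graph_plane_eq)

lemma graph_plane_is_graph:
  assumes A: "(x, y, A) \<in> HB" and c: "c \<in> charts_at \<A> x" and d: "d \<in> charts_at \<B> y"
  shows "is_graph_in (product_chart c d) split4 (graph_plane \<A> \<B> (x, y, A)) (mat c d x A)"
  unfolding is_graph_in_def
proof
  show "(\<lambda>u. split4 (u (product_chart c d))) ` graph_plane \<A> \<B> (x, y, A) \<subseteq> {(a, mat c d x A *v a) |a. True}"
  proof (rule image_subsetI)
    fix u assume "u \<in> graph_plane \<A> \<B> (x, y, A)"
    then have u: "u \<in> TM (x, y)" "dp1 (x, y) u \<in> S1.T x" "dp2 (x, y) u = A (dp1 (x, y) u)" by (auto simp: graph_plane_eq)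
    have "split4 (u (product_chart c d)) = (dp1 (x, y) u c, mat c d x A *v dp1 (x, y) u c)"
      unfolding tangent_product_eval[OF u(1) c d] split4_def pr_cat4 u(3) mat_works[OF A c u(2)] ..
    then show "split4 (u (product_chart c d)) \<in> {(a, mat c d x A *v a) |a. True}" by blast
  qed
  show "{(a, mat c d x A *v a) |a. True} \<subseteq> (\<lambda>u. split4 (u (product_chart c d))) ` graph_plane \<A> \<B> (x, y, A)"
  proof
    fix z assume "z \<in> {(a, mat c d x A *v a) |a. True}"
    then obtain a where a: "z = (a, mat c d x A *v a)" by blast
    let ?v = "coord_tvec \<A> c x a"
    have v: "?v \<in> S1.T x" "?v c = a" by (rule coord_tvec_in[OF S1.compat c], rule coord_tvec_self[OF S1.compat c])
    let ?u = "pairT x y ?v (A ?v)"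
    note u = pairT[OF v(1) hom_bundleD(3)[OF A v(1)] hom_mcarrier[OF A]]
    have "split4 (?u (product_chart c d)) = z"
      unfolding tangent_product_eval[OF u(1) c d] split4_def pr_cat4 u(2,3) mat_works[OF A c v(1)] v(2) a ..
    then show "z \<in> (\<lambda>u. split4 (u (product_chart c d))) ` graph_plane \<A> \<B> (x, y, A)"
      using graph_planeI[OF A v(1)] by (intro image_eqI[of _ _ ?u]) auto
  qed
qed

lemma graph_plane_tangent:
  assumes A: "(x, y, A) \<in> HB"
  shows "tangent_plane M (x, y) (graph_plane \<A> \<B> (x, y, A))"
proof -
  obtain c d where cd: "c \<in> charts_at \<A> x" "d \<in> charts_at \<B> y" by (rule mcarrier_productE[OF hom_mcarrier[OF A]])
  have "graph_plane \<A> \<B> (x, y, A) = graph_of M (product_chart c d) split4 (x, y) (mat c d x A)"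
    by (rule graph_of_eq[OF compat charts_at_productI[OF cd] split4(1,2) _ graph_plane_is_graph[OF A cd]]) (auto simp: graph_plane_eq)
  then show ?thesis using tangent_plane_graph_of[OF compat charts_at_productI[OF cd] split4(1,2)] by simp
qed

lemma Psi_eq: "\<Psi> (x, y, A) = ((x, y), graph_plane \<A> \<B> (x, y, A))"
  by (simp add: Psi_def)

text \<open>
  In corresponding charts of the two bundles the coordinates of a linear map and of its graph are
  the same, up to the order in which the pair of points is written.
\<close>

lemma Psi_chart:
  assumes A: "(x, y, A) \<in> HB" and c: "c \<in> charts_at \<A> x" and d: "d \<in> charts_at \<B> y"
  shows "plane_chart M (product_chart c d) split4 \<in> charts_at PM (\<Psi> (x, y, A))"
    and "snd (plane_chart M (product_chart c d) split4) (\<Psi> (x, y, A)) = (cat4 (snd c x) (snd d y), mat c d x A)"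
proof -
  have "product_chart c d \<in> M" using charts_at_productI[OF c d] by (simp add: charts_at_iff)
  then have "plane_chart M (product_chart c d) split4 \<in> PM" unfolding plane_atlas_def using split4(1,2) by blast
  moreover have "\<Psi> (x, y, A) \<in> fst (plane_chart M (product_chart c d) split4)"
    unfolding Psi_eq fst_plane_chart[OF compat]
    using c d graph_plane_tangent[OF A] graph_plane_is_graph[OF A c d] by (auto simp: fst_product_chart charts_at_iff)
  ultimately show "plane_chart M (product_chart c d) split4 \<in> charts_at PM (\<Psi> (x, y, A))" by (simp add: charts_at_iff)
  show "snd (plane_chart M (product_chart c d) split4) (\<Psi> (x, y, A)) = (cat4 (snd c x) (snd d y), mat c d x A)"
    unfolding Psi_eq snd_plane_chart[OF compat graph_plane_is_graph[OF A c d]] snd_product_chart ..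
qed

lemma inj_Psi: "inj_on \<Psi> HB"
proof (rule inj_onI)
  fix p p' assume p: "p \<in> HB" "p' \<in> HB" and eq: "\<Psi> p = \<Psi> p'"
  obtain x y A x' y' A' where e: "p = (x, y, A)" "p' = (x', y', A')" by (cases p, cases p') auto
  have xy: "x' = x" "y' = y" using eq unfolding e Psi_eq by auto
  have A: "(x, y, A) \<in> HB" "(x, y, A') \<in> HB" using p e xy by auto
  obtain c d where cd: "c \<in> charts_at \<A> x" "d \<in> charts_at \<B> y" by (rule mcarrier_productE[OF hom_mcarrier[OF A(1)]])
  have "mat c d x A = mat c d x A'"
    using Psi_chart(2)[OF A(1) cd] Psi_chart(2)[OF A(2) cd] eq unfolding e xy by simp
  then show "p = p'" using hom_eqI[OF A cd] e xy by simp
qed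

lemma smooth_Psi: "smooth_map H HB PM \<Psi>"
proof (rule smooth_mapI)
  fix p assume p: "p \<in> HB"
  obtain x y A where e: "p = (x, y, A)" by (cases p) auto
  note A = p[unfolded e]
  obtain c d where cd: "c \<in> charts_at \<A> x" "d \<in> charts_at \<B> y" by (rule mcarrier_productE[OF hom_mcarrier[OF A]])
  let ?C = "hom_chart \<A> \<B> c d" and ?D = "plane_chart M (product_chart c d) split4"
  have C: "?C \<in> charts_at H p" unfolding e by (rule charts_at_homI[OF A cd])
  have D: "?D \<in> charts_at PM (\<Psi> p)" unfolding e by (rule Psi_chart(1)[OF A cd])
  have o: "open (snd ?C ` fst ?C)" using compatible_atlas_open[OF compatible_hom] C by (simp add: charts_at_iff)
  show "\<exists>c\<in>charts_at H p. \<exists>d\<in>charts_at PM (\<Psi> p). \<exists>W F. open W \<and> snd c p \<in> W \<and> W \<subseteq> snd c ` fst c \<and> smooth_on W F \<and>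
      (\<forall>q\<in>HB \<inter> fst c. snd c q \<in> W \<longrightarrow> \<Psi> q \<in> fst d \<and> snd d (\<Psi> q) = F (snd c q))"
  proof (intro bexI[OF _ C] bexI[OF _ D] exI[of _ "snd ?C ` fst ?C"] exI[of _ "\<lambda>z. (cat4 (fst z) (fst (snd z)), snd (snd z))"] conjI o ballI impI)
    show "smooth_on (snd ?C ` fst ?C) (\<lambda>z. (cat4 (fst z) (fst (snd z)), snd (snd z)))"
      by (intro smooth_on_Pair smooth_on_cat4 smooth_on_fst smooth_on_snd smooth_on_id o)
    show "snd ?C p \<in> snd ?C ` fst ?C" using C by (simp add: charts_at_iff)
    fix p' assume p': "p' \<in> HB \<inter> fst ?C"
    obtain x' y' A' where e': "p' = (x', y', A')" by (cases p') auto
    have A': "(x', y', A') \<in> HB" and ch: "c \<in> charts_at \<A> x'" "d \<in> charts_at \<B> y'"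
      using p' cd unfolding e' by (auto simp: fst_hom_chart charts_at_iff)
    show "\<Psi> p' \<in> fst ?D" using Psi_chart(1)[OF A' ch] unfolding e' by (simp add: charts_at_iff)
    show "snd ?D (\<Psi> p') = (cat4 (fst (snd ?C p')) (fst (snd (snd ?C p'))), snd (snd (snd ?C p')))"
      unfolding e' Psi_chart(2)[OF A' ch] snd_hom_chart by simp
  qed simp
qed

lemma smooth_Psi_inv: "smooth_map PM (\<Psi> ` HB) H (inv_into HB \<Psi>)"
proof (rule smooth_mapI)
  fix q assume "q \<in> \<Psi> ` HB"
  then obtain p where p: "p \<in> HB" "q = \<Psi> p" by blast
  have inv: "inv_into HB \<Psi> (\<Psi> p) = p" if "p \<in> HB" for p by (rule inv_into_f_f[OF inj_Psi that])
  obtain x y A where e: "p = (x, y, A)" by (cases p) auto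
  note A = p(1)[unfolded e]
  obtain c d where cd: "c \<in> charts_at \<A> x" "d \<in> charts_at \<B> y" by (rule mcarrier_productE[OF hom_mcarrier[OF A]])
  let ?C = "hom_chart \<A> \<B> c d" and ?D = "plane_chart M (product_chart c d) split4"
  have invq: "inv_into HB \<Psi> q = p" unfolding p(2) by (rule inv[OF p(1)])
  have C: "?C \<in> charts_at H (inv_into HB \<Psi> q)" unfolding invq e by (rule charts_at_homI[OF A cd])
  have D: "?D \<in> charts_at PM q" unfolding p(2) e by (rule Psi_chart(1)[OF A cd])
  have o: "open (snd ?D ` fst ?D)" using compatible_atlas_open[OF compatible_PM] D by (simp add: charts_at_iff)
  show "\<exists>c\<in>charts_at PM q. \<exists>d\<in>charts_at H (inv_into HB \<Psi> q). \<exists>W F. open W \<and> snd c q \<in> W \<and> W \<subseteq> snd c ` fst c \<and> smooth_on W F \<and>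
      (\<forall>r\<in>\<Psi> ` HB \<inter> fst c. snd c r \<in> W \<longrightarrow> inv_into HB \<Psi> r \<in> fst d \<and> snd d (inv_into HB \<Psi> r) = F (snd c r))"
  proof (intro bexI[OF _ C] bexI[OF _ D] exI[of _ "snd ?D ` fst ?D"] exI[of _ "\<lambda>z. (pr1 (fst z), pr2 (fst z), snd z)"] conjI o ballI impI)
    show "smooth_on (snd ?D ` fst ?D) (\<lambda>z. (pr1 (fst z), pr2 (fst z), snd z))"
      by (intro smooth_on_Pair smooth_on_pr1 smooth_on_pr2 smooth_on_fst smooth_on_snd smooth_on_id o)
    show "snd ?D q \<in> snd ?D ` fst ?D" using D by (simp add: charts_at_iff)
    fix r assume r: "r \<in> \<Psi> ` HB \<inter> fst ?D"
    then obtain x' y' A' where e': "r = \<Psi> (x', y', A')" and A': "(x', y', A') \<in> HB" by auto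
    have "(x', y') \<in> fst (product_chart c d)" using r unfolding e' Psi_eq Int_iff fst_plane_chart[OF compat] by blast
    then have ch: "c \<in> charts_at \<A> x'" "d \<in> charts_at \<B> y'" using cd by (auto simp: fst_product_chart charts_at_iff)
    show "inv_into HB \<Psi> r \<in> fst ?C" unfolding e' inv[OF A'] using A' ch by (simp add: fst_hom_chart charts_at_iff)
    show "snd ?C (inv_into HB \<Psi> r) = (pr1 (fst (snd ?D r)), pr2 (fst (snd ?D r)), snd (snd ?D r))"
      unfolding e' inv[OF A'] Psi_chart(2)[OF A' ch] snd_hom_chart by simp
  qed simp
qed

end

section \<open>The Hodge star of a neutral metric\<close>

lemma det_4:
  "det (A::real^4^4) =
    A$1$1 * (A$2$2 * (A$3$3 * A$4$4 - A$3$4 * A$4$3) - A$2$3 * (A$3$2 * A$4$4 - A$3$4 * A$4$2) + A$2$4 * (A$3$2 * A$4$3 - A$3$3 * A$4$2))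
  - A$1$2 * (A$2$1 * (A$3$3 * A$4$4 - A$3$4 * A$4$3) - A$2$3 * (A$3$1 * A$4$4 - A$3$4 * A$4$1) + A$2$4 * (A$3$1 * A$4$3 - A$3$3 * A$4$1))
  + A$1$3 * (A$2$1 * (A$3$2 * A$4$4 - A$3$4 * A$4$2) - A$2$2 * (A$3$1 * A$4$4 - A$3$4 * A$4$1) + A$2$4 * (A$3$1 * A$4$2 - A$3$2 * A$4$1))
  - A$1$4 * (A$2$1 * (A$3$2 * A$4$3 - A$3$3 * A$4$2) - A$2$2 * (A$3$1 * A$4$3 - A$3$3 * A$4$1) + A$2$3 * (A$3$1 * A$4$2 - A$3$2 * A$4$1))"
proof -
  have f: "finite {2::4,3,4}" "1 \<notin> {2::4,3,4}" "finite {3::4,4}" "2 \<notin> {3::4,4}" "finite {4::4}" "3 \<notin> {4::4}" by auto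
  show ?thesis
    unfolding det_def UNIV_4
    unfolding sum_over_permutations_insert[OF f(1,2)]
    unfolding sum_over_permutations_insert[OF f(3,4)]
    unfolding sum_over_permutations_insert[OF f(5,6)]
    unfolding permutes_sing
    by (simp add: sign_swap_id permutation_swap_id permutation_compose sign_compose sign_id swap_id_eq algebra_simps)
qed

definition eps :: "4 \<Rightarrow> real" where "eps i = (if i = 1 \<or> i = 2 then 1 else - 1)"

lemma eps_simps [simp]: "eps 1 = 1" "eps 2 = 1" "eps 3 = - 1" "eps 4 = - 1"
  by (simp_all add: eps_def)

lemma oriented_on_frame_iff:
  "oriented_on_frame \<A> g y e \<longleftrightarrow> oriented_frame \<A> y e \<and> (\<forall>i j. g y (e i) (e j) = (if i = j then eps i else 0))"
  unfolding oriented_on_frame_def by (auto simp: forall_4)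

text \<open>
  The data on which the Hodge star at a point depends: a symmetric bilinear form on the tangent
  space and an oriented orthonormal frame. The Hodge star is prescribed on all such frames;
  the frame \<open>e\<close> serves to construct it, and the values on the others have to be derived.
\<close>

locale neutral_point =
  fixes \<N> :: "('a, real^4) atlas" and g :: "('a, real^4) metric" and y :: 'a
    and e :: "4 \<Rightarrow> ('a, real^4) tvec" and C
  assumes compat: "compatible_atlas \<N>" and C: "C \<in> charts_at \<N> y"
    and g_sym: "\<And>u v. u \<in> tangent_space \<N> y \<Longrightarrow> v \<in> tangent_space \<N> y \<Longrightarrow> g y u v = g y v u"
    and g_add: "\<And>u v w. u \<in> tangent_space \<N> y \<Longrightarrow> v \<in> tangent_space \<N> y \<Longrightarrow> w \<in> tangent_space \<N> y \<Longrightarrow>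
        g y u (v + w) = g y u v + g y u w"
    and g_scale: "\<And>u v r. u \<in> tangent_space \<N> y \<Longrightarrow> v \<in> tangent_space \<N> y \<Longrightarrow> g y u (r *\<^sub>R v) = r * g y u v"
    and frame: "oriented_on_frame \<N> g y e"
begin

abbreviation "T \<equiv> tangent_space \<N> y"

lemmas T_subspace = subspace_tangent_space[OF compat, of y]
lemmas T_add = subspace_add[OF T_subspace]
lemmas T_scale = subspace_scale[OF T_subspace]

lemma frame_in: "oriented_on_frame \<N> g y f \<Longrightarrow> f i \<in> T"
  by (simp add: oriented_on_frame_def oriented_frame_def)

lemma frame_g: "oriented_on_frame \<N> g y f \<Longrightarrow> g y (f i) (f j) = (if i = j then eps i else 0)"
  by (simp add: oriented_on_frame_iff)

lemma frame_det: "oriented_on_frame \<N> g y f \<Longrightarrow> det (\<chi> i j. f j C $ i) > 0"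
  using C by (simp add: oriented_on_frame_def oriented_frame_def)

text \<open>The sign makes these linear forms dual to the vectors of the frame.\<close>

definition coframe :: "(4 \<Rightarrow> ('a, real^4) tvec) \<Rightarrow> 4 \<Rightarrow> ('a, real^4) tvec \<Rightarrow> real"
  where "coframe f i u = eps i * g y u (f i)"

lemma frame_expand:
  assumes f: "oriented_on_frame \<N> g y f" and u: "u \<in> T"
  shows "u = coframe f 1 u *\<^sub>R f 1 + coframe f 2 u *\<^sub>R f 2 + coframe f 3 u *\<^sub>R f 3 + coframe f 4 u *\<^sub>R f 4"
proof -
  note i = frame_in[OF f]
  let ?E = "\<chi> i j. f j C $ i"
  have "invertible ?E" using frame_det[OF f] by (simp add: invertible_det_nz)
  then obtain B where B: "?E ** B = mat 1" by (auto simp: invertible_def)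
  define c where "c = B *v u C"
  have Ec: "?E *v c = u C" unfolding c_def matrix_vector_mul_assoc B by simp
  have uc: "u = c $ 1 *\<^sub>R f 1 + c $ 2 *\<^sub>R f 2 + c $ 3 *\<^sub>R f 3 + c $ 4 *\<^sub>R f 4"
  proof (rule tangent_vector_eqI[OF compat u _ C])
    show "c $ 1 *\<^sub>R f 1 + c $ 2 *\<^sub>R f 2 + c $ 3 *\<^sub>R f 3 + c $ 4 *\<^sub>R f 4 \<in> T" by (intro T_add T_scale i)
    show "u C = (c $ 1 *\<^sub>R f 1 + c $ 2 *\<^sub>R f 2 + c $ 3 *\<^sub>R f 3 + c $ 4 *\<^sub>R f 4) C"
      unfolding Ec[symmetric] by (simp add: vec_eq_iff matrix_vector_mult_def sum_4 scaleR_fun_apply)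
  qed
  have "g y (f j) u = c $ j * eps j" for j
    by (subst uc) (use exhaust_4[of j] in \<open>auto simp: g_add g_scale T_add T_scale i frame_g[OF f]\<close>)
  then have "coframe f j u = c $ j" for j
    using g_sym[OF u i] exhaust_4[of j] by (auto simp: coframe_def)
  then show ?thesis using uc by simp
qed

lemma coframe_frame: "oriented_on_frame \<N> g y f \<Longrightarrow> coframe f i (f j) = (if i = j then 1 else 0)"
  using frame_g[of f j i] exhaust_4[of i] by (auto simp: coframe_def)

lemma coframe_lin: "f i \<in> T \<Longrightarrow> u \<in> T \<Longrightarrow> v \<in> T \<Longrightarrow> coframe f i (u + v) = coframe f i u + coframe f i v"
  "f i \<in> T \<Longrightarrow> u \<in> T \<Longrightarrow> coframe f i (r *\<^sub>R u) = r * coframe f i u"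
  using g_sym[of _ "f i"] by (simp_all add: coframe_def g_add g_scale T_add T_scale algebra_simps)

text \<open>
  A bivector is a function of linear forms on the whole space of which the tangent space is a
  subspace, so the coframe has to be extended: \<open>w\<close> is replaced by the tangent vector with the same
  coordinates in the chart \<open>C\<close>.
\<close>

definition coform :: "4 \<Rightarrow> ('a, real^4) tvec \<Rightarrow> real" where "coform i w = coframe e i (coord_tvec \<N> C y (w C))"

lemma linear_coform: "linear (coform i)"
  by (rule linearI)
    (simp_all add: coform_def scaleR_fun_apply coord_tvec_add[OF compat C] coord_tvec_scaleR[OF compat C] coframe_lin
      frame_in[OF frame] coord_tvec_in[OF compat C])

lemma coform_eq: "u \<in> T \<Longrightarrow> coform i u = coframe e i u"
  by (simp add: coform_def coord_tvec_eq[OF compat _ C])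

abbreviation "BV \<equiv> bivectors T"
definition coef where "coef i j b = b (coform i) (coform j)"
abbreviation "W i j \<equiv> wedge (e i) (e j)"

lemma coef_lin: "coef i j (b + b') = coef i j b + coef i j b'" "coef i j (r *\<^sub>R b) = r * coef i j b" "coef i j 0 = 0"
  "coef i j (b - b') = coef i j b - coef i j b'"
  by (simp_all add: coef_def scaleR_fun_apply)

lemma coef_wedge: "u \<in> T \<Longrightarrow> v \<in> T \<Longrightarrow> coef i j (wedge u v) = coframe e i u * coframe e j v - coframe e i v * coframe e j u"
  by (simp add: coef_def wedge_def linear_coform coform_eq)

lemma wedge_in: "u \<in> T \<Longrightarrow> v \<in> T \<Longrightarrow> wedge u v \<in> BV"
  unfolding bivectors_def by (rule span_base) blast

lemma subspace_BV: "subspace BV"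
  unfolding bivectors_def by (rule subspace_span)

definition frame_sum where "frame_sum b = coef 1 2 b *\<^sub>R W 1 2 + coef 1 3 b *\<^sub>R W 1 3 + coef 1 4 b *\<^sub>R W 1 4
  + coef 2 3 b *\<^sub>R W 2 3 + coef 2 4 b *\<^sub>R W 2 4 + coef 3 4 b *\<^sub>R W 3 4"

lemma frame_sum_lin: "frame_sum (b + b') = frame_sum b + frame_sum b'" "frame_sum (r *\<^sub>R b) = r *\<^sub>R frame_sum b" "frame_sum 0 = 0"
  by (simp_all add: frame_sum_def coef_lin algebra_simps)

lemma wedge_expand:
  assumes u: "u \<in> T" and v: "v \<in> T" shows "frame_sum (wedge u v) = wedge u v"
proof (intro ext)
  fix \<alpha> \<beta> :: "('a, real^4) tvec \<Rightarrow> real"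
  show "frame_sum (wedge u v) \<alpha> \<beta> = wedge u v \<alpha> \<beta>"
  proof (cases "linear \<alpha> \<and> linear \<beta>")
    case True
    have ex: "h w = coframe e 1 w * h (e 1) + coframe e 2 w * h (e 2) + coframe e 3 w * h (e 3) + coframe e 4 w * h (e 4)"
      if "linear h" "w \<in> T" for h :: "('a, real^4) tvec \<Rightarrow> real" and w
    proof -
      have "h w = h (coframe e 1 w *\<^sub>R e 1 + coframe e 2 w *\<^sub>R e 2 + coframe e 3 w *\<^sub>R e 3 + coframe e 4 w *\<^sub>R e 4)"
        using frame_expand[OF frame that(2)] by simp
      then show ?thesis by (simp add: linear_add[OF that(1)] linear_cmul[OF that(1)])
    qed
    have lin: "linear \<alpha>" "linear \<beta>" using True by auto
    show ?thesis
      by (simp add: frame_sum_def coef_wedge[OF u v] scaleR_fun_apply) (simp add: wedge_def lin ex[OF lin(1) u] ex[OF lin(1) v] ex[OF lin(2) u] ex[OF lin(2) v] algebra_simps)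
  qed (auto simp: frame_sum_def wedge_def scaleR_fun_apply)
qed

text \<open>
  The bivectors are the span of the decomposable ones, for which the expansion is
  multilinearity.
\<close>

lemma bivector_expand:
  assumes "b \<in> BV" shows "frame_sum b = b"
  using assms unfolding bivectors_def
proof (induction b rule: span_induct)
  case base
  show ?case by (auto simp: subspace_def frame_sum_lin)
next
  case (step b)
  then show ?case using wedge_expand by auto
qed

lemma bivector_zero:
  assumes "b \<in> BV" "coef 1 2 b = 0" "coef 1 3 b = 0" "coef 1 4 b = 0" "coef 2 3 b = 0" "coef 2 4 b = 0" "coef 3 4 b = 0"
  shows "b = 0"
  using bivector_expand[OF assms(1)] assms(2-) by (simp add: frame_sum_def)

text \<open>
  The Hodge star in the basis of bivectors given by the frame \<open>e\<close>. The values on the three basis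
  bivectors outside of the prescription are forced by involutivity.
\<close>

definition star_map where "star_map b = coef 1 2 b *\<^sub>R W 3 4 + coef 3 4 b *\<^sub>R W 1 2 + coef 1 3 b *\<^sub>R W 2 4
  + coef 2 4 b *\<^sub>R W 1 3 + (- coef 1 4 b) *\<^sub>R W 2 3 + (- coef 2 3 b) *\<^sub>R W 1 4"

lemma coef_W: "coef i j (W k l) = (if i = k then 1 else 0) * (if j = l then 1 else 0) - (if i = l then 1 else 0) * (if j = k then 1 else 0)"
  by (simp add: coef_wedge frame_in[OF frame] coframe_frame[OF frame])

lemma coef_star: "coef 1 2 (star_map b) = coef 3 4 b" "coef 3 4 (star_map b) = coef 1 2 b" "coef 1 3 (star_map b) = coef 2 4 b" "coef 2 4 (star_map b) = coef 1 3 b"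
  "coef 1 4 (star_map b) = - coef 2 3 b" "coef 2 3 (star_map b) = - coef 1 4 b"
  by (simp_all add: star_map_def coef_lin coef_W)

lemma star_map_in: "star_map b \<in> BV"
  unfolding star_map_def by (intro subspace_add[OF subspace_BV] subspace_scale[OF subspace_BV] wedge_in frame_in[OF frame])

lemma star_map_involution: "b \<in> BV \<Longrightarrow> star_map (star_map b) = b"
  using bivector_expand[of b] unfolding frame_sum_def by (subst star_map_def) (simp add: coef_star algebra_simps)

lemma star_map_lin: "star_map (b + b') = star_map b + star_map b'" "star_map (r *\<^sub>R b) = r *\<^sub>R star_map b"
  by (simp_all add: star_map_def coef_lin algebra_simps)

text \<open>
  The coefficient of \<open>p \<and> q \<and> b\<close> with respect to the volume form of the frame \<open>e\<close>.
\<close>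

definition pairing where "pairing p q b =
    (coframe e 1 p * coframe e 2 q - coframe e 2 p * coframe e 1 q) * coef 3 4 b - (coframe e 1 p * coframe e 3 q - coframe e 3 p * coframe e 1 q) * coef 2 4 b
  + (coframe e 1 p * coframe e 4 q - coframe e 4 p * coframe e 1 q) * coef 2 3 b + (coframe e 2 p * coframe e 3 q - coframe e 3 p * coframe e 2 q) * coef 1 4 b
  - (coframe e 2 p * coframe e 4 q - coframe e 4 p * coframe e 2 q) * coef 1 3 b + (coframe e 3 p * coframe e 4 q - coframe e 4 p * coframe e 3 q) * coef 1 2 b"

lemma g_expand:
  assumes u: "u \<in> T" and v: "v \<in> T"
  shows "g y u v = coframe e 1 u * coframe e 1 v + coframe e 2 u * coframe e 2 v - coframe e 3 u * coframe e 3 v - coframe e 4 u * coframe e 4 v"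
proof -
  have "g y u v = g y u (coframe e 1 v *\<^sub>R e 1 + coframe e 2 v *\<^sub>R e 2 + coframe e 3 v *\<^sub>R e 3 + coframe e 4 v *\<^sub>R e 4)"
    using frame_expand[OF frame v] by simp
  also have "\<dots> = coframe e 1 v * g y u (e 1) + coframe e 2 v * g y u (e 2) + coframe e 3 v * g y u (e 3) + coframe e 4 v * g y u (e 4)"
    using u frame_in[OF frame] by (simp add: g_add g_scale T_add T_scale)
  finally show ?thesis by (simp add: coframe_def[of e _ u])
qed

text \<open>
  This is \<open>\<omega> \<and> *b = \<langle>\<omega>, b\<rangle> vol\<close>, the description of the Hodge star whose right-hand side does
  not refer to the frame.
\<close>

lemma pairing_star:
  assumes "p \<in> T" "q \<in> T" "r \<in> T" "s \<in> T"
  shows "pairing p q (star_map (wedge r s)) = g y p r * g y q s - g y p s * g y q r"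
  unfolding pairing_def coef_star coef_wedge[OF assms(3,4)] g_expand[OF assms(1,3)] g_expand[OF assms(2,4)] g_expand[OF assms(1,4)] g_expand[OF assms(2,3)]
  by (simp add: algebra_simps)

lemma pairing_alt:
  assumes "p \<in> T" "q \<in> T" "r \<in> T"
  shows "pairing p p b = 0" "pairing q p b = - pairing p q b" "pairing p q (wedge p r) = 0" "pairing p q (wedge r p) = 0" "pairing p q (wedge q r) = 0" "pairing p q (wedge r q) = 0"
  using assms by (simp_all add: pairing_def coef_wedge algebra_simps)

lemma pairing_swap: "r \<in> T \<Longrightarrow> s \<in> T \<Longrightarrow> p \<in> T \<Longrightarrow> q \<in> T \<Longrightarrow> pairing p r (wedge q s) = - pairing p q (wedge r s)"
   "r \<in> T \<Longrightarrow> s \<in> T \<Longrightarrow> p \<in> T \<Longrightarrow> q \<in> T \<Longrightarrow> pairing p s (wedge q r) = pairing p q (wedge r s)"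
  by (simp_all add: pairing_def coef_wedge algebra_simps)

lemma pairing_lin:
  "p \<in> T \<Longrightarrow> p' \<in> T \<Longrightarrow> pairing (p + p') q b = pairing p q b + pairing p' q b" "p \<in> T \<Longrightarrow> pairing (r *\<^sub>R p) q b = r * pairing p q b"
  "p \<in> T \<Longrightarrow> p' \<in> T \<Longrightarrow> pairing q (p + p') b = pairing q p b + pairing q p' b" "p \<in> T \<Longrightarrow> pairing q (r *\<^sub>R p) b = r * pairing q p b"
  by (simp_all add: pairing_def coframe_lin frame_in[OF frame] algebra_simps)

text \<open>
  By bilinearity the pairings vanish on the frame \<open>e\<close> too, where they are the coefficients of \<open>b\<close> up
  to sign.
\<close>

lemma pairing_nondegenerate:
  assumes f: "oriented_on_frame \<N> g y f" and b: "b \<in> BV" and zero: "\<And>i j. pairing (f i) (f j) b = 0"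
  shows "b = 0"
proof -
  note i = frame_in[OF f]
  have 1: "pairing p (f j) b = 0" if "p \<in> T" for p j
    by (subst frame_expand[OF f that]) (simp add: pairing_lin T_add T_scale i zero)
  have 2: "pairing p q b = 0" if "p \<in> T" "q \<in> T" for p q
    by (subst frame_expand[OF f that(2)]) (simp add: pairing_lin T_add T_scale i 1 that)
  have "pairing (e k) (e l) b = 0" for k l by (rule 2) (rule frame_in[OF frame])+
  note z = this[of 1 2] this[of 1 3] this[of 1 4] this[of 2 3] this[of 2 4] this[of 3 4]
  show "b = 0"
    by (rule bivector_zero[OF b]) (use z in \<open>simp_all add: pairing_def coframe_frame[OF frame]\<close>)
qed

text \<open>
  The matrix \<open>P\<close> of the change of frames satisfies \<open>P\<^sup>T \<eta> P = \<eta>\<close> for the signature matrix \<open>\<eta>\<close>, so its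
  determinant is \<open>1\<close> or \<open>-1\<close>, and both frames are oriented. Thus all oriented orthonormal frames
  have the same volume form.
\<close>

lemma frame_volume:
  assumes f: "oriented_on_frame \<N> g y f"
  shows "pairing (f 1) (f 2) (wedge (f 3) (f 4)) = 1"
proof -
  note i = frame_in[OF f]
  define P :: "real^4^4" where "P = (\<chi> i j. coframe e i (f j))"
  define \<eta> :: "real^4^4" where "\<eta> = (\<chi> i j. if i = j then eps i else 0)"
  have "(\<chi> i j. f j C $ i) = (\<chi> i j. e j C $ i) ** P"
  proof -
    have "f j C = coframe e 1 (f j) *\<^sub>R e 1 C + coframe e 2 (f j) *\<^sub>R e 2 C + coframe e 3 (f j) *\<^sub>R e 3 C + coframe e 4 (f j) *\<^sub>R e 4 C" for j
      by (subst frame_expand[OF frame i]) (simp add: scaleR_fun_apply)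
    then show ?thesis by (simp add: vec_eq_iff P_def matrix_matrix_mult_def sum_4 mult.commute)
  qed
  then have "det (\<chi> i j. f j C $ i) = det (\<chi> i j. e j C $ i) * det P" by (simp add: det_mul)
  then have pos: "det P > 0" using frame_det[OF f] frame_det[OF frame] by (simp add: zero_less_mult_iff)
  have "transpose P ** \<eta> ** P = \<eta>"
  proof -
    have "(transpose P ** \<eta> ** P) $ k $ l = g y (f k) (f l)" for k l
      unfolding g_expand[OF i i]
      by (simp add: matrix_matrix_mult_def transpose_def P_def \<eta>_def sum_4)
    then show ?thesis by (simp add: vec_eq_iff frame_g[OF f] \<eta>_def)
  qed
  then have "det P * det \<eta> * det P = det \<eta>" using det_mul det_transpose by metis
  moreover have "det \<eta> = 1" by (simp add: det_4 \<eta>_def)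
  ultimately have "(det P)\<^sup>2 = 1" by (simp add: power2_eq_square)
  then have "det P = 1" using pos by (simp add: power2_eq_1_iff)
  moreover have "pairing (f 1) (f 2) (wedge (f 3) (f 4)) = det P"
    by (simp add: pairing_def coef_wedge i det_4 P_def algebra_simps)
  ultimately show ?thesis by simp
qed

text \<open>
  Both sides have the same pairing with each \<open>f k \<and> f l\<close>: on the left by \<open>pairing_star\<close> and the
  orthonormality of \<open>f\<close>, on the right by \<open>frame_volume\<close> and antisymmetry.
\<close>

lemma star_map_frame:
  assumes f: "oriented_on_frame \<N> g y f"
  shows "star_map (wedge (f 1) (f 2)) = wedge (f 3) (f 4)" "star_map (wedge (f 1) (f 3)) = wedge (f 2) (f 4)"
    "star_map (wedge (f 1) (f 4)) = - wedge (f 2) (f 3)"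
proof -
  note i = frame_in[OF f]
  have sub: "pairing p q (b + r *\<^sub>R b') = pairing p q b + r * pairing p q b'" for p q b b' r
    by (simp add: pairing_def coef_lin algebra_simps)
  have eq: "star_map b = r *\<^sub>R b'" if b: "b' \<in> BV" and z: "\<And>k l. pairing (f k) (f l) (star_map b) = r * pairing (f k) (f l) b'" for b b' r
  proof -
    have "star_map b + (- r) *\<^sub>R b' = 0"
      by (rule pairing_nondegenerate[OF f]) (intro subspace_add[OF subspace_BV] subspace_scale[OF subspace_BV] star_map_in b, simp add: sub z del: scaleR_minus_left)
    then show ?thesis by (simp add: eq_neg_iff_add_eq_0[symmetric])
  qed
  note v = frame_volume[OF f]
  have v': "pairing (f 2) (f 1) (wedge (f 3) (f 4)) = -1" "pairing (f 1) (f 3) (wedge (f 2) (f 4)) = -1" "pairing (f 3) (f 1) (wedge (f 2) (f 4)) = 1"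
    "pairing (f 1) (f 4) (wedge (f 2) (f 3)) = 1" "pairing (f 4) (f 1) (wedge (f 2) (f 3)) = -1"
  proof -
    have a: "pairing (f l) (f k) b = - pairing (f k) (f l) b" for k l b by (rule pairing_alt(2)[OF i i i])
    have s1: "pairing (f 1) (f 3) (wedge (f 2) (f 4)) = - pairing (f 1) (f 2) (wedge (f 3) (f 4))" by (rule pairing_swap(1)[OF i i i i])
    have s2: "pairing (f 1) (f 4) (wedge (f 2) (f 3)) = pairing (f 1) (f 2) (wedge (f 3) (f 4))" by (rule pairing_swap(2)[OF i i i i])
    show "pairing (f 1) (f 3) (wedge (f 2) (f 4)) = -1" "pairing (f 1) (f 4) (wedge (f 2) (f 3)) = 1" using s1 s2 v by simp_all
    then show "pairing (f 2) (f 1) (wedge (f 3) (f 4)) = -1" "pairing (f 3) (f 1) (wedge (f 2) (f 4)) = 1" "pairing (f 4) (f 1) (wedge (f 2) (f 3)) = -1"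
      using v a[of 2 1] a[of 3 1] a[of 4 1] by simp_all
  qed
  have "star_map (wedge (f 1) (f 2)) = 1 *\<^sub>R wedge (f 3) (f 4)"
  proof (rule eq[OF wedge_in[OF i i]])
    fix k l show "pairing (f k) (f l) (star_map (wedge (f 1) (f 2))) = 1 * pairing (f k) (f l) (wedge (f 3) (f 4))"
      unfolding pairing_star[OF i i i i] frame_g[OF f]
      using exhaust_4[of k] exhaust_4[of l] by (elim disjE) (simp_all add: pairing_alt(1)[OF i i i] pairing_alt i v v')
  qed
  then show "star_map (wedge (f 1) (f 2)) = wedge (f 3) (f 4)" by simp
  have "star_map (wedge (f 1) (f 3)) = 1 *\<^sub>R wedge (f 2) (f 4)"
  proof (rule eq[OF wedge_in[OF i i]])
    fix k l show "pairing (f k) (f l) (star_map (wedge (f 1) (f 3))) = 1 * pairing (f k) (f l) (wedge (f 2) (f 4))"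
      unfolding pairing_star[OF i i i i] frame_g[OF f]
      using exhaust_4[of k] exhaust_4[of l] by (elim disjE) (simp_all add: pairing_alt(1)[OF i i i] pairing_alt i v v')
  qed
  then show "star_map (wedge (f 1) (f 3)) = wedge (f 2) (f 4)" by simp
  have "star_map (wedge (f 1) (f 4)) = (-1) *\<^sub>R wedge (f 2) (f 3)"
  proof (rule eq[OF wedge_in[OF i i]])
    fix k l show "pairing (f k) (f l) (star_map (wedge (f 1) (f 4))) = (-1) * pairing (f k) (f l) (wedge (f 2) (f 3))"
      unfolding pairing_star[OF i i i i] frame_g[OF f]
      using exhaust_4[of k] exhaust_4[of l] by (elim disjE) (simp_all add: pairing_alt(1)[OF i i i] pairing_alt i v v')
  qed
  then show "star_map (wedge (f 1) (f 4)) = - wedge (f 2) (f 3)" by simp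
qed

text \<open>
  By \<open>star_map_frame\<close> the map \<open>star_map\<close> has the defining properties. For uniqueness, three values on
  the frame \<open>e\<close> are prescribed and involutivity gives the other three.
\<close>

lemma hodge_star_eq:
  assumes "b \<in> BV" shows "hodge_star \<N> g y b = star_map b"
proof -
  have "hodge_star \<N> g y = restrict star_map BV"
    unfolding hodge_star_def
  proof (rule the_equality)
    show "restrict star_map BV \<in> BV \<rightarrow>\<^sub>E BV \<and> linear_map_on BV (restrict star_map BV) \<and> (\<forall>b\<in>BV. restrict star_map BV (restrict star_map BV b) = b) \<and>
      (\<forall>e. oriented_on_frame \<N> g y e \<longrightarrow>
        restrict star_map BV (wedge (e 1) (e 2)) = wedge (e 3) (e 4) \<and>
        restrict star_map BV (wedge (e 1) (e 3)) = wedge (e 2) (e 4) \<and>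
        restrict star_map BV (wedge (e 1) (e 4)) = - wedge (e 2) (e 3))"
      using subspace_add[OF subspace_BV] subspace_scale[OF subspace_BV]
      by (auto simp: star_map_in linear_map_on_def star_map_lin star_map_involution star_map_frame wedge_in frame_in)
  next
    fix S assume S: "S \<in> BV \<rightarrow>\<^sub>E BV \<and> linear_map_on BV S \<and> (\<forall>b\<in>BV. S (S b) = b) \<and>
      (\<forall>e. oriented_on_frame \<N> g y e \<longrightarrow> S (wedge (e 1) (e 2)) = wedge (e 3) (e 4) \<and>
        S (wedge (e 1) (e 3)) = wedge (e 2) (e 4) \<and> S (wedge (e 1) (e 4)) = - wedge (e 2) (e 3))"
    note i = frame_in[OF frame]
    have w: "W k l \<in> BV" for k l by (rule wedge_in[OF i i])
    have add: "S (b + b') = S b + S b'" if "b \<in> BV" "b' \<in> BV" for b b'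
      using S that by (auto simp: linear_map_on_def)
    have sc: "S (r *\<^sub>R b) = r *\<^sub>R S b" if "b \<in> BV" for b r
      using S that by (auto simp: linear_map_on_def)
    have inv: "S (S b) = b" if "b \<in> BV" for b using S that by blast
    have 1: "S (W 1 2) = W 3 4" "S (W 1 3) = W 2 4" "S (W 1 4) = - W 2 3" using S frame by auto
    have 2: "S (W 3 4) = W 1 2" "S (W 2 4) = W 1 3" using inv[OF w, of 1 2] inv[OF w, of 1 3] 1 by auto
    have 3: "S (W 2 3) = - W 1 4" using inv[OF w, of 1 4] sc[OF w, of "-1" 2 3] 1(3) by (simp add: minus_equation_iff)
    have "S b = restrict star_map BV b" for b
    proof (cases "b \<in> BV")
      case True
      have "S b = S (frame_sum b)" using bivector_expand[OF True] by simp
      also have "\<dots> = star_map b"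
        unfolding frame_sum_def by (simp add: add sc w subspace_add[OF subspace_BV] subspace_scale[OF subspace_BV] 1 2 3 star_map_def algebra_simps)
      finally show ?thesis using True by simp
    next
      case False
      then show ?thesis using S by auto
    qed
    then show "S = restrict star_map BV" by blast
  qed
  then show ?thesis using assms by simp
qed

text \<open>
  The wedge of \<open>e\<^sub>1 + e\<^sub>3\<close> and \<open>e\<^sub>2 + \<sigma> e\<^sub>4\<close> is \<open>e\<^sub>1 \<and> e\<^sub>2 + \<sigma> e\<^sub>1 \<and> e\<^sub>4 - e\<^sub>2 \<and> e\<^sub>3 + \<sigma> e\<^sub>3 \<and> e\<^sub>4\<close>, an
  eigenvector of the Hodge star with eigenvalue \<open>\<sigma>\<close>.
\<close>

lemma hodge_star_graph:
  assumes "n = a *\<^sub>R (e 1 + e 3) + b *\<^sub>R (e 2 + \<sigma> *\<^sub>R e 4)" "m = a' *\<^sub>R (e 1 + e 3) + b' *\<^sub>R (e 2 + \<sigma> *\<^sub>R e 4)" and \<sigma>: "\<sigma> = 1 \<or> \<sigma> = -1"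
  shows "hodge_star \<N> g y (wedge n m) = \<sigma> *\<^sub>R wedge n m" "coef 1 2 (wedge n m) = a * b' - b * a'"
proof -
  note i = frame_in[OF frame]
  have nm: "n \<in> T" "m \<in> T" unfolding assms by (intro T_add T_scale i)+
  have coframe: "coframe e 1 n = a" "coframe e 2 n = b" "coframe e 3 n = a" "coframe e 4 n = \<sigma> * b" "coframe e 1 m = a'" "coframe e 2 m = b'" "coframe e 3 m = a'" "coframe e 4 m = \<sigma> * b'"
    unfolding assms(1,2) by (simp_all add: coframe_lin T_add T_scale i coframe_frame[OF frame])
  show "coef 1 2 (wedge n m) = a * b' - b * a'" by (simp add: coef_wedge nm coframe)
  have ss: "\<sigma> * \<sigma> = 1" "\<sigma> * (\<sigma> * x) = x" for x using \<sigma> by auto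
  have "star_map (wedge n m) = \<sigma> *\<^sub>R frame_sum (wedge n m)"
    unfolding star_map_def frame_sum_def coef_wedge[OF nm] coframe by (simp add: algebra_simps ss)
  then show "hodge_star \<N> g y (wedge n m) = \<sigma> *\<^sub>R wedge n m"
    unfolding hodge_star_eq[OF wedge_in[OF nm]] wedge_expand[OF nm] .
qed

end

section \<open>Selfdual null planes are graphs of orientation preserving isometries\<close>

context surface begin

lemma cross2_chart_change:
  assumes "v \<in> T p" "w \<in> T p" "c \<in> charts_at \<A> p" "c' \<in> charts_at \<A> p"
  shows "cross2 (v c') (w c') = det (matrix (dtrans c c' p)) * cross2 (v c) (w c)"
  unfolding cross2_matrix[symmetric] matrix_works_real[OF linear_dtrans[OF compat assms(3,4)]]
    tangent_vector_transform[OF compat assms(1,3,4)] tangent_vector_transform[OF compat assms(2,3,4)] ..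

lemma zero_in_T: "0 \<in> T p"
  by (rule subspace_0[OF subspace_tangent_space[OF compat]])

lemma metric_zero: "p \<in> mcarrier \<A> \<Longrightarrow> v \<in> T p \<Longrightarrow> g p v 0 = 0" "p \<in> mcarrier \<A> \<Longrightarrow> v \<in> T p \<Longrightarrow> g p 0 v = 0"
proof -
  assume p: "p \<in> mcarrier \<A>" and v: "v \<in> T p"
  show "g p v 0 = 0" using metric_linear(2)[OF p v zero_in_T, of 0] by simp
  then show "g p 0 v = 0" using metric_sym[OF p zero_in_T v] by simp
qed

end

context surface_pair begin

lemma TM_add: "u \<in> TM p \<Longrightarrow> v \<in> TM p \<Longrightarrow> u + v \<in> TM p" and TM_scale: "u \<in> TM p \<Longrightarrow> r *\<^sub>R u \<in> TM p"
  using subspace_tangent_space[OF compat, of p] by (auto simp: subspace_def)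

lemma dproj_lin:
  assumes "(x, y) \<in> mcarrier M" "u \<in> TM (x, y)" "v \<in> TM (x, y)"
  shows "dp1 (x, y) (u + v) = dp1 (x, y) u + dp1 (x, y) v" "dp2 (x, y) (u + v) = dp2 (x, y) u + dp2 (x, y) v"
  using dproj_lincomb[OF assms(2,3,1), of 1 1] by simp_all

lemma dproj_scale:
  assumes "(x, y) \<in> mcarrier M" "u \<in> TM (x, y)"
  shows "dp1 (x, y) (r *\<^sub>R u) = r *\<^sub>R dp1 (x, y) u" "dp2 (x, y) (r *\<^sub>R u) = r *\<^sub>R dp2 (x, y) u"
  using dproj_lincomb[OF assms(2,2,1), of r 0] by simp_all

text \<open>
  An orthonormal frame of the product made of frames of the two surfaces. In a product chart its
  matrix consists of two blocks, and its determinant is the product of the two areas.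
\<close>

lemma neutral_pointI:
  assumes c: "c \<in> charts_at \<A> x" and d: "d \<in> charts_at \<B> y"
    and v: "v1 \<in> S1.T x" "v2 \<in> S1.T x" "g1 x v1 v1 = 1" "g1 x v2 v2 = 1" "g1 x v1 v2 = 0" "cross2 (v1 c) (v2 c) > 0"
    and w: "w1 \<in> S2.T y" "w2 \<in> S2.T y" "g2 y w1 w1 = 1" "g2 y w2 w2 = 1" "g2 y w1 w2 = 0" "cross2 (w1 d) (w2 d) > 0"
    and e: "e 1 = pairT x y v1 0" "e 2 = pairT x y v2 0" "e 3 = pairT x y 0 w1" "e 4 = pairT x y 0 w2"
  shows "neutral_point M g (x, y) e (product_chart c d)"
proof -
  have xy: "(x, y) \<in> mcarrier M" by (rule mcarrier_productI[OF c d])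
  then have x: "x \<in> mcarrier \<A>" and y: "y \<in> mcarrier \<B>" by (auto simp: mcarrier_product)
  note 0 = S1.zero_in_T S2.zero_in_T
  note P = pairT[OF v(1) 0(2) xy] pairT[OF v(2) 0(2) xy] pairT[OF 0(1) w(1) xy] pairT[OF 0(1) w(2) xy]
  note dp = dproj_in[OF _ xy]
  have i: "e j \<in> TM (x, y)" for j using exhaust_4[of j] P e by auto
  have sw: "g1 x v2 v1 = 0" "g2 y w2 w1 = 0" using S1.metric_sym[OF x v(1,2)] v(5) S2.metric_sym[OF y w(1,2)] w(5) by auto
  have "oriented_on_frame M g (x, y) e"
    unfolding oriented_on_frame_iff
  proof (intro conjI allI)
    show "oriented_frame M (x, y) e"
      unfolding oriented_frame_def
    proof (intro conjI allI ballI i)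
      fix C' assume "C' \<in> charts_at M (x, y)"
      then obtain c' d' where C': "C' = product_chart c' d'" and c': "c' \<in> charts_at \<A> x" and d': "d' \<in> charts_at \<B> y"
        by (auto simp: charts_at_product)
      have ev: "e 1 C' = cat4 (v1 c') 0" "e 2 C' = cat4 (v2 c') 0" "e 3 C' = cat4 0 (w1 d')" "e 4 C' = cat4 0 (w2 d')"
        unfolding C' e using P by (simp_all add: tangent_product_eval[OF _ c' d'])
      have "det (\<chi> i j. e j C' $ i) = cross2 (v1 c') (v2 c') * cross2 (w1 d') (w2 d')"
        unfolding det_4 by (simp add: ev cat4_def cross2_def algebra_simps)
      moreover have "cross2 (v1 c') (v2 c') > 0" "cross2 (w1 d') (w2 d') > 0"
        using S1.cross2_chart_change[OF v(1,2) c c'] S1.det_dtrans_pos[OF c c'] v(6)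
          S2.cross2_chart_change[OF w(1,2) d d'] S2.det_dtrans_pos[OF d d'] w(6) by simp_all
      ultimately show "det (\<chi> i j. e j C' $ i) > 0" by simp
    qed
  next
    fix j k
    show "g (x, y) (e j) (e k) = (if j = k then eps j else 0)"
      using exhaust_4[of j] exhaust_4[of k]
      by (elim disjE) (simp_all add: split_metric_def e P v w sw S1.metric_zero[OF x] S2.metric_zero[OF y] 0)
  qed
  then show ?thesis
    by unfold_locales
      (auto simp: split_metric_def compat charts_at_productI[OF c d] dproj_lin[OF xy] dproj_scale[OF xy] dp
        S1.metric_linear[OF x] S2.metric_linear[OF y] S1.metric_sym[OF x] S2.metric_sym[OF y] algebra_simps)
qed

text \<open>
  Take an oriented orthonormal basis \<open>e\<^sub>1, e\<^sub>2\<close> of the first surface and \<open>e\<^sub>3 = A e\<^sub>1\<close>, \<open>e\<^sub>4 = \<sigma> A e\<^sub>2\<close>.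
  The sign makes the frame oriented, and the graph is the plane of \<open>hodge_star_graph\<close> because
  \<open>A e\<^sub>2 = \<sigma> e\<^sub>4\<close>. Nonvanishing of the bivector is needed to tell the two eigenvalues apart.
\<close>

lemma hodge_star_graph_plane:
  assumes A: "(x, y, A) \<in> HB" and c: "c \<in> charts_at \<A> x" and d: "d \<in> charts_at \<B> y"
    and iso: "\<And>u v. u \<in> S1.T x \<Longrightarrow> v \<in> S1.T x \<Longrightarrow> g2 y (A u) (A v) = g1 x u v"
    and \<sigma>: "\<sigma> = 1 \<or> \<sigma> = -1" "\<sigma> * det (mat c d x A) > 0"
    and n: "n \<in> graph_plane \<A> \<B> (x, y, A)" and m: "m \<in> graph_plane \<A> \<B> (x, y, A)"
  shows "hodge_star M g (x, y) (wedge n m) = \<sigma> *\<^sub>R wedge n m"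
    and "cross2 (dp1 (x, y) n c) (dp1 (x, y) m c) \<noteq> 0 \<Longrightarrow> wedge n m \<noteq> 0"
proof -
  have xy: "(x, y) \<in> mcarrier M" by (rule mcarrier_productI[OF c d])
  then have x: "x \<in> mcarrier \<A>" and y: "y \<in> mcarrier \<B>" by (auto simp: mcarrier_product)
  note cp = S1.chart_point[OF c]
  define v1 v2 where "v1 = coord_tvec \<A> c x (S1.frame1 c (snd c x))" and "v2 = coord_tvec \<A> c x (S1.frame2 c (snd c x))"
  have v: "v1 \<in> S1.T x" "v2 \<in> S1.T x" unfolding v1_def v2_def by (rule coord_tvec_in[OF S1.compat c])+
  have vc: "v1 c = S1.frame1 c (snd c x)" "v2 c = S1.frame2 c (snd c x)" unfolding v1_def v2_def by (rule coord_tvec_self[OF S1.compat c])+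
  have gv: "g1 x v1 v1 = 1" "g1 x v2 v2 = 1" "g1 x v1 v2 = 0"
    using S1.metric_eq_G[OF c] v vc S1.frame_orthonormal[OF cp] by simp_all
  define w1 w2 where "w1 = A v1" and "w2 = \<sigma> *\<^sub>R A v2"
  have Av: "A v1 \<in> S2.T y" "A v2 \<in> S2.T y" using hom_bundleD(3)[OF A] v by auto
  have w: "w1 \<in> S2.T y" "w2 \<in> S2.T y"
    unfolding w1_def w2_def by (rule Av, rule subspace_scale[OF subspace_tangent_space[OF S2.compat] Av(2)])
  have ss: "\<sigma> * \<sigma> = 1" using \<sigma>(1) by auto
  have gw: "g2 y w1 w1 = 1" "g2 y w1 w2 = 0"
    unfolding w1_def w2_def using S2.metric_linear(2)[OF y Av(1) Av(2)] iso v gv by simp_all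
  have "g2 y w2 w2 = \<sigma> * (\<sigma> * g2 y (A v2) (A v2))"
    using S2.metric_linear(2)[OF y w(2) Av(2), of \<sigma>] S2.metric_sym[OF y w(2) Av(2)] S2.metric_linear(2)[OF y Av(2) Av(2), of \<sigma>]
    by (simp add: w2_def)
  then have gw2: "g2 y w2 w2 = 1" using iso[OF v(2) v(2)] gv(2) ss by simp
  have cv: "cross2 (v1 c) (v2 c) > 0" unfolding vc by (rule S1.cross2_frame[OF cp])
  have wd: "w1 d = mat c d x A *v v1 c" "w2 d = \<sigma> *\<^sub>R (mat c d x A *v v2 c)"
    unfolding w1_def w2_def scaleR_fun_apply mat_works[OF A c v(1)] mat_works[OF A c v(2)] by simp_all
  have "cross2 (w1 d) (w2 d) = \<sigma> * cross2 (mat c d x A *v v1 c) (mat c d x A *v v2 c)"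
    unfolding wd by (simp add: cross2_def algebra_simps)
  also have "\<dots> = (\<sigma> * det (mat c d x A)) * cross2 (v1 c) (v2 c)" unfolding cross2_matrix by simp
  finally have cw: "cross2 (w1 d) (w2 d) > 0" using \<sigma>(2) cv by simp
  define e :: "4 \<Rightarrow> ('a \<times> 'b, real^4) tvec" where "e = (\<lambda>j. if j = 1 then pairT x y v1 0 else if j = 2 then pairT x y v2 0
    else if j = 3 then pairT x y 0 w1 else pairT x y 0 w2)"
  have e: "e 1 = pairT x y v1 0" "e 2 = pairT x y v2 0" "e 3 = pairT x y 0 w1" "e 4 = pairT x y 0 w2"
    by (simp_all add: e_def)
  interpret neutral_point M g "(x, y)" e "product_chart c d"
    by (rule neutral_pointI[OF c d v gv cv w gw(1) gw2 gw(2) cw e])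
  note 0 = S1.zero_in_T S2.zero_in_T
  note P = pairT[OF v(1) 0(2) xy] pairT[OF v(2) 0(2) xy] pairT[OF 0(1) w(1) xy] pairT[OF 0(1) w(2) xy]
  have expand: "\<exists>a b. n = a *\<^sub>R (e 1 + e 3) + b *\<^sub>R (e 2 + \<sigma> *\<^sub>R e 4) \<and> dp1 (x, y) n c = a *\<^sub>R v1 c + b *\<^sub>R v2 c"
    if n: "n \<in> graph_plane \<A> \<B> (x, y, A)" for n
  proof -
    have n': "n \<in> TM (x, y)" "dp1 (x, y) n \<in> S1.T x" "dp2 (x, y) n = A (dp1 (x, y) n)" using n by (auto simp: graph_plane_eq)
    let ?v = "dp1 (x, y) n"
    define a b where "a = S1.G c (snd c x) (?v c) (v1 c)" and "b = S1.G c (snd c x) (?v c) (v2 c)"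
    have vc': "?v c = a *\<^sub>R v1 c + b *\<^sub>R v2 c" unfolding a_def b_def vc by (rule S1.frame_expand[OF cp])
    have ab: "a *\<^sub>R v1 \<in> S1.T x" "b *\<^sub>R v2 \<in> S1.T x" "a *\<^sub>R v1 + b *\<^sub>R v2 \<in> S1.T x"
      using v subspace_tangent_space[OF S1.compat, of x] by (auto simp: subspace_def)
    have vv: "?v = a *\<^sub>R v1 + b *\<^sub>R v2"
      by (rule tangent_vector_eqI[OF S1.compat n'(2) ab(3) c]) (simp add: vc' scaleR_fun_apply)
    have Av': "A ?v = a *\<^sub>R A v1 + b *\<^sub>R A v2"
      unfolding vv by (simp add: hom_bundleD(5,6)[OF A] ab v)
    let ?n = "a *\<^sub>R (e 1 + e 3) + b *\<^sub>R (e 2 + \<sigma> *\<^sub>R e 4)"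
    have "n = ?n"
    proof (rule tangent_product_eqI[OF n'(1) _ xy])
      show "?n \<in> TM (x, y)" by (simp add: e TM_add TM_scale P)
      show "dp1 (x, y) n = dp1 (x, y) ?n"
        by (simp add: e TM_add TM_scale P dproj_lin[OF xy] dproj_scale[OF xy] vv)
      show "dp2 (x, y) n = dp2 (x, y) ?n"
        unfolding n'(3) Av' by (simp add: e TM_add TM_scale P dproj_lin[OF xy] dproj_scale[OF xy]) (simp add: w1_def w2_def ss)
    qed
    then show ?thesis using vc' by blast
  qed
  obtain a b where nab: "n = a *\<^sub>R (e 1 + e 3) + b *\<^sub>R (e 2 + \<sigma> *\<^sub>R e 4)" "dp1 (x, y) n c = a *\<^sub>R v1 c + b *\<^sub>R v2 c" using expand[OF n] by blast
  obtain a' b' where mab: "m = a' *\<^sub>R (e 1 + e 3) + b' *\<^sub>R (e 2 + \<sigma> *\<^sub>R e 4)" "dp1 (x, y) m c = a' *\<^sub>R v1 c + b' *\<^sub>R v2 c" using expand[OF m] by blast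
  note H = hodge_star_graph[OF nab(1) mab(1) \<sigma>(1)]
  show "hodge_star M g (x, y) (wedge n m) = \<sigma> *\<^sub>R wedge n m" by (rule H(1))
  assume "cross2 (dp1 (x, y) n c) (dp1 (x, y) m c) \<noteq> 0"
  then have "a * b' - b * a' \<noteq> 0" unfolding nab(2) mab(2) cross2_combination by auto
  then show "wedge n m \<noteq> 0" using H(2) coef_lin(3)[of 1 2] by metis
qed

abbreviation "TS \<equiv> twistor_space M g"
abbreviation "TA \<equiv> twistor_atlas M g"

lemma Psi_in_twistor:
  assumes p: "(x, y, A) \<in> CS" shows "\<Psi> (x, y, A) \<in> TS"
proof -
  have A: "(x, y, A) \<in> HB" using p config_space_subset by blast
  have iso: "g2 y (A u) (A v) = g1 x u v" if "u \<in> S1.T x" "v \<in> S1.T x" for u v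
    using p that by (auto simp: config_space_def)
  have xy: "(x, y) \<in> mcarrier M" by (rule hom_mcarrier[OF A])
  obtain c d where cd: "c \<in> charts_at \<A> x" "d \<in> charts_at \<B> y" by (rule mcarrier_productE[OF xy])
  have "det (mat c d x A) > 0" using config_space_iff[OF A cd] p by (simp add: iso_mat_def)
  then have pos: "1 * det (mat c d x A) > 0" by simp
  have "selfdual M g (x, y) (graph_plane \<A> \<B> (x, y, A))"
    unfolding selfdual_def
  proof (intro allI impI)
    fix n m assume "graph_plane \<A> \<B> (x, y, A) = span {n, m}"
    then have "n \<in> graph_plane \<A> \<B> (x, y, A)" "m \<in> graph_plane \<A> \<B> (x, y, A)" using span_base[of _ "{n, m}"] by auto
    from hodge_star_graph_plane(1)[OF A cd iso _ pos this] show "hodge_star M g (x, y) (wedge n m) = wedge n m" by simp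
  qed
  moreover have "totally_null g (x, y) (graph_plane \<A> \<B> (x, y, A))"
    by (auto simp: totally_null_def graph_plane_eq split_metric_def iso)
  ultimately show ?thesis
    using graph_plane_tangent[OF A] xy by (simp add: Psi_eq twistor_space_def)
qed

text \<open>
  A vector of \<open>N\<close> that projects to zero on the first surface is null and tangent to the second
  surface, hence zero. So the first projection maps the two-dimensional space \<open>N\<close> isomorphically
  onto the tangent plane, and \<open>A\<close> is the inverse followed by the second projection. The basis \<open>n1, n2\<close> provides a nonzero bivector
  of the plane.
\<close>

lemma null_plane_graph:
  assumes xy: "(x, y) \<in> mcarrier M" and N: "tangent_plane M (x, y) N" "totally_null g (x, y) N"
  obtains A n1 n2 c where "(x, y, A) \<in> HB" "\<forall>u\<in>S1.T x. \<forall>v\<in>S1.T x. g2 y (A u) (A v) = g1 x u v"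
    "N = graph_plane \<A> \<B> (x, y, A)" "N = span {n1, n2}" "n1 \<in> N" "n2 \<in> N" "c \<in> charts_at \<A> x"
    "cross2 (dp1 (x, y) n1 c) (dp1 (x, y) n2 c) \<noteq> 0"
proof -
  have x: "x \<in> mcarrier \<A>" and y: "y \<in> mcarrier \<B>" using xy by (auto simp: mcarrier_product)
  have sub: "subspace N" "N \<subseteq> TM (x, y)" "dim N = 2" using N(1) by (auto simp: tangent_plane_def)
  have NT: "n \<in> TM (x, y)" if "n \<in> N" for n using sub(2) that by blast
  have null: "g1 x (dp1 (x, y) u) (dp1 (x, y) v) = g2 y (dp2 (x, y) u) (dp2 (x, y) v)" if "u \<in> N" "v \<in> N" for u v
  proof -
    have "g (x, y) u v = 0" using N(2) that by (simp add: totally_null_def)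
    then show ?thesis by (simp add: split_metric_def)
  qed
  obtain c d where c: "c \<in> charts_at \<A> x" and d: "d \<in> charts_at \<B> y" by (rule mcarrier_productE[OF xy])
  have inj: "n = 0" if n: "n \<in> N" "dp1 (x, y) n = 0" for n
  proof -
    have "g2 y (dp2 (x, y) n) (dp2 (x, y) n) = 0"
      using null[OF n(1) n(1)] n(2) S1.metric_zero(1)[OF x S1.zero_in_T] by simp
    then have "dp2 (x, y) n = 0" using S2.metric_pos[OF y dproj_in(2)[OF NT[OF n(1)] xy]] by (metis less_irrefl)
    moreover have "dp1 (x, y) 0 = 0" "dp2 (x, y) 0 = 0"
      using dproj_scale[OF xy NT[OF n(1)], of 0] by simp_all
    ultimately show "n = 0"
      using tangent_product_eqI[OF NT[OF n(1)] NT[OF subspace_0[OF sub(1)]] xy] n(2) by simp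
  qed
  obtain S where S: "S \<subseteq> N" "independent S" "N \<subseteq> span S" "card S = dim N" using basis_exists by blast
  then obtain n1 n2 where n12: "S = {n1, n2}" "n1 \<noteq> n2" using sub(3) card_2_iff by metis
  have nN: "n1 \<in> N" "n2 \<in> N" using S(1) n12 by auto
  have span: "N = span {n1, n2}" using S(3) span_minimal[OF S(1) sub(1)] n12(1) by auto
  have ind: "a = 0 \<and> b = 0" if "a *\<^sub>R n1 + b *\<^sub>R n2 = 0" for a b
  proof -
    let ?u = "\<lambda>v. if v = n1 then a else b"
    have no: "\<not> (\<exists>u. (\<exists>v\<in>{n1, n2}. u v \<noteq> 0) \<and> (\<Sum>v\<in>{n1, n2}. u v *\<^sub>R v) = 0)"
      using S(2) unfolding n12(1) dependent_finite[OF finite.insertI[OF finite.insertI[OF finite.emptyI]]] .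
    have u: "?u n1 = a" "?u n2 = b" using n12(2) by simp_all
    have "(\<Sum>v\<in>{n1, n2}. ?u v *\<^sub>R v) = ?u n1 *\<^sub>R n1 + ?u n2 *\<^sub>R n2"
      using n12(2) sum.insert[of "{n2}" n1 "\<lambda>v. ?u v *\<^sub>R v"] sum.insert[of "{}" n2 "\<lambda>v. ?u v *\<^sub>R v"]
      by (simp only: finite.emptyI finite.insertI singleton_iff empty_iff not_False_eq_True sum.empty add_0_right)
    then have sum: "(\<Sum>v\<in>{n1, n2}. ?u v *\<^sub>R v) = 0" using that unfolding u by simp
    show ?thesis
    proof (rule ccontr)
      assume "\<not> (a = 0 \<and> b = 0)"
      then have "?u n1 \<noteq> 0 \<or> ?u n2 \<noteq> 0" unfolding u by blast
      then have "(\<exists>v\<in>{n1, n2}. ?u v \<noteq> 0) \<and> (\<Sum>v\<in>{n1, n2}. ?u v *\<^sub>R v) = 0" using sum by blast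
      then have "\<exists>u. (\<exists>v\<in>{n1, n2}. u v \<noteq> 0) \<and> (\<Sum>v\<in>{n1, n2}. u v *\<^sub>R v) = 0" by (rule exI[of _ ?u])
      then show False using no by (rule notE[rotated])
    qed
  qed
  let ?a1 = "dp1 (x, y) n1 c" and ?a2 = "dp1 (x, y) n2 c"
  have comb: "a *\<^sub>R n1 + b *\<^sub>R n2 \<in> N" "dp1 (x, y) (a *\<^sub>R n1 + b *\<^sub>R n2) c = a *\<^sub>R ?a1 + b *\<^sub>R ?a2" for a b
    using nN subspace_add[OF sub(1)] subspace_scale[OF sub(1)] dproj_lincomb(1)[OF NT[OF nN(1)] NT[OF nN(2)] xy, of a b]
    by (auto simp: scaleR_fun_apply)
  have eq0: "dp1 (x, y) n = 0" if "n \<in> N" "dp1 (x, y) n c = 0" for n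
    by (rule tangent_vector_eqI[OF S1.compat dproj_in(1)[OF NT[OF that(1)] xy] S1.zero_in_T c]) (simp add: that)
  have cross: "cross2 ?a1 ?a2 \<noteq> 0"
  proof
    assume z: "cross2 ?a1 ?a2 = 0"
    \<comment> \<open>If the projected basis spans no area, this relation between its members lifts to one between
       \<open>n1\<close> and \<open>n2\<close>, which are independent.\<close>
    have "?a2 $ k *\<^sub>R ?a1 + (- ?a1 $ k) *\<^sub>R ?a2 = 0" for k
      using z exhaust_2[of k] by (auto simp: cross2_def vec_eq_iff forall_2 algebra_simps)
    then have "?a2 $ k *\<^sub>R n1 + (- ?a1 $ k) *\<^sub>R n2 = 0" for k
      using inj[OF comb(1) eq0[OF comb(1)]] comb(2) by metis
    then have "?a1 $ k = 0" for k using ind by fastforce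
    then have "?a1 = 0" by (simp add: vec_eq_iff)
    then have "n1 = 0" using inj[OF nN(1) eq0[OF nN(1)]] by simp
    then show False using ind[of 1 0] by simp
  qed
  have ex: "\<exists>!n. n \<in> N \<and> dp1 (x, y) n = v" if v: "v \<in> S1.T x" for v
  proof (rule ex_ex1I)
    let ?D = "cross2 ?a1 ?a2"
    \<comment> \<open>Cramer's rule for the components of \<open>v\<close> in the projected basis.\<close>
    define s t where "s = cross2 (v c) ?a2 / ?D" and "t = cross2 ?a1 (v c) / ?D"
    have "?D *\<^sub>R v c = cross2 (v c) ?a2 *\<^sub>R ?a1 + cross2 ?a1 (v c) *\<^sub>R ?a2"
      by (simp add: cross2_def vec_eq_iff forall_2 algebra_simps)
    then have "?D *\<^sub>R v c = ?D *\<^sub>R (s *\<^sub>R ?a1 + t *\<^sub>R ?a2)" using cross by (simp add: s_def t_def scaleR_add_right)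
    then have vc: "v c = s *\<^sub>R ?a1 + t *\<^sub>R ?a2" using cross by simp
    have "dp1 (x, y) (s *\<^sub>R n1 + t *\<^sub>R n2) = v"
      by (rule tangent_vector_eqI[OF S1.compat dproj_in(1)[OF NT[OF comb(1)] xy] v c]) (simp add: comb(2) vc)
    then show "\<exists>n. n \<in> N \<and> dp1 (x, y) n = v" using comb(1) by blast
    fix n m assume nm: "n \<in> N \<and> dp1 (x, y) n = v" "m \<in> N \<and> dp1 (x, y) m = v"
    have "n + (-1) *\<^sub>R m \<in> N" using nm subspace_add[OF sub(1)] subspace_scale[OF sub(1)] by blast
    moreover have "dp1 (x, y) (n + (-1) *\<^sub>R m) = 0"
      using dproj_lincomb(1)[OF NT NT xy, of n m 1 "-1"] nm by simp
    ultimately have "n + (-1) *\<^sub>R m = 0" by (rule inj)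
    then show "n = m" by simp
  qed
  define lft where "lft v = (THE n. n \<in> N \<and> dp1 (x, y) n = v)" for v
  have lft: "lft v \<in> N" "dp1 (x, y) (lft v) = v" if "v \<in> S1.T x" for v
    using theI'[OF ex[OF that]] by (auto simp: lft_def)
  have lft_eq: "lft v = n" if "n \<in> N" "dp1 (x, y) n = v" for n v
    using ex[of v] lft[of v] dproj_in(1)[OF NT[OF that(1)] xy] that by auto
  define A where "A = restrict (\<lambda>v. dp2 (x, y) (lft v)) (S1.T x)"
  have A: "A v = dp2 (x, y) (lft v)" if "v \<in> S1.T x" for v using that by (simp add: A_def)
  have HBA: "(x, y, A) \<in> HB"
  proof -
    have "A \<in> S1.T x \<rightarrow>\<^sub>E S2.T y"
      using dproj_in(2)[OF NT[OF lft(1)] xy] by (auto simp: A_def)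
    moreover have "linear_map_on (S1.T x) A"
      unfolding linear_map_on_def
    proof (intro conjI ballI allI)
      fix u v assume uv: "u \<in> S1.T x" "v \<in> S1.T x"
      have s: "u + v \<in> S1.T x" using uv subspace_add[OF subspace_tangent_space[OF S1.compat]] by blast
      have "lft (u + v) = lft u + lft v"
        by (rule lft_eq[OF subspace_add[OF sub(1) lft(1)[OF uv(1)] lft(1)[OF uv(2)]]])
          (simp add: dproj_lin(1)[OF xy NT[OF lft(1)[OF uv(1)]] NT[OF lft(1)[OF uv(2)]]] lft(2) uv)
      then show "A (u + v) = A u + A v"
        using dproj_lin(2)[OF xy NT[OF lft(1)[OF uv(1)]] NT[OF lft(1)[OF uv(2)]]] A uv s by simp
    next
      fix r u assume u: "u \<in> S1.T x"
      have s: "r *\<^sub>R u \<in> S1.T x" using u subspace_scale[OF subspace_tangent_space[OF S1.compat]] by blast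
      note l = NT[OF lft(1)[OF u]]
      have "lft (r *\<^sub>R u) = r *\<^sub>R lft u"
        by (rule lft_eq[OF subspace_scale[OF sub(1) lft(1)[OF u]]]) (simp add: dproj_scale(1)[OF xy l] lft(2) u)
      then show "A (r *\<^sub>R u) = r *\<^sub>R A u" using dproj_scale(2)[OF xy l] A u s by simp
    qed
    ultimately show ?thesis using x y by (simp add: hom_bundle_def)
  qed
  have iso: "g2 y (A u) (A v) = g1 x u v" if "u \<in> S1.T x" "v \<in> S1.T x" for u v
    using null[OF lft(1)[OF that(1)] lft(1)[OF that(2)]] that by (simp add: A lft(2))
  have "N = graph_plane \<A> \<B> (x, y, A)"
  proof
    show "N \<subseteq> graph_plane \<A> \<B> (x, y, A)"
    proof
      fix n assume n: "n \<in> N"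
      then have "dp1 (x, y) n \<in> S1.T x" by (rule dproj_in(1)[OF NT xy])
      then show "n \<in> graph_plane \<A> \<B> (x, y, A)" using n NT[OF n] lft_eq[OF n refl] by (simp add: graph_plane_eq A)
    qed
    show "graph_plane \<A> \<B> (x, y, A) \<subseteq> N"
    proof
      fix u assume "u \<in> graph_plane \<A> \<B> (x, y, A)"
      then have u: "u \<in> TM (x, y)" "dp1 (x, y) u \<in> S1.T x" "dp2 (x, y) u = A (dp1 (x, y) u)" by (auto simp: graph_plane_eq)
      have "u = lft (dp1 (x, y) u)"
        by (rule tangent_product_eqI[OF u(1) NT[OF lft(1)[OF u(2)]] xy]) (simp_all add: lft(2) u A)
      then show "u \<in> N" using lft(1)[OF u(2)] by simp
    qed
  qed
  then show ?thesis using that[OF HBA _ _ span nN c cross] iso by blast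
qed

text \<open>
  If \<open>A\<close> reversed the orientation, the nonzero bivector of its graph would be an eigenvector with
  eigenvalue \<open>-1\<close>, whereas the plane is selfdual.
\<close>

lemma twistor_space_eq: "TS = \<Psi> ` CS"
proof
  show "\<Psi> ` CS \<subseteq> TS" using Psi_in_twistor by auto
  show "TS \<subseteq> \<Psi> ` CS"
  proof
    fix q assume q: "q \<in> TS"
    obtain x y N where e: "q = ((x, y), N)" by (cases q) auto
    have xy: "(x, y) \<in> mcarrier M" and N: "tangent_plane M (x, y) N" "totally_null g (x, y) N" and sd: "selfdual M g (x, y) N"
      using q by (auto simp: e twistor_space_def)
    obtain A n1 n2 c where A: "(x, y, A) \<in> HB" and iso': "\<forall>u\<in>S1.T x. \<forall>v\<in>S1.T x. g2 y (A u) (A v) = g1 x u v"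
      and NA: "N = graph_plane \<A> \<B> (x, y, A)" "N = span {n1, n2}" "n1 \<in> N" "n2 \<in> N" and c: "c \<in> charts_at \<A> x"
      and cross: "cross2 (dp1 (x, y) n1 c) (dp1 (x, y) n2 c) \<noteq> 0"
      by (rule null_plane_graph[OF xy N]) blast
    have iso: "g2 y (A u) (A v) = g1 x u v" if "u \<in> S1.T x" "v \<in> S1.T x" for u v using iso' that by blast
    obtain d where d: "d \<in> charts_at \<B> y" by (rule mcarrier_productE[OF xy])
    let ?B = "mat c d x A"
    have "det ?B \<noteq> 0" by (rule isometry_config_iff(2)[OF A c d iso])
    moreover have "\<not> det ?B < 0"
    proof
      assume "det ?B < 0"
      then have neg: "-1 * det ?B > 0" by simp
      note h = hodge_star_graph_plane[OF A c d iso _ neg NA(3)[unfolded NA(1)] NA(4)[unfolded NA(1)]]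
      have "wedge n1 n2 = - wedge n1 n2" using h(1) sd NA(2) by (simp add: selfdual_def)
      then have "wedge n1 n2 = 0" by (simp add: fun_eq_iff)
      then show False using h(2) cross by simp
    qed
    ultimately have "(x, y, A) \<in> CS" using isometry_config_iff(1)[OF A c d iso] by simp
    then show "q \<in> \<Psi> ` CS" using NA(1) by (intro image_eqI[of q \<Psi> "(x, y, A)"]) (simp_all add: e Psi_eq)
  qed
qed

section \<open>The diffeomorphism\<close>

abbreviation "\<Psi>' \<equiv> inv_into HB \<Psi>"

lemma Psi_inverse: "p \<in> CS \<Longrightarrow> \<Psi>' (\<Psi> p) = p" "q \<in> TS \<Longrightarrow> \<Psi> (\<Psi>' q) = q" "\<Psi>' ` TS \<subseteq> CS"
proof -
  have inv: "\<Psi>' (\<Psi> p) = p" if "p \<in> CS" for p using inv_into_f_f[OF inj_Psi] config_space_subset that by blast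
  then show "p \<in> CS \<Longrightarrow> \<Psi>' (\<Psi> p) = p" .
  show "q \<in> TS \<Longrightarrow> \<Psi> (\<Psi>' q) = q" unfolding twistor_space_eq using inv by auto
  show "\<Psi>' ` TS \<subseteq> CS" unfolding twistor_space_eq using inv by auto
qed

lemma smooth_Psi_CS: "smooth_map H CS PM \<Psi>"
  by (rule smooth_map_subset[OF smooth_Psi config_space_subset])

lemma smooth_Psi'_TS: "smooth_map PM TS H \<Psi>'"
  by (rule smooth_map_subset[OF smooth_Psi_inv]) (use config_space_subset in \<open>auto simp: twistor_space_eq\<close>)

text \<open>
  The twistor space is covered by the images under \<open>\<Psi>\<close> of the charts of the configuration space.
\<close>

lemma mcarrier_twistor: "mcarrier TA = TS"
proof
  show "mcarrier TA \<subseteq> TS" unfolding twistor_atlas_def by (rule mcarrier_submanifold_subset[OF compatible_PM])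
  show "TS \<subseteq> mcarrier TA"
  proof
    fix q assume "q \<in> TS"
    then obtain p where p: "p \<in> CS" "q = \<Psi> p" by (auto simp: twistor_space_eq)
    then have "p \<in> mcarrier CA" by (simp add: mcarrier_config)
    then obtain C where C: "C \<in> CA" "p \<in> fst C" unfolding mcarrier_def by blast
    obtain V \<kappa> where e: "C = (V, \<kappa>)" by (cases C)
    have "(V, \<kappa>) \<in> submanifold_atlas H CS" using C(1) by (simp add: config_atlas_def e)
    from submanifold_chart_transport[OF compatible_hom compatible_PM smooth_Psi_CS smooth_Psi'_TS _ Psi_inverse(3,1,2) this]
    have "(\<Psi> ` V, \<lambda>q. \<kappa> (\<Psi>' q)) \<in> TA" by (simp add: twistor_atlas_def twistor_space_eq)
    moreover have "q \<in> fst (\<Psi> ` V, \<lambda>q. \<kappa> (\<Psi>' q))" using C(2) p(2) e by simp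
    ultimately show "q \<in> mcarrier TA" unfolding mcarrier_def by blast
  qed
qed

lemma compatible_twistor: "compatible_atlas TA"
  unfolding twistor_atlas_def by (rule compatible_submanifold[OF compatible_PM])

lemma smooth_config_inclusion: "smooth_map CA CS H (\<lambda>p. p)"
proof -
  have "smooth_map CA (mcarrier CA) H (\<lambda>p. p)"
    unfolding config_atlas_def by (rule smooth_submanifold_inclusion[OF compatible_hom])
  then show ?thesis unfolding mcarrier_config .
qed

lemma smooth_into_config: "compatible_atlas \<C> \<Longrightarrow> smooth_map \<C> R H f \<Longrightarrow> f ` R \<subseteq> CS \<Longrightarrow> smooth_map \<C> R CA f"
  unfolding mcarrier_config[symmetric] unfolding config_atlas_def by (rule smooth_map_into_submanifold[OF compatible_hom])

lemma smooth_into_twistor: "compatible_atlas \<C> \<Longrightarrow> smooth_map \<C> R PM f \<Longrightarrow> f ` R \<subseteq> TS \<Longrightarrow> smooth_map \<C> R TA f"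
  unfolding mcarrier_twistor[symmetric] unfolding twistor_atlas_def by (rule smooth_map_into_submanifold[OF compatible_PM])

lemma smooth_Psi_H_TA: "smooth_map H CS TA \<Psi>"
  by (rule smooth_into_twistor[OF compatible_hom smooth_Psi_CS]) (simp add: twistor_space_eq)

lemma smooth_Psi_CA_TA: "smooth_map CA CS TA \<Psi>"
  by (rule smooth_map_compose[OF compatible_config compatible_hom compatible_twistor smooth_config_inclusion smooth_Psi_H_TA]) simp

lemma diffeomorphism_Psi: "diffeomorphism CA TA \<Psi>"
  unfolding diffeomorphism_def mcarrier_config mcarrier_twistor
proof (intro conjI smooth_Psi_CA_TA)
  have inj: "inj_on \<Psi> CS" by (rule inj_on_subset[OF inj_Psi config_space_subset])
  then show "bij_betw \<Psi> CS TS" by (simp add: bij_betw_def twistor_space_eq)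
  have "smooth_map TA (mcarrier TA) PM (\<lambda>p. p)"
    unfolding twistor_atlas_def by (rule smooth_submanifold_inclusion[OF compatible_PM])
  then have "smooth_map TA TS PM (\<lambda>p. p)" unfolding mcarrier_twistor .
  from smooth_map_compose[OF compatible_twistor compatible_PM compatible_hom this smooth_Psi'_TS]
  have "smooth_map TA TS H \<Psi>'" by simp
  then have "smooth_map TA TS CA \<Psi>'" by (rule smooth_into_config[OF compatible_twistor]) (rule Psi_inverse(3))
  then show "smooth_map TA TS CA (inv_into CS \<Psi>)"
  proof (rule smooth_map_cong)
    fix q assume "q \<in> TS"
    then obtain p where "p \<in> CS" "q = \<Psi> p" by (auto simp: twistor_space_eq)
    then show "\<Psi>' q = inv_into CS \<Psi> q" using Psi_inverse(1) inv_into_f_f[OF inj] by simp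
  qed
qed

end

section \<open>Parallel transport and rolling\<close>

lemma velocity_cong_open:
  fixes \<A> :: "('a, 'e::euclidean_space) atlas"
  assumes "open I" "t \<in> I" "\<And>s. s \<in> I \<Longrightarrow> \<gamma> s = \<gamma>' s"
  shows "velocity \<A> \<gamma> t = velocity \<A> \<gamma>' t"
proof
  fix c :: "('a, 'e) chart"
  have eq: "((\<lambda>s. snd c (\<gamma> s)) has_vector_derivative D) (at t) \<longleftrightarrow> ((\<lambda>s. snd c (\<gamma>' s)) has_vector_derivative D) (at t)" for D
    using has_vector_derivative_transform_within_open[OF _ assms(1,2), of "\<lambda>s. snd c (\<gamma> s)" D "\<lambda>s. snd c (\<gamma>' s)"]
      has_vector_derivative_transform_within_open[OF _ assms(1,2), of "\<lambda>s. snd c (\<gamma>' s)" D "\<lambda>s. snd c (\<gamma> s)"] assms(3) by auto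
  show "velocity \<A> \<gamma> t c = velocity \<A> \<gamma>' t c"
    unfolding velocity_def vector_derivative_def eq using assms(3)[OF assms(2)] by simp
qed

lemma matrix_eq_basisI:
  fixes P Q :: "real^'n^'m"
  assumes "\<And>j. P *v axis j 1 = Q *v axis j 1" shows "P = Q"
proof -
  have "column j P = column j Q" for j using assms[of j] by (simp only: matrix_vector_mult_basis)
  then show ?thesis by (simp add: column_def vec_eq_iff)
qed

lemma bounded_bilinear_matrix_mult: "bounded_bilinear ((**) :: real^'n^'m \<Rightarrow> real^'k^'n \<Rightarrow> real^'k^'m)"
proof -
  have "bilinear ((**) :: real^'n^'m \<Rightarrow> real^'k^'n \<Rightarrow> real^'k^'m)"
    unfolding bilinear_def
    by (intro conjI allI linearI) (simp_all add: vec_eq_iff matrix_matrix_mult_def algebra_simps sum.distrib sum_distrib_left)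
  then show ?thesis by (rule bilinear_conv_bounded_bilinear[THEN iffD1])
qed

lemma has_vector_derivative_matrix_columns:
  fixes V :: "'n::finite \<Rightarrow> real \<Rightarrow> real^'m"
  assumes "\<And>j. (V j has_vector_derivative V' j) (at t)"
  shows "((\<lambda>s. \<chi> i j. V j s $ i) has_vector_derivative (\<chi> i j. V' j $ i)) (at t)"
  unfolding has_vector_derivative_def
proof (subst has_derivative_componentwise_within, intro ballI)
  fix b :: "real^'n^'m" assume "b \<in> Basis"
  then obtain i j where b: "b = axis i (axis j 1)" by (auto simp: Basis_vec_def)
  have "((\<lambda>s. V j s $ i) has_derivative (\<lambda>h. h *\<^sub>R V' j $ i)) (at t)"
    using bounded_linear.has_vector_derivative[OF bounded_linear_vec_nth assms[of j], of i]
    by (simp add: has_vector_derivative_def)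
  then show "((\<lambda>s. (\<chi> i j. V j s $ i) \<bullet> b) has_derivative (\<lambda>h. (h *\<^sub>R (\<chi> i j. V' j $ i)) \<bullet> b)) (at t)"
    by (simp add: b inner_axis)
qed

context surface begin

lemma parallel_along_cong:
  assumes "parallel_along \<A> g I \<gamma> V" "open I" "\<And>t. t \<in> I \<Longrightarrow> V t = W t"
  shows "parallel_along \<A> g I \<gamma> W"
  unfolding parallel_along_def
proof (intro ballI conjI)
  fix t assume t: "t \<in> I"
  note V = parallel_alongD[OF assms(1) t]
  show "W t \<in> T (\<gamma> t)" using V(1) assms(3)[OF t] by simp
  fix c assume c: "c \<in> charts_at \<A> (\<gamma> t)"
  show "parallel_in_chart c \<gamma> W t"
    unfolding assms(3)[OF t, symmetric]
    by (rule has_vector_derivative_transform_within_open[OF V(2)[OF c] assms(2) t]) (simp add: assms(3))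
qed

text \<open>
  The choice is harmless: by \<open>parallel_unique\<close> the value at \<open>t\<close> is the same for all such fields.
\<close>

definition transport :: "real set \<Rightarrow> (real \<Rightarrow> 'a) \<Rightarrow> real \<Rightarrow> real \<Rightarrow> ('a, real^2) tvec \<Rightarrow> ('a, real^2) tvec"
  where "transport I \<gamma> s t v = (SOME V. parallel_along \<A> g I \<gamma> V \<and> V s = v) t"

context
  fixes I :: "real set" and \<gamma> :: "real \<Rightarrow> 'a"
  assumes \<gamma>: "smooth_map eucl I \<A> \<gamma>" "open I" "is_interval I"
begin

lemma transport_parallel:
  assumes "s \<in> I" "v \<in> T (\<gamma> s)"
  shows "parallel_along \<A> g I \<gamma> (\<lambda>t. transport I \<gamma> s t v)" "transport I \<gamma> s s v = v"
proof -
  let ?V = "SOME V. parallel_along \<A> g I \<gamma> V \<and> V s = v"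
  have V: "parallel_along \<A> g I \<gamma> ?V \<and> ?V s = v"
    by (rule someI_ex[OF parallel_existence[OF \<gamma> assms]])
  have eq: "(\<lambda>t. transport I \<gamma> s t v) = ?V" by (rule ext) (simp add: transport_def)
  show "parallel_along \<A> g I \<gamma> (\<lambda>t. transport I \<gamma> s t v)" unfolding eq using V by blast
  show "transport I \<gamma> s s v = v" unfolding transport_def using V by blast
qed

lemma transport_eq:
  assumes "parallel_along \<A> g I \<gamma> V" "s \<in> I" "t \<in> I"
  shows "transport I \<gamma> s t (V s) = V t"
  by (rule parallel_unique[OF \<gamma> transport_parallel(1)[OF assms(2)] assms(1,2) _ assms(3)])
    (use parallel_alongD(1)[OF assms(1,2)] transport_parallel(2)[OF assms(2)] in auto)

lemma transport_in: "s \<in> I \<Longrightarrow> t \<in> I \<Longrightarrow> v \<in> T (\<gamma> s) \<Longrightarrow> transport I \<gamma> s t v \<in> T (\<gamma> t)"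
  by (rule parallel_alongD(1)[OF transport_parallel(1)])

lemma transport_lincomb:
  assumes "s \<in> I" "t \<in> I" "v \<in> T (\<gamma> s)" "w \<in> T (\<gamma> s)"
  shows "transport I \<gamma> s t (a *\<^sub>R v + b *\<^sub>R w) = a *\<^sub>R transport I \<gamma> s t v + b *\<^sub>R transport I \<gamma> s t w"
  using transport_eq[OF parallel_along_lincomb[OF transport_parallel(1)[OF assms(1,3)] transport_parallel(1)[OF assms(1,4)], of a b] assms(1,2)]
  by (simp add: transport_parallel(2)[OF assms(1)] assms(3,4))

end

end

context surface_pair begin

text \<open>
  The condition of no twisting by itself. Along an arbitrary curve in the product it describes the
  parallel transport of a graph.
\<close>

definition transporting where
  "transporting I x y A \<longleftrightarrow> open I \<and> is_interval I \<and> 0 \<in> I \<and> smooth_map eucl I \<A> x \<and> smooth_map eucl I \<B> y \<and>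
    (\<forall>t\<in>I. (x t, y t, A t) \<in> HB) \<and>
    (\<forall>V. parallel_along \<A> g1 I x V \<longrightarrow> parallel_along \<B> g2 I y (\<lambda>t. A t (V t)))"

lemma transportingD:
  assumes "transporting I x y A"
  shows "open I" "is_interval I" "0 \<in> I" "smooth_map eucl I \<A> x" "smooth_map eucl I \<B> y"
    "t \<in> I \<Longrightarrow> (x t, y t, A t) \<in> HB" "parallel_along \<A> g1 I x V \<Longrightarrow> parallel_along \<B> g2 I y (\<lambda>t. A t (V t))"
  using assms by (auto simp: transporting_def)

text \<open>Parallel transport preserves the metrics of both surfaces.\<close>

lemma transporting_isometry:
  assumes tr: "transporting I x y A" and "t \<in> I" and u: "u \<in> S1.T (x t)" and v: "v \<in> S1.T (x t)"
    and iso: "\<And>u v. u \<in> S1.T (x 0) \<Longrightarrow> v \<in> S1.T (x 0) \<Longrightarrow> g2 (y 0) (A 0 u) (A 0 v) = g1 (x 0) u v"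
  shows "g2 (y t) (A t u) (A t v) = g1 (x t) u v"
proof -
  note D = transportingD[OF tr]
  obtain U where U: "parallel_along \<A> g1 I x U" "U t = u" using S1.parallel_existence[OF D(4,1,2) \<open>t \<in> I\<close> u] by blast
  obtain V where V: "parallel_along \<A> g1 I x V" "V t = v" using S1.parallel_existence[OF D(4,1,2) \<open>t \<in> I\<close> v] by blast
  have "g2 (y t) (A t (U t)) (A t (V t)) = g2 (y 0) (A 0 (U 0)) (A 0 (V 0))"
    by (rule S2.parallel_isometry[OF D(5,1,2) D(7)[OF U(1)] D(7)[OF V(1)] \<open>t \<in> I\<close> D(3)])
  also have "\<dots> = g1 (x 0) (U 0) (V 0)"
    by (rule iso[OF S1.parallel_alongD(1)[OF U(1) D(3)] S1.parallel_alongD(1)[OF V(1) D(3)]])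
  also have "\<dots> = g1 (x t) (U t) (V t)"
    by (rule S1.parallel_isometry[OF D(4,1,2) U(1) V(1) D(3) \<open>t \<in> I\<close>])
  finally show ?thesis by (simp add: U V)
qed

text \<open>
  Let \<open>V\<close> be parallel along the curve in the product, with components \<open>V\<^sub>1\<close> and \<open>V\<^sub>2\<close>. Then \<open>A V\<^sub>1\<close> and \<open>V\<^sub>2\<close>
  are both parallel on the second surface, so they agree once they agree at time \<open>0\<close>.
  Conversely a vector of the graph at time \<open>t\<close> is the value of the parallel field with
  components \<open>V\<^sub>1\<close> and \<open>A V\<^sub>1\<close>.
\<close>

lemma parallel_transport_graph:
  assumes tr: "transporting I x y A" and t: "t \<in> I"
  shows "parallel_transport M g I (\<lambda>t. (x t, y t)) (graph_plane \<A> \<B> (x 0, y 0, A 0)) t = graph_plane \<A> \<B> (x t, y t, A t)"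
proof -
  note D = transportingD[OF tr]
  have \<gamma>: "smooth_map eucl I M (\<lambda>t. (x t, y t))" by (rule smooth_curve_pair[OF D(4,5,1)])
  note par = parallel_product_iff[OF \<gamma> D(1), simplified]
  show ?thesis
  proof
    show "parallel_transport M g I (\<lambda>t. (x t, y t)) (graph_plane \<A> \<B> (x 0, y 0, A 0)) t \<subseteq> graph_plane \<A> \<B> (x t, y t, A t)"
    proof
      fix u assume "u \<in> parallel_transport M g I (\<lambda>t. (x t, y t)) (graph_plane \<A> \<B> (x 0, y 0, A 0)) t"
      then obtain V where V: "u = V t" "parallel_along M g I (\<lambda>t. (x t, y t)) V" "V 0 \<in> graph_plane \<A> \<B> (x 0, y 0, A 0)"
        by (auto simp: parallel_transport_def)
      have VT: "\<And>s. s \<in> I \<Longrightarrow> V s \<in> TM (x s, y s)" and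
        V1: "parallel_along \<A> g1 I x (\<lambda>t. dp1 (x t, y t) (V t))" and V2: "parallel_along \<B> g2 I y (\<lambda>t. dp2 (x t, y t) (V t))"
        using V(2) unfolding par by auto
      have "dp2 (x t, y t) (V t) = A t (dp1 (x t, y t) (V t))"
        by (rule S2.parallel_unique[OF D(5,1,2) V2 D(7)[OF V1] D(3) _ t]) (use V(3) in \<open>simp add: graph_plane_eq\<close>)
      then show "u \<in> graph_plane \<A> \<B> (x t, y t, A t)"
        using VT[OF t] S1.parallel_alongD(1)[OF V1 t] by (simp add: graph_plane_eq V(1))
    qed
    show "graph_plane \<A> \<B> (x t, y t, A t) \<subseteq> parallel_transport M g I (\<lambda>t. (x t, y t)) (graph_plane \<A> \<B> (x 0, y 0, A 0)) t"
    proof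
      fix u assume "u \<in> graph_plane \<A> \<B> (x t, y t, A t)"
      then have u: "u \<in> TM (x t, y t)" "dp1 (x t, y t) u \<in> S1.T (x t)" "dp2 (x t, y t) u = A t (dp1 (x t, y t) u)"
        by (auto simp: graph_plane_eq)
      obtain V1 where V1: "parallel_along \<A> g1 I x V1" "V1 t = dp1 (x t, y t) u"
        using S1.parallel_existence[OF D(4,1,2) t u(2)] by blast
      let ?V = "\<lambda>s. pairT (x s) (y s) (V1 s) (A s (V1 s))"
      have P: "?V s \<in> TM (x s, y s)" "dp1 (x s, y s) (?V s) = V1 s" "dp2 (x s, y s) (?V s) = A s (V1 s)" if s: "s \<in> I" for s
        using pairT[OF S1.parallel_alongD(1)[OF V1(1) s] hom_bundleD(3)[OF D(6)[OF s] S1.parallel_alongD(1)[OF V1(1) s]] hom_mcarrier[OF D(6)[OF s]]]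
        by auto
      have V: "parallel_along M g I (\<lambda>t. (x t, y t)) ?V"
        unfolding par
      proof (intro conjI ballI P(1))
        show "parallel_along \<A> g1 I x (\<lambda>t. dp1 (x t, y t) (?V t))"
          by (rule S1.parallel_along_cong[OF V1(1) D(1)]) (simp add: P)
        show "parallel_along \<B> g2 I y (\<lambda>t. dp2 (x t, y t) (?V t))"
          by (rule S2.parallel_along_cong[OF D(7)[OF V1(1)] D(1)]) (simp add: P)
      qed
      have uV: "u = ?V t"
        by (rule tangent_product_eqI[OF u(1) P(1)[OF t] hom_mcarrier[OF D(6)[OF t]]]) (simp_all add: P(2,3)[OF t], simp_all add: V1(2) u(3))
      have V0: "?V 0 \<in> graph_plane \<A> \<B> (x 0, y 0, A 0)"
        by (rule graph_planeI[OF D(6)[OF D(3)] S1.parallel_alongD(1)[OF V1(1) D(3)]])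
      show "u \<in> parallel_transport M g I (\<lambda>t. (x t, y t)) (graph_plane \<A> \<B> (x 0, y 0, A 0)) t"
        unfolding parallel_transport_def by (rule CollectI, rule exI[of _ ?V], intro conjI uV V V0)
    qed
  qed
qed

text \<open>
  If \<open>V\<close> and \<open>W = B V\<close> are parallel along curves with velocities \<open>u\<close> and \<open>w\<close>, then \<open>B' V = W' - B V'\<close>
  determines the derivative of the matrix \<open>B\<close> to be this one.
\<close>

definition hor_mat where
  "hor_mat c d a q B u w = matrix (\<lambda>v. B *v S1.\<Gamma> c a u v - S2.\<Gamma> d q w (B *v v))"

lemma linear_hor_mat:
  assumes "c \<in> \<A>" "a \<in> snd c ` fst c" "d \<in> \<B>" "q \<in> snd d ` fst d"
  shows "linear (\<lambda>v. B *v S1.\<Gamma> c a u v - S2.\<Gamma> d q w (B *v v))"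
  by (rule linearI)
    (simp_all add: linear_add[OF S1.linear_christoffel[OF assms(1,2)]] linear_add[OF S2.linear_christoffel[OF assms(3,4)]]
      linear_cmul[OF S1.linear_christoffel[OF assms(1,2)]] linear_cmul[OF S2.linear_christoffel[OF assms(3,4)]]
      matrix_vector_right_distrib matrix_vector_mult_scaleR algebra_simps)

text \<open>
  Let the columns of \<open>V\<close> be a parallel frame that at time \<open>0\<close> is the coordinate frame, and let \<open>W\<close> be
  its image under \<open>A\<close>. Then \<open>B V = W\<close> for the matrix \<open>B\<close> of \<open>A\<close>, where \<open>V\<close> and \<open>W\<close> are
  differentiable. Written as \<open>B - B 0 = (W - B 0 V) V\<^sup>-\<^sup>1\<close>, the right-hand side has a first factor that
  vanishes at \<open>0\<close>, so the derivative of \<open>V\<^sup>-\<^sup>1\<close> does not contribute.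
\<close>

lemma transporting_derivative:
  assumes tr: "transporting I x y A" and c: "c \<in> charts_at \<A> (x 0)" and d: "d \<in> charts_at \<B> (y 0)"
  shows "((\<lambda>s. snd (hom_chart \<A> \<B> c d) (x s, y s, A s)) has_vector_derivative
      (velocity \<A> x 0 c, velocity \<B> y 0 d,
       hor_mat c d (snd c (x 0)) (snd d (y 0)) (mat c d (x 0) (A 0)) (velocity \<A> x 0 c) (velocity \<B> y 0 d))) (at 0)"
    and "\<forall>\<^sub>F s in at 0. (x s, y s, A s) \<in> HB \<inter> fst (hom_chart \<A> \<B> c d)"
proof -
  note D = transportingD[OF tr]
  obtain X where X: "open X" "0 \<in> X" "X \<subseteq> I" "\<And>s. s \<in> X \<Longrightarrow> x s \<in> fst c"
    by (rule smooth_curve_chart[OF S1.compat D(4,1,3) c]) blast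
  obtain Y where Y: "open Y" "0 \<in> Y" "Y \<subseteq> I" "\<And>s. s \<in> Y \<Longrightarrow> y s \<in> fst d"
    by (rule smooth_curve_chart[OF S2.compat D(5,1,3) d]) blast
  have cX: "c \<in> charts_at \<A> (x s)" if "s \<in> X" for s using X(4)[OF that] c by (simp add: charts_at_iff)
  have evX: "\<forall>\<^sub>F s in at 0. s \<in> X" "\<forall>\<^sub>F s in at 0. s \<in> Y" using X Y eventually_at_in_open' by blast+
  then show "\<forall>\<^sub>F s in at 0. (x s, y s, A s) \<in> HB \<inter> fst (hom_chart \<A> \<B> c d)"
    by eventually_elim (use X Y D(6) in \<open>auto simp: fst_hom_chart\<close>)
  let ?B = "\<lambda>s. mat c d (x s) (A s)"
  let ?u = "velocity \<A> x 0 c" and ?w = "velocity \<B> y 0 d" and ?a = "snd c (x 0)" and ?q = "snd d (y 0)"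
  define V where "V = (\<lambda>j::2. \<lambda>t. S1.transport I x 0 t (coord_tvec \<A> c (x 0) (axis j 1)))"
  have e: "coord_tvec \<A> c (x 0) (axis j 1) \<in> S1.T (x 0)" for j :: 2 by (rule coord_tvec_in[OF S1.compat c])
  have V: "parallel_along \<A> g1 I x (V j)" and V0: "V j 0 c = axis j 1" for j
    using S1.transport_parallel[OF D(4,1,2,3) e, of j] coord_tvec_self[OF S1.compat c] by (auto simp: V_def)
  define Vm Wm where "Vm = (\<lambda>s. \<chi> i j. V j s c $ i)" and "Wm = (\<lambda>s. \<chi> i j. A s (V j s) d $ i)"
  define Vm' Wm' where "Vm' = (\<chi> i j. (- S1.\<Gamma> c ?a ?u (V j 0 c)) $ i)" and "Wm' = (\<chi> i j. (- S2.\<Gamma> d ?q ?w (A 0 (V j 0) d)) $ i)"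
  have dV: "(Vm has_vector_derivative Vm') (at 0)"
    unfolding Vm_def Vm'_def
    by (rule has_vector_derivative_matrix_columns) (rule S1.parallel_alongD(2)[OF V D(3) c])
  have dW: "(Wm has_vector_derivative Wm') (at 0)"
    unfolding Wm_def Wm'_def
    by (rule has_vector_derivative_matrix_columns) (rule S2.parallel_alongD(2)[OF D(7)[OF V] D(3) d])
  have BV: "?B s ** Vm s = Wm s" if s: "s \<in> X" for s
  proof -
    have "A s (V j s) d = ?B s *v V j s c" for j
      by (rule mat_works[OF D(6) cX[OF s] S1.parallel_alongD(1)[OF V]]) (use s X in auto)
    then show ?thesis by (simp add: Vm_def Wm_def vec_eq_iff matrix_matrix_mult_def matrix_vector_mult_def)
  qed
  have Vm0: "Vm 0 = Finite_Cartesian_Product.mat 1"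
    by (simp add: Vm_def V0 vec_eq_iff Finite_Cartesian_Product.mat_def axis_def)
  \<comment> \<open>The first factor in the formula for \<open>B - B 0\<close>.\<close>
  define R where "R = (\<lambda>s. Wm s - ?B 0 ** Vm s)"
  have R0: "R 0 = 0" using BV[OF X(2)] by (simp add: R_def)
  have dR: "(R has_vector_derivative (Wm' - ?B 0 ** Vm')) (at 0)"
    unfolding R_def
    by (intro has_vector_derivative_diff dW bounded_linear.has_vector_derivative[OF bounded_bilinear.bounded_linear_right[OF bounded_bilinear_matrix_mult] dV])
  let ?O = "{P :: real^2^2. det P \<noteq> 0}"
  have "?O = UNIV \<inter> (\<lambda>P :: real^2^2. det P) -` (- {0})" by auto
  then have oO: "open ?O" using smooth_open_vimage[OF smooth_on_det2[OF open_UNIV smooth_on_id[OF open_UNIV]] open_UNIV, of "- {0}"] by auto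
  have sO: "smooth_on ?O inv2"
    by (rule smooth_on_inv2[OF oO smooth_on_id[OF oO]]) auto
  have VO: "Vm 0 \<in> ?O" by (simp add: Vm0)
  obtain C' where dC: "((\<lambda>s. inv2 (Vm s)) has_vector_derivative C') (at 0)"
  proof -
    have "((\<lambda>s. inv2 (Vm s)) has_derivative (\<lambda>h. frechet_derivative inv2 (at (Vm 0)) (h *\<^sub>R Vm'))) (at 0)"
      by (rule has_derivative_compose[OF dV[unfolded has_vector_derivative_def] smooth_on_has_derivative[OF sO VO]])
    then have "((\<lambda>s. inv2 (Vm s)) has_vector_derivative frechet_derivative inv2 (at (Vm 0)) Vm') (at 0)"
      by (simp add: has_vector_derivative_def linear_cmul[OF smooth_on_imp_linear[OF sO VO]])
    then show ?thesis by (rule that)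
  qed
  have inv0: "inv2 (Vm 0) = Finite_Cartesian_Product.mat 1"
    using inv2(1)[of "Vm 0"] VO by (simp add: Vm0)
  have "((\<lambda>s. R s ** inv2 (Vm s)) has_vector_derivative (R 0 ** C' + (Wm' - ?B 0 ** Vm') ** inv2 (Vm 0))) (at 0)"
    by (rule bounded_bilinear.has_vector_derivative[OF bounded_bilinear_matrix_mult dR dC])
  then have "((\<lambda>s. R s ** inv2 (Vm s)) has_vector_derivative (Wm' - ?B 0 ** Vm')) (at 0)"
    by (simp add: R0 inv0)
  from has_vector_derivative_add[OF has_vector_derivative_const[of "?B 0"] this]
  have dB0: "((\<lambda>s. ?B 0 + R s ** inv2 (Vm s)) has_vector_derivative (Wm' - ?B 0 ** Vm')) (at 0)" by simp
  have "isCont Vm 0" using dV has_vector_derivative_continuous by blast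
  then have "\<forall>\<^sub>F s in at 0. Vm s \<in> ?O" using oO VO by (auto simp: isCont_def tendsto_def)
  with evX(1) have ev: "\<forall>\<^sub>F s in at 0. ?B 0 + R s ** inv2 (Vm s) = ?B s"
  proof eventually_elim
    case (elim s)
    then have 1: "Vm s ** inv2 (Vm s) = Finite_Cartesian_Product.mat 1" by (simp add: inv2)
    have "R s ** inv2 (Vm s) = (?B s ** Vm s) ** inv2 (Vm s) - (?B 0 ** Vm s) ** inv2 (Vm s)"
      unfolding R_def BV[OF elim(1), symmetric] by (rule bounded_bilinear.diff_left[OF bounded_bilinear_matrix_mult])
    also have "\<dots> = ?B s - ?B 0" by (simp add: matrix_mul_assoc[symmetric] 1)
    finally show ?case by simp
  qed
  have dB: "(?B has_vector_derivative (Wm' - ?B 0 ** Vm')) (at 0)"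
    using has_derivative_transform_eventually[OF dB0[unfolded has_vector_derivative_def] ev] R0
    by (simp add: has_vector_derivative_def)
  have "Wm' - ?B 0 ** Vm' = hor_mat c d ?a ?q (?B 0) ?u ?w"
  proof -
    have W0: "A 0 (V j 0) d = ?B 0 *v axis j 1" for j
      using mat_works[OF D(6)[OF D(3)] c S1.parallel_alongD(1)[OF V D(3)]] V0 by simp
    have "(Wm' - ?B 0 ** Vm') *v axis j 1 = hor_mat c d ?a ?q (?B 0) ?u ?w *v axis j 1" for j
    proof -
      have 1: "Wm' *v axis j 1 = - S2.\<Gamma> d ?q ?w (?B 0 *v axis j 1)"
        by (simp add: matrix_vector_mult_basis column_def Wm'_def W0 vec_eq_iff)
      have 2: "Vm' *v axis j 1 = - S1.\<Gamma> c ?a ?u (axis j 1)"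
        by (simp add: matrix_vector_mult_basis column_def Vm'_def V0 vec_eq_iff)
      have 3: "hor_mat c d ?a ?q (?B 0) ?u ?w *v axis j 1 = ?B 0 *v S1.\<Gamma> c ?a ?u (axis j 1) - S2.\<Gamma> d ?q ?w (?B 0 *v axis j 1)"
        unfolding hor_mat_def by (rule matrix_works_real[OF linear_hor_mat[OF S1.chart_point[OF c] S2.chart_point[OF d]]])
      have "?B 0 *v (- S1.\<Gamma> c ?a ?u (axis j 1)) = - (?B 0 *v S1.\<Gamma> c ?a ?u (axis j 1))"
        using linear_neg[OF matrix_vector_mul_linear] .
      then show ?thesis
        unfolding matrix_vector_mult_diff_rdistrib matrix_vector_mul_assoc[symmetric] 1 2 3 by simp
    qed
    then show ?thesis by (rule matrix_eq_basisI)
  qed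
  note dB = dB[unfolded this]
  note dx = smooth_curve_coord_derivative[OF S1.compat D(4,1,3) c] and dy = smooth_curve_coord_derivative[OF S2.compat D(5,1,3) d]
  show "((\<lambda>s. snd (hom_chart \<A> \<B> c d) (x s, y s, A s)) has_vector_derivative
      (?u, ?w, hor_mat c d ?a ?q (?B 0) ?u ?w)) (at 0)"
    unfolding snd_hom_chart has_vector_derivative_def scaleR_Pair
    by (intro has_derivative_Pair dx[unfolded has_vector_derivative_def] dy[unfolded has_vector_derivative_def] dB[unfolded has_vector_derivative_def])
qed

text \<open>
  The linear maps remain isometric for all times. They preserve the orientation for small times,
  as the determinant of the matrix is continuous at \<open>0\<close> by \<open>transporting_derivative\<close>.
\<close>

lemma transporting_eventually_config:
  assumes tr: "transporting I x y A" and p: "(x 0, y 0, A 0) \<in> CS"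
  shows "\<forall>\<^sub>F s in at 0. (x s, y s, A s) \<in> CS"
proof -
  note D = transportingD[OF tr]
  obtain c d where c: "c \<in> charts_at \<A> (x 0)" and d: "d \<in> charts_at \<B> (y 0)"
    by (rule mcarrier_productE[OF hom_mcarrier[OF D(6)[OF D(3)]]])
  note der = transporting_derivative[OF tr c d]
  let ?h = "\<lambda>s. snd (hom_chart \<A> \<B> c d) (x s, y s, A s)"
  let ?O = "UNIV \<inter> (\<lambda>z :: (real^2) \<times> (real^2) \<times> (real^2^2). det (snd (snd z))) -` {0<..}"
  have "open ?O"
    by (rule smooth_open_vimage[OF smooth_on_det2[OF open_UNIV
          smooth_on_snd[OF open_UNIV smooth_on_snd[OF open_UNIV smooth_on_id[OF open_UNIV]]]]]) simp_all
  moreover have "?h 0 \<in> ?O"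
    using isometry_config_iff(1)[OF D(6)[OF D(3)] c d config_iso[OF p]] p by (simp add: snd_hom_chart)
  moreover have "isCont ?h 0" using der(1) has_vector_derivative_continuous by blast
  ultimately have "\<forall>\<^sub>F s in at 0. ?h s \<in> ?O" by (auto simp: isCont_def tendsto_def)
  moreover have "\<forall>\<^sub>F s in at 0. s \<in> I" using D(1,3) eventually_at_in_open' by blast
  ultimately show ?thesis using der(2)
  proof eventually_elim
    case (elim s)
    have ch: "c \<in> charts_at \<A> (x s)" "d \<in> charts_at \<B> (y s)"
      using elim(3) c d by (auto simp: fst_hom_chart charts_at_iff)
    have iso: "g2 (y s) (A s u) (A s v) = g1 (x s) u v" if "u \<in> S1.T (x s)" "v \<in> S1.T (x s)" for u v
      by (rule transporting_isometry[OF tr elim(2) that config_iso[OF p]])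
    show ?case using isometry_config_iff(1)[OF D(6)[OF elim(2)] ch iso] elim(1) by (simp add: snd_hom_chart)
  qed
qed

text \<open>
  Transport a vector back to time \<open>0\<close> along the first curve, apply \<open>A0\<close>, and transport the result
  along the second curve.
\<close>

lemma transporting_exists:
  assumes I: "open I" "is_interval I" "0 \<in> I" and x: "smooth_map eucl I \<A> x" and y: "smooth_map eucl I \<B> y"
    and A0: "(x 0, y 0, A0) \<in> HB"
  shows "\<exists>A. transporting I x y A \<and> A 0 = A0"
proof -
  define A where "A = (\<lambda>t. restrict (\<lambda>v. S2.transport I y 0 t (A0 (S1.transport I x t 0 v))) (S1.T (x t)))"
  note in1 = S1.transport_in[OF x I(1,2)] and in2 = S2.transport_in[OF y I(1,2)]
  note H = hom_bundleD[OF A0]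
  have Ain: "A t v \<in> S2.T (y t)" if "t \<in> I" "v \<in> S1.T (x t)" for t v
    using in2[OF I(3) that(1) H(3)[OF in1[OF that(1) I(3) that(2)]]] that by (simp add: A_def)
  have HBA: "(x t, y t, A t) \<in> HB" if t: "t \<in> I" for t
  proof -
    have lin: "A t (a *\<^sub>R u + b *\<^sub>R v) = a *\<^sub>R A t u + b *\<^sub>R A t v" if uv: "u \<in> S1.T (x t)" "v \<in> S1.T (x t)" for a b u v
    proof -
      have s: "a *\<^sub>R u + b *\<^sub>R v \<in> S1.T (x t)"
        using uv subspace_tangent_space[OF S1.compat, of "x t"] by (auto simp: subspace_def)
      let ?u = "S1.transport I x t 0 u" and ?v = "S1.transport I x t 0 v"
      have i: "?u \<in> S1.T (x 0)" "?v \<in> S1.T (x 0)" using in1[OF t I(3)] uv by auto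
      have "A0 (a *\<^sub>R ?u + b *\<^sub>R ?v) = a *\<^sub>R A0 ?u + b *\<^sub>R A0 ?v"
        using H(5,6) i subspace_scale[OF subspace_tangent_space[OF S1.compat]] by simp
      then show ?thesis
        using s uv S1.transport_lincomb[OF x I(1,2) t I(3) uv] S2.transport_lincomb[OF y I(1,2) I(3) t H(3)[OF i(1)] H(3)[OF i(2)]]
        by (simp add: A_def)
    qed
    have "linear_map_on (S1.T (x t)) (A t)"
      unfolding linear_map_on_def
    proof (intro conjI ballI allI)
      fix u v assume "u \<in> S1.T (x t)" "v \<in> S1.T (x t)"
      then show "A t (u + v) = A t u + A t v" using lin[of u v 1 1] by simp
    next
      fix r u assume "u \<in> S1.T (x t)"
      then show "A t (r *\<^sub>R u) = r *\<^sub>R A t u" using lin[of u u r 0] by simp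
    qed
    moreover have "A t \<in> S1.T (x t) \<rightarrow>\<^sub>E S2.T (y t)" using Ain[OF t] by (auto simp: A_def)
    ultimately show ?thesis
      using smooth_map_charts(2)[OF x t] smooth_map_charts(2)[OF y t] by (simp add: hom_bundle_def)
  qed
  have "A 0 = A0"
  proof
    fix v show "A 0 v = A0 v"
    proof (cases "v \<in> S1.T (x 0)")
      case True
      then show ?thesis
        using S1.transport_parallel(2)[OF x I(1,2,3) True] S2.transport_parallel(2)[OF y I(1,2,3) H(3)[OF True]]
        by (simp add: A_def)
    qed (simp add: A_def H(4))
  qed
  moreover have "parallel_along \<B> g2 I y (\<lambda>t. A t (V t))" if V: "parallel_along \<A> g1 I x V" for V
  proof (rule S2.parallel_along_cong[OF S2.transport_parallel(1)[OF y I(1,2,3) H(3)[OF S1.parallel_alongD(1)[OF V I(3)]]] I(1)])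
    fix t assume t: "t \<in> I"
    then show "S2.transport I y 0 t (A0 (V 0)) = A t (V t)"
      using S1.parallel_alongD(1)[OF V t] S1.transport_eq[OF x I(1,2) V t I(3)] by (simp add: A_def)
  qed
  ultimately show ?thesis using I x y HBA by (auto simp: transporting_def)
qed

lemma smooth_hom_base:
  assumes "smooth_map eucl I H \<sigma>" "open I"
  shows "smooth_map eucl I \<A> (\<lambda>t. fst (\<sigma> t))" "smooth_map eucl I \<B> (\<lambda>t. fst (snd (\<sigma> t)))"
proof -
  have *: "\<exists>c d W. c \<in> charts_at \<A> (fst (\<sigma> t)) \<and> d \<in> charts_at \<B> (fst (snd (\<sigma> t))) \<and> open W \<and> t \<in> W \<and> W \<subseteq> I \<and>
      (\<forall>s\<in>W. fst (\<sigma> s) \<in> fst c \<and> fst (snd (\<sigma> s)) \<in> fst d) \<and> smooth_on W (\<lambda>s. snd c (fst (\<sigma> s))) \<and> smooth_on W (\<lambda>s. snd d (fst (snd (\<sigma> s))))"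
    if t: "t \<in> I" for t
  proof -
    obtain x y A where e: "\<sigma> t = (x, y, A)" by (cases "\<sigma> t") auto
    have A: "(x, y, A) \<in> HB" using smooth_map_charts(2)[OF assms(1) t] by (simp add: mcarrier_hom e)
    obtain c d where cd: "c \<in> charts_at \<A> x" "d \<in> charts_at \<B> y" by (rule mcarrier_productE[OF hom_mcarrier[OF A]])
    have C: "hom_chart \<A> \<B> c d \<in> charts_at H (\<sigma> t)" unfolding e by (rule charts_at_homI[OF A cd])
    obtain W where W: "open W" "t \<in> W" "W \<subseteq> I" "\<And>s. s \<in> W \<Longrightarrow> \<sigma> s \<in> fst (hom_chart \<A> \<B> c d)"
      "smooth_on W (\<lambda>s. snd (hom_chart \<A> \<B> c d) (\<sigma> s))"
      by (rule smooth_curve_chart[OF compatible_hom assms t C]) blast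
    have s: "snd (hom_chart \<A> \<B> c d) (\<sigma> s) = (snd c (fst (\<sigma> s)), snd d (fst (snd (\<sigma> s))), mat c d (fst (\<sigma> s)) (snd (snd (\<sigma> s))))" for s
      using snd_hom_chart[of c d "fst (\<sigma> s)" "fst (snd (\<sigma> s))" "snd (snd (\<sigma> s))"] by simp
    have "smooth_on W (\<lambda>s. snd c (fst (\<sigma> s)))" "smooth_on W (\<lambda>s. snd d (fst (snd (\<sigma> s))))"
      using smooth_on_fst[OF W(1,5)] smooth_on_fst[OF W(1) smooth_on_snd[OF W(1,5)]] by (simp_all add: s)
    then show ?thesis using W(1-4) cd e unfolding fst_hom_chart by (metis fst_conv snd_conv)
  qed
  show "smooth_map eucl I \<A> (\<lambda>t. fst (\<sigma> t))"
  proof (rule smooth_mapI)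
    fix t assume "t \<in> I"
    from *[OF this] obtain c W where "c \<in> charts_at \<A> (fst (\<sigma> t))" "open W" "t \<in> W" "W \<subseteq> I" "\<forall>s\<in>W. fst (\<sigma> s) \<in> fst c"
      "smooth_on W (\<lambda>s. snd c (fst (\<sigma> s)))" by blast
    then show "\<exists>c\<in>charts_at eucl t. \<exists>d\<in>charts_at \<A> (fst (\<sigma> t)). \<exists>W F. open W \<and> snd c t \<in> W \<and> W \<subseteq> snd c ` fst c \<and> smooth_on W F \<and>
        (\<forall>q\<in>I \<inter> fst c. snd c q \<in> W \<longrightarrow> fst (\<sigma> q) \<in> fst d \<and> snd d (fst (\<sigma> q)) = F (snd c q))"
      by (intro bexI[of _ "(UNIV, id)"] bexI[of _ c] exI[of _ W] exI[of _ "\<lambda>s. snd c (fst (\<sigma> s))"]) auto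
  qed
  show "smooth_map eucl I \<B> (\<lambda>t. fst (snd (\<sigma> t)))"
  proof (rule smooth_mapI)
    fix t assume "t \<in> I"
    from *[OF this] obtain d W where "d \<in> charts_at \<B> (fst (snd (\<sigma> t)))" "open W" "t \<in> W" "W \<subseteq> I" "\<forall>s\<in>W. fst (snd (\<sigma> s)) \<in> fst d"
      "smooth_on W (\<lambda>s. snd d (fst (snd (\<sigma> s))))" by blast
    then show "\<exists>c\<in>charts_at eucl t. \<exists>d\<in>charts_at \<B> (fst (snd (\<sigma> t))). \<exists>W F. open W \<and> snd c t \<in> W \<and> W \<subseteq> snd c ` fst c \<and> smooth_on W F \<and>
        (\<forall>q\<in>I \<inter> fst c. snd c q \<in> W \<longrightarrow> fst (snd (\<sigma> q)) \<in> fst d \<and> snd d (fst (snd (\<sigma> q))) = F (snd c q))"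
      by (intro bexI[of _ "(UNIV, id)"] bexI[of _ d] exI[of _ W] exI[of _ "\<lambda>s. snd d (fst (snd (\<sigma> s)))"]) auto
  qed
qed

end

section \<open>Rolling along a coordinate line\<close>

lemma bounded_bilinear_matrix_vector: "bounded_bilinear ((*v) :: real^'n^'m \<Rightarrow> real^'n \<Rightarrow> real^'m)"
proof -
  have "bilinear ((*v) :: real^'n^'m \<Rightarrow> real^'n \<Rightarrow> real^'m)"
    unfolding bilinear_def
    by (intro conjI allI linearI) (simp_all add: vec_eq_iff matrix_vector_mult_def algebra_simps sum.distrib sum_distrib_left)
  then show ?thesis by (rule bilinear_conv_bounded_bilinear[THEN iffD1])
qed

lemma (in surface) smooth_christoffel_apply:
  fixes S :: "'z::euclidean_space set"
  assumes "c \<in> \<A>" "open S" "smooth_on S q" "q ` S \<subseteq> dom c" "smooth_on S u" "smooth_on S v"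
  shows "smooth_on S (\<lambda>z. \<Gamma> c (q z) (u z) (v z))"
proof -
  note o = open_dom[OF assms(1)]
  have 1: "smooth_on S (\<lambda>z. \<Gamma> c (q z) (u z) e)" for e
    by (rule smooth_on_linear_family[where L = "\<lambda>x u. \<Gamma> c x u e", OF assms(2) o smooth_christoffel[OF assms(1)] linear_christoffel'[OF assms(1)] assms(3,4,5)])
  show ?thesis
    by (rule smooth_on_linear_family[where L = "\<lambda>z. \<Gamma> c (q z) (u z)" and T = S and p = "\<lambda>z. z", OF _ _ 1 linear_christoffel[OF assms(1)] smooth_on_id _ assms(6)])
      (use assms(2,4) in auto)
qed

lemma connected_nonzero_pos:
  fixes f :: "real \<Rightarrow> real"
  assumes "continuous_on J f" "connected J" "\<And>t. t \<in> J \<Longrightarrow> f t \<noteq> 0" "s \<in> J" "f s > 0" "t \<in> J"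
  shows "f t > 0"
proof (rule ccontr)
  assume "\<not> f t > 0"
  then have "f t \<le> 0" by simp
  have "connected (f ` J)" by (rule connected_continuous_image[OF assms(1,2)])
  from connectedD_interval[OF this imageI[OF assms(6)] imageI[OF assms(4)], of 0] \<open>f t \<le> 0\<close> assms(5)
  have "0 \<in> f ` J" by simp
  then show False using assms(3) by auto
qed

context surface_pair begin

text \<open>
  In coordinates let the first point move with the constant velocity \<open>u\<close>. No slipping prescribes the
  velocity \<open>B u\<close> of the second point and no twisting prescribes the derivative \<open>hor_mat\<close> of the
  matrix \<open>B\<close>, which together is an autonomous equation. Along its solution the maps do not
  twist, by the product rule; they are isometries since parallel transport is isometric, and
  their determinant, never zero, keeps its sign.
\<close>

lemma rolling_exists:
  assumes p: "(x0, y0, A0) \<in> CS" and v0: "v0 \<in> S1.T x0"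
  shows "\<exists>I x y A. transporting I x y A \<and> smooth_map eucl I H (\<lambda>t. (x t, y t, A t)) \<and> (\<forall>t\<in>I. (x t, y t, A t) \<in> CS) \<and>
    x 0 = x0 \<and> y 0 = y0 \<and> A 0 = A0 \<and> velocity \<A> x 0 = v0 \<and> (\<forall>t\<in>I. A t (velocity \<A> x t) = velocity \<B> y t)"
proof -
  have A0: "(x0, y0, A0) \<in> HB" using p config_space_subset by blast
  obtain c d where cx: "c \<in> charts_at \<A> x0" and dy: "d \<in> charts_at \<B> y0" by (rule mcarrier_productE[OF hom_mcarrier[OF A0]])
  have c: "c \<in> \<A>" "x0 \<in> fst c" and d: "d \<in> \<B>" "y0 \<in> fst d" using cx dy by (auto simp: charts_at_iff)
  let ?D = "(snd c ` fst c) \<times> (snd d ` fst d) \<times> (UNIV :: (real^2^2) set)"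
  let ?z0 = "(snd c x0, snd d y0, mat c d x0 A0)"
  have oD: "open ?D" by (intro open_Times S1.open_dom S2.open_dom c d open_UNIV)
  define u where "u = v0 c"
  define F where "F = (\<lambda>z :: (real^2) \<times> (real^2) \<times> (real^2^2).
    (u, snd (snd z) *v u, hor_mat c d (fst z) (fst (snd z)) (snd (snd z)) u (snd (snd z) *v u)))"
  have sf: "smooth_on ?D (\<lambda>z. fst z)" "smooth_on ?D (\<lambda>z. fst (snd z))" "smooth_on ?D (\<lambda>z. snd (snd z))"
    by (intro smooth_on_fst smooth_on_snd smooth_on_id oD)+
  have sF: "smooth_on ?D F"
    unfolding F_def hor_mat_def
    by (intro smooth_on_Pair smooth_on_matrix smooth_on_diff smooth_on_matrix_vector smooth_on_const sf oD
        S1.smooth_christoffel_apply[OF c(1) oD sf(1)] S2.smooth_christoffel_apply[OF d(1) oD sf(2)]) auto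
  obtain r w where r: "r > 0" and w0: "w 0 = ?z0" and w: "\<And>t. t \<in> ball 0 r \<Longrightarrow> w t \<in> ?D"
    "\<And>t. t \<in> ball 0 r \<Longrightarrow> (w has_vector_derivative F (w t)) (at t)"
    using autonomous_ode_local[OF oD _ sF, of ?z0] c d by auto
  define J where "J = ball (0::real) r"
  have J: "open J" "is_interval J" "0 \<in> J" using r by (auto simp: J_def is_interval_ball_real)
  have wD: "w t \<in> ?D" and wF: "(w has_vector_derivative F (w t)) (at t)" if "t \<in> J" for t using w that by (auto simp: J_def)
  have sw: "smooth_on J w" by (rule smooth_on_ode_solution[OF J(1) oD sF image_subsetI[OF wD] wF])
  define x y B where "x = (\<lambda>t. chart_inv c (fst (w t)))" and "y = (\<lambda>t. chart_inv d (fst (snd (w t))))" and "B = (\<lambda>t. snd (snd (w t)))"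
  define A where "A = (\<lambda>t. hom_of c d (x t) (y t) (B t))"
  have xc: "x t \<in> fst c" "snd c (x t) = fst (w t)" and yd: "y t \<in> fst d" "snd d (y t) = fst (snd (w t))" if "t \<in> J" for t
    using wD[OF that] chart_inv_in[of "fst (w t)" c] snd_chart_inv[of "fst (w t)" c]
      chart_inv_in[of "fst (snd (w t))" d] snd_chart_inv[of "fst (snd (w t))" d] by (auto simp: x_def y_def mem_Times_iff)
  have ch: "c \<in> charts_at \<A> (x t)" "d \<in> charts_at \<B> (y t)" if "t \<in> J" for t
    using xc(1)[OF that] yd(1)[OF that] c d by (auto simp: charts_at_iff)
  have HBA: "(x t, y t, A t) \<in> HB" and matA: "mat c d (x t) (A t) = B t" if "t \<in> J" for t
    unfolding A_def by (rule hom_of_in[OF ch[OF that]], rule mat_hom_of[OF ch[OF that]])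
  have x00: "x 0 = x0" "y 0 = y0" by (simp_all add: x_def y_def w0 chart_inv_snd[OF S1.compat c] chart_inv_snd[OF S2.compat d])
  have A00: "A 0 = A0" unfolding A_def x00 B_def w0 using hom_of_mat[OF A0 cx dy] by simp
  let ?\<sigma> = "\<lambda>t. (x t, y t, A t)"
  have s\<sigma>: "smooth_map eucl J H ?\<sigma>"
  proof (rule smooth_mapI)
    fix t assume t: "t \<in> J"
    have "snd (hom_chart \<A> \<B> c d) (?\<sigma> s) = w s" if "s \<in> J" for s
      unfolding snd_hom_chart xc(2)[OF that] yd(2)[OF that] matA[OF that] by (simp add: B_def)
    then show "\<exists>b\<in>charts_at eucl t. \<exists>d\<in>charts_at H (?\<sigma> t). \<exists>W F. open W \<and> snd b t \<in> W \<and> W \<subseteq> snd b ` fst b \<and> smooth_on W F \<and>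
        (\<forall>q\<in>J \<inter> fst b. snd b q \<in> W \<longrightarrow> ?\<sigma> q \<in> fst d \<and> snd d (?\<sigma> q) = F (snd b q))"
      using charts_at_homI[OF HBA[OF t] ch[OF t]] J(1) t sw HBA xc(1) yd(1)
      by (intro bexI[of _ "(UNIV, id)"] bexI[of _ "hom_chart \<A> \<B> c d"] exI[of _ J] exI[of _ w]) (auto simp: fst_hom_chart)
  qed
  have sx: "smooth_map eucl J \<A> x" and sy: "smooth_map eucl J \<B> y"
    using smooth_hom_base[OF s\<sigma> J(1)] by simp_all
  have Fw: "F (w t) = (u, B t *v u, hor_mat c d (snd c (x t)) (snd d (y t)) (B t) u (B t *v u))" if "t \<in> J" for t
    unfolding F_def xc(2)[OF that] yd(2)[OF that] B_def ..
  have velx: "velocity \<A> x t c = u" and vely: "velocity \<B> y t d = B t *v u"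
    and dB: "(B has_vector_derivative hor_mat c d (snd c (x t)) (snd d (y t)) (B t) u (B t *v u)) (at t)" if t: "t \<in> J" for t
  proof -
    note dw = wF[OF t, unfolded Fw[OF t]]
    have "((\<lambda>s. fst (w s)) has_vector_derivative u) (at t)"
      using bounded_linear.has_vector_derivative[OF bounded_linear_fst dw] by simp
    then have "((\<lambda>s. snd c (x s)) has_vector_derivative u) (at t)"
      by (rule has_vector_derivative_transform_within_open[OF _ J(1) t]) (simp add: xc)
    from vector_derivative_at[OF this] show "velocity \<A> x t c = u" using ch[OF t] by (simp add: velocity_def)
    have "((\<lambda>s. fst (snd (w s))) has_vector_derivative B t *v u) (at t)"
      using bounded_linear.has_vector_derivative[OF bounded_linear_fst bounded_linear.has_vector_derivative[OF bounded_linear_snd dw]] by simp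
    then have "((\<lambda>s. snd d (y s)) has_vector_derivative B t *v u) (at t)"
      by (rule has_vector_derivative_transform_within_open[OF _ J(1) t]) (simp add: yd)
    from vector_derivative_at[OF this] show "velocity \<B> y t d = B t *v u" using ch[OF t] by (simp add: velocity_def)
    show "(B has_vector_derivative hor_mat c d (snd c (x t)) (snd d (y t)) (B t) u (B t *v u)) (at t)"
      using bounded_linear.has_vector_derivative[OF bounded_linear_snd bounded_linear.has_vector_derivative[OF bounded_linear_snd dw]]
      by (simp add: B_def)
  qed
  have AV: "A t v d = B t *v v c" if "t \<in> J" "v \<in> S1.T (x t)" for t v
    using mat_works[OF HBA[OF that(1)] ch(1)[OF that(1)] that(2)] matA[OF that(1)] by simp
  have "parallel_along \<B> g2 J y (\<lambda>t. A t (V t))" if V: "parallel_along \<A> g1 J x V" for V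
  proof (rule S2.parallel_alongI[OF sy J(1)])
    show "A s (V s) \<in> S2.T (y s)" if "s \<in> J" for s
      by (rule hom_bundleD(3)[OF HBA[OF that] S1.parallel_alongD(1)[OF V that]])
    fix t assume t: "t \<in> J"
    note cp = S1.chart_point[OF ch(1)[OF t]] S2.chart_point[OF ch(2)[OF t]]
    have dV: "((\<lambda>s. V s c) has_vector_derivative - S1.\<Gamma> c (snd c (x t)) u (V t c)) (at t)"
      using S1.parallel_alongD(2)[OF V t ch(1)[OF t]] velx[OF t] by simp
    have "((\<lambda>s. B s *v V s c) has_vector_derivative
        B t *v (- S1.\<Gamma> c (snd c (x t)) u (V t c)) + hor_mat c d (snd c (x t)) (snd d (y t)) (B t) u (B t *v u) *v V t c) (at t)"
      by (rule bounded_bilinear.has_vector_derivative[OF bounded_bilinear_matrix_vector dB[OF t] dV])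
    moreover have "B t *v (- S1.\<Gamma> c (snd c (x t)) u (V t c)) + hor_mat c d (snd c (x t)) (snd d (y t)) (B t) u (B t *v u) *v V t c
      = - S2.\<Gamma> d (snd d (y t)) (velocity \<B> y t d) (A t (V t) d)"
    proof -
      have "B t *v (- S1.\<Gamma> c (snd c (x t)) u (V t c)) = - (B t *v S1.\<Gamma> c (snd c (x t)) u (V t c))"
        using linear_neg[OF matrix_vector_mul_linear] .
      then show ?thesis
        unfolding hor_mat_def matrix_works_real[OF linear_hor_mat[OF cp]] vely[OF t] AV[OF t S1.parallel_alongD(1)[OF V t]] by simp
    qed
    ultimately have "((\<lambda>s. B s *v V s c) has_vector_derivative - S2.\<Gamma> d (snd d (y t)) (velocity \<B> y t d) (A t (V t) d)) (at t)" by simp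
    then have "S2.parallel_in_chart d y (\<lambda>t. A t (V t)) t"
      by (rule has_vector_derivative_transform_within_open[OF _ J(1) t]) (simp add: AV S1.parallel_alongD(1)[OF V])
    then show "\<exists>d\<in>charts_at \<B> (y t). S2.parallel_in_chart d y (\<lambda>t. A t (V t)) t" using ch(2)[OF t] by blast
  qed
  then have tr: "transporting J x y A" using J sx sy HBA by (simp add: transporting_def)
  have iso: "g2 (y t) (A t v) (A t v') = g1 (x t) v v'" if "t \<in> J" "v \<in> S1.T (x t)" "v' \<in> S1.T (x t)" for t v v'
    by (rule transporting_isometry[OF tr that]) (use config_iso[OF p] in \<open>simp add: x00 A00\<close>)
  have CSJ: "(x t, y t, A t) \<in> CS" if t: "t \<in> J" for t
  proof -
    have "det (B t) > 0"
    proof (rule connected_nonzero_pos[of J "\<lambda>t. det (B t)" 0 t])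
      have "smooth_on J B" unfolding B_def by (intro smooth_on_snd sw J)
      from smooth_on_imp_continuous_on[OF smooth_on_det2[OF J(1) this]] show "continuous_on J (\<lambda>t. det (B t))" .
      show "connected J" using J(2) is_interval_connected by blast
      show "det (B s) \<noteq> 0" if "s \<in> J" for s
        using isometry_config_iff(2)[OF HBA[OF that] ch[OF that] iso[OF that]] matA[OF that] by simp
      have "det (mat c d x0 A0) > 0" using isometry_config_iff(1)[OF A0 cx dy config_iso[OF p]] p by simp
      then show "det (B 0) > 0" by (simp add: B_def w0)
    qed (use J t in auto)
    then show ?thesis using isometry_config_iff(1)[OF HBA[OF t] ch[OF t] iso[OF t]] matA[OF t] by simp
  qed
  have slip: "A t (velocity \<A> x t) = velocity \<B> y t" if t: "t \<in> J" for t
  proof -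
    have vT: "velocity \<A> x t \<in> S1.T (x t)" by (rule smooth_curve_velocity_in[OF S1.compat sx J(1) t])
    show ?thesis
      by (rule tangent_vector_eqI[OF S2.compat hom_bundleD(3)[OF HBA[OF t] vT] smooth_curve_velocity_in[OF S2.compat sy J(1) t] ch(2)[OF t]])
        (simp add: AV[OF t vT] velx[OF t] vely[OF t])
  qed
  have "velocity \<A> x 0 = v0"
    by (rule tangent_vector_eqI[OF S1.compat smooth_curve_velocity_in[OF S1.compat sx J(1,3), unfolded x00] v0 cx])
      (simp add: velx[OF J(3)] u_def)
  then show ?thesis using tr s\<sigma> CSJ x00 A00 slip by blast
qed

section \<open>The two distributions\<close>

text \<open>
  A rolling curve is mapped by \<open>\<Psi>\<close> to the parallel transport of a plane containing the velocity of
  its base curve, which gives one inclusion. For the other one, a horizontal lift is computed along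
  a curve whose velocity lies in the plane at time \<open>0\<close>. The rolling curve with the same
  configuration and velocity at time \<open>0\<close> agrees with the transported configuration to first order, so
  \<open>\<Psi>\<close> maps both to curves with the same velocity.
\<close>

lemma distributions_correspond:
  assumes p: "(x0, y0, A0) \<in> CS"
  shows "differential CA TA \<Psi> (x0, y0, A0) ` rolling_distribution \<A> g1 \<B> g2 (x0, y0, A0)
    = twistor_distribution M g (\<Psi> (x0, y0, A0))"
proof -
  let ?N = "graph_plane \<A> \<B> (x0, y0, A0)"
  have diff: "differential CA TA \<Psi> (\<gamma> 0) (velocity CA \<gamma> 0) = velocity TA (\<lambda>t. \<Psi> (\<gamma> t)) 0"
    if "smooth_map eucl I CA \<gamma>" "open I" "0 \<in> I" for \<gamma> I
    using differential_velocity[OF compatible_config compatible_twistor _ that] smooth_Psi_CA_TA by (simp add: mcarrier_config)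
  have lift: "velocity TA (\<lambda>t. ((x t, y t), parallel_transport M g I (\<lambda>t. (x t, y t)) (graph_plane \<A> \<B> (x 0, y 0, A 0)) t)) 0
      = velocity TA (\<lambda>t. \<Psi> (x t, y t, A t)) 0" if tr: "transporting I x y A" for I x y A
    by (rule velocity_cong_open[OF transportingD(1,3)[OF tr]]) (simp add: Psi_eq parallel_transport_graph[OF tr])
  show ?thesis
  proof
    show "differential CA TA \<Psi> (x0, y0, A0) ` rolling_distribution \<A> g1 \<B> g2 (x0, y0, A0) \<subseteq> twistor_distribution M g (\<Psi> (x0, y0, A0))"
    proof (rule image_subsetI)
      fix Z0 assume "Z0 \<in> rolling_distribution \<A> g1 \<B> g2 (x0, y0, A0)"
      then obtain \<gamma> I where Z0: "Z0 = velocity CA \<gamma> 0" and I: "open_interval_around_0 I"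
        and ad: "admissible_curve \<A> g1 \<B> g2 I \<gamma>" and \<gamma>0: "\<gamma> 0 = (x0, y0, A0)"
        unfolding rolling_distribution_def by blast
      have I: "open I" "is_interval I" "0 \<in> I" using I by (auto simp: open_interval_around_0_def)
      define x y A where "x = (\<lambda>t. fst (\<gamma> t))" and "y = (\<lambda>t. fst (snd (\<gamma> t)))" and "A = (\<lambda>t. snd (snd (\<gamma> t)))"
      have \<gamma>: "\<gamma> t = (x t, y t, A t)" for t by (simp add: x_def y_def A_def)
      have s: "smooth_map eucl I CA \<gamma>" and slip: "\<And>t. t \<in> I \<Longrightarrow> A t (velocity \<A> x t) = velocity \<B> y t"
        and twist: "\<And>V. parallel_along \<A> g1 I x V \<Longrightarrow> parallel_along \<B> g2 I y (\<lambda>t. A t (V t))"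
        using ad by (auto simp: admissible_curve_def Let_def x_def y_def A_def)
      have CSI: "\<gamma> t \<in> CS" if "t \<in> I" for t using smooth_map_charts(2)[OF s that] by (simp add: mcarrier_config)
      have sH: "smooth_map eucl I H \<gamma>"
        by (rule smooth_map_compose[OF compatible_eucl compatible_config compatible_hom s smooth_config_inclusion]) (use CSI in auto)
      note sb = smooth_hom_base[OF sH I(1), folded x_def y_def]
      have tr: "transporting I x y A"
        using I sb CSI config_space_subset twist by (auto simp: transporting_def \<gamma>)
      have xyA0: "x 0 = x0" "y 0 = y0" "A 0 = A0" using \<gamma>0 \<gamma>[of 0] by auto
      let ?c = "\<lambda>t. (x t, y t)"
      have sc: "smooth_map eucl I M ?c" by (rule smooth_curve_pair[OF sb I(1)])
      define Y where "Y = velocity M ?c 0"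
      have Yin: "Y \<in> TM (x0, y0)" using smooth_curve_velocity_in[OF compat sc I(1,3)] by (simp add: Y_def xyA0)
      have Y12: "dp1 (x0, y0) Y = velocity \<A> x 0" "dp2 (x0, y0) Y = velocity \<B> y 0"
        using velocity_proj[OF sc I(1,3)] by (simp_all add: Y_def xyA0)
      have "Y \<in> ?N"
        unfolding graph_plane_eq using Yin slip[OF I(3)] smooth_curve_velocity_in[OF S1.compat sb(1) I(1,3)] by (simp add: Y12 xyA0)
      moreover have "is_horizontal_lift M g (\<Psi> (x0, y0, A0)) Y (velocity TA (\<lambda>t. \<Psi> (\<gamma> t)) 0)"
        unfolding is_horizontal_lift_def
      proof (intro exI[of _ I] exI[of _ ?c] conjI)
        show "open_interval_around_0 I" using I by (simp add: open_interval_around_0_def)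
        show "velocity TA (\<lambda>t. \<Psi> (\<gamma> t)) 0 = velocity TA (\<lambda>t. ((x t, y t), parallel_transport M g I ?c (snd (\<Psi> (x0, y0, A0))) t)) 0"
          using lift[OF tr] by (simp add: xyA0 \<gamma> Psi_eq)
      qed (use sc in \<open>simp_all add: xyA0 Psi_eq Y_def\<close>)
      moreover have "differential CA TA \<Psi> (x0, y0, A0) Z0 = velocity TA (\<lambda>t. \<Psi> (\<gamma> t)) 0"
        using diff[OF s I(1,3)] by (simp add: Z0 \<gamma>0)
      ultimately show "differential CA TA \<Psi> (x0, y0, A0) Z0 \<in> twistor_distribution M g (\<Psi> (x0, y0, A0))"
        unfolding twistor_distribution_def Psi_eq by auto
    qed
    show "twistor_distribution M g (\<Psi> (x0, y0, A0)) \<subseteq> differential CA TA \<Psi> (x0, y0, A0) ` rolling_distribution \<A> g1 \<B> g2 (x0, y0, A0)"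
    proof
      fix Z assume "Z \<in> twistor_distribution M g (\<Psi> (x0, y0, A0))"
      then obtain Y I \<gamma> where Y: "Y \<in> ?N" and I: "open_interval_around_0 I" and s: "smooth_map eucl I M \<gamma>"
        and \<gamma>0: "\<gamma> 0 = (x0, y0)" "velocity M \<gamma> 0 = Y"
        and Z: "Z = velocity TA (\<lambda>t. (\<gamma> t, parallel_transport M g I \<gamma> ?N t)) 0"
        by (auto simp: twistor_distribution_def is_horizontal_lift_def Psi_eq)
      have I: "open I" "is_interval I" "0 \<in> I" using I by (auto simp: open_interval_around_0_def)
      define x y where "x = (\<lambda>t. fst (\<gamma> t))" and "y = (\<lambda>t. snd (\<gamma> t))"
      have \<gamma>: "(\<lambda>t. (x t, y t)) = \<gamma>" "(x t, y t) = \<gamma> t" for t by (simp_all add: x_def y_def)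
      note sb = smooth_curve_proj[OF s, folded x_def y_def]
      have x0: "x 0 = x0" "y 0 = y0" using \<gamma>0 by (simp_all add: x_def y_def)
      have A0: "(x 0, y 0, A0) \<in> HB" using p config_space_subset x0 by auto
      obtain A where tr: "transporting I x y A" and A: "A 0 = A0" using transporting_exists[OF I sb A0] by blast
      have Z': "Z = velocity TA (\<lambda>t. \<Psi> (x t, y t, A t)) 0" using lift[OF tr] Z by (simp add: \<gamma> x0 A)
      have Y12: "dp1 (x0, y0) Y = velocity \<A> x 0" "dp2 (x0, y0) Y = velocity \<B> y 0"
        using velocity_proj[OF s I(1,3)] \<gamma>0 by (simp_all add: x_def y_def)
      have Ygraph: "velocity \<A> x 0 \<in> S1.T x0" "velocity \<B> y 0 = A0 (velocity \<A> x 0)" using Y by (auto simp: graph_plane_eq Y12)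
      obtain J x' y' A' where tr': "transporting J x' y' A'" and s': "smooth_map eucl J H (\<lambda>t. (x' t, y' t, A' t))"
        and CSJ: "\<And>t. t \<in> J \<Longrightarrow> (x' t, y' t, A' t) \<in> CS" and x0': "x' 0 = x0" "y' 0 = y0" "A' 0 = A0"
        and vel: "velocity \<A> x' 0 = velocity \<A> x 0" and slip: "\<And>t. t \<in> J \<Longrightarrow> A' t (velocity \<A> x' t) = velocity \<B> y' t"
        using rolling_exists[OF p Ygraph(1)] by blast
      let ?\<sigma> = "\<lambda>t. (x' t, y' t, A' t)"
      note J = transportingD(1-3)[OF tr']
      have vel2: "velocity \<B> y' 0 = velocity \<B> y 0" using slip[OF J(3)] Ygraph(2) vel x0' by simp
      have s'': "smooth_map eucl J CA ?\<sigma>" by (rule smooth_into_config[OF compatible_eucl s']) (use CSJ in auto)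
      have "admissible_curve \<A> g1 \<B> g2 J ?\<sigma>"
        unfolding admissible_curve_def Let_def fst_conv snd_conv using s'' slip transportingD(7)[OF tr'] by blast
      then have roll: "velocity CA ?\<sigma> 0 \<in> rolling_distribution \<A> g1 \<B> g2 (x0, y0, A0)"
        unfolding rolling_distribution_def using J x0' by (intro CollectI exI[of _ ?\<sigma>] exI[of _ J]) (simp add: open_interval_around_0_def)
      obtain c d where c: "c \<in> charts_at \<A> x0" and d: "d \<in> charts_at \<B> y0"
        by (rule mcarrier_productE[OF hom_mcarrier[OF A0[unfolded x0]]])
      note der = transporting_derivative[OF tr c[folded x0] d[folded x0(2)], unfolded x0 A]
      note der' = transporting_derivative[OF tr' c[folded x0'(1)] d[folded x0'(2)], unfolded x0' vel vel2]
      have "velocity TA (\<lambda>t. \<Psi> (x t, y t, A t)) 0 = velocity TA (\<lambda>t. \<Psi> (?\<sigma> t)) 0"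
      proof (rule velocity_smooth_map_cong[OF compatible_hom compatible_twistor smooth_Psi_H_TA p charts_at_homI[OF A0[unfolded x0] c d]
              _ _ der(1) _ _ der'(1)])
        show "\<forall>\<^sub>F s in at 0. (x s, y s, A s) \<in> CS \<inter> fst (hom_chart \<A> \<B> c d)"
          using transporting_eventually_config[OF tr] der(2) p by (simp add: x0 A eventually_conj_iff)
        show "\<forall>\<^sub>F s in at 0. ?\<sigma> s \<in> CS \<inter> fst (hom_chart \<A> \<B> c d)"
          using transporting_eventually_config[OF tr'] der'(2) p by (simp add: x0' eventually_conj_iff)
      qed (simp_all add: x0 A x0')
      also have "\<dots> = differential CA TA \<Psi> (x0, y0, A0) (velocity CA ?\<sigma> 0)"
        using diff[OF s'' J(1,3)] by (simp add: x0')
      finally show "Z \<in> differential CA TA \<Psi> (x0, y0, A0) ` rolling_distribution \<A> g1 \<B> g2 (x0, y0, A0)"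
        unfolding Z' using roll by (rule image_eqI)
    qed
  qed
qed

end

theorem theorem2p6:
  fixes \<A> :: "('a, real^2) atlas" and g1 :: "('a, real^2) metric"
    and \<B> :: "('b, real^2) atlas" and g2 :: "('b, real^2) metric"
    and M :: "('a \<times> 'b, real^4) atlas" and g :: "('a \<times> 'b, real^4) metric"
  assumes "oriented_riemannian_surface \<A> g1" and "oriented_riemannian_surface \<B> g2"
    and "M = product_atlas \<A> \<B>" and "g = split_metric \<A> g1 \<B> g2"
  shows "mcarrier (config_atlas \<A> g1 \<B> g2) = config_space \<A> g1 \<B> g2
    \<and> mcarrier (twistor_atlas M g) = twistor_space M g
    \<and> diffeomorphism (config_atlas \<A> g1 \<B> g2) (twistor_atlas M g) (Psi \<A> \<B>)
    \<and> (\<forall>(x, y, A) \<in> config_space \<A> g1 \<B> g2. fst (Psi \<A> \<B> (x, y, A)) = (x, y))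
    \<and> (\<forall>p \<in> config_space \<A> g1 \<B> g2.
        differential (config_atlas \<A> g1 \<B> g2) (twistor_atlas M g) (Psi \<A> \<B>) p
          ` rolling_distribution \<A> g1 \<B> g2 p
        = twistor_distribution M g (Psi \<A> \<B> p))"
proof -
  interpret surface_pair \<A> g1 \<B> g2
    by unfold_locales (fact assms)+
  show ?thesis
    unfolding assms(3,4)
  proof (intro conjI mcarrier_config mcarrier_twistor diffeomorphism_Psi ballI)
    show "case p of (x, y, A) \<Rightarrow> fst (Psi \<A> \<B> (x, y, A)) = (x, y)" for p :: "('a, 'b) config"
      by (auto simp: Psi_def)
    fix p assume "p \<in> config_space \<A> g1 \<B> g2"
    then show "differential CA TA \<Psi> p ` rolling_distribution \<A> g1 \<B> g2 p
        = twistor_distribution (product_atlas \<A> \<B>) (split_metric \<A> g1 \<B> g2) (\<Psi> p)"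
      using distributions_correspond by (cases p) auto
  qed
qed

end
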